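(* Let $0\le m<k\le n$ be integers and let $\Omega\subset\mathbb{C}^n$ be a smooth bounded domain which is strong $k$-pseudoconvex. Then there exists a constant $C$, depending only on $m$, $k$ and $\Omega$, such that for any $u\in\mathcal{P}_k^0(\Omega)$, $$\big(I_m[u]\big)^{\frac1{m+1}}\le C\,\big(I_k[u]\big)^{\frac1{k+1}}.$$
   Context: For $\lambda\in\mathbb{R}^n$ and $0\le j\le n$, $S_j(\lambda)=\frac{j!(n-j)!}{n!}\sum_{i_1<\dots<i_j}\lambda_{i_1}\cdots\lambda_{i_j}$ is the normalized $j$-th elementary symmetric function ($S_0=1$). For a Hermitian $n\times n$ matrix $A$ with vector of eigenvalues $\lambda(A)\in\mathbb{R}^n$, $S_j(A)=S_j(\lambda(A))$. Let $\Gamma_k=\{\lambda\in\mathbb{R}^n: S_j(\lambda)\ge0,\ j=1,\dots,k\}$. For a real-valued $C^2$ function $u$, $\mathrm{Hess}_{\mathbb{C}}(u)=(\partial^2u/\partial z_i\partial\bar z_j)$ is the complex Hessian matrix and $H_j[u]=S_j(\mathrm{Hess}_{\mathbb{C}}(u))$. For $u\in C^2(\bar\Omega)$, $I_j[u]=\int_\Omega(-u)H_j[u]$ (in particular $I_0[u]=\int_\Omega(-u)$). $\mathcal{P}_k^0(\Omega)$ is the set of real-valued $u\in C^2(\bar\Omega)$ with $\lambda(\mathrm{Hess}_{\mathbb{C}}(u))\in\Gamma_k$ at every point and $u=0$ on $\partial\Omega$. A smooth bounded domain $\Omega$ is strong $k$-pseudoconvex if $\partial\Omega$ is connected and the $(k-1)$-th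 elementary symmetric function of the $n-1$ eigenvalues of the Levi form of $\partial\Omega$ is strictly positive at every point of $\partial\Omega$ (the $0$-th elementary symmetric function being $1$). The Levi form is taken with the usual sign convention, i.e. it is positive definite for a ball. *)

theory Defs
  imports "HOL-Analysis.Analysis"
begin

definition elem_sym :: "nat \<Rightarrow> 'i set \<Rightarrow> ('i \<Rightarrow> real) \<Rightarrow> real" where
  "elem_sym j I f = (\<Sum>X | X \<subseteq> I \<and> card X = j. \<Prod>i\<in>X. f i)"

definition norm_sym :: "nat \<Rightarrow> real^'n \<Rightarrow> real" where
  "norm_sym j l =
     fact j * fact (CARD('n) - j) / fact CARD('n) * elem_sym j UNIV (\<lambda>i. l $ i)"

definition Gamma_cone :: "nat \<Rightarrow> (real^'n) set" where
  "Gamma_cone k = {l. \<forall>j\<in>{1..k}. norm_sym j l \<ge> 0}"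

text \<open>
  The vector of eigenvalues, counted with algebraic multiplicity, of a Hermitian matrix.
  The order of the entries is left unspecified: it is irrelevant for symmetric functions.
  For matrices whose spectrum is not real the value is unspecified.
\<close>

definition eigenvalue_vec :: "complex^'n^'n \<Rightarrow> real^'n" where
  "eigenvalue_vec A =
     (SOME l. \<forall>t. det (mat t - A) = (\<Prod>i\<in>UNIV. t - complex_of_real (l $ i)))"

definition norm_sym_mat :: "nat \<Rightarrow> complex^'n^'n \<Rightarrow> real" where
  "norm_sym_mat j A = norm_sym j (eigenvalue_vec A)"

text \<open>
  The derivatives with respect to \<open>z\<^sub>i\<close> and to the conjugate of \<open>z\<^sub>i\<close>: with \<open>z\<^sub>i = x\<^sub>i + \<i> y\<^sub>i\<close>, the
  vectors \<open>axis i 1\<close> and \<open>axis i \<i>\<close> are the directions of \<open>x\<^sub>i\<close> and \<open>y\<^sub>i\<close>.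
\<close>

definition dz :: "'n \<Rightarrow> (complex^'n \<Rightarrow> complex) \<Rightarrow> complex^'n \<Rightarrow> complex" where
  "dz i f z = (frechet_derivative f (at z) (axis i 1)
                 - \<i> * frechet_derivative f (at z) (axis i \<i>)) / 2"

definition dzbar :: "'n \<Rightarrow> (complex^'n \<Rightarrow> complex) \<Rightarrow> complex^'n \<Rightarrow> complex" where
  "dzbar i f z = (frechet_derivative f (at z) (axis i 1)
                    + \<i> * frechet_derivative f (at z) (axis i \<i>)) / 2"

definition complex_hessian :: "(complex^'n \<Rightarrow> real) \<Rightarrow> complex^'n \<Rightarrow> complex^'n^'n" where
  "complex_hessian u z = (\<chi> i j. dz i (dzbar j (\<lambda>w. complex_of_real (u w))) z)"

definition hess_op :: "nat \<Rightarrow> (complex^'n \<Rightarrow> real) \<Rightarrow> complex^'n \<Rightarrow> real" where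
  "hess_op j u z = norm_sym_mat j (complex_hessian u z)"

definition hess_integral :: "(complex^'n) set \<Rightarrow> nat \<Rightarrow> (complex^'n \<Rightarrow> real) \<Rightarrow> real" where
  "hess_integral \<Omega> j u = (LINT z:\<Omega>|lborel. (- u z) * hess_op j u z)"

text \<open>
  \<open>C_diff r U f\<close>: the function \<open>f\<close> is of class \<open>C\<^sup>r\<close> on the open set \<open>U\<close>.
  \<open>C_diff_ext r U f\<close>: moreover all derivatives of order at most \<open>r\<close> extend continuously to the
  closure of \<open>U\<close>.
\<close>

primrec C_diff :: "nat \<Rightarrow> 'a::euclidean_space set \<Rightarrow> ('a \<Rightarrow> real) \<Rightarrow> bool" where
  "C_diff 0 U f \<longleftrightarrow> continuous_on U f"
| "C_diff (Suc r) U f \<longleftrightarrow>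
     (\<forall>x\<in>U. f differentiable (at x)) \<and>
     (\<forall>v. C_diff r U (\<lambda>x. frechet_derivative f (at x) v))"

definition extends_continuously :: "'a::euclidean_space set \<Rightarrow> ('a \<Rightarrow> real) \<Rightarrow> bool" where
  "extends_continuously U f \<longleftrightarrow>
     (\<exists>g. continuous_on (closure U) g \<and> (\<forall>x\<in>U. g x = f x))"

primrec C_diff_ext :: "nat \<Rightarrow> 'a::euclidean_space set \<Rightarrow> ('a \<Rightarrow> real) \<Rightarrow> bool" where
  "C_diff_ext 0 U f \<longleftrightarrow> extends_continuously U f"
| "C_diff_ext (Suc r) U f \<longleftrightarrow>
     extends_continuously U f \<and>
     (\<forall>x\<in>U. f differentiable (at x)) \<and>
     (\<forall>v. C_diff_ext r U (\<lambda>x. frechet_derivative f (at x) v))"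

text \<open>
  Functions live on the whole space, but only their values on the closure of \<open>\<Omega>\<close> matter.
  Continuity on the closure forces the boundary values of \<open>u\<close> to be those of its continuous
  extension.
\<close>

definition C2_closure :: "(complex^'n) set \<Rightarrow> (complex^'n \<Rightarrow> real) set" where
  "C2_closure \<Omega> = {u. continuous_on (closure \<Omega>) u \<and> C_diff_ext 2 \<Omega> u}"

definition P0 :: "nat \<Rightarrow> (complex^'n) set \<Rightarrow> (complex^'n \<Rightarrow> real) set" where
  "P0 k \<Omega> = {u \<in> C2_closure \<Omega>.
      (\<forall>z\<in>\<Omega>. eigenvalue_vec (complex_hessian u z) \<in> Gamma_cone k) \<and>
      (\<forall>z\<in>frontier \<Omega>. u z = 0)}"

definition local_defining_function ::
    "(complex^'n) set \<Rightarrow> complex^'n \<Rightarrow> (complex^'n) set \<Rightarrow> (complex^'n \<Rightarrow> real) \<Rightarrow> bool" where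
  "local_defining_function \<Omega> p U \<rho> \<longleftrightarrow>
     open U \<and> p \<in> U \<and> (\<forall>r. C_diff r U \<rho>) \<and>
     (\<forall>z\<in>U. frechet_derivative \<rho> (at z) \<noteq> (\<lambda>_. 0)) \<and>
     \<Omega> \<inter> U = {z \<in> U. \<rho> z < 0}"

definition smooth_bounded_domain :: "(complex^'n) set \<Rightarrow> bool" where
  "smooth_bounded_domain \<Omega> \<longleftrightarrow>
     open \<Omega> \<and> connected \<Omega> \<and> \<Omega> \<noteq> {} \<and> bounded \<Omega> \<and>
     (\<forall>p\<in>frontier \<Omega>. \<exists>U \<rho>. local_defining_function \<Omega> p U \<rho>)"

definition herm_inner :: "complex^'n \<Rightarrow> complex^'n \<Rightarrow> complex" where
  "herm_inner \<xi> \<eta> = (\<Sum>i\<in>UNIV. \<xi> $ i * cnj (\<eta> $ i))"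

definition complex_gradient :: "(complex^'n \<Rightarrow> real) \<Rightarrow> complex^'n \<Rightarrow> complex^'n" where
  "complex_gradient \<rho> p = (\<chi> i. dz i (\<lambda>w. complex_of_real (\<rho> w)) p)"

definition complex_tangent :: "(complex^'n \<Rightarrow> real) \<Rightarrow> complex^'n \<Rightarrow> (complex^'n) set" where
  "complex_tangent \<rho> p = {\<xi>. (\<Sum>i\<in>UNIV. complex_gradient \<rho> p $ i * \<xi> $ i) = 0}"

text \<open>
  Division by the length of the gradient makes the Levi form independent of the choice of the
  defining function. Since \<open>\<rho>\<close> is negative inside, the Levi form of the unit sphere
  (\<open>\<rho> z = (norm z)\<^sup>2 - 1\<close>) is the Hermitian inner product of the complex tangent space.
\<close>

definition levi_form ::
    "(complex^'n \<Rightarrow> real) \<Rightarrow> complex^'n \<Rightarrow> complex^'n \<Rightarrow> complex^'n \<Rightarrow> complex" where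
  "levi_form \<rho> p \<xi> \<eta> =
     (\<Sum>i\<in>UNIV. \<Sum>j\<in>UNIV. complex_hessian \<rho> p $ i $ j * \<xi> $ i * cnj (\<eta> $ j))
       / complex_of_real (norm (complex_gradient \<rho> p))"

text \<open>
  The \<open>n - 1\<close> eigenvalues, indexed by \<open>{..<n - 1}\<close>, of the Levi form with respect to the Hermitian
  inner product of the complex tangent space, whose complex dimension is \<open>n - 1\<close>: \<open>e\<close> is an
  orthonormal basis of eigenvectors.
\<close>

definition levi_eigenbasis ::
    "(complex^'n \<Rightarrow> real) \<Rightarrow> complex^'n \<Rightarrow> (nat \<Rightarrow> complex^'n) \<Rightarrow> (nat \<Rightarrow> real) \<Rightarrow> bool" where
  "levi_eigenbasis \<rho> p e \<mu> \<longleftrightarrow>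
     (\<forall>a<CARD('n) - 1. e a \<in> complex_tangent \<rho> p) \<and>
     (\<forall>a<CARD('n) - 1. \<forall>b<CARD('n) - 1. herm_inner (e a) (e b) = (if a = b then 1 else 0)) \<and>
     (\<forall>a<CARD('n) - 1. \<forall>\<eta>\<in>complex_tangent \<rho> p.
        levi_form \<rho> p (e a) \<eta> = complex_of_real (\<mu> a) * herm_inner (e a) \<eta>)"

definition levi_eigenvalues :: "(complex^'n \<Rightarrow> real) \<Rightarrow> complex^'n \<Rightarrow> nat \<Rightarrow> real" where
  "levi_eigenvalues \<rho> p = (SOME \<mu>. \<exists>e. levi_eigenbasis \<rho> p e \<mu>)"

text \<open>
  The condition on the Levi form does not depend on the local defining function, so that the
  universal quantifier over \<open>\<rho>\<close> may be read as an existential one for a smooth domain.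
\<close>

definition strong_pseudoconvex :: "nat \<Rightarrow> (complex^'n) set \<Rightarrow> bool" where
  "strong_pseudoconvex k \<Omega> \<longleftrightarrow>
     connected (frontier \<Omega>) \<and>
     (\<forall>p\<in>frontier \<Omega>. \<forall>U \<rho>. local_defining_function \<Omega> p U \<rho> \<longrightarrow>
        elem_sym (k - 1) {..<CARD('n) - 1} (levi_eigenvalues \<rho> p) > 0)"

end

theory Submission
  imports Defs "HOL-Computational_Algebra.Fundamental_Theorem_Algebra"
begin

text \<open>
  Let \<open>E\<^sub>j\<close> be the elementary symmetric functions of a Hermitian matrix and \<open>T\<^sub>j\<close> its Newton transformations.
  The operator \<open>L\<^sub>j h = tr (T\<^sub>j(Hess u) Hess h)\<close> satisfies \<open>L\<^sub>j u = (j + 1) E\<^sub>j\<^sub>+\<^sub>1(Hess u)\<close>, is symmetric because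
  \<open>T\<^sub>j(Hess u)\<close> is divergence free, and by Garding's inequality is nonnegative on matrices in the cone. Let \<open>v\<close> vanish
  on the boundary and let \<open>Hess v - c\<close> lie in the dual cone, so that \<open>c E\<^sub>j \<le> L\<^sub>j v \<le> C E\<^sub>j\<close>. For
  \<open>a\<^sub>j = \<integral>(-u) E\<^sub>j(Hess u)\<close> and \<open>b\<^sub>j = \<integral>(-v) E\<^sub>j(Hess u)\<close>, integration by parts and Cauchy-Schwarz give
  \<open>c a\<^sub>j \<le> (j + 1) b\<^sub>j\<^sub>+\<^sub>1\<close>, \<open>j b\<^sub>j \<le> C a\<^sub>j\<^sub>-\<^sub>1\<close> and a bound of \<open>b\<^sub>j\<^sub>+\<^sub>1\<^sup>2\<close> by a multiple of \<open>a\<^sub>j\<^sub>+\<^sub>1 b\<^sub>j\<close>, hence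
  \<open>a\<^sub>j\<^sup>2 \<le> D a\<^sub>j\<^sub>+\<^sub>1 a\<^sub>j\<^sub>-\<^sub>1\<close>, which iterates to the claim.

  The function \<open>v\<close> is made from a global defining function \<open>\<rho>\<close>. The symmetric functions of orders below \<open>k\<close> of the Levi
  form are positive on the whole boundary, as they are nonnegative at a farthest point from the origin and the boundary
  is connected. Therefore \<open>Hess \<rho> + M \<partial>\<rho> \<otimes> \<partial>\<rho>\<^sup>*\<close> lies in the open cone near the boundary for large \<open>M\<close>. Then
  \<open>v = (\<rho> + t)\<^sub>+\<^sup>3 exp (M \<rho>) - t\<^sup>3\<close> works in a boundary layer, and a small multiple of \<open>|z|\<^sup>2\<close>, cut off near the
  boundary, makes it strict inside.
\<close>

text \<open>The obstacle is regularity: \<open>u\<close> is only C^2, so the third derivatives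
  behind the divergence-free property do not exist. Integration by parts is therefore done for
  compactly supported test functions, with the Hessian mollified entrywise, which creates the
  missing symmetric third derivatives. No boundary integral is ever formed: zero boundary values
  enter through convex truncations \<open>trunc e\<close>, supported in compact superlevel sets, and
  the sign of the truncation error gives the symmetry of the operator as two opposite inequalities.
  For \<open>v\<close> the dual cone replaces the cone because it is closed under sums by
  definition, so the pieces of \<open>v\<close> can be treated separately. Garding's inequality
  states that a derivative of a polynomial \<open>s \<mapsto> E(A + s B)\<close> at 0 is
  nonnegative; this follows once all roots are real and negative, and the roots are located by
  deforming to commuting matrices, where scalar stability applies. The chain of energies can start
  because at order 0 the quantity for \<open>v\<close> is the integral of \<open>- v\<close>, a
  constant independent of \<open>u\<close>.\<close>

section \<open>Elementary symmetric functions of scalars and their zeros\<close>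

definition esym :: "nat \<Rightarrow> 'i set \<Rightarrow> ('i \<Rightarrow> 'a::comm_ring_1) \<Rightarrow> 'a" where
  "esym j I f = (\<Sum>X | X \<subseteq> I \<and> card X = j. \<Prod>i\<in>X. f i)"

text \<open>The stability arguments evaluate symmetric functions at points of the upper half plane,
  so \<open>esym\<close> takes values in any commutative ring; this identity leads back to the real
  notion.\<close>

lemma elem_sym_esym: "elem_sym j I f = esym j I f"
  by (simp add: elem_sym_def esym_def)

lemma esym_of_real:
  "esym j I (\<lambda>i. complex_of_real (f i)) = complex_of_real (esym j I f)"
  by (simp add: esym_def)

lemma esym_0 [simp]: "finite I \<Longrightarrow> esym 0 I f = 1"
proof -
  assume "finite I"
  then have "{X. X \<subseteq> I \<and> card X = 0} = {{}}"
    by (auto simp: finite_subset)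
  then show ?thesis by (simp add: esym_def)
qed

lemma esym_eq_0: "finite I \<Longrightarrow> card I < j \<Longrightarrow> esym j I f = 0"
proof -
  assume "finite I" "card I < j"
  then have "{X. X \<subseteq> I \<and> card X = j} = {}"
    by (auto dest: card_mono)
  then show ?thesis unfolding esym_def by (simp only: sum.empty)
qed

lemma esym_insert:
  assumes "finite I" "a \<notin> I"
  shows "esym (Suc j) (insert a I) f = esym (Suc j) I f + f a * esym j I f"
proof -
  let ?A = "{X. X \<subseteq> I \<and> card X = Suc j}" and ?B = "{X. X \<subseteq> I \<and> card X = j}"
  have fin: "finite ?A" "finite ?B" using assms(1) by auto
  have fX: "finite X" if "X \<subseteq> I" for X using that assms(1) finite_subset by auto
  have eq: "{X. X \<subseteq> insert a I \<and> card X = Suc j} = ?A \<union> insert a ` ?B" (is "?L = ?R")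
  proof
    show "?L \<subseteq> ?R"
    proof
      fix X assume X: "X \<in> ?L"
      show "X \<in> ?R"
      proof (cases "a \<in> X")
        case True
        then have "X = insert a (X - {a})" "X - {a} \<subseteq> I" "card (X - {a}) = j"
          using X assms by (auto simp: card_Diff_singleton)
        then show ?thesis by blast
      next
        case False then show ?thesis using X by auto
      qed
    qed
    show "?R \<subseteq> ?L"
      using assms fX by (auto simp: card_insert_if)
  qed
  have disj: "?A \<inter> insert a ` ?B = {}" using assms(2) by auto
  have inj: "inj_on (insert a) ?B" using assms(2) by (auto simp: inj_on_def)
  have "esym (Suc j) (insert a I) f = esym (Suc j) I f + (\<Sum>X\<in>insert a ` ?B. \<Prod>i\<in>X. f i)"
    unfolding esym_def eq using fin disj by (subst sum.union_disjoint) auto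
  also have "(\<Sum>X\<in>insert a ` ?B. \<Prod>i\<in>X. f i) = (\<Sum>X\<in>?B. f a * (\<Prod>i\<in>X. f i))"
    unfolding sum.reindex[OF inj] o_def
  proof (rule sum.cong)
    fix X assume "X \<in> ?B"
    then have "finite X" "a \<notin> X" using fX assms(2) by auto
    then show "(\<Prod>i\<in>insert a X. f i) = f a * (\<Prod>i\<in>X. f i)" by simp
  qed simp
  finally show ?thesis by (simp add: esym_def sum_distrib_left)
qed

lemma esym_remove:
  assumes "finite I" "a \<in> I"
  shows "esym (Suc j) I f = esym (Suc j) (I - {a}) f + f a * esym j (I - {a}) f"
  using esym_insert[of "I - {a}" a j f] assms by (simp add: insert_absorb)

text \<open>Euler's identity for a homogeneous polynomial of degree \<open>Suc j\<close>:
  \<open>esym j (I - {i}) f\<close> is the partial derivative of \<open>esym (Suc j) I f\<close> in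
  the variable \<open>f i\<close>.\<close>

lemma esym_euler:
  assumes "finite I"
  shows "(\<Sum>i\<in>I. f i * esym j (I - {i}) f) = of_nat (Suc j) * esym (Suc j) I f"
  using assms
proof (induction I arbitrary: j rule: finite_induct)
  case empty
  then show ?case by (simp add: esym_eq_0)
next
  case (insert a I)
  have e: "insert a I - {i} = insert a (I - {i})" if "i \<in> I" for i using that insert by auto
  show ?case
  proof (cases j)
    case 0
    then show ?thesis using insert insert.IH[of 0]
      by (simp add: esym_insert)
  next
    case (Suc l)
    have "(\<Sum>i\<in>I. f i * esym j (insert a I - {i}) f)
        = (\<Sum>i\<in>I. f i * esym j (I - {i}) f + f a * (f i * esym l (I - {i}) f))"
      by (rule sum.cong) (use insert Suc in \<open>auto simp: e esym_insert algebra_simps\<close>)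
    also have "\<dots> = of_nat (Suc j) * esym (Suc j) I f + f a * (of_nat (Suc l) * esym (Suc l) I f)"
      by (simp only: sum.distrib sum_distrib_left[symmetric] insert.IH)
    finally show ?thesis using insert Suc
      by (simp add: esym_insert algebra_simps)
  qed
qed

lemma prod_add_esym:
  assumes "finite I"
  shows "(\<Prod>i\<in>I. t + f i) = (\<Sum>j\<le>card I. esym j I f * t ^ (card I - j))"
  using assms
proof (induction I rule: finite_induct)
  case (insert a I)
  let ?n = "card I"
  have "(\<Sum>j\<le>Suc ?n. esym j (insert a I) f * t ^ (Suc ?n - j))
     = t ^ Suc ?n + (\<Sum>j\<le>?n. esym (Suc j) (insert a I) f * t ^ (?n - j))"
    using insert by (subst sum.atMost_Suc_shift) simp
  also have "(\<Sum>j\<le>?n. esym (Suc j) (insert a I) f * t ^ (?n - j))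
     = (\<Sum>j\<le>?n. esym (Suc j) I f * t ^ (?n - j)) + f a * (\<Sum>j\<le>?n. esym j I f * t ^ (?n - j))"
    using insert by (simp add: esym_insert sum.distrib sum_distrib_left algebra_simps)
  also have "(\<Sum>j\<le>?n. esym (Suc j) I f * t ^ (?n - j)) =
     (\<Sum>j\<le>Suc ?n. esym j I f * t ^ (Suc ?n - j)) - t ^ Suc ?n"
    using insert by (subst sum.atMost_Suc_shift) simp
  also have "(\<Sum>j\<le>Suc ?n. esym j I f * t ^ (Suc ?n - j)) = t * (\<Sum>j\<le>?n. esym j I f * t ^ (?n - j))"
    using insert by (simp add: esym_eq_0 sum_distrib_left Suc_diff_le algebra_simps)
  finally show ?case using insert by (simp add: algebra_simps)
qed simp

text \<open>By Vieta the values are, up to sign, the coefficients of the polynomial with these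
  roots, and a polynomial function determines its coefficients. Hence a spectrum picked by
  \<open>SOME\<close>, as in \<open>eigenvalue_vec\<close>, has well-defined symmetric
  functions.\<close>

lemma esym_cong_mset:
  assumes "finite I" "\<And>t::complex. (\<Prod>i\<in>I. t - f i) = (\<Prod>i\<in>I. t - g i)"
  shows "esym j I f = esym j I g"
proof (cases "j \<le> card I")
  case True
  have p: "(\<Prod>i\<in>I. t - h i) = (\<Sum>j\<le>card I. (-1)^j * esym j I h * t ^ (card I - j))" for t and h :: "'a \<Rightarrow> complex"
  proof -
    have "esym j I (\<lambda>i. - h i) = (-1)^j * esym j I h" for j
      unfolding esym_def sum_distrib_left
    proof (rule sum.cong[OF refl])
      fix X assume "X \<in> {X. X \<subseteq> I \<and> card X = j}"
      then have "finite X" "card X = j" using assms(1) finite_subset by auto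
      then show "(\<Prod>i\<in>X. - h i) = (-1)^j * (\<Prod>i\<in>X. h i)"
        by (simp add: prod_uminus)
    qed
    then show ?thesis using prod_add_esym[OF assms(1), of t "\<lambda>i. - h i"] by simp
  qed
  have r: "(\<Sum>j\<le>card I. (-1)^j * esym j I h * t ^ (card I - j)) 
     = (\<Sum>i\<le>card I. ((-1)^(card I - i) * esym (card I - i) I h) * t ^ i)" for t and h :: "'a \<Rightarrow> complex"
    by (rule sum.reindex_bij_witness[of _ "\<lambda>i. card I - i" "\<lambda>i. card I - i"]) auto
  have "\<forall>t. (\<Sum>i\<le>card I. ((-1)^(card I - i) * esym (card I - i) I f) * t ^ i)
          = (\<Sum>i\<le>card I. ((-1)^(card I - i) * esym (card I - i) I g) * t ^ i)"
    using assms(2) by (simp add: p r[symmetric])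
  then have "\<forall>i\<le>card I. (-1)^(card I - i) * esym (card I - i) I f = (-1)^(card I - i) * esym (card I - i) I g"
    by (subst (asm) polyfun_eq_coeffs) 
  then have "(-1)^(card I - (card I - j)) * esym (card I - (card I - j)) I f = (-1)^(card I - (card I - j)) * esym (card I - (card I - j)) I g"
    by (meson diff_le_self)
  then show ?thesis using True by simp
next
  case False
  then show ?thesis using assms(1) by (simp add: esym_eq_0)
qed

text \<open>Inversion exchanges the upper and the lower half plane, and the harmonic sum is the
  inverse of the sum of the inverses.\<close>

lemma Im_parallel_sum_pos:
  assumes "Im z > 0" "Im w > 0"
  shows "z + w \<noteq> 0" "Im (z * w / (z + w)) > 0"
proof -
  show n: "z + w \<noteq> 0" using assms by (auto simp: complex_eq_iff)
  have "z \<noteq> 0" "w \<noteq> 0" using assms by auto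
  have inv: "Im (inverse x) < 0 \<longleftrightarrow> Im x > 0" for x :: complex
  proof (cases "x = 0")
    case False
    then have "(Re x)\<^sup>2 + (Im x)\<^sup>2 > 0" by (simp add: complex_eq_iff sum_power2_gt_zero_iff)
    then show ?thesis by (simp add: zero_less_divide_iff)
  qed simp
  have "inverse (z * w / (z + w)) = inverse z + inverse w"
    using \<open>z \<noteq> 0\<close> \<open>w \<noteq> 0\<close> n by (simp add: field_simps)
  then have "Im (inverse (z * w / (z + w))) < 0" using assms inv[of z] inv[of w] by simp
  then show "Im (z * w / (z + w)) > 0" using inv by blast
qed

text \<open>
  The ratio of consecutive elementary symmetric functions is an average of harmonic sums
  of the variables and of ratios of lower order (the Marcus-Lopes identity); harmonic sums preserve
  the upper half plane.
\<close>

lemma esym_ratio_upper_half_plane: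
  assumes "finite I" "j < card I" "\<And>i. i \<in> I \<Longrightarrow> Im (z i) > 0"
  shows "esym j I z \<noteq> 0 \<and> Im (esym (Suc j) I z / esym j I z) > 0"
  using assms
proof (induction j arbitrary: I)
  case 0
  have "esym (Suc 0) I z = (\<Sum>i\<in>I. z i)"
    using esym_euler[OF \<open>finite I\<close>, of z 0] \<open>finite I\<close> by simp
  moreover have "0 < (\<Sum>i\<in>I. Im (z i))"
    using 0 by (intro sum_pos) auto
  ultimately show ?case using 0 by simp
next
  case (Suc j)
  have ne: "esym (Suc j) I z \<noteq> 0"
  proof -
    have "Im (esym (Suc j) I z / esym j I z) > 0" using Suc.IH[of I] Suc.prems by auto
    then show ?thesis by auto
  qed
  have t: "Im (z i * esym (Suc j) (I - {i}) z / esym (Suc j) I z) > 0" if i: "i \<in> I" for i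
  proof -
    let ?F = "esym (Suc j) (I - {i}) z / esym j (I - {i}) z"
    have "j < card (I - {i})" using i Suc.prems by (simp add: card_Diff_singleton)
    then have F: "esym j (I - {i}) z \<noteq> 0" "Im ?F > 0" using Suc.IH[of "I - {i}"] Suc.prems by auto
    have zi: "Im (z i) > 0" using Suc.prems i by auto
    have "esym (Suc j) I z = esym j (I - {i}) z * (z i + ?F)"
      using esym_remove[OF Suc.prems(1) i, of j z] F by (simp add: field_simps)
    then have "z i * esym (Suc j) (I - {i}) z / esym (Suc j) I z = z i * ?F / (z i + ?F)"
      using F Im_parallel_sum_pos(1)[OF zi F(2)] by simp
    then show ?thesis using Im_parallel_sum_pos(2)[OF zi F(2)] by metis
  qed
  have "(\<Sum>i\<in>I. z i * esym (Suc j) (I - {i}) z / esym (Suc j) I z)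
      = of_nat (Suc (Suc j)) * (esym (Suc (Suc j)) I z / esym (Suc j) I z)"
    using esym_euler[OF Suc.prems(1), of z "Suc j"] by (simp add: sum_divide_distrib[symmetric] del: of_nat_Suc)
  moreover have im_mult: "Im (of_nat n * w) = real n * Im w" for n :: nat and w by simp
  moreover have "Im (\<Sum>i\<in>I. z i * esym (Suc j) (I - {i}) z / esym (Suc j) I z) > 0"
    unfolding Im_sum using Suc.prems t by (intro sum_pos) auto
  ultimately have "0 < Im (of_nat (Suc (Suc j)) * (esym (Suc (Suc j)) I z / esym (Suc j) I z))" by simp
  then have "0 < real (Suc (Suc j)) * Im (esym (Suc (Suc j)) I z / esym (Suc j) I z)"
    by (simp only: im_mult)
  then show ?case using ne by (simp add: zero_less_mult_iff)
qed

text \<open>A zero would make the ratio to the preceding order vanish, although that ratio has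
  positive imaginary part.\<close>

lemma esym_upper_half_plane:
  assumes "finite I" "j \<le> card I" "\<And>i. i \<in> I \<Longrightarrow> Im (z i) > 0"
  shows "esym j I z \<noteq> 0"
proof (cases j)
  case 0 then show ?thesis using assms by simp
next
  case (Suc l)
  then have "Im (esym (Suc l) I z / esym l I z) > 0"
    using esym_ratio_upper_half_plane[of I l z] assms by auto
  then show ?thesis using Suc by auto
qed

section \<open>Matrix notation: Newton transformations and sesquilinear forms\<close>

definition ctranspose :: "complex^'n^'m \<Rightarrow> complex^'m^'n" where
  "ctranspose A = (\<chi> i j. cnj (A $ j $ i))"

definition hermitian :: "complex^'n^'n \<Rightarrow> bool" where
  "hermitian A \<longleftrightarrow> (\<forall>i j. A $ j $ i = cnj (A $ i $ j))"

definition diag_mat :: "('n \<Rightarrow> complex) \<Rightarrow> complex^'n^'n" where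
  "diag_mat d = (\<chi> i j. if i = j then d i else 0)"

definition smat :: "complex \<Rightarrow> complex^'n^'n \<Rightarrow> complex^'n^'n" where
  "smat c A = (\<chi> i j. c * A $ i $ j)"

text \<open>The Faddeev-LeVerrier recursion: the trace divided by \<open>Suc j\<close> is the
  elementary symmetric function of the eigenvalues of order \<open>Suc j\<close>. No eigenvalue
  occurs, so everything is polynomial in the entries and makes sense for non-Hermitian complex
  pencils.\<close>

primrec newton_mat :: "nat \<Rightarrow> complex^'n^'n \<Rightarrow> complex^'n^'n" where
  "newton_mat 0 A = mat 1"
| "newton_mat (Suc j) A = mat (trace (A ** newton_mat j A) / of_nat (Suc j)) - A ** newton_mat j A"

primrec esym_mat :: "nat \<Rightarrow> complex^'n^'n \<Rightarrow> complex" where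
  "esym_mat 0 A = 1"
| "esym_mat (Suc j) A = trace (A ** newton_mat j A) / of_nat (Suc j)"

text \<open>The index convention is that of \<open>levi_form\<close>, so \<open>A\<close> acts on
  \<open>x\<close> through its transpose. For Hermitian \<open>A\<close> the eigenvectors of the
  form are therefore the conjugates of the eigenvectors of the matrix.\<close>

definition sform :: "complex^'n^'n \<Rightarrow> complex^'n \<Rightarrow> complex^'n \<Rightarrow> complex" where
  "sform A x y = (\<Sum>i\<in>UNIV. \<Sum>j\<in>UNIV. A $ i $ j * x $ i * cnj (y $ j))"

lemma newton_mat_Suc: "newton_mat (Suc j) A = mat (esym_mat (Suc j) A) - A ** newton_mat j A"
  by simp

subsection \<open>Spectral theorem\<close>

lemma hermitianD: "hermitian A \<Longrightarrow> cnj (A $ i $ j) = A $ j $ i"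
  unfolding hermitian_def by metis

lemma hermitianI: "(\<And>i j. cnj (A $ i $ j) = A $ j $ i) \<Longrightarrow> hermitian A"
  unfolding hermitian_def by metis

lemma sform_simps:
  "sform A (x + x') y = sform A x y + sform A x' y"
  "sform A x (y + y') = sform A x y + sform A x y'"
  "sform A (x - x') y = sform A x y - sform A x' y"
  "sform A x (y - y') = sform A x y - sform A x y'"
  "sform A (c *s x) y = c * sform A x y"
  "sform A x (c *s y) = cnj c * sform A x y"
  "sform A 0 y = 0" "sform A x 0 = 0"
proof -
  show "sform A (x + x') y = sform A x y + sform A x' y" "sform A x (y + y') = sform A x y + sform A x y'"
    by (simp_all add: sform_def sum.distrib distrib_left distrib_right)
  show "sform A (x - x') y = sform A x y - sform A x' y" "sform A x (y - y') = sform A x y - sform A x y'"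
    by (simp_all add: sform_def sum_subtractf left_diff_distrib right_diff_distrib)
  show "sform A (c *s x) y = c * sform A x y" "sform A x (c *s y) = cnj c * sform A x y"
    unfolding sform_def sum_distrib_left by (auto intro!: sum.cong)
  show "sform A 0 y = 0" "sform A x 0 = 0"
    by (simp_all add: sform_def)
qed

lemma sform_sum_right: "sform A x (\<Sum>a\<in>I. f a) = (\<Sum>a\<in>I. sform A x (f a))"
  by (induction I rule: infinite_finite_induct) (auto simp: sform_simps)

lemma sform_sum_left: "sform A (\<Sum>a\<in>I. f a) x = (\<Sum>a\<in>I. sform A (f a) x)"
  by (induction I rule: infinite_finite_induct) (auto simp: sform_simps)

lemma herm_inner_sform: "herm_inner x y = sform (mat 1) x y"
  by (simp add: herm_inner_def sform_def mat_def if_distrib[of "\<lambda>x. x * _"] cong: if_cong)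

lemma sform_cnj: "hermitian A \<Longrightarrow> sform A y x = cnj (sform A x y)"
proof -
  assume "hermitian A"
  then have A: "cnj (A $ i $ j) = A $ j $ i" for i j by (rule hermitianD)
  show ?thesis
    unfolding sform_def cnj_sum complex_cnj_mult complex_cnj_cnj A
    by (subst sum.swap) (auto intro!: sum.cong)
qed

lemma hermitian_mat: "hermitian (mat (of_real c))"
  by (rule hermitianI) (simp add: mat_def)

lemma hermitian_add: "hermitian A \<Longrightarrow> hermitian B \<Longrightarrow> hermitian (A + B)"
  by (rule hermitianI) (simp add: hermitianD)

lemma hermitian_diff: "hermitian A \<Longrightarrow> hermitian B \<Longrightarrow> hermitian (A - B)"
  by (rule hermitianI) (simp add: hermitianD)

lemma hermitian_smat: "hermitian A \<Longrightarrow> hermitian (smat (of_real c) A)"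
  by (rule hermitianI) (simp add: hermitianD smat_def)

lemma hermitian_mat_1 [simp]: "hermitian (mat 1)"
  using hermitian_mat[of 1] by simp

lemma herm_inner_cnj: "herm_inner y x = cnj (herm_inner x y)"
  unfolding herm_inner_sform by (rule sform_cnj) simp

lemma Re_herm_inner: "Re (herm_inner x y) = inner x y"
  by (simp add: herm_inner_def inner_vec_def inner_complex_def algebra_simps)

lemma herm_inner_self: "herm_inner x x = of_real ((norm x)\<^sup>2)"
proof -
  have "Im (herm_inner x x) = 0"
    using herm_inner_cnj[of x x] by (metis complex_cnj_cancel_iff Reals_cnj_iff complex_is_Real_iff)
  then show ?thesis
    by (simp add: complex_eq_iff Re_herm_inner power2_norm_eq_inner)
qed

lemma continuous_on_sform [continuous_intros]:
  assumes "continuous_on S A" "continuous_on S f" "continuous_on S g"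
  shows "continuous_on S (\<lambda>x. sform (A x) (f x) (g x))"
  unfolding sform_def by (intro continuous_intros assms)

lemma norm_smult_vec: "norm (c *s (x::complex^'n)) = cmod c * norm x"
  by (simp add: norm_vec_def L2_set_def norm_mult power_mult_distrib sum_distrib_left[symmetric] real_sqrt_mult)

text \<open>The conjugates of the vectors of \<open>W\<close> become rows of a square matrix; some
  row is left zero, so the matrix is singular, and a normalized kernel vector is orthogonal to
  \<open>W\<close>.\<close>

lemma orthogonal_vector_exists:
  fixes W :: "(complex^'n) set"
  assumes "finite W" "card W < CARD('n)"
  shows "\<exists>x. norm x = 1 \<and> (\<forall>w\<in>W. herm_inner x w = 0)"
proof -
  obtain f :: "complex^'n \<Rightarrow> 'n" where f: "f ` W \<subseteq> UNIV" "inj_on f W"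
    using card_le_inj[OF assms(1) finite_class.finite_UNIV] assms by (metis less_imp_le)
  have "card (f ` W) < CARD('n)" using f assms by (simp add: card_image)
  then have "f ` W \<noteq> UNIV" by auto
  then obtain i0 where i0: "i0 \<notin> f ` W" by blast
  define M :: "complex^'n^'n" where
    "M = (\<chi> i j. if i \<in> f ` W then cnj (inv_into W f i $ j) else 0)"
  have "det M = 0"
    using i0 by (intro det_zero_row[of i0]) (simp add: M_def row_def vec_eq_iff)
  then have "\<not> invertible M" by (simp add: invertible_det_nz)
  then have "\<not> (\<exists>B. B ** M = mat 1)"
    by (simp add: invertible_left_inverse)
  then obtain x where x: "M *v x = 0" "x \<noteq> 0"
    unfolding matrix_left_invertible_ker by blast
  have "herm_inner x w = 0" if "w \<in> W" for w
  proof -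
    have "(M *v x) $ f w = 0" using x by simp
    then have "(\<Sum>j\<in>UNIV. M $ f w $ j * x $ j) = 0" by (simp add: matrix_vector_mult_def)
    then show ?thesis using that f by (simp add: M_def herm_inner_def mult.commute)
  qed
  moreover have "herm_inner (c *s x) w = c * herm_inner x w" for c w
    unfolding herm_inner_sform by (rule sform_simps)
  moreover have "norm (complex_of_real (1 / norm x) *s x) = 1"
    using x by (simp add: norm_smult_vec norm_divide)
  ultimately show ?thesis by (metis mult_zero_right)
qed

lemma Re_of_real_mult: "Re (of_real r * z) = r * Re z"
  by simp

text \<open>Moving from \<open>e\<close> by multiples of \<open>y\<close> gives a nonnegative
  quadratic polynomial without constant term, so its linear coefficient must vanish.\<close>

lemma psd_kernel:
  assumes A: "hermitian A" and sub: "\<And>x y. x \<in> V \<Longrightarrow> y \<in> V \<Longrightarrow> x + y \<in> V" "\<And>c x. x \<in> V \<Longrightarrow> c *s x \<in> V"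
    and psd: "\<And>x. x \<in> V \<Longrightarrow> Re (sform A x x) \<ge> 0"
    and e: "e \<in> V" "Re (sform A e e) = 0" and y: "y \<in> V"
  shows "sform A e y = 0"
proof (rule ccontr)
  assume n: "sform A e y \<noteq> 0"
  let ?s = "sform A e y" and ?r = "Re (sform A y y)"
  have r0: "?r \<ge> 0" using psd y by auto
  have ineq: "2 * t * (cmod ?s)\<^sup>2 + t\<^sup>2 * (cmod ?s)\<^sup>2 * ?r \<ge> 0" for t :: real
  proof -
    let ?c = "of_real t * ?s"
    have "sform A (e + ?c *s y) (e + ?c *s y) = sform A e e + cnj ?c * sform A e y + ?c * cnj (sform A e y) + (?c * cnj ?c) * sform A y y"
      unfolding sform_cnj[OF A, of e y, symmetric] by (simp add: sform_simps algebra_simps sform_cnj[OF A, of y e])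
    moreover have "cnj ?c * ?s = of_real (t * (cmod ?s)\<^sup>2)" "?c * cnj ?s = of_real (t * (cmod ?s)\<^sup>2)"
      "?c * cnj ?c = of_real (t\<^sup>2 * (cmod ?s)\<^sup>2)"
      using complex_norm_square[of ?s] by (simp_all add: power2_eq_square mult_ac)
    ultimately have "Re (sform A (e + ?c *s y) (e + ?c *s y)) = 2 * t * (cmod ?s)\<^sup>2 + t\<^sup>2 * (cmod ?s)\<^sup>2 * ?r"
      by (simp only: plus_complex.sel Re_complex_of_real Re_of_real_mult e(2))
    moreover have "e + ?c *s y \<in> V" using sub e y by blast
    ultimately show ?thesis using psd by metis
  qed
  \<comment> \<open>With this value \<open>2 * t + t\<^sup>2 * ?r\<close> becomes
    \<open>t - t\<^sup>2\<close>, which is negative; the 1 in the denominator covers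
    \<open>?r = 0\<close>.\<close>
  define t where "t = - 1 / (?r + 1)"
  have t: "t < 0" "t * (?r + 1) = - 1" using r0 by (auto simp: t_def divide_neg_pos)
  then have "t * (t * (?r + 1)) = - t" by simp
  then have "2 * t + t\<^sup>2 * ?r = t - t\<^sup>2" by (simp add: power2_eq_square algebra_simps)
  then have "2 * t + t\<^sup>2 * ?r < 0" using t(1) zero_le_power2[of t] by linarith
  moreover have "(cmod ?s)\<^sup>2 > 0" using n by simp
  ultimately have "(2 * t + t\<^sup>2 * ?r) * (cmod ?s)\<^sup>2 < 0" by (rule mult_neg_pos)
  then show False using ineq[of t] by (simp add: algebra_simps)
qed

text \<open>Each new eigenvector minimizes the form on the unit vectors orthogonal to
  \<open>W\<close> and to those already found. The eigenvalue equation is tested only against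
  vectors orthogonal to \<open>W\<close>: thus \<open>W = {}\<close> gives the spectral theorem, and
  the conjugate gradient of a defining function gives the Levi form.\<close>

lemma hermitian_eigenbasis_on:
  fixes A :: "complex^'n^'n"
  assumes A: "hermitian A" and W: "finite W"
  shows "m + card W \<le> CARD('n) \<Longrightarrow> \<exists>e \<mu>. (\<forall>a<m. \<forall>w\<in>W. herm_inner (e a) w = 0) \<and>
    (\<forall>a<m. \<forall>b<m. herm_inner (e a) (e b) = (if a = b then 1 else 0)) \<and>
    (\<forall>a<m. \<forall>y. (\<forall>w\<in>W. herm_inner y w = 0) \<longrightarrow>
       sform A (e a) y = complex_of_real (\<mu> a) * herm_inner (e a) y)"
proof (induction m)
  case (Suc m)
  then have "m + card W \<le> CARD('n)" by simp
  from Suc.IH[OF this] obtain e \<mu> where e0: "\<forall>a<m. \<forall>w\<in>W. herm_inner (e a) w = 0"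
    "\<forall>a<m. \<forall>b<m. herm_inner (e a) (e b) = (if a = b then 1 else 0)"
    "\<forall>a<m. \<forall>y. (\<forall>w\<in>W. herm_inner y w = 0) \<longrightarrow>
       sform A (e a) y = complex_of_real (\<mu> a) * herm_inner (e a) y"
    by (elim exE conjE)
  then have e: "\<And>a w. a < m \<Longrightarrow> w \<in> W \<Longrightarrow> herm_inner (e a) w = 0"
    "\<And>a b. a < m \<Longrightarrow> b < m \<Longrightarrow> herm_inner (e a) (e b) = (if a = b then 1 else 0)"
    "\<And>a y. a < m \<Longrightarrow> (\<And>w. w \<in> W \<Longrightarrow> herm_inner y w = 0) \<Longrightarrow>
       sform A (e a) y = complex_of_real (\<mu> a) * herm_inner (e a) y"
    by blast+
  note hi = sform_simps[of "mat 1", folded herm_inner_sform]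
  define W' where "W' = W \<union> e ` {..<m}"
  define V where "V = {x. \<forall>w\<in>W'. herm_inner x w = 0}"
  have "card W' \<le> card W + card (e ` {..<m})" unfolding W'_def by (rule card_Un_le)
  also have "card (e ` {..<m}) \<le> m" using card_image_le[of "{..<m}" e] by simp
  finally have "card W' < CARD('n)" using Suc.prems by simp
  then obtain x0 where x0: "norm x0 = 1" "x0 \<in> V"
    using orthogonal_vector_exists[of W'] W unfolding V_def W'_def by auto
  define S where "S = {x \<in> V. norm x = 1}"
  have "closed V"
  proof -
    have "V = (\<Inter>w\<in>W'. {x. herm_inner x w = 0})" by (auto simp: V_def)
    moreover have "closed {x. herm_inner x w = 0}" for w
      unfolding herm_inner_sform
      by (intro closed_Collect_eq continuous_intros)
    ultimately show ?thesis by auto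
  qed
  moreover have "S = V \<inter> sphere 0 1" by (auto simp: S_def)
  ultimately have "compact S" by (metis closed_Int_compact compact_sphere)
  moreover have "S \<noteq> {}" using x0 by (auto simp: S_def)
  moreover have "continuous_on S (\<lambda>x. Re (sform A x x))" by (intro continuous_intros)
  ultimately have "\<exists>x\<in>S. \<forall>y\<in>S. Re (sform A x x) \<le> Re (sform A y y)"
    by (rule continuous_attains_inf)
  then obtain x where x: "x \<in> S" "\<And>y. y \<in> S \<Longrightarrow> Re (sform A x x) \<le> Re (sform A y y)"
    by blast
  define \<nu> where "\<nu> = Re (sform A x x)"
  \<comment> \<open>Subtracting the minimum makes the form nonnegative on \<open>V\<close> with null
    vector \<open>x\<close>, so \<open>psd_kernel\<close> turns minimality into an eigenvalue
    equation.\<close>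
  define B where "B = A - mat (complex_of_real \<nu>)"
  have B: "sform B y z = sform A y z - of_real \<nu> * herm_inner y z" for y z
  proof -
    have "sform (mat (complex_of_real \<nu>)) y z = of_real \<nu> * herm_inner y z"
      by (simp add: herm_inner_def sform_def mat_def sum_distrib_left if_distrib[of "\<lambda>x. x * _"] mult.assoc cong: if_cong)
    moreover have "sform B y z = sform A y z - sform (mat (complex_of_real \<nu>)) y z"
      by (simp add: B_def sform_def algebra_simps sum_subtractf)
    ultimately show ?thesis by simp
  qed
  have hB: "hermitian B" unfolding B_def by (intro hermitian_diff hermitian_mat A)
  have Vsub: "\<And>x y. x \<in> V \<Longrightarrow> y \<in> V \<Longrightarrow> x + y \<in> V" "\<And>c x. x \<in> V \<Longrightarrow> c *s x \<in> V"
    by (auto simp: V_def hi)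
  have xV: "x \<in> V" "norm x = 1" using x by (auto simp: S_def)
  have psd: "Re (sform B y y) \<ge> 0" if "y \<in> V" for y
  proof (cases "y = 0")
    case False
    define y' where "y' = complex_of_real (1 / norm y) *s y"
    have "y' \<in> S" using that False Vsub(2) by (simp add: S_def y'_def norm_smult_vec norm_divide)
    then have "\<nu> \<le> Re (sform A y' y')" using x by (simp add: \<nu>_def)
    also have "sform A y' y' = of_real ((1 / norm y)\<^sup>2) * sform A y y"
      unfolding y'_def sform_simps by (simp add: power2_eq_square)
    finally have "\<nu> \<le> (1 / norm y)\<^sup>2 * Re (sform A y y)" by (simp only: Re_of_real_mult)
    then have "\<nu> * (norm y)\<^sup>2 \<le> Re (sform A y y)" using False by (simp add: power_divide pos_le_divide_eq)
    then show ?thesis by (simp add: B herm_inner_self)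
  qed (simp add: sform_simps)
  have zero: "Re (sform B x x) = 0" using xV by (simp add: B herm_inner_self \<nu>_def)
  have xe: "herm_inner x (e a) = 0" if "a < m" for a using that xV by (simp add: V_def W'_def)
  have ex: "herm_inner (e a) x = 0" if "a < m" for a using xe[OF that] herm_inner_cnj[of "e a" x] by simp
  have key: "sform A x y = of_real \<nu> * herm_inner x y" if y: "\<And>w. w \<in> W \<Longrightarrow> herm_inner y w = 0" for y
  proof -
    \<comment> \<open>The projection of \<open>y\<close> to the earlier eigenvectors: the rest lies
      in \<open>V\<close>, and both terms of \<open>sform B x y1\<close> vanish by
      orthogonality.\<close>
    define y1 where "y1 = (\<Sum>a<m. herm_inner y (e a) *s e a)"
    have o: "herm_inner y1 (e b) = herm_inner y (e b)" if "b < m" for b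
    proof -
      have "herm_inner y1 (e b) = (\<Sum>a<m. herm_inner y (e a) * herm_inner (e a) (e b))"
        by (simp add: y1_def herm_inner_sform sform_sum_left sform_simps)
      also have "\<dots> = (\<Sum>a<m. if a = b then herm_inner y (e a) else 0)"
        by (rule sum.cong) (use that e(2) in auto)
      finally show ?thesis using that by simp
    qed
    have w: "herm_inner y1 w = 0" if "w \<in> W" for w
      using e(1)[OF _ that] by (simp add: y1_def herm_inner_sform sform_sum_left sform_simps)
    have "y - y1 \<in> V" using o w y by (auto simp: V_def W'_def hi)
    then have "sform B x (y - y1) = 0" using psd_kernel[OF hB Vsub psd xV(1) zero] by blast
    moreover have "sform B x y1 = 0"
    proof -
      have "sform A x (e a) = 0" if "a < m" for a
      proof -
        have "sform A (e a) x = 0" using e(3)[OF that, of x] ex[OF that] xV by (simp add: V_def W'_def)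
        then show ?thesis using sform_cnj[OF A, of x "e a"] by simp
      qed
      then show ?thesis
        using xe by (simp add: y1_def sform_sum_right sform_simps B)
    qed
    ultimately have "sform B x y = 0" by (simp add: sform_simps)
    then show ?thesis by (simp add: B)
  qed
  have one: "herm_inner x x = 1" using xV by (simp add: herm_inner_self)
  have "\<forall>w\<in>W. herm_inner x w = 0" using xV by (simp add: V_def W'_def)
  then show ?case
    using e xe ex key one
    by (intro exI[of _ "\<lambda>a. if a < m then e a else x"] exI[of _ "\<lambda>a. if a < m then \<mu> a else \<nu>"])
       (auto simp: less_Suc_eq)
qed auto

lemma hermitian_diagonalizable:
  fixes A :: "complex^'n^'n"
  assumes A: "hermitian A"
  obtains U :: "complex^'n^'n" and d where "ctranspose U ** U = mat 1" "U ** ctranspose U = mat 1"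
    "A = U ** diag_mat (\<lambda>i. complex_of_real (d i)) ** ctranspose U"
proof -
  obtain e :: "nat \<Rightarrow> complex^'n" and \<mu> where e: 
    "\<And>a b. a < CARD('n) \<Longrightarrow> b < CARD('n) \<Longrightarrow> herm_inner (e a) (e b) = (if a = b then 1 else 0)"
    "\<And>a y. a < CARD('n) \<Longrightarrow> sform A (e a) y = complex_of_real (\<mu> a) * herm_inner (e a) y"
    using hermitian_eigenbasis_on[OF A, of "{}" "CARD('n)"] by simp blast
  obtain f :: "'n \<Rightarrow> nat" where f: "bij_betw f UNIV {0..<CARD('n)}"
    using ex_bij_betw_finite_nat[OF finite_class.finite_UNIV] by blast
  then have fl: "f i < CARD('n)" for i by (auto simp: bij_betw_def)
  have fi: "f i = f j \<longleftrightarrow> i = j" for i j using f by (auto simp: bij_betw_def inj_def)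
  \<comment> \<open>The columns are conjugated because \<open>sform\<close> applies the transpose of
    \<open>A\<close>, which for Hermitian \<open>A\<close> is its conjugate.\<close>
  define U :: "complex^'n^'n" where "U = (\<chi> i k. cnj (e (f k) $ i))"
  define d where "d = \<mu> \<circ> f"
  have 1: "ctranspose U ** U = mat 1"
  proof -
    have "(ctranspose U ** U) $ i $ j = mat 1 $ i $ j" for i j
    proof -
      have "(ctranspose U ** U) $ i $ j = herm_inner (e (f i)) (e (f j))"
        by (simp add: matrix_matrix_mult_def ctranspose_def herm_inner_def U_def)
      then show ?thesis using e(1)[OF fl fl] fi by (simp add: mat_def)
    qed
    then show ?thesis by (simp add: vec_eq_iff)
  qed
  then have 2: "U ** ctranspose U = mat 1" by (simp add: matrix_left_right_inverse)
  have "A ** U = U ** diag_mat (\<lambda>i. complex_of_real (d i))"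
  proof -
    have "(A ** U) $ i $ k = (U ** diag_mat (\<lambda>i. complex_of_real (d i))) $ i $ k" for i k
    proof -
      have "sform A (e (f k)) (axis i 1) = complex_of_real (d k) * herm_inner (e (f k)) (axis i 1)"
        using e(2)[OF fl] by (simp add: d_def)
      then have "(\<Sum>l\<in>UNIV. A $ l $ i * e (f k) $ l) = complex_of_real (d k) * e (f k) $ i"
        by (simp add: sform_def herm_inner_def axis_def if_distrib[of cnj] if_distrib[of "\<lambda>x. _ * x"] cong: if_cong)
      then have "cnj (\<Sum>l\<in>UNIV. A $ l $ i * e (f k) $ l) = cnj (complex_of_real (d k) * e (f k) $ i)" by simp
      moreover have "cnj (A $ l $ i) = A $ i $ l" for l using A by (rule hermitianD)
      ultimately show ?thesis
        by (simp add: matrix_matrix_mult_def U_def diag_mat_def if_distrib[of "\<lambda>x. _ * x"] mult.commute cong: if_cong)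
    qed
    then show ?thesis by (simp add: vec_eq_iff)
  qed
  then have "A = U ** diag_mat (\<lambda>i. complex_of_real (d i)) ** ctranspose U"
    by (metis "2" matrix_mul_assoc matrix_mul_rid)
  then show thesis using that 1 2 by blast
qed

subsection \<open>Elementary symmetric functions of a matrix\<close>

lemma matrix_mul_diff_right: "A ** (B - C) = A ** B - A ** C" for A B C :: "complex^'n^'n"
  by (simp add: vec_eq_iff matrix_matrix_mult_def right_diff_distrib sum_subtractf)

lemma matrix_mul_diff_left: "(B - C) ** A = B ** A - C ** A" for A B C :: "complex^'n^'n"
  by (simp add: vec_eq_iff matrix_matrix_mult_def left_diff_distrib sum_subtractf)

lemma mat_mul_entry: "(mat c ** A) $ i $ j = c * A $ i $ (j::'n)" for A :: "complex^'n^'n"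
  by (simp add: matrix_matrix_mult_def mat_def if_distrib[of "\<lambda>x. x * _"] cong: if_cong)

lemma mul_mat_entry: "(A ** mat c) $ i $ j = A $ i $ j * c" for A :: "complex^'n^'n"
  by (simp add: matrix_matrix_mult_def mat_def if_distrib[of "\<lambda>x. _ * x"] cong: if_cong)

lemma mat_commute: "mat c ** A = A ** mat c" for A :: "complex^'n^'n"
  by (simp add: vec_eq_iff mat_mul_entry mul_mat_entry mult.commute)

lemma mat_conj: "U ** U' = mat 1 \<Longrightarrow> U ** mat c ** U' = mat c" for U :: "complex^'n^'n"
  by (metis mat_commute matrix_mul_assoc matrix_mul_rid)

lemma newton_mat_conj:
  fixes U U' X :: "complex^'n^'n"
  assumes "U' ** U = mat 1" "U ** U' = mat 1"
  shows "newton_mat j (U ** X ** U') = U ** newton_mat j X ** U'"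
    and "esym_mat j (U ** X ** U') = esym_mat j X"
proof -
  have tr: "trace (U ** Y ** U') = trace Y" for Y
    by (metis assms(1) matrix_mul_assoc matrix_mul_lid trace_mul_sym)
  have mul: "(U ** X ** U') ** (U ** Y ** U') = U ** (X ** Y) ** U'" for X Y
    by (metis assms(1) matrix_mul_assoc matrix_mul_rid)
  show 1: "newton_mat j (U ** X ** U') = U ** newton_mat j X ** U'" for j
  proof (induction j)
    case (Suc j)
    then show ?case
      by (simp add: mul tr matrix_mul_diff_right matrix_mul_diff_left mat_conj[OF assms(2)])
  qed (simp add: assms)
  show "esym_mat j (U ** X ** U') = esym_mat j X"
    by (cases j) (simp_all add: 1 mul tr)
qed

text \<open>Deleting the index \<open>i\<close> solves the recursion: \<open>esym_euler\<close>
  supplies the trace and \<open>esym_remove\<close> the difference.\<close>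

lemma newton_mat_diag:
  "newton_mat j (diag_mat d) = diag_mat (\<lambda>i. esym j (UNIV - {i}) d)"
  "esym_mat j (diag_mat d) = esym j UNIV d"
proof -
  have mul: "diag_mat a ** diag_mat b = diag_mat (\<lambda>i. a i * b i)" for a b :: "'a \<Rightarrow> complex"
    by (simp add: vec_eq_iff matrix_matrix_mult_def diag_mat_def if_distrib[of "\<lambda>x. x * _"] cong: if_cong)
  have tr: "trace (diag_mat a) = sum a UNIV" for a :: "'a \<Rightarrow> complex"
    by (simp add: trace_def diag_mat_def)
  show 1: "newton_mat j (diag_mat d) = diag_mat (\<lambda>i. esym j (UNIV - {i}) d)" for j
  proof (induction j)
    case 0
    then show ?case by (simp add: vec_eq_iff diag_mat_def mat_def)
  next
    case (Suc j)
    have "(\<Sum>i\<in>UNIV. d i * esym j (UNIV - {i}) d) / of_nat (Suc j) = esym (Suc j) UNIV d"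
      by (simp add: esym_euler del: of_nat_Suc)
    then have "newton_mat (Suc j) (diag_mat d) = mat (esym (Suc j) UNIV d) - diag_mat (\<lambda>i. d i * esym j (UNIV - {i}) d)"
      by (simp only: newton_mat.simps Suc mul tr)
    moreover have "esym (Suc j) UNIV d - d i * esym j (UNIV - {i}) d = esym (Suc j) (UNIV - {i}) d" for i
      using esym_remove[of UNIV i j d] by simp
    ultimately show ?case
      by (simp only:) (simp add: vec_eq_iff diag_mat_def mat_def)
  qed
  show "esym_mat j (diag_mat d) = esym j UNIV d"
    by (cases j) (simp_all add: 1 mul tr esym_euler del: of_nat_Suc)
qed

lemma hermitian_newton_diag:
  fixes A :: "complex^'n^'n"
  assumes A: "hermitian A"
  obtains U :: "complex^'n^'n" and d where "ctranspose U ** U = mat 1" "U ** ctranspose U = mat 1"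
    "A = U ** diag_mat (\<lambda>i. complex_of_real (d i)) ** ctranspose U"
    "\<And>j. newton_mat j A = U ** diag_mat (\<lambda>i. complex_of_real (esym j (UNIV - {i}) d)) ** ctranspose U"
    "\<And>j. esym_mat j A = complex_of_real (esym j UNIV d)"
proof -
  obtain U :: "complex^'n^'n" and d where U: "ctranspose U ** U = mat 1" "U ** ctranspose U = mat 1"
    "A = U ** diag_mat (\<lambda>i. complex_of_real (d i)) ** ctranspose U"
    using hermitian_diagonalizable[OF A] .
  show thesis
    by (rule that[OF U]) (simp_all add: U(3) newton_mat_conj[OF U(1,2)] newton_mat_diag esym_of_real)
qed

text \<open>Ties the choice in \<open>eigenvalue_vec\<close> to the polynomial
  \<open>esym_mat\<close>: diagonalization shows that the choice has a witness, and all witnesses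
  have the same symmetric functions.\<close>

lemma norm_sym_mat_eq:
  fixes A :: "complex^'n^'n"
  assumes A: "hermitian A"
  shows "norm_sym_mat j A = fact j * fact (CARD('n) - j) / fact CARD('n) * Re (esym_mat j A)"
    and "norm_sym j (eigenvalue_vec A) = fact j * fact (CARD('n) - j) / fact CARD('n) * Re (esym_mat j A)"
proof -
  obtain U :: "complex^'n^'n" and d where U: "ctranspose U ** U = mat 1" "U ** ctranspose U = mat 1"
    "A = U ** diag_mat (\<lambda>i. complex_of_real (d i)) ** ctranspose U"
    "\<And>j. esym_mat j A = complex_of_real (esym j UNIV d)"
    using hermitian_newton_diag[OF A] by metis
  have "det (mat t - A) = (\<Prod>i\<in>UNIV. t - complex_of_real (d i))" for t
  proof -
    have "mat t - A = U ** (mat t - diag_mat (\<lambda>i. complex_of_real (d i))) ** ctranspose U"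
      by (simp add: U(3) matrix_mul_diff_right matrix_mul_diff_left mat_conj[OF U(2)])
    then have "det (mat t - A) = det U * det (ctranspose U) * det (mat t - diag_mat (\<lambda>i. complex_of_real (d i)))"
      by (simp add: det_mul)
    also have "det U * det (ctranspose U) = 1"
      by (metis U(2) det_I det_mul)
    also have "det (mat t - diag_mat (\<lambda>i. complex_of_real (d i))) = (\<Prod>i\<in>UNIV. t - complex_of_real (d i))"
      by (subst det_diagonal) (auto simp: mat_def diag_mat_def)
    finally show ?thesis by simp
  qed
  then have "\<exists>l::real^'n. \<forall>t. det (mat t - A) = (\<Prod>i\<in>UNIV. t - complex_of_real (l $ i))"
    by (intro exI[of _ "\<chi> i. d i"]) simp
  then have "\<forall>t. det (mat t - A) = (\<Prod>i\<in>UNIV. t - complex_of_real (eigenvalue_vec A $ i))"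
    unfolding eigenvalue_vec_def by (rule someI_ex)
  then have "esym j UNIV (\<lambda>i. complex_of_real (eigenvalue_vec A $ i)) = esym j UNIV (\<lambda>i. complex_of_real (d i))"
    using \<open>\<And>t. det (mat t - A) = _\<close> by (intro esym_cong_mset) auto
  then have "esym j UNIV (\<lambda>i. eigenvalue_vec A $ i) = esym j UNIV d"
    by (simp add: esym_of_real)
  then show "norm_sym j (eigenvalue_vec A) = fact j * fact (CARD('n) - j) / fact CARD('n) * Re (esym_mat j A)"
    by (simp only: norm_sym_def elem_sym_esym U(4) Re_complex_of_real)
  then show "norm_sym_mat j A = fact j * fact (CARD('n) - j) / fact CARD('n) * Re (esym_mat j A)"
    by (simp add: norm_sym_mat_def)
qed

text \<open>In the recursion the scalar part contributes \<open>CARD('n)\<close> copies of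
  \<open>esym_mat j A\<close> and the product part takes away \<open>j\<close> of them.\<close>

lemma trace_newton_mat:
  fixes A :: "complex^'n^'n"
  assumes "j \<le> CARD('n)"
  shows "trace (newton_mat j A) = of_nat (CARD('n) - j) * esym_mat j A"
proof (cases j)
  case 0 then show ?thesis by (simp add: trace_I)
next
  case (Suc l)
  have "trace (mat c :: complex^'n^'n) = of_nat CARD('n) * c" for c
    by (simp add: trace_def mat_def)
  moreover have "trace (A ** newton_mat l A) = of_nat (Suc l) * esym_mat (Suc l) A"
    by (simp del: of_nat_Suc)
  ultimately show ?thesis using assms
    by (simp only: Suc newton_mat_Suc trace_sub) (simp only: of_nat_diff left_diff_distrib)
qed

subsection \<open>Differentiation of elementary symmetric functions\<close>

primrec mpow :: "nat \<Rightarrow> complex^'n^'n \<Rightarrow> complex^'n^'n" where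
  "mpow 0 A = mat 1"
| "mpow (Suc m) A = A ** mpow m A"

lemma mpow_commute: "mpow m A ** A = A ** mpow m A"
proof (induction m)
  case (Suc m)
  then show ?case by (metis matrix_mul_assoc mpow.simps(2))
qed simp

lemma mpow_add: "mpow l A ** mpow m A = mpow (l + m) A"
  by (induction l) (simp_all add: matrix_mul_assoc[symmetric])

lemma smat_simps:
  "smat c A ** B = smat c (A ** B)" "A ** smat c B = smat c (A ** B)" "trace (smat c A) = c * trace A"
  "smat c (smat d A) = smat (c * d) A" "smat 1 A = A" "smat 0 A = 0" "smat c (A + B) = smat c A + smat c B"
  "smat c (mat d) = mat (c * d)" "smat c A $ i $ j = c * A $ i $ j"
  by (simp_all add: smat_def vec_eq_iff matrix_matrix_mult_def trace_def sum_distrib_left mat_def algebra_simps)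

lemma trace_sum: "trace (\<Sum>a\<in>I. f a) = (\<Sum>a\<in>I. trace (f a))"
  unfolding trace_def sum_component by (rule sum.swap)

lemma matrix_mul_sum_right: "A ** (\<Sum>a\<in>I. f a) = (\<Sum>a\<in>I. A ** f a)" for A :: "complex^'n^'n"
  by (induction I rule: infinite_finite_induct) (auto simp: matrix_add_ldistrib)

lemma matrix_mul_add_left: "(B + C) ** A = B ** A + C ** A" for A B C :: "complex^'n^'n"
  by (simp add: vec_eq_iff matrix_matrix_mult_def distrib_right sum.distrib)

lemma matrix_mul_sum_left: "(\<Sum>a\<in>I. f a) ** A = (\<Sum>a\<in>I. f a ** A)" for A :: "complex^'n^'n" and f :: "'i \<Rightarrow> complex^'n^'n"
  by (induction I rule: infinite_finite_induct) (auto simp: matrix_mul_add_left)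

lemma newton_mat_sum:
  "newton_mat j A = (\<Sum>m\<le>j. smat ((-1) ^ m * esym_mat (j - m) A) (mpow m A))"
proof (induction j)
  case 0
  then show ?case by (simp add: smat_simps)
next
  case (Suc j)
  have "A ** newton_mat j A = (\<Sum>m\<le>j. smat ((-1) ^ m * esym_mat (j - m) A) (mpow (Suc m) A))"
    by (simp add: Suc matrix_mul_sum_right smat_simps)
  also have "\<dots> = - (\<Sum>m\<le>j. smat ((-1) ^ Suc m * esym_mat (j - m) A) (mpow (Suc m) A))"
    by (simp add: sum_negf[symmetric] smat_def vec_eq_iff)
  finally show ?case
    by (subst sum.atMost_Suc_shift) (simp add: smat_simps del: esym_mat.simps newton_mat.simps mpow.simps add: newton_mat_Suc mpow.simps(1))
qed

text \<open>Newton's identities between elementary symmetric functions and power sums; the latter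
  are traces of powers, which are easy to differentiate.\<close>

lemma newton_identity:
  "of_nat (Suc j) * esym_mat (Suc j) A = (\<Sum>m\<le>j. (-1) ^ m * esym_mat (j - m) A * trace (mpow (Suc m) A))"
proof -
  have "of_nat (Suc j) * esym_mat (Suc j) A = trace (A ** newton_mat j A)"
    by (simp del: of_nat_Suc)
  also have "\<dots> = (\<Sum>m\<le>j. (-1) ^ m * esym_mat (j - m) A * trace (mpow (Suc m) A))"
    by (simp add: newton_mat_sum matrix_mul_sum_right trace_sum smat_simps)
  finally show ?thesis .
qed

definition mat_deriv :: "(real \<Rightarrow> complex^'n^'n) \<Rightarrow> complex^'n^'n \<Rightarrow> real \<Rightarrow> bool" where
  "mat_deriv M M' t \<longleftrightarrow> (\<forall>i k. ((\<lambda>t. M t $ i $ k) has_vector_derivative M' $ i $ k) (at t))"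

lemma mat_deriv_mult:
  assumes "mat_deriv M M' t" "mat_deriv N N' t"
  shows "mat_deriv (\<lambda>t. M t ** N t) (M t ** N' + M' ** N t) t"
  unfolding mat_deriv_def matrix_matrix_mult_def
proof (intro allI)
  fix i k
  have "((\<lambda>t. \<Sum>l\<in>UNIV. M t $ i $ l * N t $ l $ k) has_vector_derivative
     (\<Sum>l\<in>UNIV. M t $ i $ l * N' $ l $ k + M' $ i $ l * N t $ l $ k)) (at t)"
    using assms unfolding mat_deriv_def
    by (intro has_vector_derivative_sum has_vector_derivative_mult) auto
  then show "((\<lambda>t. (\<chi> i j. \<Sum>l\<in>UNIV. M t $ i $ l * N t $ l $ j) $ i $ k) has_vector_derivative
     ((\<chi> i j. \<Sum>l\<in>UNIV. M t $ i $ l * N' $ l $ j) + (\<chi> i j. \<Sum>l\<in>UNIV. M' $ i $ l * N t $ l $ j)) $ i $ k) (at t)"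
    by (simp add: sum.distrib)
qed

lemma mat_deriv_const: "mat_deriv (\<lambda>_. A) 0 t"
  by (simp add: mat_deriv_def)

text \<open>In the derivative of a power \<open>M'\<close> appears at every position and need not
  commute with \<open>M t\<close>. Traced against a power of \<open>M t\<close> the \<open>m\<close>
  terms agree by cyclicity, so only these traces are recorded. For \<open>m = 0\<close> the
  truncated subtraction is multiplied by zero.\<close>

lemma mat_deriv_mpow:
  assumes M: "mat_deriv M M' t"
  shows "\<exists>D. mat_deriv (\<lambda>t. mpow m (M t)) D t \<and>
     (\<forall>l. trace (mpow l (M t) ** D) = of_nat m * trace (mpow (l + m - 1) (M t) ** M'))"
proof (induction m)
  case 0
  show ?case by (intro exI[of _ 0]) (simp add: mat_deriv_const trace_def)
next
  case (Suc m)
  then obtain D where D: "mat_deriv (\<lambda>t. mpow m (M t)) D t"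
    "\<And>l. trace (mpow l (M t) ** D) = of_nat m * trace (mpow (l + m - 1) (M t) ** M')" by auto
  let ?A = "M t"
  have "trace (mpow l ?A ** (?A ** D + M' ** mpow m ?A)) = of_nat (Suc m) * trace (mpow (l + m) ?A ** M')" for l
  proof -
    have 1: "mpow l ?A ** (?A ** D) = mpow (Suc l) ?A ** D"
      by (simp add: matrix_mul_assoc mpow_commute)
    have "trace (mpow l ?A ** (M' ** mpow m ?A)) = trace (mpow m ?A ** (mpow l ?A ** M'))"
      by (metis matrix_mul_assoc trace_mul_sym)
    also have "\<dots> = trace (mpow (l + m) ?A ** M')"
      by (simp add: matrix_mul_assoc mpow_add add.commute)
    finally have 2: "trace (mpow l ?A ** (M' ** mpow m ?A)) = trace (mpow (l + m) ?A ** M')" .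
    have "trace (mpow l ?A ** (?A ** D + M' ** mpow m ?A)) 
      = trace (mpow (Suc l) ?A ** D) + trace (mpow l ?A ** (M' ** mpow m ?A))"
      by (simp only: matrix_add_ldistrib trace_add 1)
    then show ?thesis unfolding 2 D(2) by (simp add: algebra_simps)
  qed
  then show ?case
    using mat_deriv_mult[OF M D(1)] by auto
qed

text \<open>Newton's identity is differentiated and solved for the highest order by strong
  induction, which avoids any question of differentiability of eigenvalues.\<close>

lemma esym_mat_deriv:
  assumes M: "mat_deriv M M' t"
  shows "((\<lambda>t. esym_mat j (M t)) has_vector_derivative
    (\<Sum>l<j. (-1) ^ l * esym_mat (j - 1 - l) (M t) * trace (mpow l (M t) ** M'))) (at t)"
proof (induction j rule: less_induct)
  case (less j)
  show ?case
  proof (cases j)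
    case (Suc j')
    let ?A = "M t"
    let ?E = "\<lambda>i. esym_mat i ?A" and ?q = "\<lambda>l. trace (mpow l ?A ** M')" and ?p = "\<lambda>m. trace (mpow m ?A)"
    let ?E' = "\<lambda>i. \<Sum>l<i. (-1) ^ l * ?E (i - 1 - l) * ?q l"
    have p': "((\<lambda>t. trace (mpow (Suc m) (M t))) has_vector_derivative of_nat (Suc m) * ?q m) (at t)" for m
    proof -
      obtain D where D: "mat_deriv (\<lambda>t. mpow (Suc m) (M t)) D t"
        "\<And>l. trace (mpow l (M t) ** D) = of_nat (Suc m) * trace (mpow (l + Suc m - 1) (M t) ** M')"
        using mat_deriv_mpow[OF M, of "Suc m"] by blast
      have "trace D = of_nat (Suc m) * ?q m" using D(2)[of 0] by simp
      moreover have "((\<lambda>t. trace (mpow (Suc m) (M t))) has_vector_derivative trace D) (at t)"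
        unfolding trace_def using D(1) unfolding mat_deriv_def by (intro has_vector_derivative_sum) auto
      ultimately show ?thesis by simp
    qed
    let ?S = "\<Sum>m\<le>j'. (-1) ^ m * (?E (j' - m) * (of_nat (Suc m) * ?q m) + ?E' (j' - m) * ?p (Suc m))"
    have "((\<lambda>t. \<Sum>m\<le>j'. (-1) ^ m * (esym_mat (j' - m) (M t) * trace (mpow (Suc m) (M t)))) has_vector_derivative ?S) (at t)"
    proof (intro has_vector_derivative_sum has_vector_derivative_mult_right has_vector_derivative_mult p')
      fix m assume "m \<in> {..j'}"
      then show "((\<lambda>t. esym_mat (j' - m) (M t)) has_vector_derivative ?E' (j' - m)) (at t)"
        using less.IH[of "j' - m"] Suc by auto
    qed
    then have d: "((\<lambda>t. of_nat j * esym_mat j (M t)) has_vector_derivative ?S) (at t)"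
      unfolding Suc newton_identity by (simp only: mult.assoc)
    have "(\<Sum>m\<le>j'. (-1) ^ m * (?E' (j' - m) * ?p (Suc m)))
       = (\<Sum>m\<in>{..j'}. \<Sum>l | l \<in> {..j'} \<and> l + m < j'. (-1) ^ m * (-1) ^ l * ?E (j' - m - 1 - l) * ?q l * ?p (Suc m))"
    proof (rule sum.cong[OF refl])
      fix m assume "m \<in> {..j'}"
      have "{..<j' - m} = {l. l \<in> {..j'} \<and> l + m < j'}" by auto
      then show "(-1) ^ m * (?E' (j' - m) * ?p (Suc m)) = (\<Sum>l | l \<in> {..j'} \<and> l + m < j'. (-1) ^ m * (-1) ^ l * ?E (j' - m - 1 - l) * ?q l * ?p (Suc m))"
        by (simp add: sum_distrib_left sum_distrib_right mult_ac)
    qed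
    \<comment> \<open>After the interchange the inner sum over \<open>m\<close> is Newton's identity
      of order \<open>j' - l\<close>. Together with the part from the power sums, the weights
      \<open>Suc l\<close> and \<open>j' - l\<close> add up to the common factor
      \<open>j\<close>.\<close>
    also have "\<dots> = (\<Sum>l\<in>{..j'}. \<Sum>m | m \<in> {..j'} \<and> l + m < j'. (-1) ^ m * (-1) ^ l * ?E (j' - m - 1 - l) * ?q l * ?p (Suc m))"
      by (rule sum.swap_restrict) auto
    also have "\<dots> = (\<Sum>l\<le>j'. (-1) ^ l * ?q l * (of_nat (j' - l) * ?E (j' - l)))"
    proof (rule sum.cong[OF refl])
      fix l assume "l \<in> {..j'}"
      show "(\<Sum>m | m \<in> {..j'} \<and> l + m < j'. (-1) ^ m * (-1) ^ l * ?E (j' - m - 1 - l) * ?q l * ?p (Suc m))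
         = (-1) ^ l * ?q l * (of_nat (j' - l) * ?E (j' - l))"
      proof (cases "j' - l")
        case (Suc d)
        then have "{m. m \<in> {..j'} \<and> l + m < j'} = {..d}" by auto
        moreover have "j' - m - 1 - l = d - m" for m using Suc by auto
        ultimately show ?thesis
          unfolding Suc newton_identity by (simp add: sum_distrib_left mult_ac)
      next
        case 0
        then have "{m. m \<in> {..j'} \<and> l + m < j'} = {}" by auto
        then show ?thesis using 0 by (simp only: sum.empty) simp
      qed
    qed
    finally have "?S = (\<Sum>l\<le>j'. (-1) ^ l * ?E (j' - l) * (of_nat (Suc l) * ?q l)) + (\<Sum>l\<le>j'. (-1) ^ l * ?q l * (of_nat (j' - l) * ?E (j' - l)))"
      by (simp only: distrib_left sum.distrib mult.assoc)
    also have "\<dots> = (\<Sum>l\<le>j'. of_nat j * ((-1) ^ l * ?E (j' - l) * ?q l))"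
      unfolding sum.distrib[symmetric]
    proof (rule sum.cong[OF refl])
      fix l assume "l \<in> {..j'}"
      then have "of_nat j = (of_nat (Suc l) + of_nat (j' - l) :: complex)"
        unfolding of_nat_add[symmetric] using Suc by simp
      then show "(-1) ^ l * ?E (j' - l) * (of_nat (Suc l) * ?q l) + (-1) ^ l * ?q l * (of_nat (j' - l) * ?E (j' - l))
         = of_nat j * ((-1) ^ l * ?E (j' - l) * ?q l)" by (simp only:) (simp add: algebra_simps)
    qed
    also have "\<dots> = of_nat j * (\<Sum>l<j. (-1) ^ l * ?E (j - 1 - l) * ?q l)"
      by (simp add: Suc sum_distrib_left lessThan_Suc_atMost)
    finally have S: "?S = of_nat j * (\<Sum>l<j. (-1) ^ l * ?E (j - 1 - l) * ?q l)" .
    have "of_nat j \<noteq> (0::complex)" using Suc by (simp only: of_nat_eq_0_iff nat.simps simp_thms)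
    then show ?thesis
      using has_vector_derivative_mult_right[OF d[unfolded S], of "1 / of_nat j"]
      by (simp add: field_simps)
  qed simp
qed

text \<open>\<open>newton_mat j\<close> is the gradient of \<open>esym_mat (Suc j)\<close>; this is
  what identifies Newton transformations with the coefficients of linearized Hessian
  operators.\<close>

lemma esym_mat_deriv_trace:
  assumes M: "mat_deriv M M' t"
  shows "((\<lambda>t. esym_mat (Suc j) (M t)) has_vector_derivative trace (newton_mat j (M t) ** M')) (at t)"
proof -
  have "trace (newton_mat j (M t) ** M') = (\<Sum>l<Suc j. (-1) ^ l * esym_mat (Suc j - 1 - l) (M t) * trace (mpow l (M t) ** M'))"
    by (simp add: newton_mat_sum matrix_mul_sum_left trace_sum smat_simps lessThan_Suc_atMost)
  then show ?thesis using esym_mat_deriv[OF M, of "Suc j"] by simp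
qed

subsection \<open>Dependence on a parameter\<close>

lemma continuous_on_matrix_mult:
  fixes f g :: "'a::topological_space \<Rightarrow> complex^'n^'n"
  assumes "continuous_on S f" "continuous_on S g"
  shows "continuous_on S (\<lambda>x. f x ** g x)"
  unfolding matrix_matrix_mult_def by (intro continuous_intros assms)

lemma continuous_on_trace:
  fixes f :: "'a::topological_space \<Rightarrow> complex^'n^'n"
  assumes "continuous_on S f"
  shows "continuous_on S (\<lambda>x. trace (f x))"
  unfolding trace_def by (intro continuous_intros assms)

lemma continuous_on_mat:
  assumes "continuous_on S f"
  shows "continuous_on S (\<lambda>x. mat (f x) :: complex^'n^'n)"
proof -
  have "continuous_on S (\<lambda>x. if i = j then f x else 0)" for i j :: 'n
    using assms by (cases "i = j") auto
  then show ?thesis unfolding mat_def by (intro continuous_intros)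
qed

lemma continuous_on_smat:
  assumes "continuous_on S f" "continuous_on S g"
  shows "continuous_on S (\<lambda>x. smat (f x) (g x) :: complex^'n^'n)"
  unfolding smat_def by (intro continuous_intros assms)

lemma continuous_on_newton_mat:
  fixes f :: "'a::topological_space \<Rightarrow> complex^'n^'n"
  assumes "continuous_on S f"
  shows "continuous_on S (\<lambda>x. newton_mat j (f x))"
proof (induction j)
  case (Suc j)
  have "of_nat (Suc j) \<noteq> (0::complex)" by (simp only: of_nat_eq_0_iff nat.simps simp_thms)
  then show ?case
    unfolding newton_mat.simps
    by (intro continuous_intros continuous_on_mat continuous_on_trace continuous_on_matrix_mult assms Suc ballI)
qed simp

lemma continuous_on_esym_mat:
  fixes f :: "'a::topological_space \<Rightarrow> complex^'n^'n"
  assumes "continuous_on S f"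
  shows "continuous_on S (\<lambda>x. esym_mat j (f x))"
proof (cases j)
  case (Suc l)
  have "of_nat (Suc l) \<noteq> (0::complex)" by (simp only: of_nat_eq_0_iff nat.simps simp_thms)
  then show ?thesis
    unfolding Suc esym_mat.simps
    by (intro continuous_intros continuous_on_trace continuous_on_matrix_mult continuous_on_newton_mat assms ballI)
qed simp

text \<open>A degree bound together with the coefficient at the bound, which may be zero. Carrying
  this formal leading coefficient lets sums and products be formed without deciding whether
  cancellation occurs.\<close>

definition polyd :: "nat \<Rightarrow> (complex \<Rightarrow> complex) \<Rightarrow> complex \<Rightarrow> bool" where
  "polyd k f c \<longleftrightarrow> (\<exists>p. degree p \<le> k \<and> coeff p k = c \<and> (\<forall>s. f s = poly p s))"

lemma polyd_const: "polyd 0 (\<lambda>_. c) c"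
  unfolding polyd_def by (intro exI[of _ "[:c:]"]) auto

lemma polyd_mono: "polyd k f c \<Longrightarrow> k < l \<Longrightarrow> polyd l f 0"
  unfolding polyd_def by (metis coeff_eq_0 less_imp_le le_less_trans)

lemma polyd_add: "polyd k f c \<Longrightarrow> polyd k g d \<Longrightarrow> polyd k (\<lambda>s. f s + g s) (c + d)"
  unfolding polyd_def by (metis coeff_add degree_add_le poly_add)

lemma polyd_diff: "polyd k f c \<Longrightarrow> polyd k g d \<Longrightarrow> polyd k (\<lambda>s. f s - g s) (c - d)"
  unfolding polyd_def by (metis coeff_diff degree_diff_le poly_diff)

lemma polyd_sum: "(\<And>i. i \<in> I \<Longrightarrow> polyd k (f i) (c i)) \<Longrightarrow> polyd k (\<lambda>s. \<Sum>i\<in>I. f i s) (\<Sum>i\<in>I. c i)"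
proof (induction I rule: infinite_finite_induct)
  case empty
  show ?case unfolding polyd_def by (intro exI[of _ 0]) auto
next
  case (infinite A)
  then show ?case unfolding polyd_def by (intro exI[of _ 0]) auto
qed (auto intro: polyd_add)

lemma polyd_mult: 
  assumes "polyd k f c" "polyd l g d"
  shows "polyd (k + l) (\<lambda>s. f s * g s) (c * d)"
proof -
  obtain p q where p: "degree p \<le> k" "coeff p k = c" "\<And>s. f s = poly p s"
    and q: "degree q \<le> l" "coeff q l = d" "\<And>s. g s = poly q s"
    using assms unfolding polyd_def by blast
  have "coeff (p * q) (k + l) = (\<Sum>i\<le>k + l. coeff p i * coeff q (k + l - i))" by (rule coeff_mult)
  also have "\<dots> = (\<Sum>i\<le>k + l. if i = k then c * d else 0)"
  proof (rule sum.cong[OF refl])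
    fix i assume "i \<in> {..k + l}"
    show "coeff p i * coeff q (k + l - i) = (if i = k then c * d else 0)"
    proof (cases "i < k")
      case True
      then have "coeff q (k + l - i) = 0" using q by (intro coeff_eq_0) auto
      then show ?thesis using True by simp
    next
      case False
      then show ?thesis using p q by (cases "i = k") (auto intro: coeff_eq_0)
    qed
  qed
  finally have "coeff (p * q) (k + l) = c * d" by simp
  moreover have "degree (p * q) \<le> k + l" using degree_mult_le[of p q] p q by linarith
  ultimately show ?thesis unfolding polyd_def using p q by (intro exI[of _ "p * q"]) auto
qed

lemma polyd_affine: "polyd 1 (\<lambda>s. (A + smat s B) $ a $ b) (B $ a $ b)"
  unfolding polyd_def by (intro exI[of _ "[:A $ a $ b, B $ a $ b:]"]) (auto simp: smat_def)

lemma polyd_matrix_mult: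
  fixes M N :: "complex \<Rightarrow> complex^'n^'n"
  assumes "\<And>a b. polyd k (\<lambda>s. M s $ a $ b) (M' $ a $ b)" "\<And>a b. polyd l (\<lambda>s. N s $ a $ b) (N' $ a $ b)"
  shows "polyd (k + l) (\<lambda>s. (M s ** N s) $ a $ b) ((M' ** N') $ a $ b)"
  unfolding matrix_matrix_mult_def vec_lambda_beta
  by (rule polyd_sum) (rule polyd_mult[OF assms])

lemma polyd_trace:
  fixes M :: "complex \<Rightarrow> complex^'n^'n"
  assumes "\<And>a b. polyd k (\<lambda>s. M s $ a $ b) (M' $ a $ b)"
  shows "polyd k (\<lambda>s. trace (M s)) (trace M')"
  unfolding trace_def by (rule polyd_sum) (rule assms)

lemma polyd_divide:
  assumes "polyd k f c"
  shows "polyd k (\<lambda>s. f s / a) (c / a)"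
  using polyd_mult[OF polyd_const[of "1 / a"] assms] by simp

lemma polyd_newton_mat:
  "polyd j (\<lambda>s. newton_mat j (A + smat s B) $ i $ k) (newton_mat j B $ i $ k)"
proof (induction j arbitrary: i k)
  case 0
  show ?case by (simp add: polyd_const)
next
  case (Suc j)
  have m: "polyd (Suc j) (\<lambda>s. ((A + smat s B) ** newton_mat j (A + smat s B)) $ a $ b) ((B ** newton_mat j B) $ a $ b)" for a b
    using polyd_matrix_mult[OF polyd_affine Suc] by simp
  have t: "polyd (Suc j) (\<lambda>s. trace ((A + smat s B) ** newton_mat j (A + smat s B)) / of_nat (Suc j)) (trace (B ** newton_mat j B) / of_nat (Suc j))"
    by (rule polyd_divide[OF polyd_trace[OF m]])
  have z: "polyd (Suc j) (\<lambda>_. 0) 0" using polyd_mono[OF polyd_const] by blast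
  show ?case
    using polyd_diff[OF t m[of i k]] polyd_diff[OF z m[of i k]]
    by (cases "i = k") (simp_all only: newton_mat.simps vector_minus_component mat_def vec_lambda_beta if_True if_False simp_thms)
qed

text \<open>When the leading coefficient \<open>esym_mat j B\<close> is nonzero, the pencil has
  exactly \<open>j\<close> zeros counted with multiplicity, so it factors into that many linear
  terms.\<close>

lemma polyd_esym_mat: "polyd j (\<lambda>s. esym_mat j (A + smat s B)) (esym_mat j B)"
proof (cases j)
  case 0
  then show ?thesis by (simp add: polyd_const)
next
  case (Suc l)
  have "polyd (Suc l) (\<lambda>s. ((A + smat s B) ** newton_mat l (A + smat s B)) $ a $ b) ((B ** newton_mat l B) $ a $ b)" for a b
    using polyd_matrix_mult[OF polyd_affine polyd_newton_mat] by simp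
  then show ?thesis
    unfolding Suc esym_mat.simps by (intro polyd_divide polyd_trace)
qed

lemma esym_mat_smat: "newton_mat j (smat c A) = smat (c ^ j) (newton_mat j A)"
  "esym_mat j (smat c A) = c ^ j * esym_mat j A"
proof -
  show 1: "newton_mat j (smat c A) = smat (c ^ j) (newton_mat j A)" for j
  proof (induction j)
    case (Suc j)
    have "smat c A ** newton_mat j (smat c A) = smat (c ^ Suc j) (A ** newton_mat j A)"
      by (simp add: Suc smat_simps mult.commute)
    moreover have "mat (trace (smat (c ^ Suc j) (A ** newton_mat j A)) / of_nat (Suc j)) - smat (c ^ Suc j) (A ** newton_mat j A)
       = smat (c ^ Suc j) (mat (trace (A ** newton_mat j A) / of_nat (Suc j)) - A ** newton_mat j A)"
      unfolding smat_simps by (simp add: smat_def vec_eq_iff mat_def right_diff_distrib)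
    ultimately show ?case by (simp only: newton_mat.simps)
  qed (simp add: smat_simps)
  show "esym_mat j (smat c A) = c ^ j * esym_mat j A"
    by (cases j) (simp_all add: 1 smat_simps)
qed

declare esym_mat.simps(2) [simp del] newton_mat.simps(2) [simp del]

subsection \<open>Hyperbolicity and Garding's inequality\<close>

definition herm_Gamma :: "nat \<Rightarrow> (complex^'n^'n) set" where
  "herm_Gamma k = {A. hermitian A \<and> (\<forall>j\<in>{1..k}. Re (esym_mat j A) \<ge> 0)}"

definition herm_Gamma_open :: "nat \<Rightarrow> (complex^'n^'n) set" where
  "herm_Gamma_open k = {A. hermitian A \<and> (\<forall>j\<in>{1..k}. Re (esym_mat j A) > 0)}"

lemma esym_mat_hermitian_real:
  assumes "hermitian A" shows "esym_mat j A = of_real (Re (esym_mat j A))"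
  using hermitian_newton_diag[OF assms] by (metis Re_complex_of_real)

text \<open>The real eigenvalues of \<open>A\<close> shifted by \<open>t\<close> all lie in one open
  half plane; \<open>esym_upper_half_plane\<close> covers the upper one and conjugation the lower
  one.\<close>

lemma esym_mat_add_mat_nonzero:
  fixes A :: "complex^'n^'n"
  assumes A: "hermitian A" and t: "Im t \<noteq> 0" and j: "j \<le> CARD('n)"
  shows "esym_mat j (A + mat t) \<noteq> 0"
proof -
  obtain U :: "complex^'n^'n" and d where U: "ctranspose U ** U = mat 1" "U ** ctranspose U = mat 1"
    "A = U ** diag_mat (\<lambda>i. complex_of_real (d i)) ** ctranspose U"
    using hermitian_diagonalizable[OF A] .
  have "diag_mat (\<lambda>i. complex_of_real (d i)) + mat t = diag_mat (\<lambda>i. complex_of_real (d i) + t)"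
    by (simp add: vec_eq_iff diag_mat_def mat_def)
  then have "A + mat t = U ** diag_mat (\<lambda>i. complex_of_real (d i) + t) ** ctranspose U"
    using mat_conj[OF U(2), of t] U(3) by (metis matrix_add_ldistrib matrix_mul_add_left)
  then have E: "esym_mat j (A + mat t) = esym j UNIV (\<lambda>i. complex_of_real (d i) + t)"
    by (simp add: newton_mat_conj[OF U(1,2)] newton_mat_diag)
  show ?thesis
  proof (cases "Im t > 0")
    case True
    then show ?thesis unfolding E using j by (intro esym_upper_half_plane) auto
  next
    case False
    have "cnj (esym j UNIV (\<lambda>i. complex_of_real (d i) + t)) = esym j UNIV (\<lambda>i. cnj (complex_of_real (d i) + t))"
      by (simp add: esym_def)
    moreover have "esym j UNIV (\<lambda>i. cnj (complex_of_real (d i) + t)) \<noteq> 0"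
      using False t j by (intro esym_upper_half_plane) auto
    ultimately show ?thesis unfolding E by (metis complex_cnj_zero)
  qed
qed

lemma mat_deriv_affine: "mat_deriv (\<lambda>t. A + smat (of_real t) B) B t"
  unfolding mat_deriv_def smat_def
proof (intro allI)
  fix i k
  have "((\<lambda>t. A $ i $ k + t *\<^sub>R B $ i $ k) has_vector_derivative 0 + 1 *\<^sub>R B $ i $ k) (at t)"
    by (rule derivative_eq_intros | simp)+
  then show "((\<lambda>t. (A + (\<chi> i j. complex_of_real t * B $ i $ j)) $ i $ k) has_vector_derivative B $ i $ k) (at t)"
    by (simp add: scaleR_conv_of_real)
qed

lemma esym_mat_affine_deriv:
  "((\<lambda>t. Re (esym_mat (Suc j) (A + smat (of_real t) B))) has_real_derivative
     Re (trace (newton_mat j (A + smat (of_real t) B) ** B))) (at t)"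
  using bounded_linear.has_vector_derivative[OF bounded_linear_Re esym_mat_deriv_trace[OF mat_deriv_affine[of A B t], of j]]
  by (simp add: has_real_derivative_iff_has_vector_derivative)

lemma smat_mat_1: "smat c (mat 1) = mat c"
  by (simp add: smat_simps)

text \<open>Along the identity the derivative of order \<open>Suc j\<close> is a positive multiple
  of order \<open>j\<close>, so positivity climbs up from order 0. Boundary points of the cone are
  thereby pushed into its interior.\<close>

lemma herm_Gamma_shift:
  fixes A :: "complex^'n^'n"
  assumes A: "A \<in> herm_Gamma k" and k: "k \<le> CARD('n)" and t: "t > 0" and j: "j \<le> k"
  shows "Re (esym_mat j (A + mat (of_real t))) > Re (esym_mat j A) \<or> j = 0"
    and "Re (esym_mat j (A + mat (of_real t))) > 0"
proof -
  have H: "hermitian A" using A by (simp add: herm_Gamma_def)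
  have "(Re (esym_mat j (A + mat (of_real t))) > Re (esym_mat j A) \<or> j = 0) \<and> Re (esym_mat j (A + mat (of_real t))) > 0"
    using j t
  proof (induction j arbitrary: t)
    case (Suc j)
    have d: "((\<lambda>t. Re (esym_mat (Suc j) (A + smat (of_real t) (mat 1)))) has_real_derivative
     real (CARD('n) - j) * Re (esym_mat j (A + mat (of_real t)))) (at t)" for t
      using esym_mat_affine_deriv[of j A "mat 1" t] Suc.prems k
      by (simp add: trace_newton_mat smat_mat_1)
    have "Re (esym_mat (Suc j) (A + smat (of_real 0) (mat 1))) < Re (esym_mat (Suc j) (A + smat (of_real t) (mat 1)))"
    proof (rule DERIV_pos_imp_increasing_open[OF \<open>0 < t\<close>])
      fix x :: real assume "0 < x" "x < t"
      then have "Re (esym_mat j (A + mat (of_real x))) > 0" using Suc by auto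
      moreover have "real (CARD('n) - j) > 0" using Suc.prems k by simp
      ultimately show "\<exists>y. DERIV (\<lambda>t. Re (esym_mat (Suc j) (A + smat (of_real t) (mat 1)))) x :> y \<and> y > 0"
        using d by (metis mult_pos_pos)
    next
      show "continuous_on {0..t} (\<lambda>t. Re (esym_mat (Suc j) (A + smat (of_real t) (mat 1))))"
        by (rule DERIV_continuous_on) (rule has_field_derivative_at_within[OF d])
    qed
    then have "Re (esym_mat (Suc j) A) < Re (esym_mat (Suc j) (A + mat (of_real t)))"
      by (simp only: smat_mat_1 of_real_0) (simp add: mat_def del: esym_mat.simps flip: zero_vec_def)
    moreover have "Re (esym_mat (Suc j) A) \<ge> 0" using A Suc.prems by (simp add: herm_Gamma_def del: esym_mat.simps)
    ultimately show ?case by linarith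
  qed simp
  then show "Re (esym_mat j (A + mat (of_real t))) > Re (esym_mat j A) \<or> j = 0"
    "Re (esym_mat j (A + mat (of_real t))) > 0" by auto
qed

lemma herm_Gamma_open_shift:
  fixes A :: "complex^'n^'n"
  assumes "A \<in> herm_Gamma k" "k \<le> CARD('n)" "t > 0"
  shows "A + mat (of_real t) \<in> herm_Gamma_open k"
  using herm_Gamma_shift(2)[OF assms] assms(1)
  by (auto simp: herm_Gamma_open_def herm_Gamma_def intro: hermitian_add hermitian_mat)

lemma herm_Gamma_open_subset: "herm_Gamma_open k \<subseteq> herm_Gamma k"
  by (auto simp: herm_Gamma_open_def herm_Gamma_def less_imp_le)

lemma herm_Gamma_mono: "j \<le> k \<Longrightarrow> herm_Gamma k \<subseteq> herm_Gamma j"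
  by (auto simp: herm_Gamma_def)

lemma norm_smat: "norm (smat c A) = cmod c * norm A"
proof -
  have "smat c A = (\<chi> i. c *s A $ i)" by (simp add: smat_def vec_eq_iff)
  then have "norm (smat c A) = L2_set (\<lambda>i. cmod c * norm (A $ i)) UNIV"
    by (simp only: norm_vec_def[of "\<chi> i. c *s A $ i"] vec_lambda_beta norm_smult_vec)
  then show ?thesis by (simp add: norm_vec_def[of A] L2_set_def power_mult_distrib sum_distrib_left[symmetric] real_sqrt_mult)
qed

section \<open>Zeros of Hermitian matrix pencils\<close>

lemma poly_factor:
  fixes p :: "complex poly"
  assumes "degree p \<le> k" "coeff p k = c" "c \<noteq> 0"
  obtains M where "size M = k" "p = smult c (\<Prod>x\<in>#M. [:- x, 1:])"
proof -
  have "degree p = k" using assms le_degree by (metis le_antisym)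
  moreover have "p \<noteq> 0" using assms by auto
  ultimately show thesis
    using alg_closed_imp_factorization[of p] assms that by auto
qed

lemma poly_prod_mset_linear: "poly (\<Prod>x\<in>#M. [:- x, 1:]) s = (\<Prod>x\<in>#M. s - (x::complex))"
  by (induction M) (auto simp: algebra_simps)

text \<open>
  Roots move continuously and cannot cross the real axis, so a zero in the upper half plane would
  have to be present already at the beginning of the homotopy.
\<close>

lemma esym_mat_homotopy:
  fixes B :: "complex^'n^'n" and D :: "real \<Rightarrow> complex^'n^'n"
  assumes B: "esym_mat j B \<noteq> 0" and D: "continuous_on {0..1} D"
    and real: "\<And>\<theta> s. \<theta> \<in> {0..1} \<Longrightarrow> Im s = 0 \<Longrightarrow> esym_mat j (smat s B + D \<theta>) \<noteq> 0"
    and base: "\<And>s. Im s \<ge> 0 \<Longrightarrow> esym_mat j (smat s B + D 0) \<noteq> 0"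
    and s: "Im s \<ge> 0"
  shows "esym_mat j (smat s B + D 1) \<noteq> 0"
proof
  assume bad: "esym_mat j (smat s B + D 1) = 0"
  define F where "F \<theta> z = esym_mat j (smat z B + D \<theta>)" for \<theta> z
  have "continuous_on UNIV (\<lambda>X. esym_mat j (B + X))"
    by (intro continuous_on_esym_mat continuous_intros)
  then have "isCont (\<lambda>X. esym_mat j (B + X)) 0" by (simp add: continuous_on_eq_continuous_at)
  then have "\<exists>e>0. \<forall>y. dist 0 y < e \<longrightarrow> esym_mat j (B + y) \<noteq> 0"
    using B by (intro continuous_at_avoid) auto
  then obtain e where e: "e > 0" "\<And>y. norm y < e \<Longrightarrow> esym_mat j (B + y) \<noteq> 0" by auto
  have "compact (D ` {0..1})" using D by (intro compact_continuous_image) auto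
  then have "bounded (D ` {0..1})" by (rule compact_imp_bounded)
  then obtain K where K: "\<And>\<theta>. \<theta> \<in> {0..1} \<Longrightarrow> norm (D \<theta>) \<le> K" "K > 0"
    unfolding bounded_pos by blast
  \<comment> \<open>Dividing by \<open>z\<close> leaves a small perturbation of \<open>B\<close>, so
    zeros cannot run off to infinity along the homotopy.\<close>
  have bd: "norm z \<le> K / e" if "\<theta> \<in> {0..1}" "F \<theta> z = 0" for \<theta> z
  proof (rule ccontr)
    assume "\<not> norm z \<le> K / e"
    then have z: "norm z > K / e" by simp
    have "K / e > 0" using K e by simp
    then have z0: "z \<noteq> 0" using z by auto
    have "norm (smat (1 / z) (D \<theta>)) = norm (D \<theta>) / norm z" by (simp add: norm_smat norm_divide)
    also have "\<dots> \<le> K / norm z" using K that by (intro divide_right_mono) auto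
    also have "\<dots> < e" using z e z0 by (simp add: field_simps)
    finally have "esym_mat j (B + smat (1 / z) (D \<theta>)) \<noteq> 0" by (rule e)
    moreover have "smat z B + D \<theta> = smat z (B + smat (1 / z) (D \<theta>))"
      using z0 by (simp add: smat_simps)
    ultimately have "F \<theta> z \<noteq> 0" using z0 by (simp add: F_def esym_mat_smat)
    then show False using that by simp
  qed
  \<comment> \<open>All pairs of a parameter and a zero in the closed upper half plane. Compactness
    gives a pair with least parameter; its zero is strictly above the real axis and does not occur
    at the start.\<close>
  define P where "P = {p \<in> {0..1} \<times> cball 0 (K / e). Im (snd p) \<ge> 0 \<and> F (fst p) (snd p) = 0}"
  have contF: "continuous_on ({0..1} \<times> cball 0 (K / e)) (\<lambda>p. F (fst p) (snd p))"
    unfolding F_def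
    by (intro continuous_on_esym_mat continuous_intros continuous_on_smat continuous_on_compose2[OF D]) auto
  have "P = {p \<in> {0..1} \<times> cball 0 (K / e). Im (snd p) \<ge> 0} \<inter> (({0..1} \<times> cball 0 (K / e)) \<inter> (\<lambda>p. F (fst p) (snd p)) -` {0})"
    by (auto simp: P_def)
  moreover have "closed {p \<in> {0..1::real} \<times> cball 0 (K / e). Im (snd p) \<ge> 0}"
  proof -
    have "{p \<in> {0..1::real} \<times> cball 0 (K / e). Im (snd p) \<ge> 0} = ({0..1} \<times> cball 0 (K / e)) \<inter> {p. Im (snd p) \<ge> 0}" by auto
    moreover have "closed {p :: real \<times> complex. Im (snd p) \<ge> 0}"
      by (intro closed_Collect_le continuous_intros)
    ultimately show ?thesis by (auto intro!: closed_Int closed_Times)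
  qed
  moreover have "closed (({0..1} \<times> cball 0 (K / e)) \<inter> (\<lambda>p. F (fst p) (snd p)) -` {0})"
    by (rule continuous_closed_preimage[OF contF]) (auto intro: closed_Times)
  ultimately have "closed P" by auto
  moreover have "bounded P"
    by (rule bounded_subset[of "{0..1} \<times> cball 0 (K / e)"]) (auto simp: P_def intro: bounded_Times)
  ultimately have cP: "compact P" by (simp add: compact_eq_bounded_closed)
  have "(1, s) \<in> P" using bad s bd[of 1 s] by (auto simp: P_def F_def)
  then have "P \<noteq> {}" by blast
  moreover have "continuous_on P fst" by (intro continuous_intros)
  ultimately have "\<exists>p\<in>P. \<forall>q\<in>P. fst p \<le> fst q" by (rule continuous_attains_inf[OF cP])
  then obtain p where p: "p \<in> P" "\<And>q. q \<in> P \<Longrightarrow> fst p \<le> fst q" by blast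
  obtain \<theta>0 z0 where pz: "p = (\<theta>0, z0)" by force
  have t0: "\<theta>0 \<in> {0..1}" "Im z0 \<ge> 0" "F \<theta>0 z0 = 0" using p pz by (auto simp: P_def)
  have "\<theta>0 \<noteq> 0" using t0 base[of z0] by (auto simp: F_def)
  then have tp: "\<theta>0 > 0" using t0 by simp
  have "Im z0 \<noteq> 0" using t0 real[of \<theta>0 z0] by (auto simp: F_def)
  then have zp: "Im z0 > 0" using t0 by simp
  \<comment> \<open>Before the first bad parameter every root lies below the real axis, so each
    linear factor at \<open>z0\<close> has modulus at least \<open>Im z0\<close>. This bound
    survives the limit and contradicts the zero at \<open>z0\<close>.\<close>
  have lower: "norm (F \<theta> z0) \<ge> norm (esym_mat j B) * Im z0 ^ j" if "\<theta> \<in> {0..<\<theta>0}" for \<theta>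
  proof -
    obtain q where q: "degree q \<le> j" "coeff q j = esym_mat j B" "\<And>z. F \<theta> z = poly q z"
      using polyd_esym_mat[of j "D \<theta>" B] unfolding polyd_def F_def by (auto simp: add.commute)
    obtain M where M: "size M = j" "q = smult (esym_mat j B) (\<Prod>x\<in>#M. [:- x, 1:])"
      using poly_factor[OF q(1,2) B] .
    have F: "F \<theta> z = esym_mat j B * (\<Prod>x\<in>#M. z - x)" for z
      by (simp add: q(3) M(2) poly_prod_mset_linear)
    have neg: "Im x < 0" if "x \<in># M" for x
    proof (rule ccontr)
      assume "\<not> Im x < 0"
      moreover have Fx: "F \<theta> x = 0" using that by (auto simp: F prod_mset_zero_iff)
      ultimately have "(\<theta>, x) \<in> P" using bd[OF _ Fx] \<open>\<theta> \<in> {0..<\<theta>0}\<close> t0 by (auto simp: P_def)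
      then show False using p(2) pz \<open>\<theta> \<in> {0..<\<theta>0}\<close> by fastforce
    qed
    have "(\<Prod>x\<in>#M. norm (z0 - x)) \<ge> Im z0 ^ size M"
      using neg
    proof (induction M)
      case (add x M)
      have "Im z0 \<le> Im (z0 - x)" using add.prems[of x] by simp
      also have "\<dots> \<le> norm (z0 - x)" using abs_Im_le_cmod by (metis abs_le_D1)
      finally have "Im z0 \<le> norm (z0 - x)" .
      moreover have "Im z0 ^ size M \<le> (\<Prod>x\<in>#M. norm (z0 - x))" using add by auto
      ultimately have "Im z0 * Im z0 ^ size M \<le> norm (z0 - x) * (\<Prod>x\<in>#M. norm (z0 - x))"
        using zp by (intro mult_mono) auto
      then show ?case by simp
    qed simp
    moreover have "norm (\<Prod>x\<in>#M. z0 - x) = (\<Prod>x\<in>#M. norm (z0 - x))"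
      by (induction M) (auto simp: norm_mult)
    ultimately show ?thesis using M by (simp add: F norm_mult mult_left_mono)
  qed
  have "continuous_on {0..1} (\<lambda>\<theta>. F \<theta> z0)"
    unfolding F_def by (intro continuous_on_esym_mat continuous_intros D)
  then have "continuous_on {0..\<theta>0} (\<lambda>\<theta>. F \<theta> z0)" using t0 by (auto intro: continuous_on_subset)
  then have "continuous_on {0..\<theta>0} (\<lambda>\<theta>. norm (F \<theta> z0))" by (intro continuous_intros)
  moreover have "norm (F x z0) \<ge> norm (esym_mat j B) * Im z0 ^ j" if "x \<in> {0<..<\<theta>0}" for x using lower that by auto
  moreover have "closure {0<..<\<theta>0} = {0..\<theta>0}" using tp by simp
  ultimately have "norm (F \<theta>0 z0) \<ge> norm (esym_mat j B) * Im z0 ^ j"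
    using continuous_ge_on_closure[of "{0<..<\<theta>0}" "\<lambda>\<theta>. norm (F \<theta> z0)" \<theta>0] tp by auto
  then show False using t0 B zero_less_power[OF zp, of j] by (simp add: mult_le_0_iff not_less[symmetric])
qed

lemma herm_Gamma_open_nonzero:
  "B \<in> herm_Gamma_open j \<Longrightarrow> Re (esym_mat j B) > 0"
  by (cases j) (auto simp: herm_Gamma_open_def)

text \<open>A homotopy switches on \<open>C\<close>. For real coefficients of \<open>B\<close> the
  nonreal shift \<open>t\<close> excludes zeros. At the start, for \<open>z\<close> nonzero,
  \<open>t / z\<close> is either nonreal or, by the signs of the imaginary parts, a positive real
  shift of \<open>B\<close> into the cone.\<close>

lemma esym_mat_pencil_nonzero:
  fixes B C :: "complex^'n^'n"
  assumes B: "B \<in> herm_Gamma_open j" and C: "hermitian C" and j: "j \<le> CARD('n)"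
    and s: "Im s \<ge> 0" and t: "Im t > 0"
  shows "esym_mat j (smat s B + (mat t + C)) \<noteq> 0"
proof -
  have HB: "hermitian B" using B by (simp add: herm_Gamma_open_def)
  have BG: "B \<in> herm_Gamma j" using B herm_Gamma_open_subset by auto
  note pos = herm_Gamma_open_nonzero[OF B]
  have "esym_mat j (smat s B + (mat t + smat (of_real 1) C)) \<noteq> 0"
  proof (rule esym_mat_homotopy[where D = "\<lambda>\<theta>. mat t + smat (of_real \<theta>) C"])
    show "esym_mat j B \<noteq> 0" using pos by auto
    show "continuous_on {0..1} (\<lambda>\<theta>. mat t + smat (complex_of_real \<theta>) C)"
      by (intro continuous_intros continuous_on_smat)
    show "esym_mat j (smat z B + (mat t + smat (complex_of_real \<theta>) C)) \<noteq> 0" if "Im z = 0" for z \<theta>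
    proof -
      have z: "z = of_real (Re z)" using that by (simp add: complex_eq_iff)
      have "hermitian (smat z B + smat (complex_of_real \<theta>) C)"
        by (subst z) (intro hermitian_add hermitian_smat HB C)
      then show ?thesis using esym_mat_add_mat_nonzero[of "smat z B + smat (complex_of_real \<theta>) C" t j] t j
        by (simp add: algebra_simps)
    qed
    show "esym_mat j (smat z B + (mat t + smat (complex_of_real 0) C)) \<noteq> 0" if "Im z \<ge> 0" for z
    proof (cases "z = 0")
      case True
      have "hermitian (0 :: complex^'n^'n)" by (rule hermitianI) simp
      then show ?thesis using True esym_mat_add_mat_nonzero[of 0 t j] t j by (simp add: smat_simps)
    next
      case False
      have "smat z B + (mat t + smat (complex_of_real 0) C) = smat z (B + mat (t / z))"
        using False by (simp add: smat_simps)
      moreover have "esym_mat j (B + mat (t / z)) \<noteq> 0"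
      proof (cases "Im (t / z) = 0")
        case True
        define r where "r = Re (t / z)"
        have r: "t / z = of_real r" using True by (simp add: complex_eq_iff r_def)
        then have "t = of_real r * z" using False by (simp add: field_simps)
        then have "0 < r * Im z" using t by simp
        then have "r > 0" using that by (simp add: zero_less_mult_iff)
        then have "Re (esym_mat j (B + mat (of_real r))) > 0"
          using herm_Gamma_shift(2)[OF BG j] by blast
        then show ?thesis using r by auto
      next
        case False
        then show ?thesis using esym_mat_add_mat_nonzero[OF HB _ j] by blast
      qed
      ultimately show ?thesis using False by (simp add: esym_mat_smat)
    qed
  qed (rule s)
  then show ?thesis by (simp add: smat_simps)
qed

text \<open>Stability in three variables: a second homotopy switches on \<open>b\<close>, using the
  pencil lemma for \<open>B\<close> when the coefficient of \<open>A\<close> is real and for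
  \<open>A\<close> at the start.\<close>

lemma esym_mat_stable:
  fixes A B :: "complex^'n^'n"
  assumes A: "A \<in> herm_Gamma_open j" and B: "B \<in> herm_Gamma_open j" and j: "j \<le> CARD('n)"
    and a: "Im a \<ge> 0" and b: "Im b \<ge> 0" and c: "Im c > 0"
  shows "esym_mat j (smat a A + (smat b B + mat c)) \<noteq> 0"
proof -
  have HA: "hermitian A" using A by (simp add: herm_Gamma_open_def)
  have H0: "hermitian (0 :: complex^'n^'n)" by (rule hermitianI) simp
  have "esym_mat j (smat a A + (smat (of_real 1 * b) B + mat c)) \<noteq> 0"
  proof (rule esym_mat_homotopy[where D = "\<lambda>\<theta>. smat (of_real \<theta> * b) B + mat c"])
    show "esym_mat j A \<noteq> 0" using herm_Gamma_open_nonzero[OF A] by auto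
    show "continuous_on {0..1} (\<lambda>\<theta>. smat (of_real \<theta> * b) B + mat c)"
      by (intro continuous_intros continuous_on_smat)
    show "esym_mat j (smat z A + (smat (of_real \<theta> * b) B + mat c)) \<noteq> 0" if "\<theta> \<in> {0..1}" "Im z = 0" for z \<theta>
    proof -
      have z: "z = of_real (Re z)" using that by (simp add: complex_eq_iff)
      have "hermitian (smat z A)" by (subst z) (intro hermitian_smat HA)
      moreover have "Im (of_real \<theta> * b) \<ge> 0" using b that by simp
      ultimately show ?thesis using esym_mat_pencil_nonzero[OF B _ j _ c, of "smat z A" "of_real \<theta> * b"]
        by (simp add: algebra_simps)
    qed
    show "esym_mat j (smat z A + (smat (of_real 0 * b) B + mat c)) \<noteq> 0" if "Im z \<ge> 0" for z
      using esym_mat_pencil_nonzero[OF A H0 j that c] by (simp add: smat_simps)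
  qed (rule a)
  then show ?thesis by simp
qed

lemma pderiv_prod_linear_at_0:
  assumes "\<And>x. x \<in># M \<Longrightarrow> x \<noteq> 0"
  shows "poly (pderiv (\<Prod>x\<in>#M. [:- x, 1:])) 0 = poly (\<Prod>x\<in>#M. [:- x, 1:]) 0 * (\<Sum>x\<in>#M. - inverse (x::complex))"
  using assms
proof (induction M)
  case (add x M)
  then have "x \<noteq> 0" by auto
  moreover have "poly (pderiv ([:- x, 1:] * q)) 0 = poly q 0 - x * poly (pderiv q) 0" for q
    by (simp only: pderiv_mult) (simp add: pderiv_pCons)
  moreover have "poly ([:- x, 1:] * q) 0 = - x * poly q 0" for q by simp
  moreover have "P - x * (P * S) = - x * P * (- inverse x + S)" for P S
    using \<open>x \<noteq> 0\<close> by (simp add: algebra_simps)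
  moreover have "poly (pderiv (\<Prod>x\<in>#M. [:- x, 1:])) 0 = poly (\<Prod>x\<in>#M. [:- x, 1:]) 0 * (\<Sum>x\<in>#M. - inverse x)"
    using add by auto
  ultimately show ?case by (simp only: image_mset_add_mset prod_mset.add_mset sum_mset.add_mset)
qed simp

text \<open>The logarithmic derivative at 0 is the sum of \<open>- inverse x\<close> over the roots,
  all terms positive; the derivative itself is the trace by
  \<open>esym_mat_deriv_trace\<close>.\<close>

lemma real_rooted_deriv:
  fixes A B :: "complex^'n^'n"
  assumes B: "esym_mat (Suc j) B \<noteq> 0"
    and roots: "\<And>s. esym_mat (Suc j) (A + smat s B) = 0 \<Longrightarrow> Im s = 0 \<and> Re s < 0"
    and A: "esym_mat (Suc j) A = of_real a" "a > 0"
  shows "Re (trace (newton_mat j A ** B)) > 0"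
proof -
  obtain p where p: "degree p \<le> Suc j" "coeff p (Suc j) = esym_mat (Suc j) B"
    "\<And>s. esym_mat (Suc j) (A + smat s B) = poly p s"
    using polyd_esym_mat[of "Suc j" A B] unfolding polyd_def by blast
  obtain M where M: "size M = Suc j" "p = smult (esym_mat (Suc j) B) (\<Prod>x\<in>#M. [:- x, 1:])"
    using poly_factor[OF p(1,2) B] .
  have root: "Im x = 0 \<and> Re x < 0" if "x \<in># M" for x
  proof -
    have "poly p x = 0" using that by (auto simp: M(2) poly_prod_mset_linear prod_mset_zero_iff)
    then show ?thesis using roots p by metis
  qed
  have "x \<noteq> 0" if "x \<in># M" for x using root[OF that] by auto
  then have "poly (pderiv p) 0 = poly p 0 * (\<Sum>x\<in>#M. - inverse x)"
    by (simp add: M(2) pderiv_smult pderiv_prod_linear_at_0)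
  moreover have "poly p 0 = of_real a" using p(3)[of 0] A by (simp add: smat_simps)
  ultimately have "Re (poly (pderiv p) 0) = a * Re (\<Sum>x\<in>#M. - inverse x)" by simp
  moreover have "Re (\<Sum>x\<in>#M. - inverse x) > 0"
  proof -
    have pos: "Re (- inverse x) > 0" if "Im x = 0 \<and> Re x < 0" for x
    proof -
      have "x = of_real (Re x)" using that by (simp add: complex_eq_iff)
      then have "- inverse x = of_real (- inverse (Re x))" by (metis of_real_inverse of_real_minus)
      then have "Re (- inverse x) = - inverse (Re x)" by (metis Re_complex_of_real)
      then show ?thesis using that by simp
    qed
    have ge: "Re (\<Sum>x\<in>#N. - inverse x) \<ge> 0" if "\<And>x. x \<in># N \<Longrightarrow> Im x = 0 \<and> Re x < 0" for N
      using that
    proof (induction N)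
      case (add x N)
      then have "Re (- inverse x) > 0" "Re (\<Sum>x\<in>#N. - inverse x) \<ge> 0" using pos[of x] by auto
      then show ?case by simp
    qed simp
    obtain x N where "M = add_mset x N" using M(1) by (metis size_eq_Suc_imp_eq_union union_single_eq_member add_mset_add_single multiset_nonemptyE size_empty nat.distinct(1) insert_DiffM)
    then show ?thesis using pos[of x] ge[of N] root by (auto intro: add_pos_nonneg)
  qed
  ultimately have "Re (poly (pderiv p) 0) > 0" using A by simp
  moreover have "poly (pderiv p) 0 = trace (newton_mat j A ** B)"
  proof -
    have "(poly p has_field_derivative poly (pderiv p) 0) (at (of_real 0))" using poly_DERIV by auto
    then have "((\<lambda>t. poly p (of_real t)) has_vector_derivative poly (pderiv p) 0) (at 0)"
      by (rule has_vector_derivative_real_field)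
    moreover have "((\<lambda>t. poly p (of_real t)) has_vector_derivative trace (newton_mat j A ** B)) (at 0)"
      using esym_mat_deriv_trace[OF mat_deriv_affine[of A B 0], of j] by (simp add: p smat_simps del: esym_mat.simps)
    ultimately show ?thesis by (rule vector_derivative_unique_at)
  qed
  ultimately show ?thesis by simp
qed

lemma esym_mat_1: "esym_mat j (mat 1 :: complex^'n^'n) = of_nat (CARD('n) choose j)"
proof -
  have "mat 1 = diag_mat (\<lambda>i::'n. 1)" by (simp add: mat_def diag_mat_def)
  then show ?thesis using n_subsets[of "UNIV :: 'n set" j] by (simp add: newton_mat_diag esym_def)
qed

text \<open>The trace is the derivative at 0 of \<open>esym_mat (Suc j) (A + smat s B)\<close>.
  After a shift into the open cone, stability forces all roots to be real and negative, hence a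
  positive derivative; the shift is then sent to zero.\<close>

theorem garding:
  fixes A B :: "complex^'n^'n"
  assumes A: "A \<in> herm_Gamma k" and B: "B \<in> herm_Gamma k" and j: "j < k" and k: "k \<le> CARD('n)"
  shows "Re (trace (newton_mat j A ** B)) \<ge> 0"
proof -
  have A': "A \<in> herm_Gamma (Suc j)" and B': "B \<in> herm_Gamma (Suc j)"
    using A B herm_Gamma_mono[of "Suc j" k] j by auto
  have j': "Suc j \<le> CARD('n)" using j k by simp
  \<comment> \<open>The first matrix will be shifted by \<open>2 * e\<close> and the second by
    \<open>e\<close>: the surplus multiple of the identity becomes the third variable in
    \<open>esym_mat_stable\<close>.\<close>
  define A1 B1 where "A1 e = A + mat (of_real e)" and "B1 e = B + mat (of_real e)" for e
  have pos: "Re (trace (newton_mat j (A1 (2 * e)) ** B1 e)) > 0" if e: "e > 0" for e :: real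
  proof (rule real_rooted_deriv)
    have oA: "A1 e \<in> herm_Gamma_open (Suc j)" and oB: "B1 e \<in> herm_Gamma_open (Suc j)" 
      and oA2: "A1 (2 * e) \<in> herm_Gamma_open (Suc j)"
      using A' B' e j' by (auto simp: A1_def B1_def simp del: of_real_mult intro!: herm_Gamma_open_shift)
    show "esym_mat (Suc j) (B1 e) \<noteq> 0" using herm_Gamma_open_nonzero[OF oB] by auto
    have hA: "hermitian (A1 (2 * e))" using oA2 by (simp add: herm_Gamma_open_def)
    show "esym_mat (Suc j) (A1 (2 * e)) = of_real (Re (esym_mat (Suc j) (A1 (2 * e))))"
      by (rule esym_mat_hermitian_real[OF hA])
    show "0 < Re (esym_mat (Suc j) (A1 (2 * e)))" using herm_Gamma_open_nonzero[OF oA2] .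
    fix s assume z: "esym_mat (Suc j) (A1 (2 * e) + smat s (B1 e)) = 0"
    have "s \<noteq> 0" using z \<open>0 < Re (esym_mat (Suc j) (A1 (2 * e)))\<close> by (auto simp: smat_simps)
    moreover have "\<not> Re (csqrt s) > 0"
    proof
      assume q: "Re (csqrt s) > 0"
      \<comment> \<open>This factor rotates 1 and \<open>s\<close> at the same time into the upper
        half plane, by bisecting the angle between them.\<close>
      define w where "w = \<i> * cnj (csqrt s)"
      have ws: "w * s = of_real ((cmod (csqrt s))\<^sup>2) * (\<i> * csqrt s)"
      proof -
        have "w * s = \<i> * (csqrt s * cnj (csqrt s)) * csqrt s"
          by (simp add: w_def) (metis mult.assoc mult.commute power2_csqrt power2_eq_square)
        then show ?thesis by (simp only: complex_norm_square mult_ac)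
      qed
      have 1: "Im w > 0" using q by (simp add: w_def)
      have "Im (w * s) = (cmod (csqrt s))\<^sup>2 * Re (csqrt s)" unfolding ws by simp
      then have 2: "Im (w * s) \<ge> 0" using q by simp
      have 3: "Im (w * of_real e) > 0" using 1 e by simp
      have "esym_mat (Suc j) (smat w (A1 e) + (smat (w * s) (B1 e) + mat (w * of_real e))) \<noteq> 0"
        using esym_mat_stable[OF oA oB j' _ 2 3] 1 by simp
      moreover have "smat w (A1 e) + (smat (w * s) (B1 e) + mat (w * of_real e)) = smat w (A1 (2 * e) + smat s (B1 e))"
        by (simp add: smat_simps A1_def smat_def vec_eq_iff mat_def algebra_simps)
      ultimately show False using z by (simp add: esym_mat_smat del: esym_mat.simps)
    qed
    ultimately show "Im s = 0 \<and> Re s < 0"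
    proof -
      assume "s \<noteq> 0" "\<not> Re (csqrt s) > 0"
      then have "Re (csqrt s) = 0" using csqrt_principal[of s] by auto
      moreover define r where "r = Im (csqrt s)"
      ultimately have "csqrt s = \<i> * of_real r" by (simp add: complex_eq_iff)
      then have "(csqrt s)\<^sup>2 = (\<i> * of_real r)\<^sup>2" by (rule arg_cong)
      then have s: "s = of_real (- (r\<^sup>2))" by (simp add: power_mult_distrib)
      have "Im s = 0" unfolding s by simp
      moreover have "Re s \<le> 0" unfolding s by simp
      ultimately show ?thesis using \<open>s \<noteq> 0\<close> by (auto simp: complex_eq_iff)
    qed
  qed
  define f where "f e = Re (trace (newton_mat j (A1 (2 * e)) ** B1 e))" for e
  have "continuous_on UNIV f"
    unfolding A1_def B1_def f_def
    by (intro continuous_intros continuous_on_trace continuous_on_matrix_mult continuous_on_newton_mat continuous_on_mat)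
  then have "isCont f 0" by (simp add: continuous_on_eq_continuous_at)
  then have "(f \<longlongrightarrow> f 0) (at_right 0)"
    unfolding isCont_def by (rule tendsto_mono[OF at_le[OF subset_UNIV]])
  moreover have "eventually (\<lambda>e. f e \<ge> 0) (at_right 0)"
    unfolding eventually_at_filter f_def using pos by (auto intro!: always_eventually less_imp_le)
  ultimately have "f 0 \<ge> 0" by (rule tendsto_lowerbound) simp
  then have "Re (trace (newton_mat j (A1 (2 * 0)) ** B1 0)) \<ge> 0" by (simp only: f_def)
  moreover have "mat 0 = (0 :: complex^'n^'n)" by (simp add: mat_def vec_eq_iff)
  ultimately show ?thesis by (simp add: A1_def B1_def)
qed

text \<open>If order \<open>Suc j\<close> is positive, then as a polynomial in a multiple of the
  identity added to \<open>A\<close> it has only negative roots, and its derivative at 0 is a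
  positive multiple of order \<open>j\<close>.\<close>

lemma herm_Gamma_lower_positive:
  fixes A :: "complex^'n^'n"
  assumes A: "A \<in> herm_Gamma k" and k: "k \<le> CARD('n)" and pos: "Re (esym_mat k A) > 0"
  shows "j \<le> k \<Longrightarrow> Re (esym_mat j A) > 0"
proof (induction "k - j" arbitrary: j)
  case 0
  then show ?case using pos by simp
next
  case (Suc d)
  have H: "hermitian A" using A by (simp add: herm_Gamma_def)
  have jk: "Suc j \<le> k" "Suc j \<le> CARD('n)" using Suc.hyps(2) k by arith+
  have p: "Re (esym_mat (Suc j) A) > 0" using Suc by (intro Suc.hyps(1)) auto
  have "Re (trace (newton_mat j A ** mat 1)) > 0"
  proof (rule real_rooted_deriv[OF _ _ esym_mat_hermitian_real[OF H] p])
    show "esym_mat (Suc j) (mat 1 :: complex^'n^'n) \<noteq> 0"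
      unfolding esym_mat_1 of_nat_eq_0_iff using jk by (simp add: binomial_eq_0_iff)
    fix s assume z: "esym_mat (Suc j) (A + smat s (mat 1)) = 0"
    have im: "Im s = 0" using esym_mat_add_mat_nonzero[OF H, of s "Suc j"] z jk by (auto simp: smat_mat_1)
    then have s: "s = of_real (Re s)" by (simp add: complex_eq_iff)
    have "Re s \<noteq> 0" using z p s by (metis add.right_neutral of_real_0 smat_simps(6) less_irrefl zero_complex.sel(1))
    moreover have "\<not> Re s > 0"
      using herm_Gamma_shift(2)[OF A k, of "Re s" "Suc j"] z s jk by (auto simp: smat_mat_1 simp del: esym_mat.simps)
    ultimately show "Im s = 0 \<and> Re s < 0" using im by linarith
  qed
  then have "0 < real (CARD('n) - j) * Re (esym_mat j A)" using jk by (simp add: trace_newton_mat)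
  then show ?case by (simp add: zero_less_mult_iff)
qed

subsection \<open>Positive matrices and the dual cone\<close>

definition gout :: "complex^'n \<Rightarrow> complex^'n \<Rightarrow> complex^'n^'n" where
  "gout g h = (\<chi> i j. g $ i * cnj (h $ j))"

definition psd :: "complex^'n^'n \<Rightarrow> bool" where
  "psd B \<longleftrightarrow> hermitian B \<and> (\<forall>x. Re (sform B x x) \<ge> 0)"

text \<open>The energy estimates see a comparison function only through these traces. Being defined
  by linear inequalities, the set is a convex cone at once, so pieces of a comparison function may
  be added.\<close>

definition dual_Gamma :: "nat \<Rightarrow> (complex^'n^'n) set" where
  "dual_Gamma k = {B. \<forall>A\<in>herm_Gamma k. \<forall>j<k. Re (trace (newton_mat j A ** B)) \<ge> 0}"

lemma psd_herm_Gamma: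
  fixes B :: "complex^'n^'n"
  assumes "psd B" shows "B \<in> herm_Gamma k"
proof -
  have B: "hermitian B" using assms by (simp add: psd_def)
  obtain U :: "complex^'n^'n" and d where U: "ctranspose U ** U = mat 1" "U ** ctranspose U = mat 1"
    "B = U ** diag_mat (\<lambda>i. complex_of_real (d i)) ** ctranspose U"
    "\<And>j. newton_mat j B = U ** diag_mat (\<lambda>i. complex_of_real (esym j (UNIV - {i}) d)) ** ctranspose U"
    "\<And>j. esym_mat j B = complex_of_real (esym j UNIV d)"
    using hermitian_newton_diag[OF B] by metis
  have "ctranspose U ** B ** U = diag_mat (\<lambda>i. complex_of_real (d i))"
    using U(1) U(3) by (metis matrix_mul_assoc matrix_mul_lid matrix_mul_rid)
  moreover have "(ctranspose U ** B ** U) $ i $ i = sform B (\<chi> a. cnj (U $ a $ i)) (\<chi> a. cnj (U $ a $ i))" for i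
    by (simp add: matrix_matrix_mult_def ctranspose_def sform_def sum_distrib_left sum_distrib_right mult_ac)
       (rule sum.swap)
  moreover have "diag_mat (\<lambda>i. complex_of_real (d i)) $ i $ i = complex_of_real (d i)" for i
    by (simp add: diag_mat_def)
  ultimately have "complex_of_real (d i) = sform B (\<chi> a. cnj (U $ a $ i)) (\<chi> a. cnj (U $ a $ i))" for i
    by metis
  then have "d i = Re (sform B (\<chi> a. cnj (U $ a $ i)) (\<chi> a. cnj (U $ a $ i)))" for i
    by (metis Re_complex_of_real)
  then have "d i \<ge> 0" for i using assms unfolding psd_def by simp
  then have "esym j UNIV d \<ge> 0" for j unfolding esym_def by (intro sum_nonneg prod_nonneg) auto
  then show ?thesis using B U(5) by (simp add: herm_Gamma_def)
qed

lemma hermitian_gout: "hermitian (gout g g)"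
  by (rule hermitianI) (simp add: gout_def)

lemma sform_gout: "sform (gout g h) x y = (\<Sum>i\<in>UNIV. g $ i * x $ i) * cnj (\<Sum>i\<in>UNIV. h $ i * y $ i)"
  by (simp add: sform_def gout_def sum_product mult_ac)

lemma psd_gout: "psd (gout g g)"
proof -
  have "Re (z * cnj z) \<ge> 0" for z by simp
  then show ?thesis unfolding psd_def sform_gout using hermitian_gout by blast
qed

text \<open>The quadratic form has n^2 terms, each at most \<open>c\<close> times the squared norm
  of the vector; only some multiple of the identity has to dominate, so no sharper constant is
  sought.\<close>

lemma psd_mat_diff:
  fixes B :: "complex^'n^'n"
  assumes B: "hermitian B" and c: "\<And>i j. cmod (B $ i $ j) \<le> c"
  shows "psd (mat (of_real (real CARD('n) * real CARD('n) * c)) - B)" "psd (mat (of_real (real CARD('n) * real CARD('n) * c)) + B)"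
proof -
  have c0: "c \<ge> 0" using c[of undefined undefined] norm_ge_zero order_trans by blast
  have bd: "\<bar>Re (sform B x x)\<bar> \<le> real CARD('n) * real CARD('n) * c * (norm x)\<^sup>2" for x
  proof -
    have "\<bar>Re (sform B x x)\<bar> \<le> cmod (sform B x x)" by (rule abs_Re_le_cmod)
    also have "\<dots> \<le> (\<Sum>i\<in>(UNIV::'n set). \<Sum>j\<in>(UNIV::'n set). c * (norm x)\<^sup>2)"
      unfolding sform_def
    proof (intro order_trans[OF norm_sum] sum_mono)
      fix i j
      have "cmod (B $ i $ j * x $ i * cnj (x $ j)) = cmod (B $ i $ j) * (cmod (x $ i) * cmod (x $ j))"
        by (simp add: norm_mult mult.assoc)
      also have "\<dots> \<le> c * (norm x * norm x)"
        using c0 c by (intro mult_mono Finite_Cartesian_Product.norm_nth_le) auto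
      finally show "cmod (B $ i $ j * x $ i * cnj (x $ j)) \<le> c * (norm x)\<^sup>2" by (simp add: power2_eq_square)
    qed
    finally show ?thesis by (simp add: mult_ac)
  qed
  have m: "sform (mat (of_real r)) x x = of_real (r * (norm x)\<^sup>2)" for x :: "complex^'n" and r
  proof -
    have "sform (mat (of_real r)) x x = of_real r * herm_inner x x"
      by (simp add: herm_inner_def sform_def mat_def sum_distrib_left if_distrib[of "\<lambda>x. x * _"] mult.assoc cong: if_cong)
    then show ?thesis by (simp add: herm_inner_self)
  qed
  have s: "sform (X - Y) x y = sform X x y - sform Y x y" "sform (X + Y) x y = sform X x y + sform Y x y" for X Y :: "complex^'n^'n" and x y
    by (simp_all add: sform_def algebra_simps sum_subtractf sum.distrib)
  show "psd (mat (of_real (real CARD('n) * real CARD('n) * c)) - B)" "psd (mat (of_real (real CARD('n) * real CARD('n) * c)) + B)"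
    unfolding psd_def s m using bd by (auto intro!: hermitian_add hermitian_diff hermitian_mat B simp: abs_le_iff simp del: of_real_mult) 
      (metis add.inverse_inverse add_le_same_cancel1 diff_ge_0_iff_ge le_add_same_cancel2 neg_le_iff_le add.commute minus_le_iff diff_minus_eq_add)+
qed

lemma garding_dual: "k \<le> CARD('n) \<Longrightarrow> herm_Gamma k \<subseteq> (dual_Gamma k :: (complex^'n^'n) set)"
  unfolding dual_Gamma_def using garding by blast

lemma psd_dual_Gamma: "k \<le> CARD('n) \<Longrightarrow> psd (B :: complex^'n^'n) \<Longrightarrow> B \<in> dual_Gamma k"
  using garding_dual psd_herm_Gamma by blast

lemma dual_Gamma_add: "A \<in> dual_Gamma k \<Longrightarrow> B \<in> dual_Gamma k \<Longrightarrow> A + B \<in> dual_Gamma k"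
  unfolding dual_Gamma_def by (auto simp: matrix_add_ldistrib trace_add intro: add_nonneg_nonneg)

lemma dual_Gamma_smat: "A \<in> dual_Gamma k \<Longrightarrow> c \<ge> 0 \<Longrightarrow> smat (of_real c) A \<in> dual_Gamma k"
  unfolding dual_Gamma_def by (auto simp: smat_simps)

lemma trace_gout: "trace (T ** gout g h) = (\<Sum>i\<in>UNIV. \<Sum>j\<in>UNIV. cnj (h $ i) * T $ i $ j * g $ j)"
  by (simp add: trace_def matrix_matrix_mult_def gout_def mult_ac)

subsection \<open>Matrices that are diagonal on a hyperplane\<close>

text \<open>All rows but the one at \<open>N\<close> are diagonal, and a permutation fixing every
  index other than \<open>N\<close> fixes \<open>N\<close> as well.\<close>

lemma det_arrow:
  fixes A :: "complex^'n^'n"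
  assumes "\<And>i j. i \<noteq> N \<Longrightarrow> i \<noteq> j \<Longrightarrow> A $ i $ j = 0"
  shows "det A = (\<Prod>i\<in>UNIV. A $ i $ i)"
proof -
  let ?S = "{p. p permutes (UNIV :: 'n set)}"
  have "(\<Prod>i\<in>UNIV. A $ i $ p i) = 0" if p: "p permutes UNIV" "p \<noteq> id" for p
  proof -
    have "\<exists>i. i \<noteq> N \<and> p i \<noteq> i"
    proof (rule ccontr)
      assume "\<nexists>i. i \<noteq> N \<and> p i \<noteq> i"
      then have "\<And>i. i \<noteq> N \<Longrightarrow> p i = i" by blast
      moreover have "p N = N"
        using calculation permutes_inj[OF p(1)] by (metis injD)
      ultimately show False using p(2) by (metis eq_id_iff)
    qed
    then obtain i where "i \<noteq> N" "p i \<noteq> i" by blast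
    then have "A $ i $ p i = 0" using assms by metis
    then show ?thesis by (intro prod_zero) auto
  qed
  then have "det A = (\<Sum>p\<in>{id}. of_int (sign p) * (\<Prod>i\<in>UNIV. A $ i $ p i))"
    unfolding det_def
    by (intro sum.mono_neutral_right) (auto simp: finite_permutations permutes_id)
  then show ?thesis by (simp add: sign_id)
qed

lemma mat_add_conj:
  fixes U U' D :: "complex^'n^'n"
  assumes "U ** U' = mat 1"
  shows "mat s + U ** D ** U' = U ** (mat s + D) ** U'"
  by (simp add: matrix_add_ldistrib matrix_mul_add_left mat_conj[OF assms])

text \<open>The sum is the adjugate of \<open>mat s + X\<close> as a polynomial in \<open>s\<close>.
  The product telescopes by the recursion, and the last term vanishes because
  \<open>newton_mat CARD('n) X\<close> is zero, which is the Cayley-Hamilton theorem.\<close>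

lemma newton_mat_generating:
  fixes X :: "complex^'n^'n"
  assumes "hermitian X"
  shows "(mat s + X) ** (\<Sum>j<CARD('n). smat (s ^ (CARD('n) - 1 - j)) (newton_mat j X)) = mat (det (mat s + X))"
proof -
  let ?n = "CARD('n)"
  obtain U :: "complex^'n^'n" and d where U: "ctranspose U ** U = mat 1" "U ** ctranspose U = mat 1"
    "X = U ** diag_mat (\<lambda>i. complex_of_real (d i)) ** ctranspose U"
    "\<And>j. newton_mat j X = U ** diag_mat (\<lambda>i. complex_of_real (esym j (UNIV - {i}) d)) ** ctranspose U"
    "\<And>j. esym_mat j X = complex_of_real (esym j UNIV d)"
    using hermitian_newton_diag[OF assms] by metis
  have "esym ?n (UNIV - {i}) d = 0" for i by (rule esym_eq_0) (auto simp: card_Diff_singleton)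
  then have "diag_mat (\<lambda>i. complex_of_real (esym ?n (UNIV - {i}) d)) = 0"
    by (simp add: diag_mat_def vec_eq_iff)
  then have Tn: "newton_mat ?n X = 0"
    by (simp add: U(4))
  have "diag_mat (\<lambda>i. complex_of_real (d i)) + mat s = diag_mat (\<lambda>i. s + complex_of_real (d i))"
    by (simp add: vec_eq_iff diag_mat_def mat_def)
  then have "mat s + X = U ** diag_mat (\<lambda>i. s + complex_of_real (d i)) ** ctranspose U"
    using U(3) mat_add_conj[OF U(2), of s "diag_mat (\<lambda>i. complex_of_real (d i))"] by (simp add: add.commute)
  then have "det (mat s + X) = (det U * det (ctranspose U)) * det (diag_mat (\<lambda>i. s + complex_of_real (d i)))"
    by (simp add: det_mul)
  also have "det U * det (ctranspose U) = 1" by (metis U(2) det_I det_mul)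
  also have "det (diag_mat (\<lambda>i. s + complex_of_real (d i))) = (\<Prod>i\<in>UNIV. s + complex_of_real (d i))"
    by (subst det_diagonal) (auto simp: diag_mat_def)
  finally have det: "det (mat s + X) = (\<Sum>j\<le>?n. esym_mat j X * s ^ (?n - j))"
    by (simp add: prod_add_esym U(5) esym_of_real)
  have XT: "X ** newton_mat j X = mat (esym_mat (Suc j) X) - newton_mat (Suc j) X" for j
    by (simp add: newton_mat_Suc)
  define a where "a j = smat (s ^ (?n - j)) (newton_mat j X)" for j
  have "(mat s + X) ** (\<Sum>j<?n. smat (s ^ (?n - 1 - j)) (newton_mat j X))
     = (\<Sum>j<?n. (mat s + X) ** smat (s ^ (?n - 1 - j)) (newton_mat j X))"
    by (rule matrix_mul_sum_right)
  also have "\<dots> = (\<Sum>j<?n. (a j - a (Suc j)) + mat (esym_mat (Suc j) X * s ^ (?n - Suc j)))"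
  proof (rule sum.cong[OF refl])
    fix j assume "j \<in> {..<?n}"
    then have e: "?n - j = Suc (?n - 1 - j)" "?n - Suc j = ?n - 1 - j" by auto
    have "mat s ** smat (s ^ (?n - 1 - j)) (newton_mat j X) = a j"
      unfolding a_def e by (simp add: smat_def vec_eq_iff mat_mul_entry)
    moreover have "X ** smat (s ^ (?n - 1 - j)) (newton_mat j X) = mat (esym_mat (Suc j) X * s ^ (?n - Suc j)) - a (Suc j)"
      unfolding a_def e smat_simps XT by (simp add: smat_def vec_eq_iff mat_def algebra_simps)
    ultimately show "(mat s + X) ** smat (s ^ (?n - 1 - j)) (newton_mat j X) = (a j - a (Suc j)) + mat (esym_mat (Suc j) X * s ^ (?n - Suc j))"
      by (simp add: matrix_mul_add_left)
  qed
  also have "\<dots> = (a 0 - a ?n) + (\<Sum>j<?n. mat (esym_mat (Suc j) X * s ^ (?n - Suc j)))"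
    by (simp only: sum.distrib sum_lessThan_telescope')
  also have "(\<Sum>j<?n. mat (esym_mat (Suc j) X * s ^ (?n - Suc j))) = mat (\<Sum>j<?n. esym_mat (Suc j) X * s ^ (?n - Suc j))"
    by (simp add: vec_eq_iff mat_def)
  also have "a 0 - a ?n = mat (s ^ ?n)" by (simp add: a_def Tn smat_def vec_eq_iff mat_def)
  also have "mat (s ^ ?n) + mat (\<Sum>j<?n. esym_mat (Suc j) X * s ^ (?n - Suc j)) = mat (det (mat s + X))"
  proof -
    have "det (mat s + X) = s ^ ?n + (\<Sum>j<?n. esym_mat (Suc j) X * s ^ (?n - Suc j))"
      unfolding det lessThan_Suc_atMost[symmetric] by (subst sum.lessThan_Suc_shift) simp
    then show ?thesis by (simp add: mat_def vec_eq_iff)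
  qed
  finally show ?thesis .
qed

text \<open>The entry of the adjugate at \<open>N\<close> is the minor without row and column
  \<open>N\<close>, here the product of the \<open>s + \<nu> k\<close>, and comparing powers of
  \<open>s\<close> gives every order. Cramer's rule yields the minor for nonreal \<open>s\<close>,
  which are enough values to identify the coefficients.\<close>

lemma newton_mat_arrow:
  fixes X :: "complex^'n^'n"
  assumes X: "hermitian X" and d: "\<And>k l. k \<noteq> N \<Longrightarrow> l \<noteq> N \<Longrightarrow> X $ k $ l = (if k = l then \<nu> k else 0)"
    and j: "j < CARD('n)"
  shows "newton_mat j X $ N $ N = esym j (UNIV - {N}) \<nu>"
proof -
  let ?n = "CARD('n)"
  define G where "G s = (\<Sum>j<CARD('n). smat (s ^ (CARD('n) - 1 - j)) (newton_mat j X))" for s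
  have key: "G s $ N $ N = (\<Prod>k\<in>UNIV - {N}. s + \<nu> k)" if "Im s \<noteq> 0" for s
  proof -
    let ?A = "mat s + X"
    have "esym_mat ?n (X + mat s) \<noteq> 0" using esym_mat_add_mat_nonzero[OF X that, of ?n] by simp
    obtain U :: "complex^'n^'n" and d where U: "ctranspose U ** U = mat 1" "U ** ctranspose U = mat 1"
      "X = U ** diag_mat (\<lambda>i. complex_of_real (d i)) ** ctranspose U"
      using hermitian_diagonalizable[OF X] by metis
    have "diag_mat (\<lambda>i. complex_of_real (d i)) + mat s = diag_mat (\<lambda>i. s + complex_of_real (d i))"
      by (simp add: vec_eq_iff diag_mat_def mat_def)
    then have "?A = U ** diag_mat (\<lambda>i. s + complex_of_real (d i)) ** ctranspose U"
      using U(3) mat_add_conj[OF U(2), of s "diag_mat (\<lambda>i. complex_of_real (d i))"] by (simp add: add.commute)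
    then have "det ?A = (det U * det (ctranspose U)) * det (diag_mat (\<lambda>i. s + complex_of_real (d i)))"
      by (simp add: det_mul)
    also have "det U * det (ctranspose U) = 1" by (metis U(2) det_I det_mul)
    also have "det (diag_mat (\<lambda>i. s + complex_of_real (d i))) = (\<Prod>i\<in>UNIV. s + complex_of_real (d i))"
      by (subst det_diagonal) (auto simp: diag_mat_def)
    finally have "det ?A = (\<Prod>i\<in>UNIV. s + complex_of_real (d i))" by simp
    moreover have "s + complex_of_real (d i) \<noteq> 0" for i using that by (auto simp: complex_eq_iff)
    ultimately have det: "det ?A \<noteq> 0" by simp
    define b where "b = (\<chi> i. if i = N then det ?A else 0)"
    have "(?A ** G s) $ i $ N = b $ i" for i
      using newton_mat_generating[OF X, of s] by (simp add: G_def b_def mat_def)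
    then have "?A *v column N (G s) = b"
      by (simp add: vec_eq_iff matrix_matrix_mult_def matrix_vector_mult_def column_def)
    then have "column N (G s) = (\<chi> k. det (\<chi> i j. if j = k then b $ i else ?A $ i $ j) / det ?A)"
      using cramer[OF det] by blast
    then have "column N (G s) $ N = det (\<chi> i j. if j = N then b $ i else ?A $ i $ j) / det ?A" by simp
    also have "det (\<chi> i j. if j = N then b $ i else ?A $ i $ j) = (\<Prod>i\<in>UNIV. if i = N then det ?A else s + \<nu> i)"
      by (subst det_arrow[of N]) (auto simp: b_def mat_def d intro!: prod.cong)
    also have "\<dots> = det ?A * (\<Prod>i\<in>UNIV - {N}. s + \<nu> i)"
    proof -
      have "(\<Prod>i\<in>UNIV - {N}. if i = N then det ?A else s + \<nu> i) = (\<Prod>i\<in>UNIV - {N}. s + \<nu> i)" by (rule prod.cong) auto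
      then show ?thesis by (subst prod.remove[of _ N]) auto
    qed
    finally show ?thesis using det by (simp add: column_def)
  qed
  have c: "card (UNIV - {N}) = ?n - 1" by (simp add: card_Diff_singleton)
  define c where "c i = newton_mat (?n - 1 - i) X $ N $ N - esym (?n - 1 - i) (UNIV - {N}) \<nu>" for i
  have "(\<Sum>i\<le>?n - 1. c i * s ^ i) = 0" if "Im s \<noteq> 0" for s
  proof -
    have rev: "(\<Sum>i\<le>q. F i) = (\<Sum>j\<le>q. F (q - j))" for F :: "nat \<Rightarrow> complex" and q
      by (rule sum.reindex_bij_witness[of _ "\<lambda>i. q - i" "\<lambda>i. q - i"]) auto
    have 1: "{..<?n} = {..?n - 1}" using lessThan_Suc_atMost[of "?n - 1"] by simp
    have "(\<Sum>i\<le>?n - 1. c i * s ^ i) = (\<Sum>j\<le>?n - 1. c (?n - 1 - j) * s ^ (?n - 1 - j))"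
      by (rule rev)
    also have "\<dots> = (\<Sum>j\<le>?n - 1. (newton_mat j X $ N $ N - esym j (UNIV - {N}) \<nu>) * s ^ (?n - 1 - j))"
    proof (rule sum.cong[OF refl])
      fix j assume "j \<in> {..?n - 1}"
      then have "?n - 1 - (?n - 1 - j) = j" by (intro diff_diff_cancel) simp
      then show "c (?n - 1 - j) * s ^ (?n - 1 - j) = (newton_mat j X $ N $ N - esym j (UNIV - {N}) \<nu>) * s ^ (?n - 1 - j)"
        by (simp only: c_def)
    qed
    also have "\<dots> = G s $ N $ N - (\<Prod>k\<in>UNIV - {N}. s + \<nu> k)"
      by (simp add: G_def prod_add_esym c 1 smat_simps left_diff_distrib right_diff_distrib sum_subtractf mult.commute)
    finally show ?thesis using key[OF that] by simp
  qed
  then have "{s. Im s \<noteq> 0} \<subseteq> {s. (\<Sum>i\<le>?n - 1. c i * s ^ i) = 0}" by auto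
  moreover have "infinite {s. Im s \<noteq> 0}"
  proof
    assume f: "finite {s. Im s \<noteq> 0}"
    have "inj (\<lambda>m::nat. Complex 0 (real (Suc m)))" by (auto simp: inj_def)
    then have "infinite (range (\<lambda>m::nat. Complex 0 (real (Suc m))))" by (simp add: finite_image_iff)
    moreover have "range (\<lambda>m::nat. Complex 0 (real (Suc m))) \<subseteq> {s. Im s \<noteq> 0}" by auto
    ultimately show False using f finite_subset by blast
  qed
  ultimately have "infinite {s. (\<Sum>i\<le>?n - 1. c i * s ^ i) = 0}" using finite_subset by blast
  then have "\<forall>i\<le>?n - 1. c i = 0" using polyfun_finite_roots[of c "?n - 1"] by blast
  then have "c (?n - 1 - j) = 0" by simp
  moreover have "?n - 1 - (?n - 1 - j) = j" using j by simp
  ultimately show ?thesis by (simp add: c_def)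
qed

lemma esym_reindex:
  assumes "bij_betw f I J" shows "esym j I (\<lambda>i. g (f i)) = esym j J g"
proof -
  have inj: "inj_on f I" and im: "f ` I = J" using assms by (auto simp: bij_betw_def)
  have "bij_betw ((`) f) {X. X \<subseteq> I \<and> card X = j} {Y. Y \<subseteq> J \<and> card Y = j}"
  proof (rule bij_betwI')
    fix X Y assume "X \<in> {X. X \<subseteq> I \<and> card X = j}" "Y \<in> {X. X \<subseteq> I \<and> card X = j}"
    then show "(f ` X = f ` Y) = (X = Y)" using inj_on_image_eq_iff[OF inj] by blast
  next
    fix X assume "X \<in> {X. X \<subseteq> I \<and> card X = j}"
    then show "f ` X \<in> {Y. Y \<subseteq> J \<and> card Y = j}"
      using inj im by (auto simp: card_image inj_on_subset)
  next
    fix Y assume Y: "Y \<in> {Y. Y \<subseteq> J \<and> card Y = j}"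
    then obtain X where "X \<subseteq> I" "Y = f ` X" using im by (metis (mono_tags) mem_Collect_eq subset_imageE)
    then show "\<exists>X\<in>{X. X \<subseteq> I \<and> card X = j}. Y = f ` X"
      using Y inj by (auto simp: card_image inj_on_subset)
  qed
  then have "(\<Sum>X | X \<subseteq> I \<and> card X = j. prod g (f ` X)) = esym j J g"
    unfolding esym_def by (rule sum.reindex_bij_betw)
  moreover have "prod g (f ` X) = (\<Prod>i\<in>X. g (f i))" if "X \<subseteq> I" for X
    using inj_on_subset[OF inj that] by (simp add: prod.reindex)
  ultimately show ?thesis unfolding esym_def by simp
qed

text \<open>In a unitary frame with \<open>g\<close> normalized as distinguished column, the trace
  picks out one diagonal entry of the Newton matrix, and \<open>newton_mat_arrow\<close> computes it
  from the restriction of \<open>X\<close> to the tangent space.\<close>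

lemma newton_mat_tangential:
  fixes X :: "complex^'n^'n" and g :: "complex^'n"
  assumes X: "hermitian X" and g: "g \<noteq> 0"
    and e: "\<And>a b. a < CARD('n) - 1 \<Longrightarrow> b < CARD('n) - 1 \<Longrightarrow> herm_inner (e a) (e b) = (if a = b then 1 else 0)"
    and tan: "\<And>a. a < CARD('n) - 1 \<Longrightarrow> (\<Sum>i\<in>UNIV. g $ i * e a $ i) = 0"
    and lev: "\<And>a b. a < CARD('n) - 1 \<Longrightarrow> b < CARD('n) - 1 \<Longrightarrow> sform X (e a) (e b) = (if a = b then of_real (\<nu> a) else 0)"
    and j: "j < CARD('n)"
  shows "trace (newton_mat j X ** gout g g) = of_real ((norm g)\<^sup>2 * esym j {..<CARD('n) - 1} \<nu>)"
proof -
  let ?n = "CARD('n)"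
  obtain N :: 'n where True by blast
  have "card (UNIV - {N}) = ?n - 1" by (simp add: card_Diff_singleton)
  then obtain f where f: "bij_betw f (UNIV - {N}) {..<?n - 1}"
    by (metis card_lessThan finite finite_lessThan finite_same_card_bij)
  then have fl: "f k < ?n - 1" if "k \<noteq> N" for k using that by (auto simp: bij_betw_def)
  have fi: "f k = f l \<longleftrightarrow> k = l" if "k \<noteq> N" "l \<noteq> N" for k l using f that by (auto simp: bij_betw_def inj_on_def)
  define r where "r = complex_of_real (1 / norm g)"
  \<comment> \<open>Tangency is bilinear, without conjugation, so the vectors orthogonal to
    \<open>g\<close> are the conjugates of the \<open>e a\<close>.\<close>
  define U :: "complex^'n^'n" where "U = (\<chi> i k. if k = N then r * g $ i else cnj (e (f k) $ i))"
  have gg: "(\<Sum>i\<in>UNIV. cnj (g $ i) * g $ i) = of_real ((norm g)\<^sup>2)"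
    using herm_inner_self[of g] by (simp add: herm_inner_def mult.commute)
  have rr: "r * r * of_real ((norm g)\<^sup>2) = 1" "cnj r = r" using g by (auto simp: r_def power2_eq_square)
  have "(ctranspose U ** U) $ k $ l = mat 1 $ k $ l" for k l
  proof -
    have ent: "(ctranspose U ** U) $ k $ l = (\<Sum>i\<in>UNIV. cnj (U $ i $ k) * U $ i $ l)"
      by (simp add: matrix_matrix_mult_def ctranspose_def)
    consider "k = N" "l = N" | "k = N" "l \<noteq> N" | "k \<noteq> N" "l = N" | "k \<noteq> N" "l \<noteq> N" by blast
    then show ?thesis
    proof cases
      case 1
      have "(\<Sum>i\<in>UNIV. cnj (U $ i $ k) * U $ i $ l) = r * r * (\<Sum>i\<in>UNIV. cnj (g $ i) * g $ i)"
        using 1 rr by (simp add: U_def sum_distrib_left mult_ac)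
      then show ?thesis unfolding ent gg using rr 1 by (simp add: mat_def)
    next
      case 2
      have "(\<Sum>i\<in>UNIV. cnj (U $ i $ k) * U $ i $ l) = r * cnj (\<Sum>i\<in>UNIV. g $ i * e (f l) $ i)"
        using 2 rr by (simp add: U_def sum_distrib_left mult_ac)
      then show ?thesis unfolding ent using tan[OF fl[OF 2(2)]] 2 by (simp add: mat_def)
    next
      case 3
      have "(\<Sum>i\<in>UNIV. cnj (U $ i $ k) * U $ i $ l) = r * (\<Sum>i\<in>UNIV. g $ i * e (f k) $ i)"
        using 3 rr by (simp add: U_def sum_distrib_left mult_ac)
      then show ?thesis unfolding ent using tan[OF fl[OF 3(1)]] 3 by (simp add: mat_def)
    next
      case 4
      have "(\<Sum>i\<in>UNIV. cnj (U $ i $ k) * U $ i $ l) = herm_inner (e (f k)) (e (f l))"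
        using 4 by (simp add: U_def herm_inner_def)
      then show ?thesis unfolding ent using e[OF fl fl] fi 4 by (simp add: mat_def)
    qed
  qed
  then have 1: "ctranspose U ** U = mat 1" by (simp add: vec_eq_iff)
  then have 2: "U ** ctranspose U = mat 1" by (simp add: matrix_left_right_inverse)
  define Y where "Y = ctranspose U ** X ** U"
  have ct: "ctranspose (ctranspose U) = U" by (simp add: ctranspose_def vec_eq_iff)
  have hY: "hermitian Y"
  proof (rule hermitianI)
    fix i k
    have "cnj (Y $ i $ k) = (\<Sum>b\<in>UNIV. \<Sum>a\<in>UNIV. cnj (U $ b $ k) * X $ b $ a * U $ a $ i)"
      by (simp add: Y_def matrix_matrix_mult_def ctranspose_def sum_distrib_left sum_distrib_right hermitianD[OF X] mult_ac)
    also have "\<dots> = Y $ k $ i"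
      by (subst sum.swap) (simp add: Y_def matrix_matrix_mult_def ctranspose_def sum_distrib_right)
    finally show "cnj (Y $ i $ k) = Y $ k $ i" .
  qed
  have dY: "Y $ k $ l = (if k = l then of_real (\<nu> (f k)) else 0)" if "k \<noteq> N" "l \<noteq> N" for k l
  proof -
    have "Y $ k $ l = (\<Sum>b\<in>UNIV. \<Sum>a\<in>UNIV. cnj (U $ a $ k) * X $ a $ b * U $ b $ l)"
      by (simp add: Y_def matrix_matrix_mult_def ctranspose_def sum_distrib_right)
    also have "\<dots> = sform X (e (f k)) (e (f l))"
      unfolding sform_def using that by (subst sum.swap) (simp add: U_def mult_ac)
    finally show ?thesis using lev[OF fl fl] fi that by simp
  qed
  have "newton_mat j Y $ N $ N = esym j (UNIV - {N}) (\<lambda>k. complex_of_real (\<nu> (f k)))"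
    by (rule newton_mat_arrow[OF hY _ j]) (use dY in auto)
  also have "\<dots> = complex_of_real (esym j {..<?n - 1} \<nu>)"
    by (simp add: esym_of_real esym_reindex[OF f])
  finally have NN: "newton_mat j Y $ N $ N = complex_of_real (esym j {..<?n - 1} \<nu>)" .
  have "newton_mat j Y = ctranspose U ** newton_mat j X ** U"
    unfolding Y_def by (rule newton_mat_conj(1)[OF 2 1])
  then have "newton_mat j Y $ N $ N = (\<Sum>b\<in>UNIV. \<Sum>a\<in>UNIV. cnj (U $ a $ N) * newton_mat j X $ a $ b * U $ b $ N)"
    by (simp add: matrix_matrix_mult_def ctranspose_def sum_distrib_right)
  also have "\<dots> = r * r * trace (newton_mat j X ** gout g g)"
    unfolding trace_gout using rr by (subst sum.swap) (simp add: U_def sum_distrib_left mult_ac)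
  finally have "r * r * trace (newton_mat j X ** gout g g) = complex_of_real (esym j {..<?n - 1} \<nu>)"
    using NN by simp
  then have "(r * r * of_real ((norm g)\<^sup>2)) * trace (newton_mat j X ** gout g g) = of_real ((norm g)\<^sup>2) * complex_of_real (esym j {..<?n - 1} \<nu>)"
    by (simp add: mult_ac)
  then show ?thesis unfolding rr by simp
qed

text \<open>Adding a multiple of \<open>gout g g\<close> does not change the form on the tangent
  space, so by \<open>newton_mat_tangential\<close> the derivative in \<open>M\<close> is
  constant.\<close>

lemma esym_mat_rank_one:
  fixes X :: "complex^'n^'n" and g :: "complex^'n"
  assumes X: "hermitian X" and g: "g \<noteq> 0"
    and e: "\<And>a b. a < CARD('n) - 1 \<Longrightarrow> b < CARD('n) - 1 \<Longrightarrow> herm_inner (e a) (e b) = (if a = b then 1 else 0)"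
    and tan: "\<And>a. a < CARD('n) - 1 \<Longrightarrow> (\<Sum>i\<in>UNIV. g $ i * e a $ i) = 0"
    and lev: "\<And>a b. a < CARD('n) - 1 \<Longrightarrow> b < CARD('n) - 1 \<Longrightarrow> sform X (e a) (e b) = (if a = b then of_real (\<nu> a) else 0)"
    and j: "j < CARD('n)"
  shows "Re (esym_mat (Suc j) (X + smat (of_real M) (gout g g))) =
    Re (esym_mat (Suc j) X) + M * Re (trace (newton_mat j X ** gout g g))"
proof -
  let ?c = "(norm g)\<^sup>2 * esym j {..<CARD('n) - 1} \<nu>"
  have t: "trace (newton_mat j (X + smat (of_real t) (gout g g)) ** gout g g) = of_real ?c" for t
  proof (rule newton_mat_tangential[OF _ g e tan _ j])
    show "hermitian (X + smat (of_real t) (gout g g))" by (intro hermitian_add hermitian_smat hermitian_gout X)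
    fix a b assume ab: "a < CARD('n) - 1" "b < CARD('n) - 1"
    have "sform (X + smat (of_real t) (gout g g)) (e a) (e b) = sform X (e a) (e b) + of_real t * sform (gout g g) (e a) (e b)"
      by (simp add: sform_def smat_def algebra_simps sum.distrib sum_distrib_left)
    then show "sform (X + smat (of_real t) (gout g g)) (e a) (e b) = (if a = b then of_real (\<nu> a) else 0)"
      using lev[OF ab] tan[OF ab(1)] by (simp add: sform_gout)
  qed
  let ?f = "\<lambda>t. Re (esym_mat (Suc j) (X + smat (of_real t) (gout g g))) - t * ?c"
  have "(?f has_real_derivative 0) (at t)" for t
    using DERIV_diff[OF esym_mat_affine_deriv[of j X "gout g g" t] DERIV_cmult_right[OF DERIV_ident, of ?c t]]
    by (simp add: t)
  then have "?f M = ?f 0" using DERIV_isconst_all by blast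
  moreover have "trace (newton_mat j X ** gout g g) = of_real ?c" using t[of 0] by (simp add: smat_simps)
  ultimately show ?thesis by (simp add: smat_simps)
qed

subsection \<open>Functions of class \<open>C\<^sup>r\<close>\<close>

declare C_diff.simps(2) [simp del]

lemma C_diff_SucI:
  assumes "\<And>x. x \<in> U \<Longrightarrow> (f has_derivative f' x) (at x)"
    and "\<And>v. C_diff r U (\<lambda>x. frechet_derivative f (at x) v)"
  shows "C_diff (Suc r) U f"
  unfolding C_diff.simps using assms by (auto intro: differentiableI)

lemma C_diff_differentiable: "C_diff (Suc r) U f \<Longrightarrow> x \<in> U \<Longrightarrow> (f has_derivative frechet_derivative f (at x)) (at x)"
  unfolding C_diff.simps by (simp add: frechet_derivative_works)

lemma C_diff_frechet: "C_diff (Suc r) U f \<Longrightarrow> C_diff r U (\<lambda>x. frechet_derivative f (at x) v)"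
  unfolding C_diff.simps by blast

lemma C_diff_cong:
  assumes "open U" "\<And>x. x \<in> U \<Longrightarrow> f x = g x" "C_diff r U f"
  shows "C_diff r U g"
  using assms(2,3)
proof (induction r arbitrary: f g)
  case 0
  then show ?case by (simp cong: continuous_on_cong)
next
  case (Suc r)
  have d: "(g has_derivative frechet_derivative f (at x)) (at x)" if "x \<in> U" for x
    using Suc.prems(1) by (rule has_derivative_transform_within_open[OF C_diff_differentiable[OF Suc.prems(2) that] assms(1) that])
  have eq: "frechet_derivative f (at x) = frechet_derivative g (at x)" if "x \<in> U" for x
    by (rule frechet_derivative_at[OF d[OF that]])
  show ?case
  proof (rule C_diff_SucI)
    show "C_diff r U (\<lambda>x. frechet_derivative g (at x) v)" for v
      by (rule Suc.IH[OF _ C_diff_frechet[OF Suc.prems(2), of v]]) (simp add: eq)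
  qed (rule d)
qed

lemma C_diff_subset: "C_diff r U f \<Longrightarrow> V \<subseteq> U \<Longrightarrow> C_diff r V f"
proof (induction r arbitrary: f)
  case (Suc r)
  then show ?case unfolding C_diff.simps by blast
qed (auto intro: continuous_on_subset)

lemma C_diff_Suc: "C_diff (Suc r) U f \<Longrightarrow> C_diff r U f"
proof (induction r arbitrary: f)
  case 0
  then show ?case
    unfolding C_diff.simps by (meson differentiable_at_imp_differentiable_on differentiable_imp_continuous_on)
next
  case (Suc r)
  show ?case
    by (rule C_diff_SucI[OF C_diff_differentiable[OF Suc.prems] Suc.IH[OF C_diff_frechet[OF Suc.prems]]])
qed

lemma C_diff_le: "r \<le> s \<Longrightarrow> C_diff s U f \<Longrightarrow> C_diff r U f"
  by (induction s) (auto simp: le_Suc_eq dest: C_diff_Suc)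

lemma C_diff_continuous: "C_diff r U f \<Longrightarrow> continuous_on U f"
  using C_diff_le[of 0 r] by simp

lemma C_diff_Un:
  assumes "open U" "open V" "C_diff r U f" "C_diff r V f"
  shows "C_diff r (U \<union> V) f"
  using assms(3,4)
proof (induction r arbitrary: f)
  case (Suc r)
  then show ?case unfolding C_diff.simps by blast
qed (auto intro: continuous_on_open_Un assms(1,2))

lemma C_diff_const: "C_diff r U (\<lambda>_. c)"
proof (induction r arbitrary: c)
  case (Suc r)
  show ?case by (rule C_diff_SucI[OF has_derivative_const]) (simp add: Suc)
qed simp

lemma C_diff_add: "open U \<Longrightarrow> C_diff r U f \<Longrightarrow> C_diff r U g \<Longrightarrow> C_diff r U (\<lambda>x. f x + g x)"
proof (induction r arbitrary: f g)
  case 0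
  then show ?case by (auto intro: continuous_on_add)
next
  case (Suc r)
  have d: "((\<lambda>x. f x + g x) has_derivative (\<lambda>v. frechet_derivative f (at x) v + frechet_derivative g (at x) v)) (at x)" if "x \<in> U" for x
    using Suc.prems that by (intro has_derivative_add C_diff_differentiable)
  have e: "frechet_derivative f (at x) v + frechet_derivative g (at x) v = frechet_derivative (\<lambda>x. f x + g x) (at x) v" if "x \<in> U" for x v
    by (rule fun_cong[OF frechet_derivative_at[OF d[OF that]]])
  show ?case
  proof (rule C_diff_SucI)
    show "C_diff r U (\<lambda>x. frechet_derivative (\<lambda>x. f x + g x) (at x) v)" for v
      by (rule C_diff_cong[OF Suc.prems(1) e Suc.IH[OF Suc.prems(1) C_diff_frechet[OF Suc.prems(2)] C_diff_frechet[OF Suc.prems(3)]]])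
  qed (rule d)
qed

lemma C_diff_mult: "open U \<Longrightarrow> C_diff r U f \<Longrightarrow> C_diff r U g \<Longrightarrow> C_diff r U (\<lambda>x. f x * g x)"
proof (induction r arbitrary: f g)
  case 0
  then show ?case by (auto intro: continuous_on_mult)
next
  case (Suc r)
  have d: "((\<lambda>x. f x * g x) has_derivative (\<lambda>v. f x * frechet_derivative g (at x) v + frechet_derivative f (at x) v * g x)) (at x)" if "x \<in> U" for x
    using Suc.prems that by (intro has_derivative_mult C_diff_differentiable)
  have e: "f x * frechet_derivative g (at x) v + frechet_derivative f (at x) v * g x = frechet_derivative (\<lambda>x. f x * g x) (at x) v" if "x \<in> U" for x v
    by (rule fun_cong[OF frechet_derivative_at[OF d[OF that]]])
  show ?case
  proof (rule C_diff_SucI)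
    fix v
    have "C_diff r U (\<lambda>x. f x * frechet_derivative g (at x) v)"
      by (rule Suc.IH[OF Suc.prems(1) C_diff_Suc[OF Suc.prems(2)] C_diff_frechet[OF Suc.prems(3)]])
    moreover have "C_diff r U (\<lambda>x. frechet_derivative f (at x) v * g x)"
      by (rule Suc.IH[OF Suc.prems(1) C_diff_frechet[OF Suc.prems(2)] C_diff_Suc[OF Suc.prems(3)]])
    ultimately have s: "C_diff r U (\<lambda>x. f x * frechet_derivative g (at x) v + frechet_derivative f (at x) v * g x)"
      by (rule C_diff_add[OF Suc.prems(1)])
    show "C_diff r U (\<lambda>x. frechet_derivative (\<lambda>x. f x * g x) (at x) v)"
      by (rule C_diff_cong[OF Suc.prems(1) e s])
  qed (rule d)
qed

lemma C_diff_minus: "open U \<Longrightarrow> C_diff r U f \<Longrightarrow> C_diff r U (\<lambda>x. - f x)"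
  using C_diff_mult[OF _ C_diff_const[of r U "-1"], of f] by simp

lemma C_diff_diff: "open U \<Longrightarrow> C_diff r U f \<Longrightarrow> C_diff r U g \<Longrightarrow> C_diff r U (\<lambda>x. f x - g x)"
  using C_diff_add[OF _ _ C_diff_minus, of U r f g] by simp

lemma C_diff_sum: "open U \<Longrightarrow> (\<And>i. i \<in> I \<Longrightarrow> C_diff r U (f i)) \<Longrightarrow> C_diff r U (\<lambda>x. \<Sum>i\<in>I. f i x)"
  by (induction I rule: infinite_finite_induct) (auto intro: C_diff_const C_diff_add)

lemma C_diff_linear: assumes "bounded_linear f" shows "C_diff r U f"
proof (cases r)
  case 0
  then show ?thesis using assms by (simp add: linear_continuous_on)
next
  case (Suc s)
  have d: "(f has_derivative f) (at x)" for x by (rule bounded_linear_imp_has_derivative[OF assms])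
  have "frechet_derivative f (at x) = f" for x
    using frechet_derivative_at[OF d] by simp
  then show ?thesis unfolding Suc by (intro C_diff_SucI[OF d]) (simp add: C_diff_const)
qed

lemma C_diff_inner: "C_diff r U (\<lambda>x. (x - c) \<bullet> (x - c))"
proof -
  have "C_diff r UNIV (\<lambda>x. \<Sum>b\<in>Basis. ((x - c) \<bullet> b) * ((x - c) \<bullet> b))"
    by (intro C_diff_sum C_diff_mult) (auto simp: inner_diff_left intro!: C_diff_diff[OF open_UNIV C_diff_linear[OF bounded_linear_inner_left] C_diff_const])
  then have "C_diff r UNIV (\<lambda>x. (x - c) \<bullet> (x - c))" by (simp add: euclidean_inner[symmetric])
  then show ?thesis by (rule C_diff_subset) simp
qed

text \<open>\<open>\<phi> i\<close> is the derivative of order \<open>i\<close>, given as a sequence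
  so that the induction can shift it. The last one need only be continuous, which suits truncated
  powers of limited smoothness.\<close>

lemma C_diff_compose:
  fixes \<phi> :: "nat \<Rightarrow> real \<Rightarrow> real"
  assumes "open U"
  shows "(\<And>i t. i < r \<Longrightarrow> (\<phi> i has_real_derivative \<phi> (Suc i) t) (at t)) \<Longrightarrow> continuous_on UNIV (\<phi> r) \<Longrightarrow>
    C_diff r U f \<Longrightarrow> C_diff r U (\<lambda>x. \<phi> 0 (f x))"
proof (induction r arbitrary: f \<phi>)
  case 0
  then show ?case by (auto intro: continuous_on_compose2)
next
  case (Suc r)
  have d: "((\<lambda>x. \<phi> 0 (f x)) has_derivative (\<lambda>v. \<phi> 1 (f x) * frechet_derivative f (at x) v)) (at x)" if "x \<in> U" for x
  proof -
    have "(\<phi> 0 has_derivative (*) (\<phi> 1 (f x))) (at (f x))"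
      using Suc.prems(1)[of 0 "f x"] by (simp add: has_field_derivative_def)
    then show ?thesis
      using has_derivative_compose[OF C_diff_differentiable[OF Suc.prems(3) that]] by blast
  qed
  have e: "\<phi> 1 (f x) * frechet_derivative f (at x) v = frechet_derivative (\<lambda>x. \<phi> 0 (f x)) (at x) v" if "x \<in> U" for x v
    by (rule fun_cong[OF frechet_derivative_at[OF d[OF that]]])
  have "C_diff r U (\<lambda>x. \<phi> (Suc 0) (f x))"
    using Suc.IH[of "\<lambda>i. \<phi> (Suc i)" f] Suc.prems C_diff_Suc by blast
  then have "C_diff r U (\<lambda>x. \<phi> 1 (f x))" by simp
  then have c: "C_diff r U (\<lambda>x. \<phi> 1 (f x) * frechet_derivative f (at x) v)" for v
    by (rule C_diff_mult[OF assms _ C_diff_frechet[OF Suc.prems(3)]])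
  show ?case
  proof (rule C_diff_SucI)
    show "C_diff r U (\<lambda>x. frechet_derivative (\<lambda>x. \<phi> 0 (f x)) (at x) v)" for v
      by (rule C_diff_cong[OF assms e c])
  qed (rule d)
qed

lemma frechet_derivative_line:
  assumes "(f has_derivative f') (at (x + t *\<^sub>R v))"
  shows "((\<lambda>t. f (x + t *\<^sub>R v)) has_vector_derivative f' v) (at t)"
proof -
  have "((\<lambda>t. x + t *\<^sub>R v) has_derivative (\<lambda>h. h *\<^sub>R v)) (at t)"
    by (auto intro!: derivative_eq_intros)
  then have "((\<lambda>t. f (x + t *\<^sub>R v)) has_derivative (\<lambda>h. f' (h *\<^sub>R v))) (at t)"
    using has_derivative_compose[of "\<lambda>t. x + t *\<^sub>R v" _ t UNIV f f'] assms by simp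
  then show ?thesis
    unfolding has_vector_derivative_def using has_derivative_bounded_linear[OF assms]
    by (simp add: linear_simps(5))
qed

lemma C2_continuous:
  "C_diff 2 U f \<Longrightarrow> continuous_on U (\<lambda>x. frechet_derivative (\<lambda>y. frechet_derivative f (at y) v) (at x) w)"
  using C_diff_frechet[of 0 U "\<lambda>y. frechet_derivative f (at y) v" w] C_diff_frechet[of 1 U f v]
  by (simp add: numeral_2_eq_2)

subsection \<open>Symmetry of second derivatives\<close>

text \<open>The mean value theorem is applied first in direction \<open>v\<close> to a difference in
  direction \<open>w\<close>, then in direction \<open>w\<close> to the derivative so
  obtained.\<close>

lemma second_difference_mvt:
  fixes f :: "'a::euclidean_space \<Rightarrow> real"
  assumes U: "open U" and f: "C_diff 2 U f" and s: "s > 0"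
    and sub: "\<And>a b. 0 \<le> a \<Longrightarrow> a \<le> s \<Longrightarrow> 0 \<le> b \<Longrightarrow> b \<le> s \<Longrightarrow> x + a *\<^sub>R v + b *\<^sub>R w \<in> U"
  shows "\<exists>a b. 0 < a \<and> a < s \<and> 0 < b \<and> b < s \<and>
    f (x + s *\<^sub>R v + s *\<^sub>R w) - f (x + s *\<^sub>R v) - f (x + s *\<^sub>R w) + f x
      = s * (s * frechet_derivative (\<lambda>y. frechet_derivative f (at y) v) (at (x + a *\<^sub>R v + b *\<^sub>R w)) w)"
proof -
  have f2: "C_diff (Suc 1) U f" "C_diff (Suc 0) U (\<lambda>y. frechet_derivative f (at y) v)" using f C_diff_frechet[of 1 U f v] by (simp_all add: numeral_2_eq_2)
  let ?f = "\<lambda>y. frechet_derivative f (at y) v"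
  let ?g = "\<lambda>t. f (x + s *\<^sub>R w + t *\<^sub>R v) - f (x + t *\<^sub>R v)"
  have g: "(?g has_real_derivative ?f (x + s *\<^sub>R w + t *\<^sub>R v) - ?f (x + t *\<^sub>R v)) (at t)" if "0 \<le> t" "t \<le> s" for t
  proof -
    have "x + s *\<^sub>R w + t *\<^sub>R v \<in> U" using sub[of t s] that s by (simp add: add_ac)
    moreover have "x + t *\<^sub>R v \<in> U" using sub[of t 0] that s by simp
    ultimately show ?thesis
      unfolding has_real_derivative_iff_has_vector_derivative
      by (intro has_vector_derivative_diff frechet_derivative_line C_diff_differentiable[OF f2(1)])
  qed
  obtain a where a: "0 < a" "a < s" "?g s - ?g 0 = (s - 0) * (?f (x + s *\<^sub>R w + a *\<^sub>R v) - ?f (x + a *\<^sub>R v))"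
    using MVT2[OF s, of ?g "\<lambda>t. ?f (x + s *\<^sub>R w + t *\<^sub>R v) - ?f (x + t *\<^sub>R v)"] g by auto
  let ?h = "\<lambda>t. ?f (x + a *\<^sub>R v + t *\<^sub>R w)"
  have h: "(?h has_real_derivative frechet_derivative ?f (at (x + a *\<^sub>R v + t *\<^sub>R w)) w) (at t)" if "0 \<le> t" "t \<le> s" for t
    unfolding has_real_derivative_iff_has_vector_derivative
    by (rule frechet_derivative_line[OF C_diff_differentiable[OF f2(2)]]) (use sub[of a t] a that in auto)
  obtain b where b: "0 < b" "b < s" "?h s - ?h 0 = (s - 0) * frechet_derivative ?f (at (x + a *\<^sub>R v + b *\<^sub>R w)) w"
    using MVT2[OF s, of ?h "\<lambda>t. frechet_derivative ?f (at (x + a *\<^sub>R v + t *\<^sub>R w)) w"] h by auto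
  show ?thesis
    by (rule exI[of _ a], rule exI[of _ b]) (use a b in \<open>simp add: algebra_simps\<close>)
qed

text \<open>The second difference is symmetric in \<open>v\<close> and \<open>w\<close>, so the two
  mixed derivatives agree at two points near \<open>x\<close>; continuity then excludes a gap at
  \<open>x\<close>.\<close>

lemma frechet_derivative_commute:
  fixes f :: "'a::euclidean_space \<Rightarrow> real"
  assumes U: "open U" and f: "C_diff 2 U f" and x: "x \<in> U"
  shows "frechet_derivative (\<lambda>y. frechet_derivative f (at y) v) (at x) w
       = frechet_derivative (\<lambda>y. frechet_derivative f (at y) w) (at x) v"
proof (rule ccontr)
  let ?F = "\<lambda>v w x. frechet_derivative (\<lambda>y. frechet_derivative f (at y) v) (at x) w"
  assume ne: "?F v w x \<noteq> ?F w v x"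
  define e where "e = \<bar>?F v w x - ?F w v x\<bar> / 2"
  have e: "e > 0" using ne by (simp add: e_def)
  have cont: "\<exists>d>0. \<forall>y. dist y x < d \<longrightarrow> y \<in> U \<and> \<bar>?F v w y - ?F v w x\<bar> < e" for v w
  proof -
    have "continuous_on U (?F v w)" by (rule C2_continuous[OF f])
    then have "isCont (?F v w) x" using U x by (simp add: continuous_on_eq_continuous_at)
    then obtain d1 where "d1 > 0" "\<forall>y. dist y x < d1 \<longrightarrow> dist (?F v w y) (?F v w x) < e"
      using e unfolding continuous_at_eps_delta by blast
    moreover obtain d2 where "d2 > 0" "\<forall>y. dist y x < d2 \<longrightarrow> y \<in> U" using U x unfolding open_dist by blast
    ultimately show ?thesis by (intro exI[of _ "min d1 d2"]) (auto simp: dist_real_def)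
  qed
  obtain d1 where d1: "d1 > 0" "\<And>y. dist y x < d1 \<Longrightarrow> y \<in> U \<and> \<bar>?F v w y - ?F v w x\<bar> < e" using cont[of v w] by blast
  obtain d2 where d2: "d2 > 0" "\<And>y. dist y x < d2 \<Longrightarrow> y \<in> U \<and> \<bar>?F w v y - ?F w v x\<bar> < e" using cont[of w v] by blast
  \<comment> \<open>Small enough for the whole parallelogram to lie in both neighbourhoods; the
    added 1 allows both vectors to be zero.\<close>
  define s where "s = min d1 d2 / (norm v + norm w + 1) / 2"
  have nn: "norm v + norm w + 1 > 0" by (simp add: add_nonneg_pos)
  have s: "s > 0" using d1 d2 nn by (simp add: s_def)
  have "a / N / 2 * N = a / 2" if "N > 0" for a N :: real using that by simp
  then have "s * (norm v + norm w + 1) = min d1 d2 / 2" unfolding s_def using nn by blast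
  moreover have "min d1 d2 > 0" using d1 d2 by simp
  ultimately have sd: "s * (norm v + norm w + 1) < min d1 d2" by linarith
  have near: "dist (x + a *\<^sub>R v' + b *\<^sub>R w') x < min d1 d2" if "0 \<le> a" "a \<le> s" "0 \<le> b" "b \<le> s" "{v', w'} = {v, w}" for a b v' w'
  proof -
    have "dist (x + a *\<^sub>R v' + b *\<^sub>R w') x \<le> norm (a *\<^sub>R v') + norm (b *\<^sub>R w')"
      by (simp add: dist_norm norm_triangle_ineq del: norm_scaleR)
    also have "\<dots> \<le> s * norm v' + s * norm w'" using that by (auto intro!: add_mono mult_right_mono)
    also have "\<dots> \<le> s * (norm v + norm w + 1)" using that s by (auto simp: doubleton_eq_iff algebra_simps)
    finally show ?thesis using sd by simp
  qed
  obtain a b where ab: "0 < a" "a < s" "0 < b" "b < s"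
    "f (x + s *\<^sub>R v + s *\<^sub>R w) - f (x + s *\<^sub>R v) - f (x + s *\<^sub>R w) + f x = s * (s * ?F v w (x + a *\<^sub>R v + b *\<^sub>R w))"
    using second_difference_mvt[OF U f s, of x v w] near[of _ _ v w] d1 by auto
  obtain a' b' where ab': "0 < a'" "a' < s" "0 < b'" "b' < s"
    "f (x + s *\<^sub>R w + s *\<^sub>R v) - f (x + s *\<^sub>R w) - f (x + s *\<^sub>R v) + f x = s * (s * ?F w v (x + a' *\<^sub>R w + b' *\<^sub>R v))"
    using second_difference_mvt[OF U f s, of x w v] near[of _ _ w v] d1 by (auto simp: insert_commute)
  have "s * (s * ?F v w (x + a *\<^sub>R v + b *\<^sub>R w)) = s * (s * ?F w v (x + a' *\<^sub>R w + b' *\<^sub>R v))"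
  proof -
    have "x + s *\<^sub>R w + s *\<^sub>R v = x + s *\<^sub>R v + s *\<^sub>R w" by (simp add: add_ac)
    then have "f (x + s *\<^sub>R w + s *\<^sub>R v) = f (x + s *\<^sub>R v + s *\<^sub>R w)" by (rule arg_cong)
    then show ?thesis using ab(5) ab'(5) by linarith
  qed
  then have "?F v w (x + a *\<^sub>R v + b *\<^sub>R w) = ?F w v (x + a' *\<^sub>R w + b' *\<^sub>R v)" using s by simp
  moreover have "\<bar>?F v w (x + a *\<^sub>R v + b *\<^sub>R w) - ?F v w x\<bar> < e"
    using near[of a b v w] ab d1 by auto
  moreover have "\<bar>?F w v (x + a' *\<^sub>R w + b' *\<^sub>R v) - ?F w v x\<bar> < e"
    using near[of a' b' w v] ab' d2 by (auto simp: insert_commute)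
  moreover have "False" if "p = q" "\<bar>p - a\<bar> < e" "\<bar>q - b\<bar> < e" "e = \<bar>a - b\<bar> / 2" for p q a b :: real
    using that by (auto simp: abs_if split: if_splits)
  ultimately show False using e_def by blast
qed

subsection \<open>Complex gradient and complex Hessian\<close>

lemma complex_gradient_eq:
  assumes "u differentiable (at z)"
  shows "complex_gradient u z $ i
    = (of_real (frechet_derivative u (at z) (axis i 1)) - \<i> * of_real (frechet_derivative u (at z) (axis i \<i>))) / 2"
proof -
  have "((\<lambda>w. complex_of_real (u w)) has_derivative (\<lambda>v. complex_of_real (frechet_derivative u (at z) v))) (at z)"
    using assms by (intro has_derivative_of_real) (simp add: frechet_derivative_works)
  from frechet_derivative_at[OF this, symmetric] show ?thesis by (simp add: complex_gradient_def dz_def)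
qed

lemma complex_hessian_eq:
  fixes u :: "complex^'n \<Rightarrow> real"
  assumes U: "open U" and u: "C_diff 2 U u" and z: "z \<in> U"
  defines "H \<equiv> \<lambda>v w. frechet_derivative (\<lambda>y. frechet_derivative u (at y) w) (at z) v"
  shows "complex_hessian u z $ i $ j = Complex (H (axis i 1) (axis j 1) + H (axis i \<i>) (axis j \<i>))
     (H (axis i 1) (axis j \<i>) - H (axis i \<i>) (axis j 1)) / 4"
proof -
  let ?D = "\<lambda>v y. frechet_derivative u (at y) v"
  have u2: "C_diff (Suc 1) U u" "\<And>v. C_diff (Suc 0) U (?D v)" using u C_diff_frechet[of 1 U u] by (simp_all add: numeral_2_eq_2)
  have g: "dzbar j (\<lambda>w. complex_of_real (u w)) y = (of_real (?D (axis j 1) y) + \<i> * of_real (?D (axis j \<i>) y)) / 2" if "y \<in> U" for y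
  proof -
    have "((\<lambda>w. complex_of_real (u w)) has_derivative (\<lambda>v. complex_of_real (?D v y))) (at y)"
      using C_diff_differentiable[OF u2(1) that] by (rule has_derivative_of_real)
    from frechet_derivative_at[OF this, symmetric] show ?thesis by (simp add: dzbar_def)
  qed
  have "((\<lambda>y. (1 / 2) * (of_real (?D (axis j 1) y) + \<i> * of_real (?D (axis j \<i>) y))) has_derivative 
      (\<lambda>v. (1 / 2) * (of_real (H v (axis j 1)) + \<i> * of_real (H v (axis j \<i>))))) (at z)"
    unfolding H_def
    by (intro has_derivative_add has_derivative_mult_right has_derivative_of_real C_diff_differentiable[OF u2(2) z])
  then have "((\<lambda>y. (of_real (?D (axis j 1) y) + \<i> * of_real (?D (axis j \<i>) y)) / 2) has_derivative 
      (\<lambda>v. (of_real (H v (axis j 1)) + \<i> * of_real (H v (axis j \<i>))) / 2)) (at z)" by simp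
  then have "(dzbar j (\<lambda>w. complex_of_real (u w)) has_derivative (\<lambda>v. (of_real (H v (axis j 1)) + \<i> * of_real (H v (axis j \<i>))) / 2)) (at z)"
    by (rule has_derivative_transform_within_open[OF _ U z]) (simp add: g)
  from frechet_derivative_at[OF this] have "frechet_derivative (dzbar j (\<lambda>w. complex_of_real (u w))) (at z) = (\<lambda>v. (of_real (H v (axis j 1)) + \<i> * of_real (H v (axis j \<i>))) / 2)"
    by (rule sym)
  then show ?thesis by (simp add: complex_hessian_def dz_def complex_eq_iff)
qed

lemma hermitian_complex_hessian:
  assumes "open U" "C_diff 2 U u" "z \<in> U"
  shows "hermitian (complex_hessian u z)"
proof (rule hermitianI)
  fix i j
  note c = frechet_derivative_commute[OF assms]
  show "cnj (complex_hessian u z $ i $ j) = complex_hessian u z $ j $ i"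
    unfolding complex_hessian_eq[OF assms]
    using c[of "axis j 1" "axis i 1"] c[of "axis j \<i>" "axis i \<i>"] c[of "axis j \<i>" "axis i 1"] c[of "axis j 1" "axis i \<i>"]
    by (simp only: complex_eq_iff) simp
qed

lemma complex_hessian_cong:
  assumes "open U" "C_diff 2 U u" "z \<in> U" "\<And>y. y \<in> U \<Longrightarrow> u y = v y"
  shows "complex_hessian v z = complex_hessian u z" "complex_gradient v z = complex_gradient u z"
    "frechet_derivative v (at z) = frechet_derivative u (at z)"
proof -
  have v: "C_diff 2 U v" using C_diff_cong[OF assms(1) assms(4,2)] .
  have d: "frechet_derivative v (at y) = frechet_derivative u (at y)" if "y \<in> U" for y
  proof -
    have "(v has_derivative frechet_derivative u (at y)) (at y)"
      using assms that by (intro has_derivative_transform_within_open[OF C_diff_differentiable[of 1 U u y] _ that]) (auto simp: numeral_2_eq_2)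
    from frechet_derivative_at[OF this] show ?thesis by (rule sym)
  qed
  show "frechet_derivative v (at z) = frechet_derivative u (at z)" using d assms by blast
  then show "complex_gradient v z = complex_gradient u z"
    using C_diff_differentiable[of 1 U u z] C_diff_differentiable[of 1 U v z] assms v
    by (auto simp: vec_eq_iff complex_gradient_eq numeral_2_eq_2 differentiableI)
  have "frechet_derivative (\<lambda>y. frechet_derivative v (at y) w) (at z) = frechet_derivative (\<lambda>y. frechet_derivative u (at y) w) (at z)" for w
  proof -
    have "((\<lambda>y. frechet_derivative v (at y) w) has_derivative frechet_derivative (\<lambda>y. frechet_derivative u (at y) w) (at z)) (at z)"
      using assms C_diff_frechet[of 1 U u w] by (intro has_derivative_transform_within_open[OF C_diff_differentiable[of 0 U] _ assms(3)])
        (auto simp: numeral_2_eq_2 d)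
    from frechet_derivative_at[OF this] show ?thesis by (rule sym)
  qed
  then show "complex_hessian v z = complex_hessian u z"
    by (simp add: vec_eq_iff complex_hessian_eq[OF assms(1) v assms(3)] complex_hessian_eq[OF assms(1,2,3)])
qed

lemma continuous_on_complex_hessian:
  assumes "open U" "C_diff 2 U u"
  shows "continuous_on U (complex_hessian u)"
proof -
  have "continuous_on U (\<lambda>z. complex_hessian u z $ i $ j)" for i j
  proof -
    let ?H = "\<lambda>z v w. frechet_derivative (\<lambda>y. frechet_derivative u (at y) w) (at z) v"
    have "continuous_on U (\<lambda>z. ?H z v w)" for v w by (rule C2_continuous[OF assms(2)])
    then have "continuous_on U (\<lambda>z. Complex (?H z (axis i 1) (axis j 1) + ?H z (axis i \<i>) (axis j \<i>))
     (?H z (axis i 1) (axis j \<i>) - ?H z (axis i \<i>) (axis j 1)) / 4)"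
      unfolding Complex_eq by (intro continuous_intros) auto
    then show ?thesis by (rule continuous_on_eq) (simp add: complex_hessian_eq[OF assms])
  qed
  then have "continuous_on U (\<lambda>z. \<chi> i j. complex_hessian u z $ i $ j)" by (intro continuous_on_vec_lambda)
  moreover have "(\<lambda>z. \<chi> i j. complex_hessian u z $ i $ j) = complex_hessian u" by (simp add: vec_eq_iff fun_eq_iff)
  ultimately show ?thesis by simp
qed

lemma continuous_on_complex_gradient:
  assumes "C_diff 1 U u"
  shows "continuous_on U (complex_gradient u)"
proof -
  have "continuous_on U (\<lambda>z. complex_gradient u z $ i)" for i
  proof -
    have "continuous_on U (\<lambda>z. frechet_derivative u (at z) v)" for v using C_diff_frechet[of 0 U u v] assms by simp
    then have "continuous_on U (\<lambda>z. (of_real (frechet_derivative u (at z) (axis i 1)) - \<i> * of_real (frechet_derivative u (at z) (axis i \<i>))) / 2)"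
      by (intro continuous_intros) auto
    then show ?thesis by (rule continuous_on_eq) (use C_diff_differentiable[of 0 U u, THEN differentiableI] assms in \<open>simp add: complex_gradient_eq\<close>)
  qed
  then have "continuous_on U (\<lambda>z. \<chi> i. complex_gradient u z $ i)" by (intro continuous_on_vec_lambda)
  moreover have "(\<lambda>z. \<chi> i. complex_gradient u z $ i) = complex_gradient u" by (simp add: vec_eq_iff fun_eq_iff)
  ultimately show ?thesis by simp
qed

subsection \<open>Cutoff functions\<close>

text \<open>The cube of the positive part is of class C^2 and so serves for every cutoff for which
  two derivatives are enough.\<close>

definition ppos :: "nat \<Rightarrow> real \<Rightarrow> real" where "ppos k t = (max 0 t) ^ k"

lemma ppos_deriv:
  assumes "k \<ge> 2"
  shows "(ppos k has_real_derivative real k * ppos (k - 1) t) (at t)"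
proof -
  consider "t > 0" | "t < 0" | "t = 0" by linarith
  then show ?thesis
  proof cases
    case 1
    have "((\<lambda>t. t ^ k) has_real_derivative real k * t ^ (k - 1)) (at t)"
      by (auto intro!: derivative_eq_intros)
    then show ?thesis
      by (rule has_field_derivative_transform_within_open[where S = "{0<..}", THEN DERIV_cong]) (use 1 in \<open>auto simp: ppos_def\<close>)
  next
    case 2
    have "((\<lambda>t. 0) has_real_derivative 0) (at t)" by simp
    then show ?thesis
      by (rule has_field_derivative_transform_within_open[where S = "{..<0}", THEN DERIV_cong]) (use 2 assms in \<open>auto simp: ppos_def zero_power\<close>)
  next
    case 3
    have "((\<lambda>h. ppos k h / h) \<longlongrightarrow> 0) (at 0)"
    proof (rule Lim_null_comparison)
      show "\<forall>\<^sub>F h in at 0. norm (ppos k h / h) \<le> \<bar>h\<bar> ^ (k - 1)"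
      proof (rule always_eventually, rule allI)
        fix h :: real
        have "\<bar>h\<bar> ^ k = \<bar>h\<bar> ^ (k - 1) * \<bar>h\<bar>" using assms by (metis Suc_diff_1 power_Suc2 less_le_trans zero_less_numeral)
        then show "norm (ppos k h / h) \<le> \<bar>h\<bar> ^ (k - 1)"
          using assms by (cases "h > 0") (auto simp: ppos_def max_def zero_power)
      qed
      have "((\<lambda>h. \<bar>h\<bar> ^ (k - 1)) \<longlongrightarrow> \<bar>0::real\<bar> ^ (k - 1)) (at 0)" by (intro tendsto_intros)
      then show "((\<lambda>h::real. \<bar>h\<bar> ^ (k - 1)) \<longlongrightarrow> 0) (at 0)" using assms by (simp add: zero_power)
    qed
    then show ?thesis using 3 assms by (simp add: DERIV_def ppos_def zero_power)
  qed
qed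

lemma continuous_ppos: "continuous_on S (ppos k)"
  unfolding ppos_def by (intro continuous_intros)

lemma C_diff_ppos3:
  assumes "open U" "C_diff 2 U f" shows "C_diff 2 U (\<lambda>x. ppos 3 (f x))"
proof -
  define \<phi> where "\<phi> i = (if i = 0 then ppos 3 else if i = 1 then (\<lambda>t. 3 * ppos 2 t) else (\<lambda>t. 6 * ppos 1 t))" for i :: nat
  have "(\<phi> i has_real_derivative \<phi> (Suc i) t) (at t)" if "i < 2" for i t
  proof -
    consider "i = 0" | "i = 1" using \<open>i < 2\<close> by linarith
    then show ?thesis
    proof cases
      case 1
      then show ?thesis using ppos_deriv[of 3 t] by (simp add: \<phi>_def)
    next
      case 2
      have "((\<lambda>t. 3 * ppos 2 t) has_real_derivative 3 * (real 2 * ppos (2 - 1) t)) (at t)"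
        by (intro DERIV_cmult ppos_deriv) simp
      then show ?thesis using 2 by (simp add: \<phi>_def)
    qed
  qed
  moreover have "continuous_on UNIV (\<phi> 2)" by (auto simp: \<phi>_def intro!: continuous_intros continuous_ppos)
  ultimately have "C_diff 2 U (\<lambda>x. \<phi> 0 (f x))" by (rule C_diff_compose[OF assms(1) _ _ assms(2)])
  then show ?thesis by (simp add: \<phi>_def)
qed

lemma cutoff_exists:
  fixes \<Omega> :: "'a::euclidean_space set"
  assumes "open \<Omega>" "compact K" "K \<subseteq> \<Omega>"
  obtains \<zeta> W K' where "C_diff 2 UNIV \<zeta>" "open W" "K \<subseteq> W" "\<And>x. x \<in> W \<Longrightarrow> \<zeta> x = 1"
    "compact K'" "K' \<subseteq> \<Omega>" "\<And>x. x \<notin> K' \<Longrightarrow> \<zeta> x = 0"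
proof -
  have "\<forall>x\<in>K. \<exists>r>0. cball x r \<subseteq> \<Omega>" using assms by (meson open_contains_cball subsetD)
  then obtain r where r: "\<And>x. x \<in> K \<Longrightarrow> r x > 0 \<and> cball x (r x) \<subseteq> \<Omega>" by metis
  have "K \<subseteq> (\<Union>x\<in>K. ball x (r x))" using r by fastforce
  then obtain F where F: "F \<subseteq> K" "finite F" "K \<subseteq> (\<Union>x\<in>F. ball x (r x))"
    using compactE_image[OF assms(2), of K "\<lambda>x. ball x (r x)"] by auto
  define w where "w x = (\<Sum>c\<in>F. ppos 3 ((r c)\<^sup>2 - (x - c) \<bullet> (x - c)))" for x
  have wd: "C_diff 2 UNIV w" unfolding w_def
    by (intro C_diff_sum C_diff_ppos3 C_diff_diff C_diff_const C_diff_inner) auto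
  have w0: "w x \<ge> 0" for x unfolding w_def by (intro sum_nonneg) (auto simp: ppos_def)
  have pin: "(x - c) \<bullet> (x - c) = (dist c x)\<^sup>2" for x c by (simp add: dist_norm power2_norm_eq_inner inner_diff_left inner_diff_right inner_commute)
  have wp: "w x > 0" if xK: "x \<in> K" for x
  proof -
    obtain c where c: "c \<in> F" "dist c x < r c" using F xK by auto
    have "ppos 3 ((r c)\<^sup>2 - (x - c) \<bullet> (x - c)) > 0"
      using c power_strict_mono[of "dist c x" "r c" 2] by (auto simp: ppos_def pin)
    then show ?thesis unfolding w_def using c F(2) by (intro sum_pos2[of F c]) (auto simp: ppos_def)
  qed
  have cw: "continuous_on UNIV w" using wd C_diff_continuous by blast
  obtain d where d: "d > 0" "\<And>x. x \<in> K \<Longrightarrow> w x > d"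
  proof (cases "K = {}")
    case False
    then obtain x where x: "x \<in> K" "\<And>y. y \<in> K \<Longrightarrow> w x \<le> w y"
      using continuous_attains_inf[OF assms(2) False continuous_on_subset[OF cw]] by auto
    then show thesis using that[of "w x / 2"] wp[of x] by force
  qed (use that[of 1] in auto)
  \<comment> \<open>The cubed profile equals 1 where \<open>w\<close> exceeds \<open>d\<close> and 0
    where \<open>w\<close> vanishes, with two continuous derivatives throughout.\<close>
  define \<zeta> where "\<zeta> x = 1 - ppos 3 (1 - w x * (1 / d))" for x
  show thesis
  proof (rule that[of \<zeta> "{x. w x > d}" "\<Union>c\<in>F. cball c (r c)"])
    show "C_diff 2 UNIV \<zeta>" unfolding \<zeta>_def by (intro C_diff_diff C_diff_const C_diff_ppos3 C_diff_mult wd) auto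
    show "open {x. w x > d}" by (intro open_Collect_less continuous_intros cw)
    show "K \<subseteq> {x. w x > d}" using d by auto
    show "\<zeta> x = 1" if "x \<in> {x. w x > d}" for x
      using that d by (simp add: \<zeta>_def ppos_def field_simps)
    show "compact (\<Union>c\<in>F. cball c (r c))" using F by auto
    show "(\<Union>c\<in>F. cball c (r c)) \<subseteq> \<Omega>" using F r by blast
    show "\<zeta> x = 0" if "x \<notin> (\<Union>c\<in>F. cball c (r c))" for x
    proof -
      have "(r c)\<^sup>2 \<le> (x - c) \<bullet> (x - c)" if "c \<in> F" for c
      proof -
        have "r c \<le> dist c x" "r c > 0" using that \<open>x \<notin> _\<close> r[of c] F(1) by auto
        then show ?thesis unfolding pin by (intro power_mono) auto
      qed
      then have "w x = 0" unfolding w_def by (intro sum.neutral) (auto simp: ppos_def)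
      then show ?thesis by (simp add: \<zeta>_def ppos_def)
    qed
  qed
qed

lemma C_diff_extend_by_zero:
  assumes U: "open U" and K: "compact K" "K \<subseteq> U" and f: "C_diff r U f" "\<And>x. x \<in> U - K \<Longrightarrow> f x = 0"
  shows "C_diff r UNIV (\<lambda>x. if x \<in> U then f x else 0)"
proof -
  have "C_diff r U (\<lambda>x. if x \<in> U then f x else 0)" by (rule C_diff_cong[OF U _ f(1)]) simp
  moreover have "open (- K)" using K by (simp add: compact_imp_closed open_Compl)
  moreover have "C_diff r (- K) (\<lambda>x. if x \<in> U then f x else 0)"
    by (rule C_diff_cong[OF \<open>open (- K)\<close> _ C_diff_const[of r "- K" 0]]) (use f in auto)
  ultimately have "C_diff r (U \<union> - K) (\<lambda>x. if x \<in> U then f x else 0)" using C_diff_Un[OF U] by blast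
  moreover have "U \<union> - K = UNIV" using K by auto
  ultimately show ?thesis by simp
qed

text \<open>Replaces a function on the domain by a compactly supported one with the same values near
  \<open>K\<close>, so that integrals against test functions supported in \<open>K\<close> can be
  taken over the whole space.\<close>

lemma C2_cutoff:
  fixes \<Omega> :: "'a::euclidean_space set"
  assumes \<Omega>: "open \<Omega>" and K: "compact K" "K \<subseteq> \<Omega>" and u: "C_diff 2 \<Omega> u"
  obtains V W R where "C_diff 2 UNIV V" "open W" "K \<subseteq> W" "\<And>x. x \<in> W \<Longrightarrow> V x = u x" "W \<subseteq> \<Omega>"
    "\<And>x. norm x > R \<Longrightarrow> V x = 0"
proof -
  obtain \<zeta> W K' where c: "C_diff 2 UNIV \<zeta>" "open W" "K \<subseteq> W" "\<And>x. x \<in> W \<Longrightarrow> \<zeta> x = 1"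
    "compact K'" "K' \<subseteq> \<Omega>" "\<And>x. x \<notin> K' \<Longrightarrow> \<zeta> x = 0"
    using cutoff_exists[OF \<Omega> K] by metis
  let ?V = "\<lambda>x. if x \<in> \<Omega> then \<zeta> x * u x else 0"
  obtain R where R: "\<And>x. x \<in> K' \<Longrightarrow> norm x \<le> R" using compact_imp_bounded[OF c(5)] unfolding bounded_iff by blast
  show thesis
  proof (rule that[of ?V "W \<inter> \<Omega>" R])
    show "C_diff 2 UNIV ?V"
      by (rule C_diff_extend_by_zero[OF \<Omega> c(5,6)]) (use c u \<Omega> in \<open>auto intro!: C_diff_mult C_diff_subset[OF c(1)]\<close>)
    show "?V x = 0" if "norm x > R" for x using R[of x] c(7)[of x] that by (cases "x \<in> K'") auto
  qed (use c \<Omega> K in auto)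
qed

subsection \<open>Integrals of compactly supported functions\<close>

definition csupp :: "('a::euclidean_space \<Rightarrow> 'b::zero) \<Rightarrow> bool" where
  "csupp F \<longleftrightarrow> (\<exists>R. \<forall>x. norm x > R \<longrightarrow> F x = 0)"

lemma integrable_csupp:
  fixes F :: "'a::euclidean_space \<Rightarrow> 'b::euclidean_space"
  assumes "continuous_on UNIV F" "csupp F"
  shows "integrable lborel F"
proof -
  obtain R where R: "\<And>x. norm x > R \<Longrightarrow> F x = 0" using assms(2) unfolding csupp_def by blast
  have "F = (\<lambda>x. indicator (cball 0 R) x *\<^sub>R F x)"
    using R by (force simp: fun_eq_iff indicator_def)
  moreover have "integrable lborel (\<lambda>x. indicator (cball 0 R) x *\<^sub>R F x)"
    by (intro borel_integrable_compact continuous_on_subset[OF assms(1)]) auto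
  ultimately show ?thesis by simp
qed

lemma cball_subset_cbox:
  fixes R :: real
  shows "cball 0 R \<subseteq> cbox (- R *\<^sub>R One) (R *\<^sub>R One :: 'a::euclidean_space)"
proof
  fix x :: 'a assume "x \<in> cball 0 R"
  then have "\<bar>x \<bullet> i\<bar> \<le> R" if "i \<in> Basis" for i using Basis_le_norm[OF that, of x] by auto
  then show "x \<in> cbox (- R *\<^sub>R One) (R *\<^sub>R One)" by (auto simp: mem_box abs_le_iff) (metis minus_le_iff)
qed

lemma lborel_integral_cbox:
  fixes F :: "'a::euclidean_space \<Rightarrow> 'b::euclidean_space"
  assumes "continuous_on UNIV F" and R: "\<And>x. norm x > R \<Longrightarrow> F x = 0"
  shows "integral\<^sup>L lborel F = integral (cbox (- R *\<^sub>R One) (R *\<^sub>R One)) F"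
proof -
  have "integrable lborel F" using assms by (intro integrable_csupp) (auto simp: csupp_def)
  then have "integral\<^sup>L lborel F = integral UNIV F" by (simp add: integral_lborel)
  moreover have "(\<lambda>x. if x \<in> cbox (- R *\<^sub>R One) (R *\<^sub>R One) then F x else 0) = F"
    using R cball_subset_cbox[of R, where 'a = 'a] by (force simp: fun_eq_iff)
  ultimately show ?thesis
    using integral_restrict_UNIV[of "cbox (- R *\<^sub>R One) (R *\<^sub>R One)" F] by simp
qed

lemma lborel_integral_isometry:
  fixes F :: "'a::euclidean_space \<Rightarrow> 'b::euclidean_space"
  assumes "continuous_on UNIV F" "\<bar>c\<bar> = 1"
  shows "integral\<^sup>L lborel (\<lambda>y. F (t + c *\<^sub>R y)) = integral\<^sup>L lborel F"
proof -
  have c0: "c \<noteq> 0" using assms(2) by auto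
  have m: "F \<in> borel_measurable borel" using assms(1) by (rule borel_measurable_continuous_onI)
  have "(lborel :: 'a measure) = density (distr lborel borel (\<lambda>x. t + c *\<^sub>R x)) (\<lambda>_. 1)"
    using lborel_affine[OF c0, of t] assms(2) by simp
  then have "(lborel :: 'a measure) = distr lborel borel (\<lambda>x. t + c *\<^sub>R x)" by (simp add: density_1)
  then have "integral\<^sup>L lborel F = integral\<^sup>L (distr lborel borel (\<lambda>x. t + c *\<^sub>R x)) F" by simp
  also have "\<dots> = integral\<^sup>L lborel (\<lambda>y. F (t + c *\<^sub>R y))"
    by (rule integral_distr) (use m in auto)
  finally show ?thesis by simp
qed

subsection \<open>Directional derivatives\<close>

definition dirder :: "('a::euclidean_space \<Rightarrow> 'b::euclidean_space) \<Rightarrow> 'a \<Rightarrow> ('a \<Rightarrow> 'b) \<Rightarrow> bool" where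
  "dirder F v F' \<longleftrightarrow> (\<forall>x. ((\<lambda>t. F (x + t *\<^sub>R v)) has_vector_derivative F' x) (at 0))"

lemma dirder_line:
  assumes "dirder F v F'"
  shows "((\<lambda>t. F (x + t *\<^sub>R v)) has_vector_derivative F' (x + t *\<^sub>R v)) (at t)"
proof -
  have 1: "((\<lambda>s. s - t) has_vector_derivative 1) (at t)"
    by (auto intro!: derivative_eq_intros simp: has_vector_derivative_def)
  have "((\<lambda>s. F ((x + t *\<^sub>R v) + s *\<^sub>R v)) has_vector_derivative F' (x + t *\<^sub>R v)) (at (t - t))"
    using assms unfolding dirder_def by simp
  from vector_diff_chain_at[OF 1 this] show ?thesis
    by (simp add: o_def algebra_simps)
qed

lemma dirder_support:
  assumes "dirder F v F'" "open S" "\<And>x. x \<in> S \<Longrightarrow> F x = 0" "x \<in> S"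
  shows "F' x = 0"
proof -
  have "open ((\<lambda>t. x + t *\<^sub>R v) -` S)"
    by (intro open_vimage assms continuous_intros)
  moreover have "(0::real) \<in> (\<lambda>t. x + t *\<^sub>R v) -` S" using assms by simp
  moreover have "((\<lambda>t. F (x + t *\<^sub>R v)) has_vector_derivative F' x) (at 0)" using assms(1) by (simp add: dirder_def)
  ultimately have "((\<lambda>t::real. 0) has_vector_derivative F' x) (at 0)"
    using assms(3) by (auto intro: has_vector_derivative_transform_within_open)
  then show ?thesis using vector_derivative_unique_at[OF _ has_vector_derivative_const] by blast
qed

lemma dirder_csupp:
  assumes "dirder F v F'" "\<And>x. norm x > R \<Longrightarrow> F x = 0" "norm x > R"
  shows "F' x = 0"
proof (rule dirder_support[OF assms(1)])
  show "open {x. norm x > R}" by (intro open_Collect_less continuous_intros)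
qed (use assms in auto)

text \<open>The integral of a translate does not depend on the translation parameter;
  differentiation under the integral sign then gives zero.\<close>

lemma integral_dirder_zero:
  fixes F :: "'a::euclidean_space \<Rightarrow> 'b::euclidean_space"
  assumes F: "continuous_on UNIV F" "csupp F" "dirder F v F'" and F': "continuous_on UNIV F'"
  shows "integral\<^sup>L lborel F' = 0"
proof -
  obtain R0 where R0: "\<And>x. norm x > R0 \<Longrightarrow> F x = 0" using F(2) unfolding csupp_def by blast
  \<comment> \<open>Enlarged by \<open>norm v\<close> so that all translates with parameter between
    -1 and 1 are supported in one fixed box.\<close>
  define R where "R = R0 + norm v"
  have R: "F (x + t *\<^sub>R v) = 0" if "norm x > R" "\<bar>t\<bar> \<le> 1" for x t
  proof -
    have "norm x \<le> norm (x + t *\<^sub>R v) + norm (t *\<^sub>R v)" by (metis add_diff_cancel norm_triangle_ineq4)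
    also have "norm (t *\<^sub>R v) \<le> norm v" using that by (simp add: mult_left_le_one_le)
    finally show ?thesis using that R0 by (simp add: R_def)
  qed
  let ?Q = "cbox (- R *\<^sub>R One) (R *\<^sub>R One :: 'a)"
  let ?\<phi> = "\<lambda>t. integral ?Q (\<lambda>x. F (x + t *\<^sub>R v))"
  have Fc: "continuous_on S (\<lambda>x. F (f x))" if "continuous_on S f" for S :: "'c::topological_space set" and f
    using continuous_on_compose2[OF F(1) that] by simp
  have F'c: "continuous_on S (\<lambda>x. F' (f x))" if "continuous_on S f" for S :: "'c::topological_space set" and f
    using continuous_on_compose2[OF F' that] by simp
  have "(?\<phi> has_vector_derivative integral ?Q (\<lambda>x. F' (x + 0 *\<^sub>R v))) (at 0 within {-1..1})"
  proof (rule leibniz_rule_vector_derivative)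
    show "((\<lambda>t. F (x + t *\<^sub>R v)) has_vector_derivative F' (x + t *\<^sub>R v)) (at t within {-1..1})" for t x
      using dirder_line[OF F(3)] by (rule has_vector_derivative_at_within)
    show "(\<lambda>x. F (x + t *\<^sub>R v)) integrable_on ?Q" for t
      by (intro integrable_continuous Fc continuous_intros)
    show "continuous_on ({-1..1} \<times> ?Q) (\<lambda>(t, x). F' (x + t *\<^sub>R v))"
      unfolding split_beta by (intro F'c continuous_intros)
  qed auto
  moreover have "?\<phi> t = integral\<^sup>L lborel F" if "t \<in> {-1..1}" for t
  proof -
    have "integral\<^sup>L lborel (\<lambda>x. F (x + t *\<^sub>R v)) = ?\<phi> t"
      using that R by (intro lborel_integral_cbox Fc continuous_intros) auto
    moreover have "integral\<^sup>L lborel (\<lambda>x. F (t *\<^sub>R v + 1 *\<^sub>R x)) = integral\<^sup>L lborel F"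
      by (rule lborel_integral_isometry[OF F(1)]) simp
    ultimately show ?thesis by (simp add: add.commute)
  qed
  then have "(?\<phi> has_vector_derivative 0) (at 0 within {-1..1})"
    by (intro has_vector_derivative_transform[OF _ _ has_vector_derivative_const]) auto
  ultimately have "integral ?Q (\<lambda>x. F' (x + 0 *\<^sub>R v)) = 0"
    by (rule vector_derivative_unique_within[rotated]) (simp add: trivial_limit_within islimpt_Icc)
  moreover have "integral\<^sup>L lborel F' = integral ?Q F'"
  proof (rule lborel_integral_cbox[OF F'])
    fix x :: 'a assume "norm x > R"
    then have "norm x > R0" using norm_ge_zero[of v] unfolding R_def by linarith
    then show "F' x = 0" using dirder_csupp[OF F(3), of R0 x] R0 by blast
  qed
  ultimately show ?thesis by simp
qed

lemma dirder_mult: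
  fixes F G :: "'a::euclidean_space \<Rightarrow> complex"
  assumes "dirder F v F'" "dirder G v G'"
  shows "dirder (\<lambda>x. F x * G x) v (\<lambda>x. F x * G' x + F' x * G x)"
  using assms unfolding dirder_def
  by (auto intro!: has_vector_derivative_eq_rhs[OF has_vector_derivative_mult])

lemma dirder_sum:
  "(\<And>i. i \<in> I \<Longrightarrow> dirder (F i) v (F' i)) \<Longrightarrow> dirder (\<lambda>x. \<Sum>i\<in>I. F i x) v (\<lambda>x. \<Sum>i\<in>I. F' i x)"
  unfolding dirder_def by (auto intro!: has_vector_derivative_sum)

lemma C_diff_dirder:
  assumes "C_diff (Suc r) UNIV f"
  shows "dirder f v (\<lambda>x. frechet_derivative f (at x) v)"
  unfolding dirder_def
proof
  fix x
  show "((\<lambda>t. f (x + t *\<^sub>R v)) has_vector_derivative frechet_derivative f (at x) v) (at 0)"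
    by (rule frechet_derivative_line) (use C_diff_differentiable[OF assms] in simp)
qed

lemma dirder_of_real:
  assumes "dirder f v f'" shows "dirder (\<lambda>x. complex_of_real (f x)) v (\<lambda>x. complex_of_real (f' x))"
  using assms unfolding dirder_def by (auto intro: bounded_linear.has_vector_derivative[OF bounded_linear_of_real])

subsection \<open>Mollification\<close>

lemma csupp_mult: "csupp g \<Longrightarrow> csupp (\<lambda>y. f y * g y :: complex)"
  by (auto simp: csupp_def)

lemma dirder_csupp': "dirder F v F' \<Longrightarrow> csupp F \<Longrightarrow> csupp F'"
  unfolding csupp_def using dirder_csupp by metis

definition conv :: "('a::euclidean_space \<Rightarrow> real) \<Rightarrow> ('a \<Rightarrow> complex) \<Rightarrow> 'a \<Rightarrow> complex" where
  "conv \<eta> g x = integral\<^sup>L lborel (\<lambda>y. complex_of_real (\<eta> (x - y)) * g y)"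

lemma continuous_on_conv_kernel:
  fixes \<eta> :: "'a::euclidean_space \<Rightarrow> real"
  assumes "continuous_on UNIV \<eta>" "continuous_on UNIV g"
  shows "continuous_on UNIV (\<lambda>y. complex_of_real (\<eta> (x - y)) * g y)"
proof -
  have "continuous_on UNIV (\<lambda>y. \<eta> (x - y))"
    by (rule continuous_on_compose2[OF assms(1) continuous_on_diff[OF continuous_on_const continuous_on_id]]) simp
  then show ?thesis by (intro continuous_intros assms)
qed

lemma conv_eq_cbox:
  assumes "continuous_on UNIV \<eta>" "continuous_on UNIV g" "\<And>x. norm x > R \<Longrightarrow> g x = 0"
  shows "conv \<eta> g x = integral (cbox (- R *\<^sub>R One) (R *\<^sub>R One)) (\<lambda>y. complex_of_real (\<eta> (x - y)) * g y)"
  unfolding conv_def using assms by (intro lborel_integral_cbox continuous_on_conv_kernel) auto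

lemma conv_dirder:
  assumes \<eta>: "C_diff 1 UNIV \<eta>" and g: "continuous_on UNIV g" "csupp g"
  shows "dirder (conv \<eta> g) v (conv (\<lambda>x. frechet_derivative \<eta> (at x) v) g)" "continuous_on UNIV (conv \<eta> g)"
proof -
  obtain R where R: "\<And>x. norm x > R \<Longrightarrow> g x = 0" using g(2) unfolding csupp_def by blast
  let ?Q = "cbox (- R *\<^sub>R One) (R *\<^sub>R One)"
  let ?\<eta>' = "\<lambda>x. frechet_derivative \<eta> (at x) v"
  have c: "continuous_on UNIV \<eta>" using \<eta> by (rule C_diff_continuous)
  have c': "continuous_on UNIV ?\<eta>'" using C_diff_frechet[of 0 UNIV \<eta> v] \<eta> by simp
  have cc: "continuous_on S (\<lambda>x. \<eta> (f x))" "continuous_on S (\<lambda>x. ?\<eta>' (f x))" "continuous_on S (\<lambda>x. g (f x))"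
    if "continuous_on S f" for S :: "'c::topological_space set" and f
    using continuous_on_compose2[OF c that] continuous_on_compose2[OF c' that] continuous_on_compose2[OF g(1) that] by auto
  have "continuous_on UNIV (\<lambda>x. integral ?Q (\<lambda>y. complex_of_real (\<eta> (x - y)) * g y))"
    by (rule integral_continuous_on_param) (auto simp: split_beta intro!: cc continuous_intros)
  then show "continuous_on UNIV (conv \<eta> g)"
    using conv_eq_cbox[OF c g(1) R] by (simp cong: continuous_on_cong)
  show "dirder (conv \<eta> g) v (conv ?\<eta>' g)"
    unfolding dirder_def
  proof
    fix x
    have "((\<lambda>t. integral ?Q (\<lambda>y. complex_of_real (\<eta> (x + t *\<^sub>R v - y)) * g y)) has_vector_derivative
       integral ?Q (\<lambda>y. complex_of_real (?\<eta>' (x + 0 *\<^sub>R v - y)) * g y)) (at 0 within UNIV)"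
    proof (rule leibniz_rule_vector_derivative)
      fix t y
      have "((\<lambda>t. \<eta> ((x - y) + t *\<^sub>R v)) has_vector_derivative ?\<eta>' ((x - y) + t *\<^sub>R v)) (at t)"
        using dirder_line[OF C_diff_dirder] \<eta> by auto
      then have "((\<lambda>t. complex_of_real (\<eta> ((x - y) + t *\<^sub>R v)) * g y) has_vector_derivative complex_of_real (?\<eta>' ((x - y) + t *\<^sub>R v)) * g y) (at t)"
        by (intro has_vector_derivative_mult_left bounded_linear.has_vector_derivative[OF bounded_linear_of_real])
      moreover have "x - y + s *\<^sub>R v = x + s *\<^sub>R v - y" for s by simp
      ultimately show "((\<lambda>t. complex_of_real (\<eta> (x + t *\<^sub>R v - y)) * g y) has_vector_derivative complex_of_real (?\<eta>' (x + t *\<^sub>R v - y)) * g y) (at t)"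
        by simp
    next
      show "(\<lambda>y. complex_of_real (\<eta> (x + t *\<^sub>R v - y)) * g y) integrable_on ?Q" for t
        by (intro integrable_continuous cc continuous_intros)
      show "continuous_on (UNIV \<times> ?Q) (\<lambda>(t, y). complex_of_real (?\<eta>' (x + t *\<^sub>R v - y)) * g y)"
        unfolding split_beta by (intro cc continuous_intros)
    qed auto
    then show "((\<lambda>t. conv \<eta> g (x + t *\<^sub>R v)) has_vector_derivative conv ?\<eta>' g x) (at 0)"
      using conv_eq_cbox[OF c g(1) R] conv_eq_cbox[OF c' g(1) R] by simp
  qed
qed

text \<open>One derivative is moved from \<open>G\<close> to the kernel, where second derivatives
  commute. With \<open>G\<close> a first derivative of a C^2 function, this is the symmetry of third
  derivatives after mollification.\<close>

lemma conv_swap_derivatives: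
  assumes \<eta>: "C_diff 2 UNIV \<eta>" and G: "continuous_on UNIV G" "csupp G"
    and Ga: "dirder G a Ga" "continuous_on UNIV Ga" and Gb: "dirder G b Gb" "continuous_on UNIV Gb"
  shows "conv (\<lambda>x. frechet_derivative \<eta> (at x) a) Gb x = conv (\<lambda>x. frechet_derivative \<eta> (at x) b) Ga x"
proof -
  let ?D = "\<lambda>a x. frechet_derivative \<eta> (at x) a"
  let ?DD = "\<lambda>a b x. frechet_derivative (?D a) (at x) b"
  have \<eta>1: "C_diff (Suc 0) UNIV (?D a)" for a using C_diff_frechet[of 1 UNIV \<eta> a] \<eta> by (simp add: numeral_2_eq_2)
  have key: "conv (?D a) Gb x = conv (?DD a b) G x" if Gb: "dirder G b Gb" "continuous_on UNIV Gb" for a b Gb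
  proof -
    let ?F = "\<lambda>y. complex_of_real (?D a (x - y)) * G y"
    have d: "dirder (\<lambda>y. ?D a (x - y)) b (\<lambda>y. - ?DD a b (x - y))"
      unfolding dirder_def
    proof
      fix y
      have 1: "((\<lambda>s. - s) has_vector_derivative - 1) (at (0::real))"
        by (auto intro!: derivative_eq_intros simp: has_vector_derivative_def)
      have "((\<lambda>t. ?D a (x - y + t *\<^sub>R b)) has_vector_derivative ?DD a b (x - y)) (at (- 0))"
        using C_diff_dirder[OF \<eta>1] unfolding dirder_def by simp
      from vector_diff_chain_at[OF 1 this]
      show "((\<lambda>t. ?D a (x - (y + t *\<^sub>R b))) has_vector_derivative - ?DD a b (x - y)) (at 0)"
        by (simp add: o_def algebra_simps)
    qed
    have dF: "dirder ?F b (\<lambda>y. complex_of_real (?D a (x - y)) * Gb y + complex_of_real (- ?DD a b (x - y)) * G y)"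
      by (rule dirder_mult[OF dirder_of_real[OF d] Gb(1)])
    have c1: "continuous_on UNIV (?D a)" using \<eta>1 by (rule C_diff_continuous)
    have c2: "continuous_on UNIV (?DD a b)" using C2_continuous[OF \<eta>] .
    have i1: "integrable lborel (\<lambda>y. complex_of_real (?D a (x - y)) * Gb y)"
      by (intro integrable_csupp continuous_on_conv_kernel c1 Gb csupp_mult dirder_csupp'[OF Gb(1) G(2)])
    have i2: "integrable lborel (\<lambda>y. complex_of_real (?DD a b (x - y)) * G y)"
      by (intro integrable_csupp continuous_on_conv_kernel c2 G csupp_mult)
    have "integral\<^sup>L lborel (\<lambda>y. complex_of_real (?D a (x - y)) * Gb y + complex_of_real (- ?DD a b (x - y)) * G y) = 0"
    proof (rule integral_dirder_zero[OF _ _ dF])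
      show "continuous_on UNIV ?F" by (rule continuous_on_conv_kernel[OF c1 G(1)])
      show "csupp ?F" by (intro csupp_mult G)
      show "continuous_on UNIV (\<lambda>y. complex_of_real (?D a (x - y)) * Gb y + complex_of_real (- ?DD a b (x - y)) * G y)"
        using continuous_on_conv_kernel[OF c2 G(1), of x]
        by (auto intro!: continuous_on_diff continuous_on_conv_kernel c1 Gb)
    qed
    then show ?thesis using i1 i2 by (simp add: conv_def)
  qed
  have "conv (?D a) Gb x = conv (?DD a b) G x" by (rule key[OF Gb])
  also have "?DD a b = ?DD b a" using frechet_derivative_commute[OF open_UNIV \<eta>] by auto
  also have "conv (?DD b a) G x = conv (?D b) Ga x" by (rule key[OF Ga, symmetric])
  finally show ?thesis .
qed

definition mollifier :: "('a::euclidean_space \<Rightarrow> real) \<Rightarrow> real \<Rightarrow> bool" where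
  "mollifier \<eta> e \<longleftrightarrow> C_diff 2 UNIV \<eta> \<and> (\<forall>x. \<eta> x \<ge> 0) \<and> (\<forall>x. norm x > e \<longrightarrow> \<eta> x = 0) \<and> integral\<^sup>L lborel \<eta> = 1"

lemma mollifier_exists:
  assumes e: "e > 0"
  shows "\<exists>\<eta> :: 'a::euclidean_space \<Rightarrow> real. mollifier \<eta> e"
proof -
  define w :: "'a \<Rightarrow> real" where "w x = ppos 3 (e\<^sup>2 - (x - 0) \<bullet> (x - 0))" for x
  have w2: "C_diff 2 UNIV w" unfolding w_def by (intro C_diff_ppos3 C_diff_diff C_diff_const C_diff_inner) auto
  have w0: "w x \<ge> 0" for x by (simp add: w_def ppos_def)
  have ws: "w x = 0" if "norm x > e" for x
    using that power_mono[of e "norm x" 2] e by (simp add: w_def ppos_def power2_norm_eq_inner)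
  have i: "integrable lborel w" using ws by (intro integrable_csupp C_diff_continuous[OF w2]) (auto simp: csupp_def)
  have "integral\<^sup>L lborel w \<noteq> 0"
  proof
    assume "integral\<^sup>L lborel w = 0"
    then have "AE x in lborel. w x = 0" using integral_nonneg_eq_0_iff_AE[OF i] w0 by auto
    then have "AE x\<in>ball (0::'a) e in lborel. False"
    proof (rule eventually_mono, intro impI)
      fix x :: 'a assume "w x = 0" "x \<in> ball 0 e"
      then show False using power_strict_mono[of "norm x" e 2] by (simp add: w_def ppos_def power2_norm_eq_inner max_def split: if_splits)
    qed
    moreover have "{x::'a. norm x < e} = ball 0 e" by auto
    ultimately have "emeasure lborel (ball (0::'a) e) = 0"
      by (subst (asm) AE_iff_measurable[OF _ refl]) (auto simp: space_lborel)
    then have "ball (0::'a) e \<in> null_sets lebesgue" by (intro null_sets_completionI) auto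
    then have "negligible (ball (0::'a) e)" by (simp add: negligible_iff_null_sets)
    then show False using e open_not_negligible[of "ball (0::'a) e"] by simp
  qed
  moreover have "integral\<^sup>L lborel w \<ge> 0" using w0 by simp
  ultimately have I: "integral\<^sup>L lborel w > 0" by simp
  let ?c = "1 / integral\<^sup>L lborel w"
  have "mollifier (\<lambda>x. ?c * w x) e"
    unfolding mollifier_def using w0 ws I i C_diff_mult[OF open_UNIV C_diff_const[of 2 UNIV ?c] w2]
    by auto
  then show ?thesis by blast
qed

lemma mollifier_shift:
  assumes "mollifier \<eta> e"
  shows "integrable lborel (\<lambda>y. \<eta> (x - y))" "integral\<^sup>L lborel (\<lambda>y. \<eta> (x - y)) = 1"
proof -
  have c: "continuous_on UNIV \<eta>" using assms C_diff_continuous by (auto simp: mollifier_def)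
  have "integral\<^sup>L lborel (\<lambda>y. \<eta> (x + (- 1) *\<^sub>R y)) = integral\<^sup>L lborel \<eta>"
    by (rule lborel_integral_isometry[OF c]) simp
  then show "integral\<^sup>L lborel (\<lambda>y. \<eta> (x - y)) = 1" using assms by (simp add: mollifier_def)
  then show "integrable lborel (\<lambda>y. \<eta> (x - y))" using not_integrable_integral_eq by fastforce
qed

text \<open>The convolution averages, with nonnegative weights of total mass 1, values of
  \<open>g\<close> at points within distance \<open>e\<close> of \<open>x\<close>.\<close>

lemma conv_close:
  assumes \<eta>: "mollifier \<eta> e" and g: "continuous_on UNIV g" "csupp g" 
    and d: "\<And>y. norm (y - x) \<le> e \<Longrightarrow> norm (g y - c) \<le> d"
  shows "norm (conv \<eta> g x - c) \<le> d"
proof -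
  have ce: "continuous_on UNIV \<eta>" using \<eta> C_diff_continuous by (auto simp: mollifier_def)
  note sh = mollifier_shift[OF \<eta>]
  have i: "integrable lborel (\<lambda>y. complex_of_real (\<eta> (x - y)) * g y)"
    by (intro integrable_csupp continuous_on_conv_kernel ce csupp_mult g)
  have i1: "integrable lborel (\<lambda>y. complex_of_real (\<eta> (x - y)) * c)"
    using sh(1)[of x] by (intro integrable_mult_left) (simp add: integrable_of_real)
  have "integral\<^sup>L lborel (\<lambda>y. complex_of_real (\<eta> (x - y)) * c) = c"
    using sh(1)[of x] sh(2)[of x] by (simp add: integral_of_real[symmetric])
  then have "conv \<eta> g x - c = integral\<^sup>L lborel (\<lambda>y. complex_of_real (\<eta> (x - y)) * g y - complex_of_real (\<eta> (x - y)) * c)"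
    using i i1 by (simp add: conv_def)
  also have "norm \<dots> \<le> integral\<^sup>L lborel (\<lambda>y. d * \<eta> (x - y))"
  proof (rule Bochner_Integration.integral_norm_bound_integral)
    show "integrable lborel (\<lambda>y. complex_of_real (\<eta> (x - y)) * g y - complex_of_real (\<eta> (x - y)) * c)"
      using i i1 by (rule Bochner_Integration.integrable_diff)
    show "integrable lborel (\<lambda>y. d * \<eta> (x - y))" using sh(1) by simp
    fix y
    have "norm (complex_of_real (\<eta> (x - y)) * (g y - c)) \<le> \<eta> (x - y) * d"
    proof (cases "norm (y - x) \<le> e")
      case True
      then show ?thesis using d[OF True] \<eta> by (auto simp: norm_mult mollifier_def intro!: mult_mono)
    next
      case False
      then have "\<eta> (x - y) = 0" using \<eta> by (auto simp: mollifier_def norm_minus_commute)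
      then show ?thesis by simp
    qed
    then show "norm (complex_of_real (\<eta> (x - y)) * g y - complex_of_real (\<eta> (x - y)) * c) \<le> d * \<eta> (x - y)"
      by (simp add: algebra_simps)
  qed
  also have "\<dots> = d" using sh by simp
  finally show ?thesis .
qed

subsection \<open>The divergence structure\<close>

text \<open>Obtained by differentiating the recursion of \<open>newton_mat\<close> in the direction
  \<open>B\<close>; the trace is the derivative of \<open>esym_mat (Suc j)\<close>.\<close>

primrec newton_der :: "nat \<Rightarrow> complex^'n^'n \<Rightarrow> complex^'n^'n \<Rightarrow> complex^'n^'n" where
  "newton_der 0 A B = 0"
| "newton_der (Suc j) A B = mat (trace (newton_mat j A ** B)) - (A ** newton_der j A B + B ** newton_mat j A)"

lemma mat_deriv_newton:
  assumes "mat_deriv M M' t"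
  shows "mat_deriv (\<lambda>t. newton_mat j (M t)) (newton_der j (M t) M') t"
proof (induction j)
  case 0
  then show ?case by (simp add: mat_deriv_const)
next
  case (Suc j)
  have "mat_deriv (\<lambda>t. M t ** newton_mat j (M t)) (M t ** newton_der j (M t) M' + M' ** newton_mat j (M t)) t"
    by (rule mat_deriv_mult[OF assms Suc])
  moreover have "mat_deriv (\<lambda>t. mat (esym_mat (Suc j) (M t))) (mat (trace (newton_mat j (M t) ** M'))) t"
    unfolding mat_deriv_def mat_def using esym_mat_deriv_trace[OF assms, of j] by simp
  ultimately show ?case
    unfolding newton_mat_Suc newton_der.simps mat_deriv_def vector_minus_component
    by (intro allI has_vector_derivative_diff) auto
qed

lemma newton_der_linear:
  "newton_der j A (B + C) = newton_der j A B + newton_der j A C" "newton_der j A (smat c B) = smat c (newton_der j A B)"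
proof (induction j)
  case (Suc j)
  { case 1 show ?case by (simp add: Suc matrix_add_ldistrib matrix_mul_add_left trace_add) (simp add: vec_eq_iff mat_def) }
  { case 2 show ?case by (simp add: Suc smat_simps) (simp add: vec_eq_iff mat_def smat_def algebra_simps) }
qed (simp_all add: smat_def vec_eq_iff)

text \<open>
  For the third derivatives \<open>dA a\<close> of a function with complex Hessian \<open>A\<close> the hypothesis is the symmetry of
  mixed derivatives; the conclusion then says that the rows of the Newton transformation are divergence free.
\<close>

lemma newton_der_divergence:
  fixes dA :: "'n::finite \<Rightarrow> complex^'n^'n"
  assumes sym: "\<And>a b c. dA a $ b $ c = dA b $ a $ c"
  shows "(\<Sum>a\<in>UNIV. newton_der j A (dA a) $ b $ a) = 0"
proof (induction j arbitrary: b)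
  case (Suc j)
  have "(\<Sum>a\<in>UNIV. newton_der (Suc j) A (dA a) $ b $ a) = 
    (\<Sum>a\<in>UNIV. (if b = a then trace (newton_mat j A ** dA a) else 0)) 
     - ((\<Sum>a\<in>UNIV. \<Sum>c\<in>UNIV. A $ b $ c * newton_der j A (dA a) $ c $ a) + (\<Sum>a\<in>UNIV. \<Sum>c\<in>UNIV. dA a $ b $ c * newton_mat j A $ c $ a))"
    by (simp add: mat_def sum_subtractf sum.distrib matrix_matrix_mult_def)
  also have "(\<Sum>a\<in>UNIV. \<Sum>c\<in>UNIV. A $ b $ c * newton_der j A (dA a) $ c $ a) = (\<Sum>c\<in>UNIV. A $ b $ c * (\<Sum>a\<in>UNIV. newton_der j A (dA a) $ c $ a))"
    by (subst sum.swap) (simp add: sum_distrib_left)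
  also have "\<dots> = 0" by (simp add: Suc)
  \<comment> \<open>The assumed symmetry moves the index of differentiation into the row index, so
    the double sum becomes a trace, which cancels the diagonal term.\<close>
  also have "(\<Sum>a\<in>UNIV. \<Sum>c\<in>UNIV. dA a $ b $ c * newton_mat j A $ c $ a) = trace (dA b ** newton_mat j A)"
    by (simp add: sym[of _ b] trace_def matrix_matrix_mult_def)
  also have "\<dots> = trace (newton_mat j A ** dA b)" by (rule trace_mul_sym)
  finally show ?case by simp
qed simp

text \<open>The trace is the divergence, in the holomorphic derivatives, of \<open>F\<close>
  contracted with the Newton matrix: by \<open>newton_der_divergence\<close> the derivatives of the
  matrix contribute nothing.\<close>

lemma integral_newton_smooth:
  fixes A :: "complex^'n \<Rightarrow> complex^'n^'n" and F :: "complex^'n \<Rightarrow> complex^'n"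
  assumes A: "continuous_on UNIV A"
    and AX: "\<And>a b c. dirder (\<lambda>x. A x $ b $ c) (axis a 1) (\<lambda>x. AX a x $ b $ c)" "\<And>a. continuous_on UNIV (AX a)"
    and AY: "\<And>a b c. dirder (\<lambda>x. A x $ b $ c) (axis a \<i>) (\<lambda>x. AY a x $ b $ c)" "\<And>a. continuous_on UNIV (AY a)"
    and sym: "\<And>a b c x. AX a x $ b $ c - \<i> * AY a x $ b $ c = AX b x $ a $ c - \<i> * AY b x $ a $ c"
    and F: "continuous_on UNIV F" "csupp F"
    and FX: "\<And>a b. dirder (\<lambda>x. F x $ b) (axis a 1) (\<lambda>x. FX a x $ b)" "\<And>a. continuous_on UNIV (FX a)"
    and FY: "\<And>a b. dirder (\<lambda>x. F x $ b) (axis a \<i>) (\<lambda>x. FY a x $ b)" "\<And>a. continuous_on UNIV (FY a)"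
  shows "integral\<^sup>L lborel (\<lambda>x. trace (newton_mat j (A x) ** (\<chi> a b. (FX a x $ b - \<i> * FY a x $ b) / 2))) = 0"
proof -
  let ?T = "\<lambda>x. newton_mat j (A x)"
  have cT: "continuous_on UNIV ?T" by (rule continuous_on_newton_mat[OF A])
  have cder: "continuous_on UNIV (\<lambda>x. newton_der j (A x) (B x))" if "continuous_on UNIV B" for B j
  proof (induction j)
    case (Suc j)
    then show ?case unfolding newton_der.simps
      by (intro continuous_intros continuous_on_mat continuous_on_trace continuous_on_matrix_mult continuous_on_newton_mat A that)
  qed simp
  have zero: "integral\<^sup>L lborel (\<lambda>x. \<Sum>b\<in>UNIV. ?T x $ b $ a * FV a x $ b + newton_der j (A x) (AV a x) $ b $ a * F x $ b) = 0
    \<and> integrable lborel (\<lambda>x. \<Sum>b\<in>UNIV. ?T x $ b $ a * FV a x $ b + newton_der j (A x) (AV a x) $ b $ a * F x $ b)"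
    if V: "\<And>b c. dirder (\<lambda>x. A x $ b $ c) v (\<lambda>x. AV a x $ b $ c)" "continuous_on UNIV (AV a)"
      "\<And>b. dirder (\<lambda>x. F x $ b) v (\<lambda>x. FV a x $ b)" "continuous_on UNIV (FV a)" for a AV FV v
  proof -
    have dT: "dirder (\<lambda>x. ?T x $ b $ c) v (\<lambda>x. newton_der j (A x) (AV a x) $ b $ c)" for b c
      unfolding dirder_def
    proof
      fix x
      have "mat_deriv (\<lambda>t. A (x + t *\<^sub>R v)) (AV a x) 0" using V(1) unfolding mat_deriv_def dirder_def by blast
      from mat_deriv_newton[OF this, of j]
      show "((\<lambda>t. ?T (x + t *\<^sub>R v) $ b $ c) has_vector_derivative newton_der j (A x) (AV a x) $ b $ c) (at 0)"
        unfolding mat_deriv_def by simp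
    qed
    let ?G = "\<lambda>x. \<Sum>b\<in>UNIV. ?T x $ b $ a * F x $ b"
    let ?G' = "\<lambda>x. \<Sum>b\<in>UNIV. ?T x $ b $ a * FV a x $ b + newton_der j (A x) (AV a x) $ b $ a * F x $ b"
    have d: "dirder ?G v ?G'" by (intro dirder_sum dirder_mult dT V)
    obtain R where R: "\<And>x. norm x > R \<Longrightarrow> F x = 0" using F(2) unfolding csupp_def by blast
    have GR: "?G x = 0" if "norm x > R" for x using R[OF that] by simp
    have c: "continuous_on UNIV ?G" by (intro continuous_intros cT F)
    have c': "continuous_on UNIV ?G'" by (intro continuous_intros cT F V cder)
    have "csupp ?G" using GR by (auto simp: csupp_def)
    moreover have "csupp ?G'" using dirder_csupp[OF d GR] by (auto simp: csupp_def)
    ultimately show ?thesis using integral_dirder_zero[OF c _ d c'] integrable_csupp[OF c'] by blast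
  qed
  let ?IX = "\<lambda>a x. \<Sum>b\<in>UNIV. ?T x $ b $ a * FX a x $ b + newton_der j (A x) (AX a x) $ b $ a * F x $ b"
  let ?IY = "\<lambda>a x. \<Sum>b\<in>UNIV. ?T x $ b $ a * FY a x $ b + newton_der j (A x) (AY a x) $ b $ a * F x $ b"
  have "trace (?T x ** (\<chi> a b. (FX a x $ b - \<i> * FY a x $ b) / 2)) = (\<Sum>a\<in>UNIV. (?IX a x - \<i> * ?IY a x) / 2)" for x
  proof -
    define dA where "dA a = AX a x + smat (- \<i>) (AY a x)" for a
    have dd: "newton_der j (A x) (AX a x) $ b $ a - \<i> * newton_der j (A x) (AY a x) $ b $ a = newton_der j (A x) (dA a) $ b $ a" for a b
      unfolding dA_def newton_der_linear by (simp add: smat_def)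
    have s: "dA a $ b $ c = dA b $ a $ c" for a b c
      using sym[of a x b c] by (simp add: dA_def smat_def)
    have "(\<Sum>a\<in>UNIV. (?IX a x - \<i> * ?IY a x) / 2) = 
       (\<Sum>a\<in>UNIV. \<Sum>b\<in>UNIV. ?T x $ b $ a * ((FX a x $ b - \<i> * FY a x $ b) / 2) + newton_der j (A x) (dA a) $ b $ a * F x $ b / 2)"
    proof (rule sum.cong[OF refl])
      fix a
      show "(?IX a x - \<i> * ?IY a x) / 2 =
        (\<Sum>b\<in>UNIV. ?T x $ b $ a * ((FX a x $ b - \<i> * FY a x $ b) / 2) + newton_der j (A x) (dA a) $ b $ a * F x $ b / 2)"
        unfolding sum_distrib_left sum_subtractf[symmetric] sum_divide_distrib
        by (rule sum.cong[OF refl]) (simp add: dd[symmetric] field_simps)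
    qed
    also have "\<dots> = (\<Sum>a\<in>UNIV. \<Sum>b\<in>UNIV. ?T x $ b $ a * ((FX a x $ b - \<i> * FY a x $ b) / 2)) + (\<Sum>b\<in>UNIV. (\<Sum>a\<in>UNIV. newton_der j (A x) (dA a) $ b $ a) * F x $ b / 2)"
      by (simp only: sum.distrib sum_distrib_right sum_divide_distrib) (subst (2) sum.swap, rule refl)
    also have "\<dots> = (\<Sum>a\<in>UNIV. \<Sum>b\<in>UNIV. ?T x $ b $ a * ((FX a x $ b - \<i> * FY a x $ b) / 2))"
      by (simp add: newton_der_divergence[OF s])
    also have "\<dots> = trace (?T x ** (\<chi> a b. (FX a x $ b - \<i> * FY a x $ b) / 2))"
      unfolding trace_def matrix_matrix_mult_def by (subst sum.swap) simp
    finally show ?thesis by simp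
  qed
  moreover have "integral\<^sup>L lborel (\<lambda>x. \<Sum>a\<in>UNIV. (?IX a x - \<i> * ?IY a x) / 2) = 0"
  proof -
    have "integral\<^sup>L lborel (?IX a) = 0 \<and> integrable lborel (?IX a)" for a
      by (rule zero[where AV = AX and FV = FX and v = "axis a 1"]) (rule AX FX)+
    moreover have "integral\<^sup>L lborel (?IY a) = 0 \<and> integrable lborel (?IY a)" for a
      by (rule zero[where AV = AY and FV = FY and v = "axis a \<i>"]) (rule AY FY)+
    ultimately show ?thesis by (subst Bochner_Integration.integral_sum) auto
  qed
  ultimately show ?thesis by simp
qed

subsection \<open>Integration by parts for Hessian operators\<close>

lemma conv_linear:
  assumes "continuous_on UNIV \<eta>" "continuous_on UNIV p" "csupp p" "continuous_on UNIV q" "csupp q"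
  shows "conv \<eta> (\<lambda>y. (p y - \<i> * q y) / 2) x = (conv \<eta> p x - \<i> * conv \<eta> q x) / 2"
proof -
  have i: "integrable lborel (\<lambda>y. complex_of_real (\<eta> (x - y)) * p y)" "integrable lborel (\<lambda>y. complex_of_real (\<eta> (x - y)) * q y)"
    by (intro integrable_csupp continuous_on_conv_kernel csupp_mult assms)+
  have "conv \<eta> (\<lambda>y. (p y - \<i> * q y) / 2) x = integral\<^sup>L lborel (\<lambda>y. (complex_of_real (\<eta> (x - y)) * p y - \<i> * (complex_of_real (\<eta> (x - y)) * q y)) / 2)"
    unfolding conv_def by (rule Bochner_Integration.integral_cong) (auto simp: algebra_simps)
  also have "\<dots> = (conv \<eta> p x - \<i> * conv \<eta> q x) / 2"
    unfolding conv_def using i by simp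
  finally show ?thesis .
qed

lemma C2_frechet: "C_diff 2 U f \<Longrightarrow> C_diff 1 U (\<lambda>x. frechet_derivative f (at x) v)"
  using C_diff_frechet[of 1 U f v] by (simp add: numeral_2_eq_2)

definition dbar :: "'n \<Rightarrow> (complex^'n \<Rightarrow> real) \<Rightarrow> complex^'n \<Rightarrow> complex" where
  "dbar c u x = (of_real (frechet_derivative u (at x) (axis c 1)) + \<i> * of_real (frechet_derivative u (at x) (axis c \<i>))) / 2"

definition dbar_der :: "'n \<Rightarrow> complex^'n \<Rightarrow> (complex^'n \<Rightarrow> real) \<Rightarrow> complex^'n \<Rightarrow> complex" where
  "dbar_der c v u x = (of_real (frechet_derivative (\<lambda>y. frechet_derivative u (at y) (axis c 1)) (at x) v)
     + \<i> * of_real (frechet_derivative (\<lambda>y. frechet_derivative u (at y) (axis c \<i>)) (at x) v)) / 2"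

lemma dbar_dirder:
  assumes "C_diff 2 UNIV u"
  shows "dirder (dbar c u) v (dbar_der c v u)" "continuous_on UNIV (dbar_der c v u)" "continuous_on UNIV (dbar c u)"
proof -
  have 1: "dirder (\<lambda>x. complex_of_real (frechet_derivative u (at x) w)) v
     (\<lambda>x. complex_of_real (frechet_derivative (\<lambda>y. frechet_derivative u (at y) w) (at x) v))" for w
    using C2_frechet[OF assms, of w] by (intro dirder_of_real C_diff_dirder) auto
  show "dirder (dbar c u) v (dbar_der c v u)"
    unfolding dirder_def dbar_def dbar_der_def
    using 1 unfolding dirder_def
    by (auto intro!: has_vector_derivative_divide has_vector_derivative_add has_vector_derivative_mult_right)
  show "continuous_on UNIV (dbar_der c v u)"
    unfolding dbar_der_def by (intro continuous_intros C2_continuous[OF assms]) auto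
  show "continuous_on UNIV (dbar c u)"
    unfolding dbar_def by (intro continuous_intros C_diff_continuous[OF C2_frechet[OF assms]]) auto
qed

lemma complex_hessian_dbar:
  assumes "open U" "C_diff 2 U u" "x \<in> U"
  shows "complex_hessian u x $ b $ c = (dbar_der c (axis b 1) u x - \<i> * dbar_der c (axis b \<i>) u x) / 2"
  by (simp add: complex_hessian_eq[OF assms] dbar_der_def complex_eq_iff)

lemma complex_gradient_dbar:
  assumes "u differentiable (at x)"
  shows "cnj (complex_gradient u x $ b) = dbar b u x"
  by (simp add: complex_gradient_eq[OF assms] dbar_def)

lemma csupp_frechet:
  fixes u :: "'a::euclidean_space \<Rightarrow> real"
  assumes "\<And>x. norm x > R \<Longrightarrow> u x = 0" "norm x > R"
  shows "frechet_derivative u (at x) v = 0"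
proof -
  have "open {x::'a. norm x > R}" by (intro open_Collect_less continuous_intros)
  then have "(u has_derivative (\<lambda>_. 0)) (at x)"
    by (rule has_derivative_transform_within_open[OF has_derivative_const[of 0]]) (use assms in auto)
  from fun_cong[OF frechet_derivative_at[OF this]] show ?thesis by metis
qed

lemma csupp_dbar:
  assumes "\<And>x. norm x > R \<Longrightarrow> u x = 0" "norm x > R"
  shows "dbar c u x = 0" "dbar_der c v u x = 0"
  using csupp_frechet[of R u, OF assms(1)] csupp_frechet[of R "\<lambda>y. frechet_derivative u (at y) w" for w, OF csupp_frechet[of R u, OF assms(1)] assms(2)] assms(2)
  by (auto simp: dbar_def dbar_der_def)

text \<open>Here the Hessian is merely continuous. Its mollified entries satisfy the smooth
  identity, and dominated convergence removes the mollification; \<open>F\<close> stays as it is,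
  since only its first derivatives occur.\<close>

lemma integral_newton_hessian:
  fixes F :: "complex^'n \<Rightarrow> complex^'n"
  assumes U: "C_diff 2 UNIV U" "\<And>x. norm x > R \<Longrightarrow> U x = 0"
    and F: "continuous_on UNIV F" "\<And>x. norm x > R \<Longrightarrow> F x = 0"
    and FX: "\<And>a b. dirder (\<lambda>x. F x $ b) (axis a 1) (\<lambda>x. FX a x $ b)" "\<And>a. continuous_on UNIV (FX a)"
    and FY: "\<And>a b. dirder (\<lambda>x. F x $ b) (axis a \<i>) (\<lambda>x. FY a x $ b)" "\<And>a. continuous_on UNIV (FY a)"
  defines "DF \<equiv> \<lambda>x. (\<chi> a b. (FX a x $ b - \<i> * FY a x $ b) / 2) :: complex^'n^'n"
  shows "integral\<^sup>L lborel (\<lambda>x. trace (newton_mat j (complex_hessian U x) ** DF x)) = 0"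
    "integrable lborel (\<lambda>x. trace (newton_mat j (complex_hessian U x) ** DF x))"
proof -
  let ?A = "complex_hessian U"
  have cA: "continuous_on UNIV ?A" by (rule continuous_on_complex_hessian[OF open_UNIV U(1)])
  have cs: "csupp F" using F(2) by (auto simp: csupp_def)
  have A0: "?A x = 0" if "norm x > R" for x
    using csupp_dbar(2)[OF U(2) that] by (simp add: vec_eq_iff complex_hessian_dbar[OF open_UNIV U(1)])
  have Ae: "continuous_on UNIV (\<lambda>y. ?A y $ b $ c)" "csupp (\<lambda>y. ?A y $ b $ c)" for b c
    by (intro continuous_intros cA) (auto simp: csupp_def A0 intro!: exI[of _ R])
  have dbs: "csupp (dbar c U)" "csupp (dbar_der c v U)" for c v
    unfolding csupp_def using csupp_dbar[of R U] U(2) by blast+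
  have "\<exists>\<eta> :: nat \<Rightarrow> complex^'n \<Rightarrow> real. \<forall>n. mollifier (\<eta> n) (1 / real (Suc n))"
    by (intro choice allI mollifier_exists) simp
  then obtain \<eta> :: "nat \<Rightarrow> complex^'n \<Rightarrow> real" where \<eta>: "\<And>n. mollifier (\<eta> n) (1 / real (Suc n))" by blast
  then have \<eta>2: "C_diff 2 UNIV (\<eta> n)" for n by (simp add: mollifier_def)
  then have \<eta>1: "C_diff 1 UNIV (\<eta> n)" for n using C_diff_le[of 1 2] by auto
  define D where "D n v x = frechet_derivative (\<eta> n) (at x) v" for n v x
  have D1: "C_diff 1 UNIV (D n v)" for n v unfolding D_def by (rule C2_frechet[OF \<eta>2])
  have cD: "continuous_on UNIV (D n v)" for n v by (rule C_diff_continuous[OF D1])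
  define An where "An n x = (\<chi> b c. conv (\<eta> n) (\<lambda>y. ?A y $ b $ c) x)" for n x
  define Ad where "Ad n v x = (\<chi> b c. conv (D n v) (\<lambda>y. ?A y $ b $ c) x)" for n v x
  have zero: "integral\<^sup>L lborel (\<lambda>x. trace (newton_mat j (An n x) ** DF x)) = 0" for n
    unfolding DF_def
  proof (rule integral_newton_smooth[where AX = "\<lambda>a. Ad n (axis a 1)" and AY = "\<lambda>a. Ad n (axis a \<i>)", OF _ _ _ _ _ _ F(1) cs FX FY])
    show "continuous_on UNIV (An n)"
      unfolding An_def by (intro continuous_on_vec_lambda conv_dirder(2) \<eta>1 Ae)
    have "continuous_on UNIV (Ad n v)" for v
      unfolding Ad_def by (intro continuous_on_vec_lambda conv_dirder(2) D1 Ae)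
    then show "continuous_on UNIV (Ad n (axis a 1))" "continuous_on UNIV (Ad n (axis a \<i>))" for a by auto
    have "dirder (\<lambda>x. An n x $ b $ c) v (\<lambda>x. Ad n v x $ b $ c)" for b c v
      by (simp add: An_def Ad_def D_def[abs_def] conv_dirder(1)[OF \<eta>1 Ae])
    then show "dirder (\<lambda>x. An n x $ b $ c) (axis a 1) (\<lambda>x. Ad n (axis a 1) x $ b $ c)"
      "dirder (\<lambda>x. An n x $ b $ c) (axis a \<i>) (\<lambda>x. Ad n (axis a \<i>) x $ b $ c)" for a b c by auto
    show "Ad n (axis a 1) x $ b $ c - \<i> * Ad n (axis a \<i>) x $ b $ c = Ad n (axis b 1) x $ a $ c - \<i> * Ad n (axis b \<i>) x $ a $ c" for a b c x
    proof -
      \<comment> \<open>\<open>S v w\<close> is the mollified third-order term, with one derivative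
        on the kernel; its symmetry in \<open>v\<close> and \<open>w\<close> is the condition on
        mixed derivatives in \<open>integral_newton_smooth\<close>.\<close>
      define S where "S v w = conv (D n v) (dbar_der c w U) x" for v w
      have e: "Ad n v x $ b $ c = (S v (axis b 1) - \<i> * S v (axis b \<i>)) / 2" for v b
        unfolding Ad_def S_def vec_lambda_beta complex_hessian_dbar[OF open_UNIV U(1) UNIV_I]
        by (rule conv_linear[OF cD dbar_dirder(2)[OF U(1)] dbs(2) dbar_dirder(2)[OF U(1)] dbs(2)])
      have s: "S v w = S w v" for v w
        unfolding S_def D_def[abs_def]
        by (rule conv_swap_derivatives[OF \<eta>2 dbar_dirder(3)[OF U(1)] dbs(1) dbar_dirder(1,2)[OF U(1)] dbar_dirder(1,2)[OF U(1)]])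
      show ?thesis unfolding e using s[of "axis a 1" "axis b 1"] s[of "axis a \<i>" "axis b \<i>"] s[of "axis a 1" "axis b \<i>"] s[of "axis a \<i>" "axis b 1"]
        by (simp add: algebra_simps diff_divide_distrib add_divide_distrib)
    qed
  qed
  have "bounded (?A ` cball 0 R)"
    by (intro compact_imp_bounded compact_continuous_image continuous_on_subset[OF cA]) auto
  then obtain M0 where M0: "\<And>x. x \<in> cball 0 R \<Longrightarrow> norm (?A x) \<le> M0" unfolding bounded_iff by blast
  define M where "M = max M0 0"
  have M: "norm (?A x) \<le> M" for x using M0[of x] A0[of x] by (cases "norm x \<le> R") (auto simp: M_def)
  have Mb: "norm (An n x $ b $ c) \<le> M" for n x b c
  proof -
    have "norm (?A y $ b $ c) \<le> M" for y
      using M[of y] Finite_Cartesian_Product.norm_nth_le[of "?A y" b] Finite_Cartesian_Product.norm_nth_le[of "?A y $ b" c] by linarith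
    then show ?thesis
      using conv_close[OF \<eta> Ae, where c = 0 and d = M] by (simp add: An_def)
  qed
  have lim: "(\<lambda>n. An n x $ b $ c) \<longlonglongrightarrow> ?A x $ b $ c" for x b c
  proof (rule LIMSEQ_I)
    fix r :: real assume r: "r > 0"
    have "isCont (\<lambda>y. ?A y $ b $ c) x" using Ae(1) by (simp add: continuous_on_eq_continuous_at)
    then obtain d where d: "d > 0" "\<And>y. dist y x < d \<Longrightarrow> dist (?A y $ b $ c) (?A x $ b $ c) < r / 2"
      unfolding continuous_at_eps_delta using r by (meson half_gt_zero)
    obtain N where N: "1 / real (Suc N) < d" using d(1) nat_approx_posE by blast
    have "norm (An n x $ b $ c - ?A x $ b $ c) < r" if n: "n \<ge> N" for n
    proof -
      have "1 / real (Suc n) \<le> 1 / real (Suc N)" using n by (simp add: divide_simps)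
      then have sm: "1 / real (Suc n) < d" using N by linarith
      have "norm (conv (\<eta> n) (\<lambda>y. ?A y $ b $ c) x - ?A x $ b $ c) \<le> r / 2"
      proof (rule conv_close[OF \<eta> Ae])
        fix y :: "complex^'n" assume "norm (y - x) \<le> 1 / real (Suc n)"
        then have "dist y x < d" using sm by (simp add: dist_norm)
        from d(2)[OF this] show "norm (?A y $ b $ c - ?A x $ b $ c) \<le> r / 2" by (simp add: dist_norm)
      qed
      then show ?thesis using r by (simp add: An_def)
    qed
    then show "\<exists>no. \<forall>n\<ge>no. norm (An n x $ b $ c - ?A x $ b $ c) < r" by blast
  qed
  have limA: "(\<lambda>n. An n x) \<longlonglongrightarrow> ?A x" for x
    by (intro vec_tendstoI lim)
  have DF0: "DF x = 0" if "norm x > R" for x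
  proof -
    have e: "F y $ b = 0" if "norm y > R" for y b using F(2)[OF that] by simp
    show ?thesis
      using dirder_csupp[OF FX(1) e that] dirder_csupp[OF FY(1) e that] by (simp add: DF_def vec_eq_iff)
  qed
  have cDF: "continuous_on UNIV DF"
    unfolding DF_def by (intro continuous_on_vec_lambda continuous_intros FX FY) auto
  have tr0: "trace (X ** (0 :: complex^'n^'n)) = 0" for X by (simp add: trace_def matrix_matrix_mult_def)
  have cont2: "continuous_on UNIV (\<lambda>p. trace (newton_mat j (fst p) ** DF (snd p)))"
    by (intro continuous_on_trace continuous_on_matrix_mult continuous_on_newton_mat continuous_intros continuous_on_compose2[OF cDF]) auto
  \<comment> \<open>The norm is bounded by the sum of n^2 entries. All mollified Hessians thus stay
    in one compact ball, which yields an integrable majorant.\<close>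
  define K where "K = real CARD('n) * (real CARD('n) * M)"
  have Kb: "norm (An n x) \<le> K" for n x
  proof -
    have "norm (An n x) \<le> (\<Sum>b\<in>UNIV. norm (An n x $ b))" unfolding norm_vec_def by (rule L2_set_le_sum) simp
    also have "\<dots> \<le> (\<Sum>b\<in>(UNIV::'n set). real CARD('n) * M)"
    proof (rule sum_mono)
      fix b
      have "norm (An n x $ b) \<le> (\<Sum>c\<in>UNIV. norm (An n x $ b $ c))" unfolding norm_vec_def by (rule L2_set_le_sum) simp
      also have "\<dots> \<le> (\<Sum>c\<in>(UNIV::'n set). M)" by (intro sum_mono Mb)
      finally show "norm (An n x $ b) \<le> real CARD('n) * M" by simp
    qed
    finally show ?thesis by (simp add: K_def)
  qed
  have "bounded ((\<lambda>p. trace (newton_mat j (fst p) ** DF (snd p))) ` (cball 0 K \<times> cball 0 R))"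
    by (intro compact_imp_bounded compact_continuous_image continuous_on_subset[OF cont2] compact_Times) auto
  then obtain C where C: "\<And>B x. B \<in> cball 0 K \<Longrightarrow> x \<in> cball 0 R \<Longrightarrow> norm (trace (newton_mat j B ** DF x)) \<le> C"
    unfolding bounded_iff by fastforce
  define f where "f n x = trace (newton_mat j (An n x) ** DF x)" for n x
  define g where "g x = trace (newton_mat j (?A x) ** DF x)" for x
  have cg: "continuous_on UNIV g" unfolding g_def
    by (intro continuous_on_trace continuous_on_matrix_mult continuous_on_newton_mat cA cDF)
  have cf: "continuous_on UNIV (f n)" for n unfolding f_def An_def
    by (intro continuous_on_trace continuous_on_matrix_mult continuous_on_newton_mat cDF continuous_on_vec_lambda conv_dirder(2) \<eta>1 Ae)
  show "integrable lborel (\<lambda>x. trace (newton_mat j (?A x) ** DF x))"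
    using cg DF0 tr0 unfolding g_def by (intro integrable_csupp) (auto simp: csupp_def intro!: exI[of _ R])
  have "(\<lambda>n. integral\<^sup>L lborel (f n)) \<longlonglongrightarrow> integral\<^sup>L lborel g"
  proof (rule integral_dominated_convergence[where w = "\<lambda>x. C * indicator (cball 0 R) x"])
    show "g \<in> borel_measurable lborel" "f n \<in> borel_measurable lborel" for n
      using cg cf by (auto intro: borel_measurable_continuous_onI)
    have "emeasure lborel (cball (0 :: complex^'n) R) < \<infinity>" by (rule emeasure_bounded_finite) simp
    then show "integrable lborel (\<lambda>x::complex^'n. C * indicator (cball 0 R) x)"
      by (intro integrable_mult_right integrable_real_indicator) auto
    show "AE x in lborel. (\<lambda>n. f n x) \<longlonglongrightarrow> g x"
    proof (rule AE_I2)
      fix x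
      have "continuous_on UNIV (\<lambda>B. trace (newton_mat j B ** DF x))"
        by (intro continuous_on_trace continuous_on_matrix_mult continuous_on_newton_mat continuous_intros)
      then have "isCont (\<lambda>B. trace (newton_mat j B ** DF x)) (?A x)" by (simp add: continuous_on_eq_continuous_at)
      from isCont_tendsto_compose[OF this limA] show "(\<lambda>n. f n x) \<longlonglongrightarrow> g x" by (simp add: f_def g_def)
    qed
    show "AE x in lborel. norm (f n x) \<le> C * indicator (cball 0 R) x" for n
      using C[of "An n x" x for x] Kb DF0 tr0 by (intro AE_I2) (auto simp: f_def indicator_def dist_norm not_le)
  qed
  moreover have "integral\<^sup>L lborel (f n) = 0" for n using zero[of n] unfolding f_def[abs_def] .
  ultimately have "(\<lambda>n. 0) \<longlonglongrightarrow> integral\<^sup>L lborel g" by simp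
  then have "integral\<^sup>L lborel g = 0" using LIMSEQ_unique tendsto_const by blast
  then show "integral\<^sup>L lborel (\<lambda>x. trace (newton_mat j (?A x) ** DF x)) = 0" unfolding g_def[abs_def] .
qed

definition lin_op :: "nat \<Rightarrow> (complex^'n \<Rightarrow> real) \<Rightarrow> (complex^'n \<Rightarrow> real) \<Rightarrow> complex^'n \<Rightarrow> real" where
  "lin_op j u h x = Re (trace (newton_mat j (complex_hessian u x) ** complex_hessian h x))"

definition grad_form :: "nat \<Rightarrow> (complex^'n \<Rightarrow> real) \<Rightarrow> (complex^'n \<Rightarrow> real) \<Rightarrow> (complex^'n \<Rightarrow> real) \<Rightarrow> complex^'n \<Rightarrow> real" where
  "grad_form j u f h x = Re (trace (newton_mat j (complex_hessian u x) ** gout (complex_gradient f x) (complex_gradient h x)))"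

text \<open>The vector field has components \<open>f\<close> times \<open>dbar b\<close> of
  \<open>h\<close>; its derivative splits into \<open>f\<close> times the Hessian of
  \<open>h\<close> and the product of the two gradients. As \<open>f\<close> vanishes off
  \<open>K\<close>, compactly supported substitutes for \<open>u\<close> and \<open>h\<close> may be
  used.\<close>

lemma integration_by_parts:
  fixes \<Omega> :: "(complex^'n) set"
  assumes \<Omega>: "open \<Omega>" and K: "compact K" "K \<subseteq> \<Omega>"
    and u: "C_diff 2 \<Omega> u" and h: "C_diff 2 \<Omega> h" and f: "C_diff 1 \<Omega> f" "\<And>x. x \<in> \<Omega> - K \<Longrightarrow> f x = 0"
  shows "(LINT x:\<Omega>|lborel. f x * lin_op j u h x + grad_form j u f h x) = 0"
proof -
  obtain U W R1 where U: "C_diff 2 UNIV U" "open W" "K \<subseteq> W" "\<And>x. x \<in> W \<Longrightarrow> U x = u x" "W \<subseteq> \<Omega>"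
    "\<And>x. norm x > R1 \<Longrightarrow> U x = 0" using C2_cutoff[OF \<Omega> K u] by metis
  obtain V W' R2 where V: "C_diff 2 UNIV V" "open W'" "K \<subseteq> W'" "\<And>x. x \<in> W' \<Longrightarrow> V x = h x" "W' \<subseteq> \<Omega>"
    "\<And>x. norm x > R2 \<Longrightarrow> V x = 0" using C2_cutoff[OF \<Omega> K h] by metis
  obtain R3 where R3: "\<And>x. x \<in> K \<Longrightarrow> norm x \<le> R3" using compact_imp_bounded[OF K(1)] unfolding bounded_iff by blast
  define R where "R = Max {R1, R2, R3}"
  define g where "g x = (if x \<in> \<Omega> then f x else 0)" for x
  have g1: "C_diff 1 UNIV g" unfolding g_def by (rule C_diff_extend_by_zero[OF \<Omega> K f])
  have g0: "g x = 0" if "x \<notin> K" for x using that f(2) by (auto simp: g_def)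
  define D where "D v x = frechet_derivative g (at x) v" for v x
  have cD: "continuous_on UNIV (D v)" for v using C_diff_frechet[of 0 UNIV g v] g1 by (simp add: D_def[abs_def])
  have D0: "D v x = 0" if "x \<notin> K" for x v
    unfolding D_def
  proof -
    have "open (- K)" using K(1) by (simp add: compact_imp_closed open_Compl)
    then have "(g has_derivative (\<lambda>_. 0)) (at x)"
      by (rule has_derivative_transform_within_open[OF has_derivative_const[of 0]]) (use g0 that in auto)
    from fun_cong[OF frechet_derivative_at[OF this]] show "frechet_derivative g (at x) v = 0" by metis
  qed
  define F where "F x = (\<chi> b. complex_of_real (g x) * dbar b V x)" for x
  define Fd where "Fd v x = (\<chi> b. complex_of_real (g x) * dbar_der b v V x + complex_of_real (D v x) * dbar b V x)" for v x
  have cg: "continuous_on UNIV g" using g1 by (rule C_diff_continuous)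
  have dF: "dirder (\<lambda>x. F x $ b) v (\<lambda>x. Fd v x $ b)" for v b
    unfolding F_def Fd_def D_def vec_lambda_beta
    using g1 by (intro dirder_mult dirder_of_real C_diff_dirder dbar_dirder V) auto
  have cFd: "continuous_on UNIV (Fd v)" for v
    unfolding Fd_def by (intro continuous_on_vec_lambda continuous_intros cg cD dbar_dirder V)
  have cF: "continuous_on UNIV F"
    unfolding F_def by (intro continuous_on_vec_lambda continuous_intros cg dbar_dirder V)
  have F0: "F x = 0" if "norm x > R" for x
    using that R3[of x] g0[of x] by (force simp: F_def R_def vec_eq_iff)
  have U0: "U x = 0" if "norm x > R" for x using that U(6)[of x] by (auto simp: R_def)
  define DF where "DF x = (\<chi> a b. (Fd (axis a 1) x $ b - \<i> * Fd (axis a \<i>) x $ b) / 2)" for x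
  note main = integral_newton_hessian[OF U(1) U0 cF F0 dF cFd dF cFd, where j = j, folded DF_def]
  have eq: "Re (trace (newton_mat j (complex_hessian U x) ** DF x)) = indicator \<Omega> x *\<^sub>R (f x * lin_op j u h x + grad_form j u f h x)" for x
  proof (cases "x \<in> K")
    case True
    then have x: "x \<in> \<Omega>" "x \<in> W" "x \<in> W'" using K U V by auto
    have gd: "g differentiable (at x)" using C_diff_differentiable[of 0 UNIV g x] g1 by (auto intro: differentiableI)
    have fd: "frechet_derivative g (at x) = frechet_derivative f (at x)"
    proof -
      have "(f has_derivative frechet_derivative f (at x)) (at x)" using C_diff_differentiable[of 0 \<Omega> f x] f x by auto
      then have "(g has_derivative frechet_derivative f (at x)) (at x)"
        by (rule has_derivative_transform_within_open[OF _ \<Omega> x(1)]) (simp add: g_def)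
      from frechet_derivative_at[OF this] show ?thesis by (rule sym)
    qed
    have fdiff: "f differentiable (at x)" using C_diff_differentiable[of 0 \<Omega> f x] f x by (auto intro: differentiableI)
    have cg: "complex_gradient f x = complex_gradient g x"
      by (simp add: vec_eq_iff complex_gradient_eq[OF gd] complex_gradient_eq[OF fdiff] fd)
    have H: "complex_hessian U x = complex_hessian u x"
      by (rule complex_hessian_cong(1)[OF U(2) C_diff_subset[OF u U(5)] x(2)]) (simp add: U(4))
    have HV: "complex_hessian V x = complex_hessian h x" "complex_gradient V x = complex_gradient h x"
      by (rule complex_hessian_cong[OF V(2) C_diff_subset[OF h V(5)] x(3)], simp add: V(4))+
    have Vd: "V differentiable (at x)" using C_diff_differentiable[of 1 UNIV V x] V(1) by (auto simp: numeral_2_eq_2 intro: differentiableI)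
    have "DF x = smat (of_real (f x)) (complex_hessian V x) + gout (complex_gradient g x) (complex_gradient V x)"
      using x by (simp add: vec_eq_iff DF_def Fd_def smat_def gout_def complex_hessian_dbar[OF open_UNIV V(1)] complex_gradient_dbar[OF Vd]
        complex_gradient_eq[OF gd] D_def g_def[of x] field_simps)
    then have "trace (newton_mat j (complex_hessian U x) ** DF x) = of_real (f x) * trace (newton_mat j (complex_hessian u x) ** complex_hessian h x)
      + trace (newton_mat j (complex_hessian u x) ** gout (complex_gradient f x) (complex_gradient h x))"
      unfolding H HV cg by (simp add: matrix_add_ldistrib trace_add smat_simps)
    then show ?thesis using x by (simp add: lin_op_def grad_form_def)
  next
    case False
    have "DF x = 0" using g0[OF False] D0[OF False] by (simp add: vec_eq_iff DF_def Fd_def)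
    then have l: "Re (trace (newton_mat j (complex_hessian U x) ** DF x)) = 0" by (simp add: trace_def matrix_matrix_mult_def)
    show ?thesis
    proof (cases "x \<in> \<Omega>")
      case True
      have "open (\<Omega> - K)" using \<Omega> K by (simp add: compact_imp_closed open_Diff)
      then have d0: "(f has_derivative (\<lambda>_. 0)) (at x)"
        by (rule has_derivative_transform_within_open[OF has_derivative_const[of 0]]) (use True False f in auto)
      have "frechet_derivative f (at x) v = 0" for v using fun_cong[OF frechet_derivative_at[OF d0]] by metis
      then have "complex_gradient f x = 0" using complex_gradient_eq[OF differentiableI[OF d0]] by (simp add: vec_eq_iff)
      then have "grad_form j u f h x = 0" by (simp add: grad_form_def trace_def matrix_matrix_mult_def gout_def)
      then show ?thesis using l f(2)[of x] True False by simp
    qed (use l in simp)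
  qed
  have "(LINT x:\<Omega>|lborel. f x * lin_op j u h x + grad_form j u f h x) = integral\<^sup>L lborel (\<lambda>x. Re (trace (newton_mat j (complex_hessian U x) ** DF x)))"
    unfolding set_lebesgue_integral_def eq ..
  also have "\<dots> = Re (integral\<^sup>L lborel (\<lambda>x. trace (newton_mat j (complex_hessian U x) ** DF x)))"
    by (rule integral_Re[OF main(2)])
  finally show ?thesis using main(1) by simp
qed

subsection \<open>Calculus rules for complex gradients and Hessians\<close>

lemma frechet_cong_open:
  assumes "open U" "x \<in> U" "\<And>y. y \<in> U \<Longrightarrow> f y = g y"
  shows "frechet_derivative f (at x) = frechet_derivative g (at x)"
proof -
  have "(f has_derivative f') (at x) \<longleftrightarrow> (g has_derivative f') (at x)" for f'
  proof
    show "(f has_derivative f') (at x) \<Longrightarrow> (g has_derivative f') (at x)"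
      by (erule has_derivative_transform_within_open[OF _ assms(1,2)]) (rule assms(3))
    show "(g has_derivative f') (at x) \<Longrightarrow> (f has_derivative f') (at x)"
      by (erule has_derivative_transform_within_open[OF _ assms(1,2)]) (simp add: assms(3))
  qed
  then show ?thesis by (simp add: frechet_derivative_def)
qed

lemma frechet_add:
  assumes "f differentiable (at x)" "g differentiable (at x)"
  shows "frechet_derivative (\<lambda>x. f x + g x) (at x) v = frechet_derivative f (at x) v + frechet_derivative g (at x) v"
proof -
  have "((\<lambda>x. f x + g x) has_derivative (\<lambda>v. frechet_derivative f (at x) v + frechet_derivative g (at x) v)) (at x)"
    using assms by (intro has_derivative_add) (simp_all add: frechet_derivative_works)
  from fun_cong[OF frechet_derivative_at[OF this]] show ?thesis by (rule sym)
qed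

lemma frechet_mult:
  fixes f g :: "'a::real_normed_vector \<Rightarrow> real"
  assumes "f differentiable (at x)" "g differentiable (at x)"
  shows "frechet_derivative (\<lambda>x. f x * g x) (at x) v = f x * frechet_derivative g (at x) v + frechet_derivative f (at x) v * g x"
proof -
  have "((\<lambda>x. f x * g x) has_derivative (\<lambda>v. f x * frechet_derivative g (at x) v + frechet_derivative f (at x) v * g x)) (at x)"
    using assms by (intro has_derivative_mult) (simp_all add: frechet_derivative_works)
  from fun_cong[OF frechet_derivative_at[OF this]] show ?thesis by (rule sym)
qed

lemma frechet_compose:
  fixes f :: "'a::real_normed_vector \<Rightarrow> real"
  assumes "f differentiable (at x)" "(\<phi> has_real_derivative d) (at (f x))"
  shows "frechet_derivative (\<lambda>x. \<phi> (f x)) (at x) v = d * frechet_derivative f (at x) v"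
    and "(\<lambda>x. \<phi> (f x)) differentiable (at x)"
proof -
  have "(\<phi> has_derivative (*) d) (at (f x))" using assms(2) by (simp add: has_field_derivative_def)
  then have *: "((\<lambda>x. \<phi> (f x)) has_derivative (\<lambda>v. d * frechet_derivative f (at x) v)) (at x)"
    using has_derivative_compose[OF assms(1)[unfolded frechet_derivative_works]] by blast
  from fun_cong[OF frechet_derivative_at[OF *]]
  show "frechet_derivative (\<lambda>x. \<phi> (f x)) (at x) v = d * frechet_derivative f (at x) v" by (rule sym)
  show "(\<lambda>x. \<phi> (f x)) differentiable (at x)" using * by (rule differentiableI)
qed

lemma C_diff_diffble: "C_diff (Suc r) U f \<Longrightarrow> x \<in> U \<Longrightarrow> f differentiable (at x)"
  using C_diff_differentiable differentiableI by blast

lemma C2_diffble: "C_diff 2 U f \<Longrightarrow> x \<in> U \<Longrightarrow> f differentiable (at x)"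
  "C_diff 2 U f \<Longrightarrow> x \<in> U \<Longrightarrow> (\<lambda>y. frechet_derivative f (at y) v) differentiable (at x)"
  using C_diff_diffble[of 1 U f x] C_diff_diffble[of 0 U _ x] C2_frechet[of U f v] by (simp_all add: numeral_2_eq_2)

lemma complex_gradient_mult:
  assumes "f differentiable (at x)" "g differentiable (at x)"
  shows "complex_gradient (\<lambda>x. f x * g x) x = of_real (f x) *s complex_gradient g x + of_real (g x) *s complex_gradient f x"
  using assms differentiable_mult[OF assms]
  by (simp add: vec_eq_iff complex_gradient_eq frechet_mult algebra_simps add_divide_distrib diff_divide_distrib)

lemma complex_gradient_compose:
  assumes "f differentiable (at x)" "(\<phi> has_real_derivative d) (at (f x))"
  shows "complex_gradient (\<lambda>x. \<phi> (f x)) x = of_real d *s complex_gradient f x"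
  using assms frechet_compose[OF assms]
  by (simp add: vec_eq_iff complex_gradient_eq algebra_simps diff_divide_distrib)

lemma complex_hessian_add:
  assumes U: "open U" and f: "C_diff 2 U f" and g: "C_diff 2 U g" and x: "x \<in> U"
  shows "complex_hessian (\<lambda>x. f x + g x) x = complex_hessian f x + complex_hessian g x"
proof -
  have fg: "C_diff 2 U (\<lambda>x. f x + g x)" by (rule C_diff_add[OF U f g])
  have "frechet_derivative (\<lambda>y. frechet_derivative (\<lambda>x. f x + g x) (at y) w) (at x) v
    = frechet_derivative (\<lambda>y. frechet_derivative f (at y) w) (at x) v + frechet_derivative (\<lambda>y. frechet_derivative g (at y) w) (at x) v" for v w
  proof -
    have "frechet_derivative (\<lambda>y. frechet_derivative (\<lambda>x. f x + g x) (at y) w) (at x) 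
      = frechet_derivative (\<lambda>y. frechet_derivative f (at y) w + frechet_derivative g (at y) w) (at x)"
      by (rule frechet_cong_open[OF U x], rule frechet_add[OF C2_diffble(1)[OF f] C2_diffble(1)[OF g]])
    then show ?thesis by (simp add: frechet_add C2_diffble[OF f x] C2_diffble[OF g x])
  qed
  then show ?thesis
    by (simp add: vec_eq_iff complex_hessian_eq[OF U fg x] complex_hessian_eq[OF U f x] complex_hessian_eq[OF U g x] complex_eq_iff add_divide_distrib[symmetric] diff_divide_distrib[symmetric])
qed

lemma complex_hessian_compose:
  fixes \<phi> \<phi>1 \<phi>2 :: "real \<Rightarrow> real"
  assumes U: "open U" and f: "C_diff 2 U f" and x: "x \<in> U"
    and \<phi>: "\<And>t. (\<phi> has_real_derivative \<phi>1 t) (at t)" "\<And>t. (\<phi>1 has_real_derivative \<phi>2 t) (at t)" "continuous_on UNIV \<phi>2"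
  shows "complex_hessian (\<lambda>x. \<phi> (f x)) x = smat (of_real (\<phi>1 (f x))) (complex_hessian f x)
      + smat (of_real (\<phi>2 (f x))) (gout (complex_gradient f x) (complex_gradient f x))"
    and "C_diff 2 U (\<lambda>x. \<phi> (f x))"
proof -
  define p where "p i = (if i = 0 then \<phi> else if i = 1 then \<phi>1 else \<phi>2)" for i :: nat
  have "(p i has_real_derivative p (Suc i) t) (at t)" if "i < 2" for i t
    using that \<phi>(1,2)[of t] by (cases "i = 0") (auto simp: p_def)
  moreover have "continuous_on UNIV (p 2)" using \<phi>(3) by (simp add: p_def)
  ultimately have "C_diff 2 U (\<lambda>x. p 0 (f x))" by (rule C_diff_compose[OF U _ _ f])
  then show c: "C_diff 2 U (\<lambda>x. \<phi> (f x))" by (simp add: p_def)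
  have *: "frechet_derivative (\<lambda>y. frechet_derivative (\<lambda>x. \<phi> (f x)) (at y) w) (at x) v
    = \<phi>1 (f x) * frechet_derivative (\<lambda>y. frechet_derivative f (at y) w) (at x) v + \<phi>2 (f x) * (frechet_derivative f (at x) v * frechet_derivative f (at x) w)" for v w
  proof -
    have "frechet_derivative (\<lambda>y. frechet_derivative (\<lambda>x. \<phi> (f x)) (at y) w) (at x) 
      = frechet_derivative (\<lambda>y. \<phi>1 (f y) * frechet_derivative f (at y) w) (at x)"
      by (rule frechet_cong_open[OF U x], rule frechet_compose(1)[OF C2_diffble(1)[OF f] \<phi>(1)])
    then show ?thesis
      using frechet_compose[OF C2_diffble(1)[OF f x] \<phi>(2)]
      by (simp add: frechet_mult C2_diffble[OF f x])
  qed
  have aux: "Complex ((p * h1 + q * (a * c)) + (p * h2 + q * (b * d))) ((p * h3 + q * (a * d)) - (p * h4 + q * (b * c))) / 4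
    = of_real p * (Complex (h1 + h2) (h3 - h4) / 4)
      + of_real q * (((of_real a - \<i> * of_real b) / 2) * cnj ((of_real c - \<i> * of_real d) / 2))"
    for p q h1 h2 h3 h4 a b c d :: real
    by (rule complex_eqI) (simp_all add: field_simps)
  show "complex_hessian (\<lambda>x. \<phi> (f x)) x = smat (of_real (\<phi>1 (f x))) (complex_hessian f x)
      + smat (of_real (\<phi>2 (f x))) (gout (complex_gradient f x) (complex_gradient f x))"
    unfolding vec_eq_iff
    by (simp only: complex_hessian_eq[OF U c x] * smat_def gout_def complex_hessian_eq[OF U f x]
        complex_gradient_eq[OF C2_diffble(1)[OF f x]] aux vec_lambda_beta vector_add_component) simp
qed

lemma complex_hessian_scale:
  assumes "open U" "C_diff 2 U f" "x \<in> U"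
  shows "complex_hessian (\<lambda>x. c * f x) x = smat (of_real c) (complex_hessian f x)"
proof -
  have "complex_hessian (\<lambda>x. (*) c (f x)) x = smat (of_real c) (complex_hessian f x)
      + smat (of_real 0) (gout (complex_gradient f x) (complex_gradient f x))"
    by (rule complex_hessian_compose(1)[OF assms, of "(*) c" "\<lambda>_. c" "\<lambda>_. 0"]) (auto intro!: derivative_eq_intros)
  then show ?thesis by (simp add: smat_simps)
qed

lemma norm_square_hessian:
  "C_diff 2 U (\<lambda>z :: complex^'n. z \<bullet> z - r)" "complex_hessian (\<lambda>z :: complex^'n. z \<bullet> z - r) x = mat 1"
proof -
  have "C_diff 2 UNIV (\<lambda>z :: complex^'n. (z - 0) \<bullet> (z - 0) - r)" by (intro C_diff_diff C_diff_inner C_diff_const) auto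
  then have c: "C_diff 2 UNIV (\<lambda>z :: complex^'n. z \<bullet> z - r)" by simp
  then show "C_diff 2 U (\<lambda>z :: complex^'n. z \<bullet> z - r)" by (rule C_diff_subset) simp
  have 1: "frechet_derivative (\<lambda>z. z \<bullet> z - r) (at y) w = 2 * (y \<bullet> w)" for y w :: "complex^'n"
  proof -
    have "((\<lambda>z. z \<bullet> z - r) has_derivative (\<lambda>w. 2 * (y \<bullet> w))) (at y)"
      by (auto intro!: derivative_eq_intros simp: inner_commute)
    from fun_cong[OF frechet_derivative_at[OF this]] show ?thesis by (rule sym)
  qed
  have "((\<lambda>y. 2 * (y \<bullet> w)) has_derivative (\<lambda>v. 2 * (v \<bullet> w))) (at x)" for w :: "complex^'n"
    by (auto intro!: derivative_eq_intros)
  then have 2: "frechet_derivative (\<lambda>y. 2 * (y \<bullet> w)) (at x) v = 2 * (v \<bullet> w)" for v w :: "complex^'n"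
    using fun_cong[OF frechet_derivative_at] by metis
  have ax: "axis i a \<bullet> axis j b = (if i = j then a \<bullet> b else 0)" for i j :: 'n and a b :: complex
    by (simp add: inner_axis_axis)
  show "complex_hessian (\<lambda>z :: complex^'n. z \<bullet> z - r) x = mat 1"
    unfolding vec_eq_iff complex_hessian_eq[OF open_UNIV c UNIV_I] 1 2 ax
    by (simp add: mat_def inner_complex_def complex_eq_iff)
qed

subsection \<open>Truncations\<close>

text \<open>
  \<open>trunc e\<close> is a convex function that vanishes on \<open>t \<le> e\<close> and tends to the positive part of \<open>t\<close>;
  the zero divisions are harmless because the numerators vanish there.
\<close>

definition trunc :: "real \<Rightarrow> real \<Rightarrow> real" where "trunc e t = ppos 3 (t - e) / t\<^sup>2"
definition trunc1 :: "real \<Rightarrow> real \<Rightarrow> real" where "trunc1 e t = ppos 2 (t - e) * (t + 2 * e) / t ^ 3"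
definition trunc2 :: "real \<Rightarrow> real \<Rightarrow> real" where "trunc2 e t = 6 * e\<^sup>2 * ppos 1 (t - e) / t ^ 4"

lemma trunc_zero: "t \<le> e \<Longrightarrow> trunc e t = 0" "t \<le> e \<Longrightarrow> trunc1 e t = 0" "t \<le> e \<Longrightarrow> trunc2 e t = 0"
  by (auto simp: trunc_def trunc1_def trunc2_def ppos_def)

lemma trunc_deriv:
  assumes "e > 0"
  shows "(trunc e has_real_derivative trunc1 e t) (at t)" "(trunc1 e has_real_derivative trunc2 e t) (at t)"
proof -
  consider "t > e" | "t < e" | "t = e" by linarith
  then have "(trunc e has_real_derivative trunc1 e t) (at t) \<and> (trunc1 e has_real_derivative trunc2 e t) (at t)"
  proof cases
    case 2
    have "(trunc e has_real_derivative 0) (at t)" "(trunc1 e has_real_derivative 0) (at t)"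
      by (rule has_field_derivative_transform_within_open[of "\<lambda>_. 0" _ _ "{..<e}"]; use 2 trunc_zero in auto)+
    then show ?thesis using 2 by (simp add: trunc_zero)
  next
    case 1
    have t: "t \<noteq> 0" using 1 assms by auto
    have a: "((\<lambda>t. (t - e) ^ 3 / t\<^sup>2) has_real_derivative (3 * (t - e)\<^sup>2 * t\<^sup>2 - (t - e) ^ 3 * (2 * t)) / (t\<^sup>2 * t\<^sup>2)) (at t)"
      using t by (auto intro!: derivative_eq_intros)
    have "3 * (t - e)\<^sup>2 * t\<^sup>2 - (t - e) ^ 3 * (2 * t) = ((t - e)\<^sup>2 * (t + 2 * e)) * t"
      by (simp add: power2_eq_square power3_eq_cube algebra_simps)
    then have a': "(3 * (t - e)\<^sup>2 * t\<^sup>2 - (t - e) ^ 3 * (2 * t)) / (t\<^sup>2 * t\<^sup>2) = (t - e)\<^sup>2 * (t + 2 * e) / t ^ 3"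
      using t by (simp add: power2_eq_square power3_eq_cube)
    have b: "((\<lambda>t. (t - e)\<^sup>2 * (t + 2 * e) / t ^ 3) has_real_derivative
       ((2 * (t - e) * (t + 2 * e) + (t - e)\<^sup>2) * t ^ 3 - (t - e)\<^sup>2 * (t + 2 * e) * (3 * t\<^sup>2)) / (t ^ 3 * t ^ 3)) (at t)"
      using t by (auto intro!: derivative_eq_intros)
    have "(2 * (t - e) * (t + 2 * e) + (t - e)\<^sup>2) * t ^ 3 - (t - e)\<^sup>2 * (t + 2 * e) * (3 * t\<^sup>2) = (6 * e\<^sup>2 * (t - e)) * t\<^sup>2"
      by (simp add: power2_eq_square power3_eq_cube algebra_simps)
    moreover have "t ^ 3 * t ^ 3 = t ^ 4 * t\<^sup>2" by (simp add: power_add[symmetric])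
    moreover have "x * t\<^sup>2 / (t ^ 4 * t\<^sup>2) = x / t ^ 4" for x
      by (rule nonzero_mult_divide_mult_cancel_right) (use t in simp)
    ultimately have b': "((2 * (t - e) * (t + 2 * e) + (t - e)\<^sup>2) * t ^ 3 - (t - e)\<^sup>2 * (t + 2 * e) * (3 * t\<^sup>2)) / (t ^ 3 * t ^ 3) = 6 * e\<^sup>2 * (t - e) / t ^ 4"
      by (simp only:)
    have "(trunc e has_real_derivative (t - e)\<^sup>2 * (t + 2 * e) / t ^ 3) (at t)"
      by (rule has_field_derivative_transform_within_open[OF a[unfolded a'], of "{e<..}"]) (use 1 in \<open>auto simp: trunc_def ppos_def\<close>)
    moreover have "(trunc1 e has_real_derivative 6 * e\<^sup>2 * (t - e) / t ^ 4) (at t)"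
      by (rule has_field_derivative_transform_within_open[OF b[unfolded b'], of "{e<..}"]) (use 1 in \<open>auto simp: trunc1_def ppos_def\<close>)
    ultimately show ?thesis using 1 by (simp add: trunc1_def trunc2_def ppos_def)
  next
    case 3
    have t: "t \<noteq> 0" using 3 assms by auto
    have p: "((\<lambda>t. ppos k (t - e)) has_real_derivative 0) (at t)" if "k \<ge> 2" for k
    proof -
      have "((\<lambda>x. ppos k (x - e)) has_real_derivative (real k * ppos (k - 1) (t - e)) * 1) (at t)"
        by (rule DERIV_chain2[OF ppos_deriv[OF that]]) (auto intro!: derivative_eq_intros)
      then show ?thesis using 3 that by (simp add: ppos_def zero_power)
    qed
    have "((\<lambda>t. ppos 3 (t - e) / t\<^sup>2) has_real_derivative (0 * t\<^sup>2 - ppos 3 (t - e) * (2 * t)) / (t\<^sup>2 * t\<^sup>2)) (at t)"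
      using t by (intro DERIV_divide p) (auto intro!: derivative_eq_intros)
    moreover have "((\<lambda>t. ppos 2 (t - e) * (t + 2 * e) / t ^ 3) has_real_derivative ((0 * (t + 2 * e) + 1 * ppos 2 (t - e)) * t ^ 3 - ppos 2 (t - e) * (t + 2 * e) * (3 * t\<^sup>2)) / (t ^ 3 * t ^ 3)) (at t)"
      using t by (intro DERIV_divide DERIV_mult p) (auto intro!: derivative_eq_intros)
    ultimately show ?thesis using 3 by (simp add: trunc_def[abs_def] trunc1_def[abs_def] trunc2_def ppos_def)
  qed
  then show "(trunc e has_real_derivative trunc1 e t) (at t)" "(trunc1 e has_real_derivative trunc2 e t) (at t)" by auto
qed

text \<open>Convexity gives the error term in the energy identities a sign, slope at most 1 allows
  passing from the truncated to the full integrand, and domination by \<open>t\<close> gives the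
  majorant for the limit.\<close>

lemma trunc_bounds:
  assumes "e > 0"
  shows "0 \<le> trunc e t" "t \<ge> 0 \<Longrightarrow> trunc e t \<le> t" "0 \<le> trunc1 e t" "trunc1 e t \<le> 1" "0 \<le> trunc2 e t"
proof -
  show "0 \<le> trunc e t" by (simp add: trunc_def ppos_def)
  show "0 \<le> trunc1 e t" "0 \<le> trunc2 e t"
    using assms by (cases "t \<le> e"; simp add: trunc_zero trunc1_def trunc2_def ppos_def)+
  show "trunc e t \<le> t" if "t \<ge> 0"
  proof (cases "t \<le> e")
    case False
    then have "(t - e) ^ 3 \<le> t ^ 3" using assms by (intro power_mono) auto
    then show ?thesis using False assms by (simp add: trunc_def ppos_def divide_le_eq power2_eq_square power3_eq_cube)
  qed (simp add: trunc_zero that)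
  show "trunc1 e t \<le> 1"
  proof (cases "t \<le> e")
    case False
    have "t ^ 3 - (t - e)\<^sup>2 * (t + 2 * e) = e\<^sup>2 * (3 * t - 2 * e)" by (simp add: power2_eq_square power3_eq_cube algebra_simps)
    moreover have "e\<^sup>2 * (3 * t - 2 * e) \<ge> 0" using False assms by simp
    ultimately have "(t - e)\<^sup>2 * (t + 2 * e) \<le> t ^ 3" by linarith
    then show ?thesis using False assms by (simp add: trunc1_def ppos_def divide_le_eq)
  qed (simp add: trunc_zero)
qed

lemma trunc2_continuous:
  assumes "e > 0" shows "continuous_on UNIV (trunc2 e)"
proof -
  have "continuous_on {0<..} (trunc2 e)" unfolding trunc2_def ppos_def by (intro continuous_intros) auto
  moreover have "continuous_on {..<e} (trunc2 e)"
    by (rule continuous_on_eq[OF continuous_on_const[of _ 0]]) (simp add: trunc_zero)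
  ultimately have "continuous_on ({0<..} \<union> {..<e}) (trunc2 e)" by (intro continuous_on_open_Un) auto
  moreover have "{0<..} \<union> {..<e} = UNIV" using assms by auto
  ultimately show ?thesis by simp
qed

lemma trunc_tendsto: "(\<lambda>n. trunc (1 / real (Suc n)) t) \<longlonglongrightarrow> max t 0"
proof (cases "t \<le> 0")
  case True
  then have "trunc (1 / real (Suc n)) t = 0" for n by (intro trunc_zero) (simp add: order_trans[of t 0])
  then show ?thesis using True by simp
next
  case False
  have "(\<lambda>n. ppos 3 (t - 1 / real (Suc n)) / t\<^sup>2) \<longlonglongrightarrow> max 0 (t - 0) ^ 3 / t\<^sup>2"
    unfolding ppos_def using False by (intro tendsto_intros LIMSEQ_Suc[OF lim_1_over_n]) auto
  then show ?thesis using False by (simp add: trunc_def power2_eq_square power3_eq_cube)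
qed

subsection \<open>Symmetry of the Hessian quadratic forms\<close>

lemma hermitian_newton_mat:
  fixes A :: "complex^'n^'n"
  assumes "hermitian A" shows "hermitian (newton_mat j A)"
proof -
  obtain U :: "complex^'n^'n" and d where U:
    "newton_mat j A = U ** diag_mat (\<lambda>i. complex_of_real (esym j (UNIV - {i}) d)) ** ctranspose U"
    using hermitian_newton_diag[OF assms] by metis
  have "newton_mat j A $ a $ b = (\<Sum>k\<in>UNIV. U $ a $ k * complex_of_real (esym j (UNIV - {k}) d) * cnj (U $ b $ k))" for a b
    by (simp add: U matrix_matrix_mult_def diag_mat_def ctranspose_def if_distrib[of "\<lambda>x. _ * x"] cong: if_cong)
  then show ?thesis by (intro hermitianI) (simp add: mult_ac)
qed

text \<open>The Newton matrix of a Hermitian matrix is Hermitian, so exchanging the gradients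
  conjugates the trace and keeps its real part.\<close>

lemma grad_form_commute:
  assumes "hermitian (complex_hessian u x)"
  shows "grad_form j u f h x = grad_form j u h f x"
proof -
  let ?T = "newton_mat j (complex_hessian u x)"
  have "cnj (trace (?T ** gout g k)) = trace (?T ** gout k g)" for g k
    unfolding trace_gout cnj_sum complex_cnj_mult complex_cnj_cnj hermitianD[OF hermitian_newton_mat[OF assms]]
    by (subst sum.swap) (simp add: mult_ac)
  then show ?thesis unfolding grad_form_def by (metis complex_cnj(1) cnj.sel(1))
qed

lemma grad_form_nonneg:
  fixes u :: "complex^'n \<Rightarrow> real"
  assumes "complex_hessian u x \<in> herm_Gamma k" "j < k" "k \<le> CARD('n)"
  shows "grad_form j u f f x \<ge> 0"
  unfolding grad_form_def using garding[OF assms(1) psd_herm_Gamma[OF psd_gout] assms(2,3)] .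

lemma gout_smult:
  "gout (of_real c *s g) h = smat (of_real c) (gout g h)" "gout g (of_real c *s h) = smat (of_real c) (gout g h)"
  "gout (g + g') h = gout g h + gout g' h"
  by (simp_all add: gout_def smat_def vec_eq_iff algebra_simps)

subsection \<open>Integrability\<close>

lemma bounded_continuous_set_integrable:
  fixes f :: "'a::euclidean_space \<Rightarrow> real"
  assumes \<Omega>: "open \<Omega>" "bounded \<Omega>" and f: "continuous_on \<Omega> f" "\<And>x. x \<in> \<Omega> \<Longrightarrow> \<bar>f x\<bar> \<le> B"
  shows "set_integrable lborel \<Omega> f"
  unfolding set_integrable_def
proof (rule Bochner_Integration.integrable_bound)
  show "integrable lborel (\<lambda>x. B * indicator \<Omega> x)"
    using emeasure_bounded_finite[OF \<Omega>(2)] \<Omega>(1)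
    by (intro integrable_mult_right integrable_real_indicator) auto
  show "(\<lambda>x. indicator \<Omega> x *\<^sub>R f x) \<in> borel_measurable lborel"
    using borel_measurable_continuous_on_indicator[OF _ f(1)] \<Omega>(1) by auto
  show "AE x in lborel. norm (indicator \<Omega> x *\<^sub>R f x) \<le> norm (B * indicator \<Omega> x)"
    using order_trans[OF f(2) abs_ge_self] by (intro AE_I2) (auto simp: indicator_def)
qed

definition bounded_on :: "'a set \<Rightarrow> ('a \<Rightarrow> real) \<Rightarrow> bool" where
  "bounded_on \<Omega> f \<longleftrightarrow> (\<exists>B. \<forall>x\<in>\<Omega>. \<bar>f x\<bar> \<le> B)"

lemma bounded_on_mult: "bounded_on \<Omega> f \<Longrightarrow> bounded_on \<Omega> g \<Longrightarrow> bounded_on \<Omega> (\<lambda>x. f x * g x)"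
proof -
  assume "bounded_on \<Omega> f" "bounded_on \<Omega> g"
  then obtain B C where "\<And>x. x \<in> \<Omega> \<Longrightarrow> \<bar>f x\<bar> \<le> B" "\<And>x. x \<in> \<Omega> \<Longrightarrow> \<bar>g x\<bar> \<le> C" unfolding bounded_on_def by blast
  then have "\<bar>f x * g x\<bar> \<le> B * C" if "x \<in> \<Omega>" for x
    unfolding abs_mult using that by (intro mult_mono) (auto intro: order_trans[OF abs_ge_zero])
  then show ?thesis unfolding bounded_on_def by blast
qed

text \<open>Continuity and zero boundary values make superlevel sets compact, and the Hessian bound
  makes the energy integrands bounded. Nothing is recorded about gradients at the boundary, which
  truncated test functions never reach.\<close>

definition adm :: "(complex^'n) set \<Rightarrow> (complex^'n \<Rightarrow> real) \<Rightarrow> bool" where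
  "adm \<Omega> w \<longleftrightarrow> C_diff 2 \<Omega> w \<and> continuous_on (closure \<Omega>) w \<and> (\<forall>z\<in>frontier \<Omega>. w z = 0) \<and>
     (\<exists>M. \<forall>z\<in>\<Omega>. norm (complex_hessian w z) \<le> M)"

text \<open>The energy estimates live on a bounded open set; the geometry of the boundary enters
  only later, through the existence of the comparison function.\<close>

locale hess_domain =
  fixes \<Omega> :: "(complex^'n) set" and k :: nat
  assumes open_dom: "open \<Omega>" and bounded_dom: "bounded \<Omega>" and k_le: "k \<le> CARD('n)"
begin

lemma adm_C2: "adm \<Omega> w \<Longrightarrow> C_diff 2 \<Omega> w"
  by (simp add: adm_def)

lemma adm_bounded: "adm \<Omega> w \<Longrightarrow> bounded_on \<Omega> w"
proof -
  assume w: "adm \<Omega> w"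
  have "compact (w ` closure \<Omega>)"
    using w bounded_dom by (intro compact_continuous_image) (auto simp: adm_def compact_closure)
  then have "bounded (w ` closure \<Omega>)" by (rule compact_imp_bounded)
  then show ?thesis using closure_subset[of \<Omega>] unfolding bounded_on_def bounded_iff by (metis imageI real_norm_def subsetD)
qed

lemma adm_combination:
  assumes "adm \<Omega> f" "adm \<Omega> g" shows "adm \<Omega> (\<lambda>x. f x + c * g x)"
proof -
  have cg: "C_diff 2 \<Omega> (\<lambda>x. c * g x)" using assms by (intro C_diff_mult C_diff_const open_dom) (auto simp: adm_def)
  obtain M N where "\<And>z. z \<in> \<Omega> \<Longrightarrow> norm (complex_hessian f z) \<le> M" "\<And>z. z \<in> \<Omega> \<Longrightarrow> norm (complex_hessian g z) \<le> N"
    using assms unfolding adm_def by blast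
  then have "norm (complex_hessian (\<lambda>x. f x + c * g x) z) \<le> M + \<bar>c\<bar> * N" if "z \<in> \<Omega>" for z
    unfolding complex_hessian_add[OF open_dom adm_C2[OF assms(1)] cg that] complex_hessian_scale[OF open_dom adm_C2[OF assms(2)] that]
    using that by (intro order_trans[OF norm_triangle_ineq]) (auto simp: norm_smat intro!: add_mono mult_left_mono)
  then show ?thesis
    unfolding adm_def using assms cg
    by (auto simp: adm_def intro!: C_diff_add open_dom continuous_intros)
qed

lemma adm_uminus: "adm \<Omega> w \<Longrightarrow> adm \<Omega> (\<lambda>x. - w x)"
proof -
  assume w: "adm \<Omega> w"
  have "adm \<Omega> (\<lambda>x. w x + (- 2) * w x)" by (rule adm_combination[OF w w])
  then show ?thesis by simp
qed

lemma adm_superlevel_compact: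
  assumes w: "adm \<Omega> w" and e: "e > 0"
  shows "compact {z \<in> closure \<Omega>. w z \<ge> e}" "{z \<in> closure \<Omega>. w z \<ge> e} \<subseteq> \<Omega>"
proof -
  have "{z \<in> closure \<Omega>. w z \<ge> e} = closure \<Omega> \<inter> w -` {e..}" by auto
  moreover have "closed (closure \<Omega> \<inter> w -` {e..})"
    using w by (intro continuous_closed_preimage) (auto simp: adm_def)
  ultimately show "compact {z \<in> closure \<Omega>. w z \<ge> e}"
    using bounded_dom by (auto simp: compact_eq_bounded_closed intro: bounded_subset[OF bounded_closure])
  show "{z \<in> closure \<Omega>. w z \<ge> e} \<subseteq> \<Omega>"
  proof
    fix z assume z: "z \<in> {z \<in> closure \<Omega>. w z \<ge> e}"
    then have "z \<notin> frontier \<Omega>" using w e by (auto simp: adm_def)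
    then show "z \<in> \<Omega>" using z open_dom by (simp add: frontier_def interior_open)
  qed
qed

lemma lin_op_continuous:
  assumes "C_diff 2 \<Omega> u" "C_diff 2 \<Omega> h"
  shows "continuous_on \<Omega> (lin_op j u h)"
  unfolding lin_op_def[abs_def]
  by (intro continuous_on_Re continuous_on_trace continuous_on_matrix_mult continuous_on_newton_mat continuous_on_complex_hessian open_dom assms)

lemma lin_op_bounded:
  assumes u: "adm \<Omega> u" and h: "adm \<Omega> h"
  shows "bounded_on \<Omega> (lin_op j u h)"
proof -
  obtain M N where MN: "\<And>z. z \<in> \<Omega> \<Longrightarrow> norm (complex_hessian u z) \<le> M" "\<And>z. z \<in> \<Omega> \<Longrightarrow> norm (complex_hessian h z) \<le> N"
    using u h unfolding adm_def by blast
  have "continuous_on UNIV (\<lambda>p. Re (trace (newton_mat j (fst p) ** (snd p :: complex^'n^'n))))"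
    by (intro continuous_on_Re continuous_on_trace continuous_on_matrix_mult continuous_on_newton_mat continuous_intros)
  then have "bounded ((\<lambda>p. Re (trace (newton_mat j (fst p) ** (snd p :: complex^'n^'n)))) ` (cball 0 M \<times> cball 0 N))"
    by (intro compact_imp_bounded compact_continuous_image compact_Times) (auto intro: continuous_on_subset)
  then obtain B where B: "\<And>A C. A \<in> cball 0 M \<Longrightarrow> C \<in> cball 0 N \<Longrightarrow> \<bar>Re (trace (newton_mat j A ** (C :: complex^'n^'n)))\<bar> \<le> B"
    unfolding bounded_iff by fastforce
  show ?thesis
    unfolding bounded_on_def lin_op_def using B MN by (intro exI[of _ B]) auto
qed

lemma lin_op_integrable:
  assumes u: "adm \<Omega> u" and w: "adm \<Omega> w" and hh: "adm \<Omega> h"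
  shows "set_integrable lborel \<Omega> (\<lambda>z. w z * lin_op j u h z)"
proof -
  obtain B where "\<And>x. x \<in> \<Omega> \<Longrightarrow> \<bar>w x * lin_op j u h x\<bar> \<le> B"
    using bounded_on_mult[OF adm_bounded[OF w] lin_op_bounded[OF u hh]] unfolding bounded_on_def by blast
  then show ?thesis
    by (intro bounded_continuous_set_integrable open_dom bounded_dom continuous_intros lin_op_continuous adm_C2 u hh
        C_diff_continuous[OF adm_C2[OF w]]) auto
qed

lemma lin_op_combination:
  assumes "C_diff 2 \<Omega> f" "C_diff 2 \<Omega> g" "x \<in> \<Omega>"
  shows "lin_op j u (\<lambda>x. f x + c * g x) x = lin_op j u f x + c * lin_op j u g x"
proof -
  have "complex_hessian (\<lambda>x. f x + c * g x) x = complex_hessian f x + smat (of_real c) (complex_hessian g x)"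
    using assms by (simp add: complex_hessian_add[OF open_dom] complex_hessian_scale[OF open_dom] C_diff_mult[OF open_dom C_diff_const])
  then show ?thesis by (simp add: lin_op_def matrix_add_ldistrib trace_add smat_simps)
qed

lemma lin_op_uminus:
  assumes "C_diff 2 \<Omega> g" "x \<in> \<Omega>"
  shows "lin_op j u (\<lambda>x. - g x) x = - lin_op j u g x"
  using lin_op_combination[OF assms(1) assms(1,2), of j u "-2"] by simp

subsection \<open>Energy identities\<close>

text \<open>The first identity tests with \<open>trunc e (w x)\<close>, the second with
  \<open>h\<close> times \<open>trunc1 e (w x)\<close>. Both are supported in a compact superlevel
  set of \<open>w\<close>, so no boundary term arises.\<close>

lemma truncation_parts:
  assumes u: "C_diff 2 \<Omega> u" and w: "adm \<Omega> w" and h: "C_diff 2 \<Omega> h" and e: "e > 0"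
  shows "(LINT x:\<Omega>|lborel. trunc e (w x) * lin_op j u h x + trunc1 e (w x) * grad_form j u w h x) = 0"
    "(LINT x:\<Omega>|lborel. (h x * trunc1 e (w x)) * lin_op j u w x + (h x * trunc2 e (w x) * grad_form j u w w x + trunc1 e (w x) * grad_form j u h w x)) = 0"
    "set_integrable lborel \<Omega> (\<lambda>x. trunc e (w x) * lin_op j u h x)"
    "set_integrable lborel \<Omega> (\<lambda>x. trunc1 e (w x) * grad_form j u w h x)"
    "set_integrable lborel \<Omega> (\<lambda>x. (h x * trunc1 e (w x)) * lin_op j u w x)"
    "set_integrable lborel \<Omega> (\<lambda>x. h x * trunc2 e (w x) * grad_form j u w w x)"
    "set_integrable lborel \<Omega> (\<lambda>x. trunc1 e (w x) * grad_form j u h w x)"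
proof -
  let ?K = "{z \<in> closure \<Omega>. w z \<ge> e}"
  note K = adm_superlevel_compact[OF w e]
  have w2: "C_diff 2 \<Omega> w" by (rule adm_C2[OF w])
  have off: "w x \<le> e" if "x \<in> \<Omega> - ?K" for x using that closure_subset[of \<Omega>] by force
  have w1: "C_diff 1 \<Omega> w" using w2 C_diff_le[of 1 2] by simp
  have h1: "C_diff 1 \<Omega> h" using h C_diff_le[of 1 2] by simp
  have f1: "C_diff 1 \<Omega> (\<lambda>x. trunc e (w x))"
  proof -
    define p where "p i = (if i = 0 then trunc e else trunc1 e)" for i :: nat
    have "(p i has_real_derivative p (Suc i) t) (at t)" if "i < 1" for i t using that trunc_deriv[OF e] by (simp add: p_def)
    moreover have "continuous_on UNIV (p 1)" using trunc_deriv(2)[OF e] by (auto simp: p_def intro: DERIV_continuous_on)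
    ultimately have "C_diff 1 \<Omega> (\<lambda>x. p 0 (w x))" by (rule C_diff_compose[OF open_dom _ _ w1])
    then show ?thesis by (simp add: p_def)
  qed
  have f2: "C_diff 1 \<Omega> (\<lambda>x. trunc1 e (w x))"
  proof -
    define p where "p i = (if i = 0 then trunc1 e else trunc2 e)" for i :: nat
    have "(p i has_real_derivative p (Suc i) t) (at t)" if "i < 1" for i t using that trunc_deriv[OF e] by (simp add: p_def)
    moreover have "continuous_on UNIV (p 1)" using trunc2_continuous[OF e] by (simp add: p_def)
    ultimately have "C_diff 1 \<Omega> (\<lambda>x. p 0 (w x))" by (rule C_diff_compose[OF open_dom _ _ w1])
    then show ?thesis by (simp add: p_def)
  qed
  have wd: "w differentiable (at x)" "h differentiable (at x)" if "x \<in> \<Omega>" for x using C2_diffble w2 h that by auto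
  have g1: "grad_form j u (\<lambda>x. trunc e (w x)) h x = trunc1 e (w x) * grad_form j u w h x" if "x \<in> \<Omega>" for x
    unfolding grad_form_def complex_gradient_compose[OF wd(1)[OF that] trunc_deriv(1)[OF e]] gout_smult
    by (simp add: smat_simps)
  have g2: "grad_form j u (\<lambda>x. h x * trunc1 e (w x)) w x = h x * trunc2 e (w x) * grad_form j u w w x + trunc1 e (w x) * grad_form j u h w x" if "x \<in> \<Omega>" for x
  proof -
    have "complex_gradient (\<lambda>x. h x * trunc1 e (w x)) x = of_real (h x) *s (of_real (trunc2 e (w x)) *s complex_gradient w x) + of_real (trunc1 e (w x)) *s complex_gradient h x"
      using complex_gradient_mult[OF wd(2)[OF that] frechet_compose(2)[OF wd(1)[OF that] trunc_deriv(2)[OF e]]]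
        complex_gradient_compose[OF wd(1)[OF that] trunc_deriv(2)[OF e]] by simp
    then show ?thesis
      unfolding grad_form_def by (simp only: gout_smult matrix_add_ldistrib trace_add smat_simps plus_complex.sel Re_of_real_mult) (simp only: mult.assoc Re_of_real_mult)
  qed
  have "(LINT x:\<Omega>|lborel. trunc e (w x) * lin_op j u h x + grad_form j u (\<lambda>x. trunc e (w x)) h x) = 0"
    by (rule integration_by_parts[OF open_dom K u h f1]) (use off trunc_zero in auto)
  then show "(LINT x:\<Omega>|lborel. trunc e (w x) * lin_op j u h x + trunc1 e (w x) * grad_form j u w h x) = 0"
    using g1 open_dom by (subst set_lebesgue_integral_cong[of _ _ _ "\<lambda>x. trunc e (w x) * lin_op j u h x + grad_form j u (\<lambda>x. trunc e (w x)) h x"]) auto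
  have "(LINT x:\<Omega>|lborel. (h x * trunc1 e (w x)) * lin_op j u w x + grad_form j u (\<lambda>x. h x * trunc1 e (w x)) w x) = 0"
    by (rule integration_by_parts[OF open_dom K u w2 C_diff_mult[OF open_dom h1 f2]]) (use off trunc_zero in auto)
  then show "(LINT x:\<Omega>|lborel. (h x * trunc1 e (w x)) * lin_op j u w x + (h x * trunc2 e (w x) * grad_form j u w w x + trunc1 e (w x) * grad_form j u h w x)) = 0"
    using g2 open_dom by (subst set_lebesgue_integral_cong[of _ _ _ "\<lambda>x. (h x * trunc1 e (w x)) * lin_op j u w x + grad_form j u (\<lambda>x. h x * trunc1 e (w x)) w x"]) auto
  have int: "set_integrable lborel \<Omega> f" if f: "continuous_on \<Omega> f" "\<And>x. x \<in> \<Omega> - ?K \<Longrightarrow> f x = 0" for f :: "complex^'n \<Rightarrow> real"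
  proof -
    have "bounded (f ` ?K)" using K by (intro compact_imp_bounded compact_continuous_image) (auto intro: continuous_on_subset[OF f(1)])
    then obtain B where B: "\<And>x. x \<in> ?K \<Longrightarrow> \<bar>f x\<bar> \<le> B" unfolding bounded_iff by auto
    have "\<bar>f x\<bar> \<le> max B 0" if "x \<in> \<Omega>" for x using B[of x] f(2)[of x] that by (cases "x \<in> ?K") auto
    then show ?thesis by (rule bounded_continuous_set_integrable[OF open_dom bounded_dom f(1)])
  qed
  have cw: "continuous_on \<Omega> w" "continuous_on \<Omega> h" using w2 h C_diff_continuous by auto
  have cT: "continuous_on \<Omega> (\<lambda>x. trunc e (w x))" "continuous_on \<Omega> (\<lambda>x. trunc1 e (w x))"
    using f1 f2 C_diff_continuous by auto
  have cT2: "continuous_on \<Omega> (\<lambda>x. trunc2 e (w x))"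
    by (rule continuous_on_compose2[OF trunc2_continuous[OF e] cw(1)]) simp
  have cG: "continuous_on \<Omega> (grad_form j u a b)" if "C_diff 1 \<Omega> a" "C_diff 1 \<Omega> b" for a b
  proof -
    have "continuous_on \<Omega> (\<lambda>x. gout (complex_gradient a x) (complex_gradient b x))"
      unfolding gout_def
      by (intro continuous_on_vec_lambda continuous_on_mult continuous_on_cnj continuous_on_component continuous_on_complex_gradient that)
    then show ?thesis
      unfolding grad_form_def[abs_def]
      by (intro continuous_on_Re continuous_on_trace continuous_on_matrix_mult continuous_on_newton_mat continuous_on_complex_hessian open_dom u)
  qed
  note cL = lin_op_continuous[OF u h, of j] lin_op_continuous[OF u w2, of j]
  have z: "trunc e (w x) = 0" "trunc1 e (w x) = 0" "trunc2 e (w x) = 0" if "x \<in> \<Omega> - ?K" for x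
    using trunc_zero[OF off[OF that]] by auto
  show "set_integrable lborel \<Omega> (\<lambda>x. trunc e (w x) * lin_op j u h x)"
    "set_integrable lborel \<Omega> (\<lambda>x. trunc1 e (w x) * grad_form j u w h x)"
    "set_integrable lborel \<Omega> (\<lambda>x. (h x * trunc1 e (w x)) * lin_op j u w x)"
    "set_integrable lborel \<Omega> (\<lambda>x. h x * trunc2 e (w x) * grad_form j u w w x)"
    "set_integrable lborel \<Omega> (\<lambda>x. trunc1 e (w x) * grad_form j u h w x)"
    by (rule int, intro continuous_on_mult cw cT cT2 cL cG w1 h1, simp add: z)+
qed

text \<open>The mixed gradient terms of the two identities agree by
  \<open>grad_form_commute\<close>. What remains is Green's identity with one defect, the
  \<open>trunc2\<close> term, which has the sign of \<open>h\<close> whenever the quadratic form is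
  nonnegative.\<close>

lemma truncation_identity:
  assumes u: "C_diff 2 \<Omega> u" and w: "adm \<Omega> w" and h: "C_diff 2 \<Omega> h" and e: "e > 0"
  shows "(LINT x:\<Omega>|lborel. trunc e (w x) * lin_op j u h x)
    = (LINT x:\<Omega>|lborel. (h x * trunc1 e (w x)) * lin_op j u w x) + (LINT x:\<Omega>|lborel. h x * trunc2 e (w x) * grad_form j u w w x)"
proof -
  note p = truncation_parts[OF assms, of j]
  have "(LINT x:\<Omega>|lborel. trunc1 e (w x) * grad_form j u w h x) = (LINT x:\<Omega>|lborel. trunc1 e (w x) * grad_form j u h w x)"
  proof (rule set_lebesgue_integral_cong)
    show "\<forall>x. x \<in> \<Omega> \<longrightarrow> trunc1 e (w x) * grad_form j u w h x = trunc1 e (w x) * grad_form j u h w x"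
      using grad_form_commute[OF hermitian_complex_hessian[OF open_dom u], of _ j w h] by metis
  qed (use open_dom in auto)
  moreover have "(LINT x:\<Omega>|lborel. trunc e (w x) * lin_op j u h x) + (LINT x:\<Omega>|lborel. trunc1 e (w x) * grad_form j u w h x) = 0"
    using p(1) set_integral_add(2)[OF p(3,4)] by simp
  moreover have "(LINT x:\<Omega>|lborel. (h x * trunc1 e (w x)) * lin_op j u w x) + ((LINT x:\<Omega>|lborel. h x * trunc2 e (w x) * grad_form j u w w x) + (LINT x:\<Omega>|lborel. trunc1 e (w x) * grad_form j u h w x)) = 0"
    using p(2) set_integral_add(2)[OF p(5) set_integral_add(1)[OF p(6,7)]] set_integral_add(2)[OF p(6,7)] by simp
  ultimately show ?thesis by linarith
qed

lemma trunc_integral_tendsto: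
  assumes u: "adm \<Omega> u" and h: "adm \<Omega> h" and w: "adm \<Omega> w"
  shows "(\<lambda>n. LINT x:\<Omega>|lborel. trunc (1 / real (Suc n)) (w x) * lin_op j u h x) \<longlonglongrightarrow> (LINT x:\<Omega>|lborel. max (w x) 0 * lin_op j u h x)"
  unfolding set_lebesgue_integral_def
proof (rule integral_dominated_convergence[where w = "\<lambda>x. norm (indicator \<Omega> x *\<^sub>R (w x * lin_op j u h x))"])
  have m: "(\<lambda>x. indicator \<Omega> x *\<^sub>R f x) \<in> borel_measurable lborel" if "continuous_on \<Omega> f" for f :: "complex^'n \<Rightarrow> real"
    using borel_measurable_continuous_on_indicator[OF _ that] open_dom by auto
  have cw: "continuous_on \<Omega> w" using adm_C2[OF w] C_diff_continuous by auto
  note cL = lin_op_continuous[OF adm_C2[OF u] adm_C2[OF h], of j]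
  show "(\<lambda>x. indicator \<Omega> x *\<^sub>R (max (w x) 0 * lin_op j u h x)) \<in> borel_measurable lborel"
    by (intro m continuous_on_mult cL continuous_intros cw)
  have "continuous_on UNIV (trunc (1 / real (Suc n)))" for n
    using trunc_deriv(1)[of "1 / real (Suc n)"] by (auto intro: DERIV_continuous_on)
  then show "(\<lambda>x. indicator \<Omega> x *\<^sub>R (trunc (1 / real (Suc n)) (w x) * lin_op j u h x)) \<in> borel_measurable lborel" for n
    by (intro m continuous_on_mult cL continuous_on_compose2[OF _ cw]) auto
  show "integrable lborel (\<lambda>x. norm (indicator \<Omega> x *\<^sub>R (w x * lin_op j u h x)))"
    using lin_op_integrable[OF u w h, of j] unfolding set_integrable_def by (rule integrable_norm)
  show "AE x in lborel. (\<lambda>n. indicator \<Omega> x *\<^sub>R (trunc (1 / real (Suc n)) (w x) * lin_op j u h x)) \<longlonglongrightarrow> indicator \<Omega> x *\<^sub>R (max (w x) 0 * lin_op j u h x)"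
    by (intro AE_I2 tendsto_intros trunc_tendsto)
  show "AE x in lborel. norm (indicator \<Omega> x *\<^sub>R (trunc (1 / real (Suc n)) (w x) * lin_op j u h x)) \<le> norm (indicator \<Omega> x *\<^sub>R (w x * lin_op j u h x))" for n
  proof (rule AE_I2)
    fix x
    have "\<bar>trunc (1 / real (Suc n)) (w x)\<bar> \<le> \<bar>w x\<bar>"
      using trunc_bounds(1,2)[of "1 / real (Suc n)" "w x"] trunc_zero(1)[of "w x" "1 / real (Suc n)"]
      by (cases "w x \<ge> 0") (auto simp: order_trans[of "w x" 0])
    then show "norm (indicator \<Omega> x *\<^sub>R (trunc (1 / real (Suc n)) (w x) * lin_op j u h x)) \<le> norm (indicator \<Omega> x *\<^sub>R (w x * lin_op j u h x))"
      by (auto simp: indicator_def abs_mult intro: mult_right_mono)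
  qed
qed

lemma set_integral_nonneg_dom:
  "(\<And>x. x \<in> \<Omega> \<Longrightarrow> 0 \<le> f x) \<Longrightarrow> 0 \<le> (LINT x:\<Omega>|lborel. f x :: real)"
  unfolding set_lebesgue_integral_def by (rule Bochner_Integration.integral_nonneg) (simp add: indicator_def)

text \<open>With \<open>- f\<close> truncated, the defect in \<open>truncation_identity\<close> is
  nonpositive and \<open>trunc1\<close> is at most 1, so an inequality survives the limit. If both
  functions qualify, exchanging them gives equality.\<close>

lemma energy_swap_le:
  assumes u: "adm \<Omega> u" "\<And>x. x \<in> \<Omega> \<Longrightarrow> complex_hessian u x \<in> herm_Gamma k" and j: "j < k"
    and f: "adm \<Omega> f" "\<And>x. x \<in> \<Omega> \<Longrightarrow> f x \<le> 0" "\<And>x. x \<in> \<Omega> \<Longrightarrow> lin_op j u f x \<ge> 0"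
    and g: "adm \<Omega> g" "\<And>x. x \<in> \<Omega> \<Longrightarrow> g x \<le> 0"
  shows "(LINT x:\<Omega>|lborel. - f x * lin_op j u g x) \<le> (LINT x:\<Omega>|lborel. - g x * lin_op j u f x)"
proof -
  let ?w = "\<lambda>x. - f x"
  have w: "adm \<Omega> ?w" by (rule adm_uminus[OF f(1)])
  have le: "(LINT x:\<Omega>|lborel. trunc (1 / real (Suc n)) (?w x) * lin_op j u g x) \<le> (LINT x:\<Omega>|lborel. - g x * lin_op j u f x)" for n
  proof -
    let ?e = "1 / real (Suc n)"
    have e: "?e > 0" by simp
    note p = truncation_parts[OF adm_C2[OF u(1)] w adm_C2[OF g(1)] e, of j]
    have "(LINT x:\<Omega>|lborel. g x * trunc2 ?e (?w x) * grad_form j u ?w ?w x) \<le> 0"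
    proof -
      have "0 \<le> (LINT x:\<Omega>|lborel. - (g x * trunc2 ?e (?w x) * grad_form j u ?w ?w x))"
      proof (rule set_integral_nonneg_dom)
        fix x assume x: "x \<in> \<Omega>"
        have "0 \<le> - g x * trunc2 ?e (?w x) * grad_form j u ?w ?w x"
          using g(2)[OF x] trunc_bounds(5)[OF e, of "?w x"] grad_form_nonneg[OF u(2)[OF x] j k_le, of ?w]
          by (intro mult_nonneg_nonneg) auto
        then show "0 \<le> - (g x * trunc2 ?e (?w x) * grad_form j u ?w ?w x)" by simp
      qed
      then show ?thesis by (simp add: set_lebesgue_integral_def)
    qed
    moreover have "(LINT x:\<Omega>|lborel. (g x * trunc1 ?e (?w x)) * lin_op j u ?w x) \<le> (LINT x:\<Omega>|lborel. - g x * lin_op j u f x)"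
    proof (rule set_integral_mono[OF p(5) lin_op_integrable[OF u(1) adm_uminus[OF g(1)] f(1)]])
      fix x assume x: "x \<in> \<Omega>"
      have "g x * trunc1 ?e (?w x) * lin_op j u ?w x = trunc1 ?e (?w x) * (- g x * lin_op j u f x)"
        by (simp add: lin_op_uminus[OF adm_C2[OF f(1)] x])
      also have "\<dots> \<le> 1 * (- g x * lin_op j u f x)"
        using trunc_bounds(4)[OF e] g(2)[OF x] f(3)[OF x] by (intro mult_right_mono mult_nonneg_nonneg) auto
      finally show "g x * trunc1 ?e (?w x) * lin_op j u ?w x \<le> - g x * lin_op j u f x" by simp
    qed
    ultimately show ?thesis unfolding truncation_identity[OF adm_C2[OF u(1)] w adm_C2[OF g(1)] e] by linarith
  qed
  have "(LINT x:\<Omega>|lborel. max (?w x) 0 * lin_op j u g x) \<le> (LINT x:\<Omega>|lborel. - g x * lin_op j u f x)"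
    using trunc_integral_tendsto[OF u(1) g(1) w, of j] le by (intro LIMSEQ_le_const2) auto
  moreover have "(LINT x:\<Omega>|lborel. max (?w x) 0 * lin_op j u g x) = (LINT x:\<Omega>|lborel. - f x * lin_op j u g x)"
    using f(2) open_dom by (intro set_lebesgue_integral_cong) (auto simp: max_def intro: antisym)
  ultimately show ?thesis by simp
qed

text \<open>Testing with truncations controls only the positive part of a function, so the argument
  is run for \<open>w\<close> and for \<open>- w\<close> and the results are added.\<close>

lemma energy_nonneg:
  assumes u: "adm \<Omega> u" "\<And>x. x \<in> \<Omega> \<Longrightarrow> complex_hessian u x \<in> herm_Gamma k" and j: "j < k" and w: "adm \<Omega> w"
  shows "(LINT x:\<Omega>|lborel. - w x * lin_op j u w x) \<ge> 0"
proof -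
  have half: "(LINT x:\<Omega>|lborel. max (w x) 0 * lin_op j u w x) \<le> 0" if w: "adm \<Omega> w" for w
  proof -
    have "(LINT x:\<Omega>|lborel. trunc (1 / real (Suc n)) (w x) * lin_op j u w x) \<le> 0" for n
    proof -
      let ?e = "1 / real (Suc n)"
      have e: "?e > 0" by simp
      note p = truncation_parts[OF adm_C2[OF u(1)] w adm_C2[OF w] e, of j]
      have "0 \<le> (LINT x:\<Omega>|lborel. trunc1 ?e (w x) * grad_form j u w w x)"
        using trunc_bounds(3)[OF e] grad_form_nonneg[OF u(2) j k_le, of _ w]
        by (intro set_integral_nonneg_dom mult_nonneg_nonneg) auto
      then show ?thesis using p(1) set_integral_add(2)[OF p(3,4)] by simp
    qed
    then show ?thesis using trunc_integral_tendsto[OF u(1) w w, of j] by (intro LIMSEQ_le_const2) auto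
  qed
  let ?v = "\<lambda>x. - w x"
  have v: "adm \<Omega> ?v" by (rule adm_uminus[OF w])
  have int: "set_integrable lborel \<Omega> (\<lambda>x. max (f x) 0 * lin_op j u f x)" if f: "adm \<Omega> f" for f
  proof -
    obtain B where B: "\<And>x. x \<in> \<Omega> \<Longrightarrow> \<bar>f x * lin_op j u f x\<bar> \<le> B"
      using bounded_on_mult[OF adm_bounded[OF f] lin_op_bounded[OF u(1) f]] unfolding bounded_on_def by blast
    have "\<bar>max (f x) 0 * lin_op j u f x\<bar> \<le> B" if "x \<in> \<Omega>" for x
      using B[OF that] by (cases "f x \<ge> 0") (auto simp: max_def)
    then show ?thesis
      by (intro bounded_continuous_set_integrable open_dom bounded_dom continuous_intros lin_op_continuous adm_C2 u f
        C_diff_continuous[OF adm_C2[OF f]]) auto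
  qed
  have "(LINT x:\<Omega>|lborel. w x * lin_op j u w x) = (LINT x:\<Omega>|lborel. max (w x) 0 * lin_op j u w x + max (?v x) 0 * lin_op j u ?v x)"
    using open_dom lin_op_uminus[OF adm_C2[OF w]] by (intro set_lebesgue_integral_cong) (auto simp: max_def)
  also have "\<dots> \<le> 0" using half[OF w] half[OF v] set_integral_add(2)[OF int[OF w] int[OF v]] by simp
  finally show ?thesis by (simp add: set_lebesgue_integral_def)
qed

text \<open>Maximum principle by testing against the squared norm minus a constant, which is
  nonpositive and has positive \<open>lin_op 0\<close>. The truncation of \<open>u\<close> then
  vanishes almost everywhere, and an open null set is empty.\<close>

lemma subharmonic_nonpos:
  assumes u: "adm \<Omega> u" "\<And>x. x \<in> \<Omega> \<Longrightarrow> lin_op 0 u u x \<ge> 0" and x: "x \<in> \<Omega>"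
  shows "u x \<le> 0"
proof (rule field_le_epsilon)
  fix e :: real assume e: "e > 0"
  obtain R where R: "\<And>z. z \<in> \<Omega> \<Longrightarrow> norm z \<le> R" using bounded_dom unfolding bounded_iff by blast
  let ?h = "\<lambda>z :: complex^'n. z \<bullet> z - R\<^sup>2"
  have h: "C_diff 2 \<Omega> ?h" by (rule norm_square_hessian)
  have h0: "?h z \<le> 0" if "z \<in> \<Omega>" for z using power_mono[OF R[OF that], of 2] by (simp add: power2_norm_eq_inner)
  have T: "newton_mat 0 A = mat 1" for A :: "complex^'n^'n" by simp
  have Lh: "lin_op 0 u ?h z = real CARD('n)" for z unfolding lin_op_def norm_square_hessian T by (simp add: trace_I)
  have G: "grad_form 0 u u u z \<ge> 0" for z
  proof -
    have "trace (mat 1 ** gout g g) = herm_inner g g" for g :: "complex^'n"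
      by (simp add: trace_def gout_def herm_inner_def)
    then show ?thesis by (simp only: grad_form_def T herm_inner_self) simp
  qed
  note p = truncation_parts[OF adm_C2[OF u(1)] u(1) h e, of 0]
  have "(LINT x:\<Omega>|lborel. trunc e (u x) * lin_op 0 u ?h x) \<le> 0"
  proof -
    have "0 \<le> (LINT x:\<Omega>|lborel. - ((?h x * trunc1 e (u x)) * lin_op 0 u u x))"
    proof (rule set_integral_nonneg_dom)
      fix x assume x: "x \<in> \<Omega>"
      have "0 \<le> - ?h x * trunc1 e (u x) * lin_op 0 u u x"
        using h0[OF x] trunc_bounds(3)[OF e, of "u x"] u(2)[OF x] by (intro mult_nonneg_nonneg) auto
      then show "0 \<le> - ((?h x * trunc1 e (u x)) * lin_op 0 u u x)" by (simp only: mult_minus_left)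
    qed
    moreover have "0 \<le> (LINT x:\<Omega>|lborel. - (?h x * trunc2 e (u x) * grad_form 0 u u u x))"
    proof (rule set_integral_nonneg_dom)
      fix x assume x: "x \<in> \<Omega>"
      have "0 \<le> - ?h x * trunc2 e (u x) * grad_form 0 u u u x"
        using h0[OF x] trunc_bounds(5)[OF e, of "u x"] G[of x] by (intro mult_nonneg_nonneg) auto
      then show "0 \<le> - (?h x * trunc2 e (u x) * grad_form 0 u u u x)" by (simp only: mult_minus_left)
    qed
    ultimately show ?thesis
      unfolding truncation_identity[OF adm_C2[OF u(1)] u(1) h e] by (simp add: set_lebesgue_integral_def)
  qed
  moreover have "0 \<le> (LINT x:\<Omega>|lborel. trunc e (u x) * lin_op 0 u ?h x)"
    using trunc_bounds(1)[OF e] Lh by (intro set_integral_nonneg_dom) simp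
  ultimately have "integral\<^sup>L lborel (\<lambda>x. indicator \<Omega> x *\<^sub>R (trunc e (u x) * lin_op 0 u ?h x)) = 0"
    by (simp add: set_lebesgue_integral_def)
  then have "AE x in lborel. indicator \<Omega> x *\<^sub>R (trunc e (u x) * lin_op 0 u ?h x) = 0"
    using p(3) trunc_bounds(1)[OF e] Lh unfolding set_integrable_def
    by (subst (asm) integral_nonneg_eq_0_iff_AE) auto
  then have AE: "AE x in lborel. x \<notin> {x \<in> \<Omega>. u x > e}"
  proof (rule eventually_mono)
    fix x assume z: "indicator \<Omega> x *\<^sub>R (trunc e (u x) * lin_op 0 u ?h x) = 0"
    show "x \<notin> {x \<in> \<Omega>. u x > e}"
    proof
      assume a: "x \<in> {x \<in> \<Omega>. u x > e}"
      then have "trunc e (u x) > 0" using e by (simp add: trunc_def ppos_def)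
      then show False using z a Lh by simp
    qed
  qed
  have o: "open {x \<in> \<Omega>. u x > e}"
  proof -
    have "{x \<in> \<Omega>. u x > e} = \<Omega> \<inter> u -` {e<..}" by auto
    then show ?thesis using C_diff_continuous[OF adm_C2[OF u(1)]] open_dom by (auto intro: continuous_open_preimage)
  qed
  have "{x \<in> \<Omega>. u x > e} \<in> null_sets lborel"
    using AE o by (subst (asm) AE_iff_null_sets[symmetric]) auto
  then have "{x \<in> \<Omega>. u x > e} \<in> null_sets lebesgue" by (rule null_sets_completionI)
  then have "negligible {x \<in> \<Omega>. u x > e}" by (simp add: negligible_iff_null_sets)
  then have "{x \<in> \<Omega>. u x > e} = {}" using open_not_negligible[OF o] by blast
  then show "u x \<le> 0 + e" using x by force
qed

end

subsection \<open>The chain of energies\<close>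

text \<open>Raising the recursion to the power \<open>j + 2\<close> and inserting the bound for
  \<open>a j\<close> leaves the factor \<open>a (Suc j) ^ (j + 1)\<close> on both sides, which is
  cancelled. The constant is fixed before \<open>a\<close>, as uniformity in \<open>u\<close>
  demands.\<close>

lemma power_chain_step:
  fixes D :: real
  assumes D: "D \<ge> 0"
  shows "\<exists>E\<ge>0. \<forall>a. (\<forall>i\<le>Suc j. a i \<ge> 0) \<and> (a 0)\<^sup>2 \<le> D * a 1 \<and> (\<forall>i<j. (a (Suc i))\<^sup>2 \<le> D * a (Suc (Suc i)) * a i)
     \<longrightarrow> a j ^ (j + 2) \<le> E * a (Suc j) ^ (j + 1)"
proof (induction j)
  case 0
  show ?case
    using D by (intro exI[of _ D] conjI allI impI) (simp_all add: power2_eq_square)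
next
  case (Suc j)
  then obtain E where E: "E \<ge> 0" "\<And>a. (\<forall>i\<le>Suc j. a i \<ge> 0) \<Longrightarrow> (a 0)\<^sup>2 \<le> D * a 1 \<Longrightarrow> (\<forall>i<j. (a (Suc i))\<^sup>2 \<le> D * a (Suc (Suc i)) * a i)
     \<Longrightarrow> a j ^ (j + 2) \<le> E * a (Suc j) ^ (j + 1)" by blast
  show ?case
  proof (intro exI[of _ "D ^ (j + 2) * E"] conjI allI impI)
    fix a :: "nat \<Rightarrow> real"
    assume a: "(\<forall>i\<le>Suc (Suc j). a i \<ge> 0) \<and> (a 0)\<^sup>2 \<le> D * a 1 \<and> (\<forall>i<Suc j. (a (Suc i))\<^sup>2 \<le> D * a (Suc (Suc i)) * a i)"
    have IH: "a j ^ (j + 2) \<le> E * a (Suc j) ^ (j + 1)" using a by (intro E(2)) auto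
    have pos: "a j \<ge> 0" "a (Suc j) \<ge> 0" "a (Suc (Suc j)) \<ge> 0" using a by auto
    show "a (Suc j) ^ (Suc j + 2) \<le> D ^ (j + 2) * E * a (Suc (Suc j)) ^ (Suc j + 1)"
    proof (cases "a (Suc j) = 0")
      case True
      then show ?thesis using pos D E by simp
    next
      case False
      then have p: "a (Suc j) > 0" using pos by simp
      have "a (Suc j) ^ (j + 1) * a (Suc j) ^ (Suc j + 2) = ((a (Suc j))\<^sup>2) ^ (j + 2)"
        unfolding power_add[symmetric] power_mult[symmetric] by (rule arg_cong[of _ _ "(^) (a (Suc j))"]) simp
      also have "\<dots> \<le> (D * a (Suc (Suc j)) * a j) ^ (j + 2)" using a by (intro power_mono) auto
      also have "\<dots> = (D * a (Suc (Suc j))) ^ (j + 2) * a j ^ (j + 2)" by (simp add: power_mult_distrib)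
      also have "\<dots> \<le> (D * a (Suc (Suc j))) ^ (j + 2) * (E * a (Suc j) ^ (j + 1))"
        using IH pos D by (intro mult_left_mono) auto
      also have "\<dots> = a (Suc j) ^ (j + 1) * (D ^ (j + 2) * E * a (Suc (Suc j)) ^ (Suc j + 1))"
        by (simp add: power_mult_distrib mult_ac)
      finally show ?thesis using p by (simp only: mult_le_cancel_left_pos zero_less_power)
    qed
  qed (use D E in simp)
qed

text \<open>Taking the power with exponent 1 over the product of \<open>j + 1\<close> and
  \<open>j + 2\<close> normalizes both sides at once.\<close>

lemma powr_of_power_chain:
  fixes a b E :: real
  assumes "a \<ge> 0" "b \<ge> 0" "E \<ge> 0" "a ^ (j + 2) \<le> E * b ^ (j + 1)"
  shows "a powr (1 / real (j + 1)) \<le> E powr (1 / (real (j + 1) * real (j + 2))) * b powr (1 / real (j + 2))"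
proof (cases "a = 0")
  case False
  then have a: "a > 0" using assms by simp
  then have "0 < E * b ^ (j + 1)" using assms(4) zero_less_power[OF a, of "j + 2"] by linarith
  then have b: "b > 0" "E > 0" using assms(2,3) by (auto simp: zero_less_mult_iff le_less)
  let ?r = "1 / (real (j + 1) * real (j + 2))"
  have j2: "real (j + 2) * ?r = 1 / real (j + 1)" "real (j + 1) * ?r = 1 / real (j + 2)" by (simp_all del: of_nat_add)
  have "(a powr real (j + 2)) powr ?r \<le> (E * b powr real (j + 1)) powr ?r"
    unfolding powr_realpow[OF a] powr_realpow[OF b(1)] using assms a by (intro powr_mono2) auto
  also have "\<dots> = E powr ?r * (b powr real (j + 1)) powr ?r" using b by (intro powr_mult)
  finally show ?thesis unfolding powr_powr j2 .
qed simp

lemma power_chain: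
  fixes D :: real
  assumes D: "D \<ge> 0" and "m < k"
  shows "\<exists>C\<ge>0. \<forall>a. (\<forall>i\<le>k. a i \<ge> 0) \<and> (a 0)\<^sup>2 \<le> D * a 1 \<and> (\<forall>i. Suc i < k \<longrightarrow> (a (Suc i))\<^sup>2 \<le> D * a (Suc (Suc i)) * a i)
     \<longrightarrow> a m powr (1 / real (m + 1)) \<le> C * a k powr (1 / real (k + 1))"
  using assms(2)
proof (induction k)
  case (Suc k)
  obtain E where E: "E \<ge> 0" "\<And>a. (\<forall>i\<le>Suc k. a i \<ge> 0) \<Longrightarrow> (a 0)\<^sup>2 \<le> D * a 1 \<Longrightarrow> (\<forall>i<k. (a (Suc i))\<^sup>2 \<le> D * a (Suc (Suc i)) * a i)
     \<Longrightarrow> a k ^ (k + 2) \<le> E * a (Suc k) ^ (k + 1)" using power_chain_step[OF D, of k] by blast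
  let ?c = "E powr (1 / (real (k + 1) * real (k + 2)))"
  have st: "a k powr (1 / real (k + 1)) \<le> ?c * a (Suc k) powr (1 / real (Suc k + 1))"
    if "(\<forall>i\<le>Suc k. a i \<ge> 0) \<and> (a 0)\<^sup>2 \<le> D * a 1 \<and> (\<forall>i. Suc i < Suc k \<longrightarrow> (a (Suc i))\<^sup>2 \<le> D * a (Suc (Suc i)) * a i)" for a
    using powr_of_power_chain[of "a k" "a (Suc k)" E k] E that by auto
  show ?case
  proof (cases "m = k")
    case True
    then show ?thesis using st by (intro exI[of _ ?c]) auto
  next
    case False
    then obtain C where C: "C \<ge> 0" "\<And>a. (\<forall>i\<le>k. a i \<ge> 0) \<Longrightarrow> (a 0)\<^sup>2 \<le> D * a 1 \<Longrightarrow> (\<forall>i. Suc i < k \<longrightarrow> (a (Suc i))\<^sup>2 \<le> D * a (Suc (Suc i)) * a i)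
     \<Longrightarrow> a m powr (1 / real (m + 1)) \<le> C * a k powr (1 / real (k + 1))" using Suc by auto
    show ?thesis
    proof (intro exI[of _ "C * ?c"] conjI allI impI)
      fix a :: "nat \<Rightarrow> real"
      assume a: "(\<forall>i\<le>Suc k. a i \<ge> 0) \<and> (a 0)\<^sup>2 \<le> D * a 1 \<and> (\<forall>i. Suc i < Suc k \<longrightarrow> (a (Suc i))\<^sup>2 \<le> D * a (Suc (Suc i)) * a i)"
      have "a m powr (1 / real (m + 1)) \<le> C * a k powr (1 / real (k + 1))" using a by (intro C(2)) auto
      also have "\<dots> \<le> C * (?c * a (Suc k) powr (1 / real (Suc k + 1)))" by (intro mult_left_mono st a C)
      finally show "a m powr (1 / real (m + 1)) \<le> C * ?c * a (Suc k) powr (1 / real (Suc k + 1))" by simp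
    qed (use C in simp)
  qed
qed simp

text \<open>The Cauchy-Schwarz inequality in the form in which it is available, from the energy
  along a line in function space.\<close>

lemma quadratic_nonneg_discriminant:
  fixes A X Z :: real
  assumes "\<And>t. A + 2 * t * X + t\<^sup>2 * Z \<ge> 0" "Z \<ge> 0"
  shows "X\<^sup>2 \<le> A * Z"
proof (cases "Z = 0")
  case True
  have "X = 0"
  proof (rule ccontr)
    assume "X \<noteq> 0"
    \<comment> \<open>For \<open>Z = 0\<close> the polynomial is affine in \<open>t\<close>, and at
      this \<open>t\<close> its value is -1.\<close>
    then show False using assms(1)[of "- (A + 1) / (2 * X)"] True by (simp add: field_simps)
  qed
  then show ?thesis using True by simp
next
  case False
  then have Z: "Z > 0" using assms(2) by simp
  have "0 \<le> (A + 2 * (- X / Z) * X + (- X / Z)\<^sup>2 * Z) * Z" using assms(1)[of "- X / Z"] Z by simp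
  also have "\<dots> = A * Z - X\<^sup>2" using Z by (simp add: field_simps power2_eq_square)
  finally show ?thesis by simp
qed

lemma C2_closure_C_diff:
  assumes "u \<in> C2_closure \<Omega>"
  shows "C_diff 2 \<Omega> u" "extends_continuously \<Omega> (\<lambda>x. frechet_derivative (\<lambda>y. frechet_derivative u (at y) w) (at x) v)"
proof -
  have e: "C_diff_ext (Suc (Suc 0)) \<Omega> u" using assms by (simp add: C2_closure_def numeral_2_eq_2)
  then show x: "extends_continuously \<Omega> (\<lambda>x. frechet_derivative (\<lambda>y. frechet_derivative u (at y) w) (at x) v)" for v w
    unfolding C_diff_ext.simps by blast
  have "continuous_on \<Omega> f" if "extends_continuously \<Omega> f" for f
  proof -
    obtain g where "continuous_on (closure \<Omega>) g" "\<And>x. x \<in> \<Omega> \<Longrightarrow> g x = f x" using \<open>extends_continuously \<Omega> f\<close> unfolding extends_continuously_def by blast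
    then show ?thesis using closure_subset continuous_on_subset by (metis (no_types, lifting) continuous_on_cong)
  qed
  then show "C_diff 2 \<Omega> u"
    using e x unfolding numeral_2_eq_2 C_diff.simps C_diff_ext.simps by blast
qed

text \<open>The second derivatives extend continuously to the compact closure, which bounds the
  Hessian. The cone condition is transferred by \<open>norm_sym_mat_eq\<close>, the normalizing
  factors being positive.\<close>

lemma P0_adm:
  fixes \<Omega> :: "(complex^'n) set"
  assumes \<Omega>: "open \<Omega>" "bounded \<Omega>" and u: "u \<in> P0 k \<Omega>"
  shows "adm \<Omega> u" "\<And>z. z \<in> \<Omega> \<Longrightarrow> complex_hessian u z \<in> herm_Gamma k"
proof -
  have u': "u \<in> C2_closure \<Omega>" "\<And>z. z \<in> \<Omega> \<Longrightarrow> eigenvalue_vec (complex_hessian u z) \<in> Gamma_cone k" "\<And>z. z \<in> frontier \<Omega> \<Longrightarrow> u z = 0"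
    using u by (auto simp: P0_def)
  note C2 = C2_closure_C_diff[OF u'(1)]
  let ?H = "\<lambda>v w x. frechet_derivative (\<lambda>y. frechet_derivative u (at y) w) (at x) v"
  have "\<forall>v w. \<exists>g. continuous_on (closure \<Omega>) g \<and> (\<forall>x\<in>\<Omega>. g x = ?H v w x)"
    using C2(2) unfolding extends_continuously_def by blast
  then obtain g where g: "\<And>v w. continuous_on (closure \<Omega>) (g v w)" "\<And>v w x. x \<in> \<Omega> \<Longrightarrow> g v w x = ?H v w x" by metis
  define G where "G z = (\<chi> i j. Complex (g (axis i 1) (axis j 1) z + g (axis i \<i>) (axis j \<i>) z)
     (g (axis i 1) (axis j \<i>) z - g (axis i \<i>) (axis j 1) z) / 4)" for z
  have "continuous_on (closure \<Omega>) G"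
    unfolding G_def Complex_eq by (intro continuous_on_vec_lambda continuous_intros g) auto
  then have "compact (G ` closure \<Omega>)"
    using \<Omega>(2) by (intro compact_continuous_image) (auto simp: compact_closure)
  then have "bounded (G ` closure \<Omega>)" by (rule compact_imp_bounded)
  then obtain M where M: "\<And>z. z \<in> closure \<Omega> \<Longrightarrow> norm (G z) \<le> M" unfolding bounded_iff by blast
  have "complex_hessian u z = G z" if "z \<in> \<Omega>" for z
    using that by (simp add: vec_eq_iff G_def complex_hessian_eq[OF \<Omega>(1) C2(1)] g)
  then have "\<exists>M. \<forall>z\<in>\<Omega>. norm (complex_hessian u z) \<le> M" using M closure_subset by (intro exI[of _ M]) auto
  then show "adm \<Omega> u" using C2(1) u' by (simp add: adm_def C2_closure_def)
  fix z assume z: "z \<in> \<Omega>"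
  have H: "hermitian (complex_hessian u z)" by (rule hermitian_complex_hessian[OF \<Omega>(1) C2(1) z])
  define r :: "nat \<Rightarrow> real" where "r j = fact j * fact (CARD('n) - j) / fact CARD('n)" for j
  have r: "r j > 0" for j by (simp add: r_def)
  have "Re (esym_mat j (complex_hessian u z)) \<ge> 0" if "j \<in> {1..k}" for j
  proof -
    have "norm_sym j (eigenvalue_vec (complex_hessian u z)) \<ge> 0"
      using u'(2)[OF z] that by (simp add: Gamma_cone_def)
    then have "0 \<le> r j * Re (esym_mat j (complex_hessian u z))"
      unfolding norm_sym_mat_eq(2)[OF H] r_def .
    then show ?thesis using r[of j] by (simp add: zero_le_mult_iff)
  qed
  then show "complex_hessian u z \<in> herm_Gamma k" using H by (simp add: herm_Gamma_def)
qed

context hess_domain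
begin

lemma lin_op_self: "lin_op j u u z = real (j + 1) * Re (esym_mat (j + 1) (complex_hessian u z))"
proof -
  have "trace (complex_hessian u z ** newton_mat j (complex_hessian u z)) = of_real (real (j + 1)) * esym_mat (j + 1) (complex_hessian u z)"
    by (simp add: esym_mat.simps(2) del: of_nat_Suc)
  then have "trace (newton_mat j (complex_hessian u z) ** complex_hessian u z) = of_real (real (j + 1)) * esym_mat (j + 1) (complex_hessian u z)"
    by (simp only: trace_mul_sym[of "newton_mat j (complex_hessian u z)"])
  then show ?thesis unfolding lin_op_def by (simp only: Re_of_real_mult)
qed

text \<open>The lower bound comes from the dual cone, the upper one from Garding's inequality for a
  large multiple of the identity minus the Hessian of \<open>v\<close>. Both lead to the trace of
  the Newton matrix, i.e. \<open>CARD('n) - j\<close> times \<open>e\<close>, a factor of at least 1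
  because \<open>j < k\<close>.\<close>

lemma lin_op_dual_bounds:
  fixes u v :: "complex^'n \<Rightarrow> real"
  assumes A: "complex_hessian u z \<in> herm_Gamma k" and j: "j < k" and c: "c > 0"
    and v: "complex_hessian v z - mat (of_real c) \<in> dual_Gamma k" and H: "hermitian (complex_hessian v z)"
    and M: "norm (complex_hessian v z) \<le> M"
  defines "e \<equiv> Re (esym_mat j (complex_hessian u z))"
  shows "e \<ge> 0" "c * e \<le> lin_op j u v z" "lin_op j u v z \<le> real CARD('n) * real CARD('n) * M * real CARD('n) * e"
proof -
  let ?T = "newton_mat j (complex_hessian u z)" and ?B = "complex_hessian v z" and ?n = "real CARD('n)"
  have j': "j \<le> CARD('n)" using j k_le by simp
  show e: "e \<ge> 0"
    using A j unfolding e_def by (cases j) (auto simp: herm_Gamma_def)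
  have tr: "Re (trace (?T ** mat (of_real r))) = r * (real (CARD('n) - j) * e)" for r
  proof -
    have "?T ** mat (of_real r) = smat (of_real r) ?T" by (simp add: vec_eq_iff mul_mat_entry smat_def mult.commute)
    moreover have "trace ?T = of_real (real (CARD('n) - j)) * esym_mat j (complex_hessian u z)"
      using trace_newton_mat[OF j'] by simp
    ultimately show ?thesis by (simp only: smat_simps Re_of_real_mult e_def)
  qed
  have d: "Re (trace (?T ** (?B - mat (of_real c)))) \<ge> 0" using v A j unfolding dual_Gamma_def by blast
  have "real (CARD('n) - j) \<ge> 1" using j k_le by simp
  then have "1 * e \<le> real (CARD('n) - j) * e" using e by (intro mult_right_mono)
  then have "e \<le> real (CARD('n) - j) * e" by simp
  then have "c * e \<le> c * (real (CARD('n) - j) * e)" using c by simp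
  also have "\<dots> \<le> lin_op j u v z" using d by (simp add: matrix_mul_diff_right trace_sub tr lin_op_def)
  finally show "c * e \<le> lin_op j u v z" .
  have M0: "M \<ge> 0" using M norm_ge_zero order_trans by blast
  have "cmod (?B $ a $ b) \<le> M" for a b
    using M Finite_Cartesian_Product.norm_nth_le[of ?B a] Finite_Cartesian_Product.norm_nth_le[of "?B $ a" b] by linarith
  then have "psd (mat (of_real (?n * ?n * M)) - ?B)" by (rule psd_mat_diff(1)[OF H])
  then have "Re (trace (?T ** (mat (of_real (?n * ?n * M)) - ?B))) \<ge> 0"
    using garding[OF A psd_herm_Gamma j k_le] by blast
  then have "lin_op j u v z \<le> ?n * ?n * M * (real (CARD('n) - j) * e)"
    by (simp only: matrix_mul_diff_right trace_sub minus_complex.sel tr lin_op_def)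
  also have "\<dots> \<le> ?n * ?n * M * (?n * e)" using M0 e by (intro mult_left_mono mult_right_mono) auto
  finally show "lin_op j u v z \<le> ?n * ?n * M * ?n * e" by simp
qed

lemma esym_integrable:
  assumes u: "adm \<Omega> u" and w: "adm \<Omega> w"
  shows "set_integrable lborel \<Omega> (\<lambda>z. w z * Re (esym_mat j (complex_hessian u z)))"
proof (cases j)
  case 0
  obtain B where "\<And>x. x \<in> \<Omega> \<Longrightarrow> \<bar>w x\<bar> \<le> B" using adm_bounded[OF w] unfolding bounded_on_def by blast
  then show ?thesis using 0
    by (auto intro!: bounded_continuous_set_integrable[OF open_dom bounded_dom C_diff_continuous[OF adm_C2[OF w]]])
next
  case (Suc i)
  have "set_integrable lborel \<Omega> (\<lambda>z. (1 / real (i + 1)) * (w z * lin_op i u u z))"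
    using set_integrable_mult_right[OF lin_op_integrable[OF u w u]] by blast
  moreover have "(1 / real (i + 1)) * (w z * (real (i + 1) * t)) = w z * t" for z t
    by (simp del: of_nat_add)
  ultimately show ?thesis using Suc unfolding lin_op_self by simp
qed

text \<open>Apart from the domain, \<open>D\<close> depends only on \<open>k\<close>,
  \<open>v\<close> and \<open>c\<close>. It is found before \<open>u\<close> is given, which is the
  source of the uniformity of the final constant.\<close>

lemma energy_recursion:
  assumes k0: "0 < k" and v: "adm \<Omega> v" and c: "c > 0" and dual: "\<And>z. z \<in> \<Omega> \<Longrightarrow> complex_hessian v z - mat (of_real c) \<in> dual_Gamma k"
  shows "\<exists>D\<ge>0. \<forall>u\<in>P0 k \<Omega>. let a = (\<lambda>j. LINT z:\<Omega>|lborel. - u z * Re (esym_mat j (complex_hessian u z))) in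
    (\<forall>i\<le>k. a i \<ge> 0) \<and> (a 0)\<^sup>2 \<le> D * a 1 \<and> (\<forall>i. Suc i < k \<longrightarrow> (a (Suc i))\<^sup>2 \<le> D * a (Suc (Suc i)) * a i)"
proof -
  obtain M0 where M0: "\<And>z. z \<in> \<Omega> \<Longrightarrow> norm (complex_hessian v z) \<le> M0" using v unfolding adm_def by blast
  define M where "M = max M0 0"
  have M: "norm (complex_hessian v z) \<le> M" if "z \<in> \<Omega>" for z using M0[OF that] by (simp add: M_def)
  define C1 where "C1 = real CARD('n) * real CARD('n) * M * real CARD('n)"
  have C1: "C1 \<ge> 0" by (simp add: C1_def M_def)
  define V0 where "V0 = \<bar>LINT z:\<Omega>|lborel. - v z\<bar>"
  \<comment> \<open>\<open>V0\<close> serves order 0, where \<open>b 0\<close> is the integral of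
    \<open>- v\<close>; \<open>C1\<close> serves higher orders, where \<open>b\<close> is at most
    \<open>C1\<close> times the preceding \<open>a\<close>.\<close>
  define D where "D = real k * C1 * (V0 + C1) / c\<^sup>2"
  have H: "hermitian (complex_hessian v z)" if "z \<in> \<Omega>" for z
    by (rule hermitian_complex_hessian[OF open_dom adm_C2[OF v] that])
  have main: "(\<forall>i\<le>k. a i \<ge> 0) \<and> (a 0)\<^sup>2 \<le> D * a 1 \<and> (\<forall>i. Suc i < k \<longrightarrow> (a (Suc i))\<^sup>2 \<le> D * a (Suc (Suc i)) * a i)"
    if uP: "u \<in> P0 k \<Omega>" and a_def: "a = (\<lambda>j. LINT z:\<Omega>|lborel. - u z * Re (esym_mat j (complex_hessian u z)))" for u a
  proof -
    note u = P0_adm[OF open_dom bounded_dom uP]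
    let ?e = "\<lambda>j z. Re (esym_mat j (complex_hessian u z))"
    define b where "b j = (LINT z:\<Omega>|lborel. - v z * ?e j z)" for j
    note bd = lin_op_dual_bounds[OF u(2) _ c dual H M, folded C1_def]
    have e0: "?e j z \<ge> 0" if "z \<in> \<Omega>" "j \<le> k" for j z
      using u(2)[OF that(1)] that(2) by (cases j) (auto simp: herm_Gamma_def)
    have Luu: "lin_op j u u z \<ge> 0" if "z \<in> \<Omega>" "j < k" for j z
      using e0[OF that(1), of "j + 1"] that(2) by (simp add: lin_op_self)
    have Luv: "lin_op j u v z \<ge> 0" if "z \<in> \<Omega>" "j < k" for j z
      using bd(1,2)[OF that(1,2,1,1,1)] c by (meson mult_nonneg_nonneg less_imp_le order_trans)
    have un: "u z \<le> 0" if "z \<in> \<Omega>" for z by (rule subharmonic_nonpos[OF u(1) Luu that]) (use k0 in auto)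
    \<comment> \<open>The Newton matrix of order 0 is the identity, so \<open>lin_op 0\<close> is
      the same Laplacian for all \<open>u\<close> and the maximum principle applies to
      \<open>v\<close>.\<close>
    have vn: "v z \<le> 0" if "z \<in> \<Omega>" for z
    proof (rule subharmonic_nonpos[OF v _ that])
      fix x assume x: "x \<in> \<Omega>"
      have "newton_mat 0 (complex_hessian v x) = newton_mat 0 (complex_hessian u x)" by simp
      then have "lin_op 0 v v x = lin_op 0 u v x" unfolding lin_op_def by metis
      then show "lin_op 0 v v x \<ge> 0" using Luv[OF x k0] by simp
    qed
    have uu: "adm \<Omega> (\<lambda>z. - u z)" and vv: "adm \<Omega> (\<lambda>z. - v z)" by (intro adm_uminus u v)+
    have a0: "a i \<ge> 0" if "i \<le> k" for i
      unfolding a_def by (intro set_integral_nonneg_dom mult_nonneg_nonneg) (use un e0 that in auto)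
    have b0: "b i \<ge> 0" if "i \<le> k" for i
      unfolding b_def by (intro set_integral_nonneg_dom mult_nonneg_nonneg) (use vn e0 that in auto)
    define X where "X j = (LINT z:\<Omega>|lborel. - u z * lin_op j u v z)" for j
    define Z where "Z j = (LINT z:\<Omega>|lborel. - v z * lin_op j u v z)" for j
    have Yb: "(LINT z:\<Omega>|lborel. - v z * lin_op j u u z) = real (j + 1) * b (j + 1)" for j
      unfolding lin_op_self b_def by (subst set_integral_mult_right[symmetric]) (simp add: mult_ac)
    have Aa: "(LINT z:\<Omega>|lborel. - u z * lin_op j u u z) = real (j + 1) * a (j + 1)" for j
      unfolding lin_op_self a_def by (subst set_integral_mult_right[symmetric]) (simp add: mult_ac)
    \<comment> \<open>Symmetry of the operator from the two one-sided swaps: both functions are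
      nonpositive with nonnegative \<open>lin_op\<close>.\<close>
    have XY: "X j = real (j + 1) * b (j + 1)" if j: "j < k" for j
      using energy_swap_le[OF u j u(1) un Luu[OF _ j] v vn] energy_swap_le[OF u j v vn Luv[OF _ j] u(1) un]
      unfolding X_def Yb[symmetric] by (intro antisym) auto
    have lowX: "c * a j \<le> X j" if j: "j < k" for j
    proof -
      have "(LINT z:\<Omega>|lborel. c * (- u z * ?e j z)) \<le> X j"
        unfolding X_def
      proof (rule set_integral_mono[OF set_integrable_mult_right[OF esym_integrable[OF u(1) uu]] lin_op_integrable[OF u(1) uu v]])
        fix z assume z: "z \<in> \<Omega>"
        have "- u z * (c * ?e j z) \<le> - u z * lin_op j u v z"
          using bd(2)[OF z j z z z] un[OF z] by (intro mult_left_mono) auto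
        then show "c * (- u z * ?e j z) \<le> - u z * lin_op j u v z" by (simp add: mult_ac)
      qed
      then show ?thesis by (simp only: a_def set_integral_mult_right)
    qed
    have upX: "X j \<le> C1 * a j" if j: "j < k" for j
    proof -
      have "X j \<le> (LINT z:\<Omega>|lborel. C1 * (- u z * ?e j z))"
        unfolding X_def
      proof (rule set_integral_mono[OF lin_op_integrable[OF u(1) uu v] set_integrable_mult_right[OF esym_integrable[OF u(1) uu]]])
        fix z assume z: "z \<in> \<Omega>"
        have "- u z * lin_op j u v z \<le> - u z * (C1 * ?e j z)"
          using bd(3)[OF z j z z z] un[OF z] by (intro mult_left_mono) auto
        then show "- u z * lin_op j u v z \<le> C1 * (- u z * ?e j z)" by (simp add: mult_ac)
      qed
      then show ?thesis by (simp only: a_def set_integral_mult_right)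
    qed
    have upZ: "Z j \<le> C1 * b j" if j: "j < k" for j
    proof -
      have "Z j \<le> (LINT z:\<Omega>|lborel. C1 * (- v z * ?e j z))"
        unfolding Z_def
      proof (rule set_integral_mono[OF lin_op_integrable[OF u(1) vv v] set_integrable_mult_right[OF esym_integrable[OF u(1) vv]]])
        fix z assume z: "z \<in> \<Omega>"
        have "- v z * lin_op j u v z \<le> - v z * (C1 * ?e j z)"
          using bd(3)[OF z j z z z] vn[OF z] by (intro mult_left_mono) auto
        then show "- v z * lin_op j u v z \<le> C1 * (- v z * ?e j z)" by (simp add: mult_ac)
      qed
      then show ?thesis by (simp only: b_def set_integral_mult_right)
    qed
    have Z0: "Z j \<ge> 0" if "j < k" for j
      unfolding Z_def by (intro set_integral_nonneg_dom mult_nonneg_nonneg) (use vn Luv that in auto)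
    \<comment> \<open>The energy of \<open>u + t v\<close> is a nonnegative quadratic polynomial in
      \<open>t\<close>, whose mixed coefficient is \<open>X j\<close> by the symmetry just
      shown.\<close>
    have cs: "(X j)\<^sup>2 \<le> (real (j + 1) * a (j + 1)) * Z j" if j: "j < k" for j
    proof (rule quadratic_nonneg_discriminant[OF _ Z0[OF j]])
      fix t
      let ?w = "\<lambda>z. u z + t * v z"
      have "0 \<le> (LINT z:\<Omega>|lborel. - ?w z * lin_op j u ?w z)"
        by (rule energy_nonneg[OF u j adm_combination[OF u(1) v]])
      also have "\<dots> = (LINT z:\<Omega>|lborel. (- u z * lin_op j u u z + t * (- v z * lin_op j u u z)) + (t * (- u z * lin_op j u v z) + t\<^sup>2 * (- v z * lin_op j u v z)))"
        using open_dom by (intro set_lebesgue_integral_cong) (auto simp: lin_op_combination[OF adm_C2[OF u(1)] adm_C2[OF v]] algebra_simps power2_eq_square)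
      also have "\<dots> = (real (j + 1) * a (j + 1) + t * (real (j + 1) * b (j + 1))) + (t * X j + t\<^sup>2 * Z j)"
        unfolding Aa[symmetric] Yb[symmetric] X_def Z_def
        by (subst set_integral_add(2) set_integral_mult_right;
            (intro set_integral_add(1) set_integrable_mult_right lin_op_integrable u v uu vv)?)+ simp
      also have "\<dots> = real (j + 1) * a (j + 1) + 2 * t * X j + t\<^sup>2 * Z j" using XY[OF j] by simp
      finally show "0 \<le> real (j + 1) * a (j + 1) + 2 * t * X j + t\<^sup>2 * Z j" .
    qed
    \<comment> \<open>The lower bound for \<open>X j\<close>, Cauchy-Schwarz and the upper bound for
      \<open>Z j\<close> in succession; \<open>j + 1\<close> is enlarged to
      \<open>k\<close>.\<close>
    have step: "(a j)\<^sup>2 \<le> real k * C1 * b j * a (j + 1) / c\<^sup>2" if j: "j < k" for j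
    proof -
      have ap: "a (j + 1) \<ge> 0" "b j \<ge> 0" "a j \<ge> 0" using a0 b0 j by auto
      have "(c * a j)\<^sup>2 \<le> (X j)\<^sup>2" using lowX[OF j] c ap by (intro power_mono) auto
      also have "\<dots> \<le> (real (j + 1) * a (j + 1)) * Z j" by (rule cs[OF j])
      also have "\<dots> \<le> (real k * a (j + 1)) * (C1 * b j)"
        using upZ[OF j] Z0[OF j] ap j by (intro mult_mono mult_right_mono) auto
      finally have "c\<^sup>2 * (a j)\<^sup>2 \<le> real k * C1 * b j * a (j + 1)" by (simp add: power_mult_distrib mult_ac)
      then show ?thesis using c by (simp add: pos_le_divide_eq mult.commute)
    qed
    have "(a 0)\<^sup>2 \<le> D * a 1"
    proof -
      have "b 0 \<le> V0 + C1" using C1 by (simp add: b_def V0_def)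
      then have "real k * C1 * b 0 * a 1 / c\<^sup>2 \<le> real k * C1 * (V0 + C1) * a 1 / c\<^sup>2"
        using C1 a0[of 1] k0 by (intro divide_right_mono mult_right_mono mult_left_mono) auto
      then show ?thesis using step[OF k0] by (simp add: D_def)
    qed
    moreover have "(a (Suc i))\<^sup>2 \<le> D * a (Suc (Suc i)) * a i" if i: "Suc i < k" for i
    proof -
      have "real (i + 1) * b (Suc i) \<le> C1 * a i" using upX[of i] XY[of i] i by simp
      moreover have "b (Suc i) \<le> real (i + 1) * b (Suc i)" using b0[of "Suc i"] i by (simp add: mult_le_cancel_right1)
      ultimately have "b (Suc i) \<le> C1 * a i" by linarith
      also have "\<dots> \<le> (V0 + C1) * a i" using a0[of i] i by (intro mult_right_mono) (auto simp: V0_def)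
      finally have "real k * C1 * b (Suc i) * a (Suc i + 1) / c\<^sup>2 \<le> real k * C1 * ((V0 + C1) * a i) * a (Suc i + 1) / c\<^sup>2"
        using C1 a0[of "Suc (Suc i)"] i by (intro divide_right_mono mult_right_mono mult_left_mono) auto
      then show ?thesis using step[OF i] by (simp add: D_def mult_ac)
    qed
    ultimately show ?thesis using a0 by blast
  qed
  have "D \<ge> 0" using C1 by (simp add: D_def V0_def)
  then show ?thesis using main by (intro exI[of _ D]) (auto simp: Let_def)
qed

end

subsection \<open>Smooth bump functions\<close>

text \<open>Differentiating \<open>p (1 / x) * exp (- 1 / x)\<close> replaces \<open>p\<close> by
  \<open>p\<close> minus its derivative and multiplies by \<open>1 / x\<^sup>2\<close>, which is the
  factor with coefficients 0, 0, 1.\<close>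

primrec bump_poly :: "nat \<Rightarrow> real poly" where
  "bump_poly 0 = 1"
| "bump_poly (Suc j) = [:0, 0, 1:] * (bump_poly j - pderiv (bump_poly j))"

text \<open>\<open>bump j\<close> is the \<open>j\<close>-th derivative of \<open>exp (- 1 / x)\<close>, extended by zero.\<close>

definition bump :: "nat \<Rightarrow> real \<Rightarrow> real" where
  "bump j x = (if x \<le> 0 then 0 else poly (bump_poly j) (1 / x) * exp (- (1 / x)))"

lemma poly_exp_tendsto_0: "((\<lambda>y. y ^ k * poly p y * exp (- y)) \<longlongrightarrow> (0::real)) at_top"
proof (induction p arbitrary: k)
  case (pCons a p)
  have "((\<lambda>y. a * (y ^ k / exp y) + y ^ Suc k * poly p y * exp (- y)) \<longlongrightarrow> a * 0 + 0) at_top"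
    by (intro tendsto_add tendsto_mult tendsto_const tendsto_power_div_exp_0 pCons)
  then show ?case by (simp add: exp_minus field_simps)
qed simp

lemma bump_deriv: "(bump j has_real_derivative bump (Suc j) x) (at x)"
proof -
  consider "x > 0" | "x < 0" | "x = 0" by linarith
  then show ?thesis
  proof cases
    case 1
    have "((\<lambda>x. poly (bump_poly j) (1 / x) * exp (- (1 / x))) has_real_derivative
       poly (pderiv (bump_poly j)) (1 / x) * (- (1 / x\<^sup>2)) * exp (- (1 / x)) + poly (bump_poly j) (1 / x) * (exp (- (1 / x)) * (1 / x\<^sup>2))) (at x)"
      using 1 by (auto intro!: derivative_eq_intros DERIV_chain2[OF poly_DERIV] simp: power2_eq_square field_simps)
    moreover have "poly (pderiv (bump_poly j)) (1 / x) * (- (1 / x\<^sup>2)) * exp (- (1 / x)) + poly (bump_poly j) (1 / x) * (exp (- (1 / x)) * (1 / x\<^sup>2)) = bump (Suc j) x"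
      using 1 by (simp add: bump_def power2_eq_square field_simps)
    ultimately have "((\<lambda>x. poly (bump_poly j) (1 / x) * exp (- (1 / x))) has_real_derivative bump (Suc j) x) (at x)" by simp
    then show ?thesis
      by (rule has_field_derivative_transform_within_open[of _ _ _ "{0<..}"]) (use 1 in \<open>auto simp: bump_def\<close>)
  next
    case 2
    have "((\<lambda>_. 0) has_real_derivative bump (Suc j) x) (at x)" using 2 by (simp add: bump_def)
    then show ?thesis
      by (rule has_field_derivative_transform_within_open[of _ _ _ "{..<0}"]) (use 2 in \<open>auto simp: bump_def\<close>)
  next
    case 3
    \<comment> \<open>In the variable \<open>1 / h\<close> the difference quotient at 0 from the
      right is a polynomial times a decaying exponential.\<close>
    have "((\<lambda>y. y ^ 1 * poly (bump_poly j) y * exp (- y)) \<longlongrightarrow> 0) at_top" by (rule poly_exp_tendsto_0)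
    then have "((\<lambda>h. (inverse h) ^ 1 * poly (bump_poly j) (inverse h) * exp (- inverse h)) \<longlongrightarrow> 0) (at_right 0)"
      by (rule filterlim_compose[OF _ filterlim_inverse_at_top_right])
    then have "((\<lambda>h. bump j h / h) \<longlongrightarrow> 0) (at_right 0)"
      by (rule Lim_transform_eventually) (auto simp: eventually_at_filter bump_def field_simps)
    moreover have "((\<lambda>h. bump j h / h) \<longlongrightarrow> 0) (at_left 0)"
      by (rule Lim_transform_eventually[OF tendsto_const]) (auto simp: eventually_at_filter bump_def)
    ultimately have "((\<lambda>h. bump j h / h) \<longlongrightarrow> 0) (at 0)" by (simp add: filterlim_at_split)
    then show ?thesis using 3 by (simp add: DERIV_def bump_def)
  qed
qed

lemma C_diff_bump: "open U \<Longrightarrow> C_diff r U f \<Longrightarrow> C_diff r U (\<lambda>x. bump 0 (f x))"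
  by (rule C_diff_compose[where \<phi> = bump]) (auto intro: bump_deriv DERIV_continuous_on[OF bump_deriv])

lemma bump_0: "bump 0 x \<ge> 0" "bump 0 x > 0 \<longleftrightarrow> x > 0"
  by (auto simp: bump_def)

text \<open>Local defining functions have to be smooth of every order, so the C^2 profiles
  \<open>ppos\<close> do not serve for gluing them.\<close>

definition ball_bump :: "'a::euclidean_space \<Rightarrow> real \<Rightarrow> 'a \<Rightarrow> real" where
  "ball_bump c r z = bump 0 (r\<^sup>2 - (z - c) \<bullet> (z - c))"

lemma C_diff_ball_bump: "C_diff s U (ball_bump c r)"
proof -
  have "C_diff s UNIV (ball_bump c r)"
    unfolding ball_bump_def[abs_def] by (intro C_diff_bump C_diff_diff C_diff_const C_diff_inner) auto
  then show ?thesis by (rule C_diff_subset) simp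
qed

lemma ball_bump:
  assumes "r > 0"
  shows "ball_bump c r z \<ge> 0" "ball_bump c r z > 0 \<longleftrightarrow> z \<in> ball c r" "z \<notin> ball c r \<Longrightarrow> ball_bump c r z = 0"
proof -
  show 0: "ball_bump c r z \<ge> 0" unfolding ball_bump_def by (rule bump_0)
  have "(z - c) \<bullet> (z - c) = (dist c z)\<^sup>2"
    by (simp add: dist_norm power2_norm_eq_inner inner_diff_left inner_diff_right inner_commute)
  moreover have "(dist c z)\<^sup>2 < r\<^sup>2 \<longleftrightarrow> dist c z < r" using assms by (auto intro: power2_less_imp_less power_strict_mono)
  ultimately show 1: "ball_bump c r z > 0 \<longleftrightarrow> z \<in> ball c r" unfolding ball_bump_def bump_0 by simp
  show "z \<notin> ball c r \<Longrightarrow> ball_bump c r z = 0" using 0 1 by linarith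
qed

subsection \<open>A global defining function\<close>

lemma right_derivative_nonpos:
  fixes f :: "real \<Rightarrow> real"
  assumes "(f has_real_derivative d) (at 0)" "e > 0" "\<And>t. 0 < t \<Longrightarrow> t < e \<Longrightarrow> f t \<le> f 0"
  shows "d \<le> 0"
proof (rule ccontr)
  assume "\<not> d \<le> 0"
  then obtain s where "s > 0" "\<And>h. h > 0 \<Longrightarrow> h < s \<Longrightarrow> f 0 < f (0 + h)"
    using DERIV_pos_inc_right[OF assms(1)] by auto
  then show False using assms(2) assms(3)[of "min s e / 2"] by (smt (verit) field_sum_of_halves)
qed

lemma second_derivative_nonneg:
  fixes f :: "real \<Rightarrow> real"
  assumes f: "\<And>t. (f has_real_derivative f' t) (at t)" "(f' has_real_derivative d) (at 0)" and min: "\<And>t. f 0 \<le> f t"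
  shows "d \<ge> 0"
proof (rule ccontr)
  assume "\<not> d \<ge> 0"
  have f0: "f' 0 = 0" by (rule DERIV_local_min[OF f(1), of 1]) (use min in auto)
  obtain s where s: "s > 0" "\<And>h. h > 0 \<Longrightarrow> h < s \<Longrightarrow> f' (0 + h) < f' 0"
    using DERIV_neg_dec_right[OF f(2)] \<open>\<not> d \<ge> 0\<close> by auto
  have "f (s / 2) < f 0"
  proof (rule DERIV_neg_imp_decreasing_open[of 0 "s / 2"])
    show "continuous_on {0..s / 2} f" using f(1) by (auto intro: DERIV_continuous_on has_field_derivative_at_within)
    fix x assume "0 < x" "x < s / 2"
    then show "\<exists>y. DERIV f x :> y \<and> y < 0" using f(1)[of x] s(2)[of x] f0 s(1) by auto
  qed (use s in simp)
  then show False using min[of "s / 2"] by simp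
qed

text \<open>Local defining functions agree in sign, so weighted by bumps they can be added without
  normalization; bumps over the remaining compact part are subtracted to keep the sum negative
  there. The gradient survives because along an inward ray the sum lies below a single term, and
  both vanish at the boundary point.\<close>

lemma global_defining_function:
  fixes \<Omega> :: "(complex^'n) set"
  assumes \<Omega>: "smooth_bounded_domain \<Omega>"
  obtains \<rho> where "\<And>r. C_diff r UNIV \<rho>" "\<And>z. z \<in> \<Omega> \<longleftrightarrow> \<rho> z < 0" "\<And>z. z \<in> frontier \<Omega> \<Longrightarrow> \<rho> z = 0"
    "\<And>z. z \<in> frontier \<Omega> \<Longrightarrow> \<exists>v. frechet_derivative \<rho> (at z) v \<noteq> 0"
proof -
  have op: "open \<Omega>" and bd: "bounded \<Omega>" using \<Omega> by (auto simp: smooth_bounded_domain_def)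
  have fc: "compact (frontier \<Omega>)" using bd by (rule compact_frontier_bounded)
  have fn: "z \<notin> \<Omega>" if "z \<in> frontier \<Omega>" for z using that op by (simp add: frontier_def interior_open)
  have "\<forall>p\<in>frontier \<Omega>. \<exists>U \<rho> r. local_defining_function \<Omega> p U \<rho> \<and> r > 0 \<and> cball p r \<subseteq> U"
  proof
    fix p assume "p \<in> frontier \<Omega>"
    then obtain U \<rho> where l: "local_defining_function \<Omega> p U \<rho>" using \<Omega> unfolding smooth_bounded_domain_def by blast
    then obtain r where "r > 0" "cball p r \<subseteq> U" unfolding local_defining_function_def by (meson open_contains_cball)
    then show "\<exists>U \<rho> r. local_defining_function \<Omega> p U \<rho> \<and> r > 0 \<and> cball p r \<subseteq> U" using l by blast
  qed
  then obtain U L r where loc: "\<And>p. p \<in> frontier \<Omega> \<Longrightarrow> local_defining_function \<Omega> p (U p) (L p)"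
    and r: "\<And>p. p \<in> frontier \<Omega> \<Longrightarrow> r p > 0" "\<And>p. p \<in> frontier \<Omega> \<Longrightarrow> cball p (r p) \<subseteq> U p" by metis
  have oU: "open (U p)" and LC: "C_diff s (U p) (L p)" and Ld: "z \<in> U p \<Longrightarrow> frechet_derivative (L p) (at z) \<noteq> (\<lambda>_. 0)"
    and LO: "z \<in> U p \<Longrightarrow> z \<in> \<Omega> \<longleftrightarrow> L p z < 0" if "p \<in> frontier \<Omega>" for p s z
    using loc[OF that] unfolding local_defining_function_def by auto
  have "frontier \<Omega> \<subseteq> (\<Union>p\<in>frontier \<Omega>. ball p (r p))" using r by fastforce
  then obtain F where F: "F \<subseteq> frontier \<Omega>" "finite F" "frontier \<Omega> \<subseteq> (\<Union>p\<in>F. ball p (r p))"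
    using compactE_image[OF fc, of "frontier \<Omega>" "\<lambda>p. ball p (r p)"] by auto
  define T where "T p z = (if z \<in> U p then ball_bump p (r p) z * L p z else 0)" for p z
  have TC: "C_diff s UNIV (T p)" if p: "p \<in> F" for p s
  proof -
    have pf: "p \<in> frontier \<Omega>" using p F by auto
    show ?thesis unfolding T_def[abs_def]
    proof (rule C_diff_extend_by_zero[OF oU[OF pf] _ r(2)[OF pf]])
      show "C_diff s (U p) (\<lambda>z. ball_bump p (r p) z * L p z)"
        by (intro C_diff_mult oU[OF pf] C_diff_ball_bump LC[OF pf])
      show "ball_bump p (r p) z * L p z = 0" if "z \<in> U p - cball p (r p)" for z
        using ball_bump(3)[OF r(1)[OF pf], of z p] that by auto
    qed simp
  qed
  define N where "N = (\<Union>p\<in>F. ball p (r p))"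
  define K where "K = closure \<Omega> - N"
  have "open N" by (auto simp: N_def)
  then have Kc: "compact K" using bd unfolding K_def by (simp add: compact_diff compact_closure)
  have K\<Omega>: "K \<subseteq> \<Omega>" using F(3) op by (auto simp: K_def N_def frontier_def interior_open)
  have "\<forall>q\<in>K. \<exists>s>0. cball q s \<subseteq> \<Omega>" using K\<Omega> op by (meson open_contains_cball subsetD)
  then obtain s where s: "\<And>q. q \<in> K \<Longrightarrow> s q > 0 \<and> cball q (s q) \<subseteq> \<Omega>" by metis
  have "K \<subseteq> (\<Union>q\<in>K. ball q (s q))" using s by fastforce
  then obtain G where G: "G \<subseteq> K" "finite G" "K \<subseteq> (\<Union>q\<in>G. ball q (s q))"
    using compactE_image[OF Kc, of K "\<lambda>q. ball q (s q)"] by auto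
  define E where "E z = (\<Sum>q\<in>G. ball_bump q (s q) z)" for z
  have sG: "s q > 0" "cball q (s q) \<subseteq> \<Omega>" if "q \<in> G" for q using s G that by auto
  have rF: "r p > 0" "p \<in> frontier \<Omega>" if "p \<in> F" for p using r F that by auto
  have E0: "E z \<ge> 0" for z unfolding E_def by (intro sum_nonneg ball_bump sG)
  define \<rho> where "\<rho> z = (\<Sum>p\<in>F. T p z) - E z" for z
  have \<rho>C: "C_diff i UNIV \<rho>" for i
    unfolding \<rho>_def[abs_def] E_def by (intro C_diff_diff C_diff_sum TC C_diff_ball_bump) auto
  have Tneg: "T p z \<le> 0" if "p \<in> F" "z \<in> \<Omega>" for p z
    using that LO[OF rF(2)[OF that(1)], of z] ball_bump(1)[OF rF(1)[OF that(1)], of p z] by (auto simp: T_def mult_nonneg_nonpos)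
  have Tpos: "T p z \<ge> 0" if "p \<in> F" "z \<notin> \<Omega>" for p z
    using that LO[OF rF(2)[OF that(1)], of z] ball_bump(1)[OF rF(1)[OF that(1)], of p z] by (auto simp: T_def not_less)
  have inn: "\<rho> z < 0" if z: "z \<in> \<Omega>" for z
  proof (cases "z \<in> N")
    case True
    then obtain p where p: "p \<in> F" "z \<in> ball p (r p)" by (auto simp: N_def)
    then have "z \<in> U p" using r(2)[OF rF(2)[OF p(1)]] by auto
    moreover have "ball_bump p (r p) z > 0" using ball_bump(2)[OF rF(1)[OF p(1)], of p z] p(2) by simp
    ultimately have "T p z < 0" using LO[OF rF(2)[OF p(1)]] z by (auto simp: T_def mult_pos_neg)
    then have "(\<Sum>p\<in>F. T p z) < (\<Sum>p\<in>F. 0)" using F(2) p(1) Tneg[OF _ z] by (intro sum_strict_mono_ex1) auto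
    then show ?thesis using E0[of z] by (simp add: \<rho>_def)
  next
    case False
    then have "z \<in> K" using z closure_subset by (auto simp: K_def)
    then obtain q where q: "q \<in> G" "z \<in> ball q (s q)" using G by auto
    then have "ball_bump q (s q) z > 0" using ball_bump(2)[OF sG(1), of q q z] by blast
    then have "E z > 0" unfolding E_def using G(2) q(1) by (intro sum_pos2[of G q]) (auto intro: ball_bump sG)
    moreover have "(\<Sum>p\<in>F. T p z) \<le> 0" by (intro sum_nonpos Tneg z)
    ultimately show ?thesis by (simp add: \<rho>_def)
  qed
  have out: "\<rho> z \<ge> 0" if z: "z \<notin> \<Omega>" for z
  proof -
    have "ball_bump q (s q) z = 0" if "q \<in> G" for q
    proof (rule ball_bump(3)[OF sG(1)[OF that]])
      show "z \<notin> ball q (s q)" using ball_subset_cball[of q "s q"] sG(2)[OF that] z by blast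
    qed
    then have "E z = 0" by (simp add: E_def)
    moreover have "(\<Sum>p\<in>F. T p z) \<ge> 0" by (intro sum_nonneg Tpos z)
    ultimately show ?thesis by (simp add: \<rho>_def)
  qed
  have \<rho>cont: "continuous_on UNIV \<rho>" by (rule C_diff_continuous[OF \<rho>C])
  have zero: "\<rho> z = 0" if z: "z \<in> frontier \<Omega>" for z
  proof -
    have "\<rho> z \<le> 0"
      by (rule continuous_le_on_closure[OF continuous_on_subset[OF \<rho>cont]]) (use z inn in \<open>auto simp: frontier_def less_imp_le\<close>)
    then show ?thesis using out[OF fn[OF z]] by simp
  qed
  have grad: "\<exists>v. frechet_derivative \<rho> (at z) v \<noteq> 0" if z: "z \<in> frontier \<Omega>" for z
  proof -
    obtain p where p: "p \<in> F" "z \<in> ball p (r p)" using F(3) z by auto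
    note pf = rF(2)[OF p(1)]
    have zU: "z \<in> U p" using r(2)[OF pf] p(2) by auto
    let ?B = "ball_bump p (r p)"
    have Bz: "?B z > 0" using ball_bump(2)[OF r(1)[OF pf], of p z] p(2) by simp
    have Ldf: "(L p has_derivative frechet_derivative (L p) (at z)) (at z)"
      using C_diff_differentiable[OF LC[OF pf, of "Suc 0"] zU] .
    \<comment> \<open>A positive value would persist nearby and keep points of
      \<open>\<Omega>\<close> away from \<open>z\<close>.\<close>
    have Lz: "L p z = 0"
    proof (rule ccontr)
      assume "L p z \<noteq> 0"
      moreover have "L p z \<ge> 0" using LO[OF pf zU] fn[OF z] by simp
      ultimately have pos: "L p z > 0" by simp
      have "open (U p \<inter> L p -` {0<..})"
        by (intro continuous_open_preimage oU[OF pf] C_diff_continuous[OF LC[OF pf]]) auto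
      moreover have "z \<in> U p \<inter> L p -` {0<..}" using zU pos by auto
      moreover have "z \<in> closure \<Omega>" using z by (simp add: frontier_def)
      ultimately obtain y where "y \<in> \<Omega>" "y \<in> U p" "L p y > 0" unfolding closure_iff_nhds_not_empty by blast
      then show False using LO[OF pf] by force
    qed
    have "\<exists>v. frechet_derivative (L p) (at z) v \<noteq> 0" using Ld[OF pf zU] by blast
    then obtain v0 where v0: "frechet_derivative (L p) (at z) v0 \<noteq> 0" by blast
    have lin: "linear (frechet_derivative (L p) (at z))" using Ldf by (rule has_derivative_linear)
    \<comment> \<open>The sign is chosen so that \<open>L p\<close> decreases and the ray enters
      \<open>\<Omega>\<close>, where all terms of the sum are nonpositive.\<close>
    define v where "v = (if frechet_derivative (L p) (at z) v0 < 0 then v0 else - v0)"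
    have v: "frechet_derivative (L p) (at z) v < 0" using v0 by (auto simp: v_def linear_neg[OF lin])
    let ?l = "\<lambda>t::real. z + t *\<^sub>R v"
    have dL: "((\<lambda>t. L p (?l t)) has_real_derivative frechet_derivative (L p) (at z) v) (at 0)"
      unfolding has_real_derivative_iff_has_vector_derivative using Ldf by (intro frechet_derivative_line) simp
    have dB: "((\<lambda>t. ?B (?l t)) has_real_derivative frechet_derivative ?B (at z) v) (at 0)"
      unfolding has_real_derivative_iff_has_vector_derivative
      using C_diff_differentiable[OF C_diff_ball_bump[of "Suc 0" UNIV p "r p"], of z] by (intro frechet_derivative_line) simp
    have d\<rho>: "((\<lambda>t. \<rho> (?l t)) has_real_derivative frechet_derivative \<rho> (at z) v) (at 0)"
      unfolding has_real_derivative_iff_has_vector_derivative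
      using C_diff_differentiable[OF \<rho>C[of "Suc 0"], of z] by (intro frechet_derivative_line) simp
    have dBL: "((\<lambda>t. ?B (?l t) * L p (?l t)) has_real_derivative ?B z * frechet_derivative (L p) (at z) v) (at 0)"
      using DERIV_mult[OF dB dL] Lz by (simp add: mult.commute)
    obtain e1 where e1: "e1 > 0" "\<And>t. 0 < t \<Longrightarrow> t < e1 \<Longrightarrow> L p (?l t) < 0"
      using DERIV_neg_dec_right[OF dL v] Lz by auto
    have "open (?l -` U p)" by (intro open_vimage oU[OF pf] continuous_intros)
    then obtain e2 where e2: "e2 > 0" "\<And>t. \<bar>t\<bar> < e2 \<Longrightarrow> ?l t \<in> U p"
      using zU unfolding open_dist by (auto simp: dist_real_def dest!: bspec[of _ _ 0])
    have "frechet_derivative \<rho> (at z) v - ?B z * frechet_derivative (L p) (at z) v \<le> 0"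
    proof (rule right_derivative_nonpos[OF DERIV_diff[OF d\<rho> dBL], of "min e1 e2"])
      fix t :: real assume t: "0 < t" "t < min e1 e2"
      then have U: "?l t \<in> U p" and neg: "L p (?l t) < 0" using e1 e2 by auto
      then have \<Omega>t: "?l t \<in> \<Omega>" using LO[OF pf] by blast
      have "(\<Sum>q\<in>F. T q (?l t)) = T p (?l t) + (\<Sum>q\<in>F - {p}. T q (?l t))" using F(2) p(1) by (simp add: sum.remove)
      also have "(\<Sum>q\<in>F - {p}. T q (?l t)) \<le> 0" using Tneg[OF _ \<Omega>t] by (intro sum_nonpos) auto
      finally have "\<rho> (?l t) \<le> T p (?l t)" using E0[of "?l t"] by (simp add: \<rho>_def)
      then show "\<rho> (?l t) - ?B (?l t) * L p (?l t) \<le> \<rho> (?l 0) - ?B (?l 0) * L p (?l 0)"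
        using U zero[OF z] Lz by (simp add: T_def)
    qed (use e1 e2 in auto)
    moreover have "?B z * frechet_derivative (L p) (at z) v < 0" using Bz v by (rule mult_pos_neg)
    ultimately show ?thesis by (intro exI[of _ v]) linarith
  qed
  show thesis
    by (rule that[OF \<rho>C _ zero grad]) (use inn out in force)+
qed

lemma frechet_complex_gradient:
  fixes u :: "complex^'n \<Rightarrow> real"
  assumes "u differentiable (at x)"
  shows "frechet_derivative u (at x) v = (\<Sum>i\<in>UNIV. Re (v $ i) * frechet_derivative u (at x) (axis i 1) + Im (v $ i) * frechet_derivative u (at x) (axis i \<i>))"
    and "frechet_derivative u (at x) v = 2 * Re (\<Sum>i\<in>UNIV. complex_gradient u x $ i * v $ i)"
proof -
  have lin: "linear (frechet_derivative u (at x))" using assms by (rule linear_frechet_derivative)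
  have "v = (\<Sum>i\<in>UNIV. Re (v $ i) *\<^sub>R axis i 1 + Im (v $ i) *\<^sub>R axis i \<i>)"
  proof -
    have "(\<Sum>i\<in>UNIV. Re (v $ i) *\<^sub>R axis i 1 + Im (v $ i) *\<^sub>R axis i \<i>) $ j = (\<Sum>i\<in>UNIV. if i = j then v $ j else 0)" for j
      unfolding sum_component by (rule sum.cong) (auto simp: axis_def complex_eq_iff)
    then show ?thesis by (simp add: vec_eq_iff)
  qed
  then have "frechet_derivative u (at x) v = frechet_derivative u (at x) (\<Sum>i\<in>UNIV. Re (v $ i) *\<^sub>R axis i 1 + Im (v $ i) *\<^sub>R axis i \<i>)" by simp
  then show 1: "frechet_derivative u (at x) v = (\<Sum>i\<in>UNIV. Re (v $ i) * frechet_derivative u (at x) (axis i 1) + Im (v $ i) * frechet_derivative u (at x) (axis i \<i>))"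
    by (simp add: linear_sum[OF lin] linear_add[OF lin] linear_scale[OF lin])
  show "frechet_derivative u (at x) v = 2 * Re (\<Sum>i\<in>UNIV. complex_gradient u x $ i * v $ i)"
    unfolding 1 Re_sum sum_distrib_left
    by (rule sum.cong) (auto simp: complex_gradient_eq[OF assms] algebra_simps)
qed

text \<open>Averaging the real Hessian over the directions \<open>\<xi>\<close> and
  \<open>\<i> *s \<xi>\<close> cancels its parts of type (2,0) and (0,2) and leaves the complex
  Hessian.\<close>

lemma second_derivative_expand:
  fixes u :: "complex^'n \<Rightarrow> real" and x \<xi> :: "complex^'n"
  assumes u: "C_diff 2 UNIV u"
  defines "H \<equiv> \<lambda>v w. frechet_derivative (\<lambda>y. frechet_derivative u (at y) w) (at x) v"
  shows "Re (sform (complex_hessian u x) \<xi> \<xi>) = (H \<xi> \<xi> + H (\<i> *s \<xi>) (\<i> *s \<xi>)) / 4"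
proof -
  have Hw: "H v w = (\<Sum>j\<in>UNIV. Re (w $ j) * H v (axis j 1) + Im (w $ j) * H v (axis j \<i>))" for v w
  proof -
    have d: "(\<lambda>y. frechet_derivative u (at y) a) differentiable (at x)" for a by (rule C2_diffble(2)[OF u UNIV_I])
    let ?g = "\<lambda>y. \<Sum>j\<in>UNIV. Re (w $ j) * frechet_derivative u (at y) (axis j 1) + Im (w $ j) * frechet_derivative u (at y) (axis j \<i>)"
    have e1: "(\<lambda>y. frechet_derivative u (at y) w) = ?g"
      by (intro ext frechet_complex_gradient(1)[OF C2_diffble(1)[OF u UNIV_I]])
    have "(?g has_derivative (\<lambda>v. \<Sum>j\<in>UNIV. Re (w $ j) * H v (axis j 1) + Im (w $ j) * H v (axis j \<i>))) (at x)"
      unfolding H_def using d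
      by (intro has_derivative_sum has_derivative_add has_derivative_mult_right) (simp_all add: frechet_derivative_works)
    then have "frechet_derivative ?g (at x) v = (\<Sum>j\<in>UNIV. Re (w $ j) * H v (axis j 1) + Im (w $ j) * H v (axis j \<i>))"
      by (rule fun_cong[OF frechet_derivative_at[symmetric]])
    moreover have "H v w = frechet_derivative ?g (at x) v" unfolding H_def e1 ..
    ultimately show ?thesis by simp
  qed
  have Hv: "H v a = (\<Sum>i\<in>UNIV. Re (v $ i) * H (axis i 1) a + Im (v $ i) * H (axis i \<i>) a)" for v a
    unfolding H_def by (rule frechet_complex_gradient(1)[OF C2_diffble(2)[OF u UNIV_I]])
  have HH: "H v v = (\<Sum>i\<in>UNIV. \<Sum>j\<in>UNIV. Re (v $ i) * Re (v $ j) * H (axis i 1) (axis j 1) + Im (v $ i) * Re (v $ j) * H (axis i \<i>) (axis j 1)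
      + Re (v $ i) * Im (v $ j) * H (axis i 1) (axis j \<i>) + Im (v $ i) * Im (v $ j) * H (axis i \<i>) (axis j \<i>))" for v
  proof -
    have "H v v = (\<Sum>j\<in>UNIV. Re (v $ j) * (\<Sum>i\<in>UNIV. Re (v $ i) * H (axis i 1) (axis j 1) + Im (v $ i) * H (axis i \<i>) (axis j 1))
       + Im (v $ j) * (\<Sum>i\<in>UNIV. Re (v $ i) * H (axis i 1) (axis j \<i>) + Im (v $ i) * H (axis i \<i>) (axis j \<i>)))"
      by (subst Hw, rule sum.cong[OF refl], subst (1 2) Hv, rule refl)
    also have "\<dots> = (\<Sum>j\<in>UNIV. \<Sum>i\<in>UNIV. Re (v $ i) * Re (v $ j) * H (axis i 1) (axis j 1) + Im (v $ i) * Re (v $ j) * H (axis i \<i>) (axis j 1)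
      + Re (v $ i) * Im (v $ j) * H (axis i 1) (axis j \<i>) + Im (v $ i) * Im (v $ j) * H (axis i \<i>) (axis j \<i>))"
      unfolding sum_distrib_left sum.distrib[symmetric] by (intro sum.cong refl) (simp add: algebra_simps)
    finally show ?thesis by (subst sum.swap)
  qed
  have "4 * Re (sform (complex_hessian u x) \<xi> \<xi>) = H \<xi> \<xi> + H (\<i> *s \<xi>) (\<i> *s \<xi>)"
    unfolding HH sform_def Re_sum sum_distrib_left sum.distrib[symmetric]
    by (intro sum.cong refl) (simp add: complex_hessian_eq[OF open_UNIV u UNIV_I] H_def field_simps)
  then show ?thesis by simp
qed

subsection \<open>Symmetric functions of the Levi form\<close>

lemma esym_scale: "esym j I (\<lambda>i. c * f i) = c ^ j * esym j I f"
  unfolding esym_def sum_distrib_left by (intro sum.cong refl) (auto simp: prod.distrib)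

lemma esym_nonneg: "(\<And>i. i \<in> I \<Longrightarrow> f i \<ge> 0) \<Longrightarrow> esym j I f \<ge> (0::real)"
  unfolding esym_def by (intro sum_nonneg prod_nonneg) auto

text \<open>Padding with zeros to a diagonal matrix of full size leaves the symmetric functions
  unchanged and reduces the claim to \<open>herm_Gamma_lower_positive\<close>.\<close>

lemma esym_lower_positive:
  fixes \<nu> :: "nat \<Rightarrow> real"
  assumes "finite I" "card I < CARD('n::finite)" and j: "j < CARD('n)" "esym j I \<nu> > 0" "\<And>i. i \<le> j \<Longrightarrow> esym i I \<nu> \<ge> 0" and i: "i \<le> j"
  shows "esym i I \<nu> > 0"
proof -
  obtain J :: "'n set" where J: "card J = card I" using assms(2) by (metis obtain_subset_with_card_n less_imp_le)
  obtain f where f: "bij_betw f J I" using J assms(1) by (metis bij_betw_iff_card finite)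
  define d where "d x = (if x \<in> J then \<nu> (f x) else 0)" for x
  have d: "esym l UNIV d = esym l I \<nu>" for l
  proof -
    have "esym l UNIV d = esym l J d"
      unfolding esym_def
    proof (rule sum.mono_neutral_right)
      show "\<forall>X\<in>{X. X \<subseteq> UNIV \<and> card X = l} - {X. X \<subseteq> J \<and> card X = l}. prod d X = 0"
      proof
        fix X assume "X \<in> {X. X \<subseteq> UNIV \<and> card X = l} - {X. X \<subseteq> J \<and> card X = l}"
        then obtain x where "x \<in> X" "x \<notin> J" by auto
        then show "prod d X = 0" by (intro prod_zero bexI[of _ x]) (auto simp: d_def)
      qed
    qed auto
    also have "\<dots> = esym l J (\<lambda>x. \<nu> (f x))" unfolding esym_def by (intro sum.cong refl prod.cong) (auto simp: d_def)
    also have "\<dots> = esym l I \<nu>" by (rule esym_reindex[OF f])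
    finally show ?thesis .
  qed
  let ?A = "diag_mat (\<lambda>x. complex_of_real (d x)) :: complex^'n^'n"
  have e: "Re (esym_mat l ?A) = esym l I \<nu>" for l by (simp add: newton_mat_diag esym_of_real d)
  have "hermitian ?A" by (rule hermitianI) (auto simp: diag_mat_def)
  then have "?A \<in> herm_Gamma j" using j(3) by (simp add: herm_Gamma_def e)
  from herm_Gamma_lower_positive[OF this _ _ i] show ?thesis using j e by simp
qed

text \<open>At points with nonzero gradient this is, up to a power of the gradient norm, the
  symmetric function of order \<open>j\<close> of the Levi eigenvalues. Being polynomial in
  derivatives of \<open>\<rho>\<close>, it is visibly continuous, unlike a chosen system of
  eigenvalues.\<close>

definition levi_sym :: "nat \<Rightarrow> (complex^'n \<Rightarrow> real) \<Rightarrow> complex^'n \<Rightarrow> real" where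
  "levi_sym j \<rho> p = Re (trace (newton_mat j (complex_hessian \<rho> p) ** gout (complex_gradient \<rho> p) (complex_gradient \<rho> p)))"

lemma levi_form_sform: "levi_form \<rho> p \<xi> \<eta> = sform (complex_hessian \<rho> p) \<xi> \<eta> / of_real (norm (complex_gradient \<rho> p))"
  by (simp add: levi_form_def sform_def)

text \<open>The complex tangent space is the orthogonal complement of the conjugate gradient, so the
  single vector in \<open>W\<close> leaves room for \<open>CARD('n) - 1\<close>
  eigenvectors.\<close>

lemma levi_eigenbasis_exists:
  fixes \<rho> :: "complex^'n \<Rightarrow> real"
  assumes "hermitian (complex_hessian \<rho> p)"
  shows "\<exists>e \<mu>. levi_eigenbasis \<rho> p e \<mu>"
proof -
  let ?g = "complex_gradient \<rho> p"
  have t: "herm_inner y (\<chi> i. cnj (?g $ i)) = (\<Sum>i\<in>UNIV. ?g $ i * y $ i)" for y by (simp add: herm_inner_def mult.commute)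
  have "CARD('n) - 1 + card {\<chi> i. cnj (?g $ i)} \<le> CARD('n)" by simp
  from hermitian_eigenbasis_on[OF assms _ this] obtain e \<mu> where
    e: "\<forall>a<CARD('n) - 1. (\<Sum>i\<in>UNIV. ?g $ i * e a $ i) = 0"
      "\<forall>a<CARD('n) - 1. \<forall>b<CARD('n) - 1. herm_inner (e a) (e b) = (if a = b then 1 else 0)"
      "\<forall>a<CARD('n) - 1. \<forall>y. (\<Sum>i\<in>UNIV. ?g $ i * y $ i) = 0 \<longrightarrow>
         sform (complex_hessian \<rho> p) (e a) y = complex_of_real (\<mu> a) * herm_inner (e a) y"
    by (auto simp: t)
  have "levi_eigenbasis \<rho> p e (\<lambda>a. \<mu> a / norm ?g)"
    unfolding levi_eigenbasis_def levi_form_sform complex_tangent_def using e by auto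
  then show ?thesis by blast
qed

text \<open>\<open>levi_form\<close> is divided by the gradient norm, so the Hessian itself has
  tangential eigenvalues \<open>\<mu> a\<close> times that norm. Homogeneity gives the power
  \<open>j\<close>, and the rank-one matrix two further powers.\<close>

lemma levi_eigenbasis_sym:
  fixes \<rho> :: "complex^'n \<Rightarrow> real"
  assumes H: "hermitian (complex_hessian \<rho> p)" and g: "complex_gradient \<rho> p \<noteq> 0" and e: "levi_eigenbasis \<rho> p e \<mu>"
    and j: "j < CARD('n)"
  shows "levi_sym j \<rho> p = norm (complex_gradient \<rho> p) ^ (j + 2) * esym j {..<CARD('n) - 1} \<mu>"
    and "Re (esym_mat (Suc j) (complex_hessian \<rho> p + smat (of_real M) (gout (complex_gradient \<rho> p) (complex_gradient \<rho> p))))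
      = Re (esym_mat (Suc j) (complex_hessian \<rho> p)) + M * levi_sym j \<rho> p"
proof -
  let ?g = "complex_gradient \<rho> p"
  have 1: "herm_inner (e a) (e b) = (if a = b then 1 else 0)" if "a < CARD('n) - 1" "b < CARD('n) - 1" for a b
    using e that by (simp add: levi_eigenbasis_def)
  have 2: "(\<Sum>i\<in>UNIV. ?g $ i * e a $ i) = 0" if "a < CARD('n) - 1" for a
    using e that by (simp add: levi_eigenbasis_def complex_tangent_def)
  have 3: "sform (complex_hessian \<rho> p) (e a) (e b) = (if a = b then of_real (norm ?g * \<mu> a) else 0)"
    if "a < CARD('n) - 1" "b < CARD('n) - 1" for a b
  proof -
    have "levi_form \<rho> p (e a) (e b) = of_real (\<mu> a) * (if a = b then 1 else 0)"
      using e that 1[OF that] by (simp add: levi_eigenbasis_def)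
    then show ?thesis using g by (auto simp: levi_form_sform field_simps split: if_splits)
  qed
  show "levi_sym j \<rho> p = norm ?g ^ (j + 2) * esym j {..<CARD('n) - 1} \<mu>"
  proof -
    have "trace (newton_mat j (complex_hessian \<rho> p) ** gout ?g ?g) = of_real ((norm ?g)\<^sup>2 * esym j {..<CARD('n) - 1} (\<lambda>a. norm ?g * \<mu> a))"
      by (rule newton_mat_tangential[OF H g 1 2 3 j])
    then show ?thesis by (simp add: levi_sym_def esym_scale power_add power2_eq_square)
  qed
  show "Re (esym_mat (Suc j) (complex_hessian \<rho> p + smat (of_real M) (gout ?g ?g)))
      = Re (esym_mat (Suc j) (complex_hessian \<rho> p)) + M * levi_sym j \<rho> p"
    unfolding levi_sym_def by (rule esym_mat_rank_one[OF H g 1 2 3 j])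
qed

text \<open>Since an eigenbasis exists, the choice in \<open>levi_eigenvalues\<close> is a genuine
  one, and the two sides differ by a positive power of the gradient norm.\<close>

lemma levi_sym_pos_iff:
  fixes \<rho> :: "complex^'n \<Rightarrow> real"
  assumes H: "hermitian (complex_hessian \<rho> p)" and g: "complex_gradient \<rho> p \<noteq> 0" and j: "j < CARD('n)"
  shows "levi_sym j \<rho> p > 0 \<longleftrightarrow> elem_sym j {..<CARD('n) - 1} (levi_eigenvalues \<rho> p) > 0"
proof -
  have "\<exists>\<mu> e. levi_eigenbasis \<rho> p e \<mu>" using levi_eigenbasis_exists[OF H] by blast
  then have "\<exists>e. levi_eigenbasis \<rho> p e (levi_eigenvalues \<rho> p)" unfolding levi_eigenvalues_def by (rule someI_ex)
  then obtain e where "levi_eigenbasis \<rho> p e (levi_eigenvalues \<rho> p)" by blast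
  note levi_eigenbasis_sym(1)[OF H g this j]
  moreover have "norm (complex_gradient \<rho> p) ^ (j + 2) > 0" using g by simp
  ultimately show ?thesis unfolding elem_sym_esym by (metis zero_less_mult_pos mult_pos_pos)
qed

lemma levi_sym_lower_positive:
  fixes \<rho> :: "complex^'n \<Rightarrow> real"
  assumes H: "hermitian (complex_hessian \<rho> p)" and g: "complex_gradient \<rho> p \<noteq> 0" and j: "j < CARD('n)"
    and "levi_sym j \<rho> p > 0" "\<And>i. i \<le> j \<Longrightarrow> levi_sym i \<rho> p \<ge> 0" and i: "i \<le> j"
  shows "levi_sym i \<rho> p > 0"
proof -
  obtain e \<mu> where e: "levi_eigenbasis \<rho> p e \<mu>" using levi_eigenbasis_exists[OF H] by blast
  have eq: "levi_sym i \<rho> p = norm (complex_gradient \<rho> p) ^ (i + 2) * esym i {..<CARD('n) - 1} \<mu>" if "i \<le> j" for i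
    using levi_eigenbasis_sym(1)[OF H g e, of i] j that by simp
  have pos: "norm (complex_gradient \<rho> p) ^ (i + 2) > 0" for i using g by simp
  have "esym i {..<CARD('n) - 1} \<mu> > 0"
  proof (rule esym_lower_positive[OF _ _ j _ _ i])
    show "card {..<CARD('n) - 1} < CARD('n)" by simp
    show "esym j {..<CARD('n) - 1} \<mu> > 0" using assms(4) pos[of j] unfolding eq[OF order_refl] by (rule zero_less_mult_pos)
    show "esym i {..<CARD('n) - 1} \<mu> \<ge> 0" if "i \<le> j" for i
      using assms(5)[OF that] pos[of i] unfolding eq[OF that] zero_le_mult_iff by linarith
  qed simp
  then show ?thesis using eq[OF i] pos[of i] by simp
qed

lemma continuous_on_gout:
  fixes f g :: "'a::topological_space \<Rightarrow> complex^'n"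
  assumes "continuous_on S f" "continuous_on S g"
  shows "continuous_on S (\<lambda>x. gout (f x) (g x))"
  unfolding gout_def by (intro continuous_intros assms)

lemma continuous_on_levi_sym:
  assumes "C_diff 2 UNIV \<rho>"
  shows "continuous_on S (levi_sym j \<rho>)"
proof -
  have g: "continuous_on UNIV (complex_gradient \<rho>)"
    by (rule continuous_on_complex_gradient) (rule C_diff_le[OF _ assms], simp)
  show ?thesis
    unfolding levi_sym_def
    by (intro continuous_on_Re continuous_on_trace continuous_on_matrix_mult continuous_on_newton_mat continuous_on_gout
        continuous_on_subset[OF g] continuous_on_subset[OF continuous_on_complex_hessian[OF open_UNIV assms]] subset_UNIV)
qed

text \<open>At a boundary point of maximal norm the domain lies in the tangent ball, hence the Levi form is nonnegative.\<close>

lemma levi_sym_nonneg_somewhere: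
  fixes \<rho> :: "complex^'n \<Rightarrow> real"
  assumes op: "open \<Omega>" and bd: "bounded \<Omega>" and ne: "\<Omega> \<noteq> {}" and \<rho>: "C_diff 2 UNIV \<rho>" and
    zero: "\<And>z. z \<in> \<Omega> \<longleftrightarrow> \<rho> z < 0" "\<And>z. z \<in> frontier \<Omega> \<Longrightarrow> \<rho> z = 0"
    and grad: "\<And>z. z \<in> frontier \<Omega> \<Longrightarrow> complex_gradient \<rho> z \<noteq> 0"
  shows "\<exists>p\<in>frontier \<Omega>. \<forall>j<CARD('n). levi_sym j \<rho> p \<ge> 0"
proof -
  have "compact (closure \<Omega>)" "closure \<Omega> \<noteq> {}" using bd ne by auto
  then obtain p where p: "p \<in> closure \<Omega>" "\<And>y. y \<in> closure \<Omega> \<Longrightarrow> norm y \<le> norm p"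
    using continuous_attains_sup[of "closure \<Omega>" norm] by (auto intro: continuous_intros)
  have "\<Omega> \<subseteq> interior (cball 0 (norm p))"
    by (rule interior_maximal) (use p(2) closure_subset[of \<Omega>] op in \<open>auto simp: subset_iff\<close>)
  then have sub: "\<Omega> \<subseteq> ball 0 (norm p)" by simp
  have out: "\<rho> y \<ge> 0" if "norm y \<ge> norm p" for y
    using sub zero(1)[of y] that by force
  have pF: "p \<in> frontier \<Omega>" using p(1) sub op by (force simp: frontier_def interior_open)
  have \<rho>p: "\<rho> p = 0" using zero(2)[OF pF] .
  let ?D = "\<lambda>y. frechet_derivative \<rho> (at y)"
  let ?H = "\<lambda>v w. frechet_derivative (\<lambda>y. ?D y w) (at p) v"
  have lin: "linear (?D p)" using C2_diffble(1)[OF \<rho> UNIV_I] by (rule linear_frechet_derivative)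
  \<comment> \<open>On a line through \<open>p\<close> orthogonal to \<open>p\<close> the norm is
    nowhere smaller than at \<open>p\<close>, so \<open>\<rho>\<close> restricted to it has a
    minimum at \<open>p\<close>.\<close>
  have tang: "?D p v = 0 \<and> ?H v v \<ge> 0" if v: "p \<bullet> v = 0" for v
  proof -
    let ?f = "\<lambda>t. \<rho> (p + t *\<^sub>R v)"
    have d1: "(?f has_real_derivative ?D (p + t *\<^sub>R v) v) (at t)" for t
      unfolding has_real_derivative_iff_has_vector_derivative
      by (intro frechet_derivative_line) (use C2_diffble(1)[OF \<rho> UNIV_I] in \<open>simp add: frechet_derivative_works\<close>)
    have d2: "((\<lambda>t. ?D (p + t *\<^sub>R v) v) has_real_derivative ?H v v) (at 0)"
      unfolding has_real_derivative_iff_has_vector_derivative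
      by (rule frechet_derivative_line) (use C2_diffble(2)[OF \<rho> UNIV_I] in \<open>simp add: frechet_derivative_works\<close>)
    have min: "?f 0 \<le> ?f t" for t
    proof -
      have "(norm (p + t *\<^sub>R v))\<^sup>2 = (norm p)\<^sup>2 + (norm (t *\<^sub>R v))\<^sup>2"
        using v by (simp add: power2_norm_eq_inner inner_add_left inner_add_right inner_commute del: norm_scaleR)
      then have "(norm p)\<^sup>2 \<le> (norm (p + t *\<^sub>R v))\<^sup>2" by simp
      then have "norm p \<le> norm (p + t *\<^sub>R v)" by (rule power2_le_imp_le) simp
      then show ?thesis using out \<rho>p by simp
    qed
    have "?D (p + 0 *\<^sub>R v) v = 0" by (rule DERIV_local_min[OF d1, of 1]) (use min in auto)
    moreover have "?H v v \<ge> 0" by (rule second_derivative_nonneg[OF d1 d2 min])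
    ultimately show ?thesis by simp
  qed
  \<comment> \<open>A vector in the kernel of the differential not orthogonal to \<open>p\<close>
    would, together with the hyperplane orthogonal to \<open>p\<close>, span the whole space and
    force the gradient to vanish.\<close>
  have normal: "p \<bullet> v = 0" if v: "?D p v = 0" for v
  proof (rule ccontr)
    assume c: "p \<bullet> v \<noteq> 0"
    have "?D p w = 0" for w
    proof -
      have "?D p (w - ((p \<bullet> w) / (p \<bullet> v)) *\<^sub>R v) = 0" using tang[of "w - ((p \<bullet> w) / (p \<bullet> v)) *\<^sub>R v"] c by (simp add: inner_diff_right)
      then show ?thesis using v by (simp add: linear_diff[OF lin] linear_cmul[OF lin])
    qed
    then have "complex_gradient \<rho> p = 0"
      by (simp add: vec_eq_iff complex_gradient_eq[OF C2_diffble(1)[OF \<rho> UNIV_I]])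
    then show False using grad[OF pF] by simp
  qed
  have pos: "Re (sform (complex_hessian \<rho> p) \<xi> \<xi>) \<ge> 0" if "\<xi> \<in> complex_tangent \<rho> p" for \<xi>
  proof -
    have s: "(\<Sum>i\<in>UNIV. complex_gradient \<rho> p $ i * \<xi> $ i) = 0" using that by (simp add: complex_tangent_def)
    \<comment> \<open>The complex tangent space is invariant under multiplication by
      \<open>\<i>\<close>, so both real second derivatives in
      \<open>second_derivative_expand\<close> are nonnegative.\<close>
    have "(\<Sum>i\<in>UNIV. complex_gradient \<rho> p $ i * (\<i> *s \<xi>) $ i) = \<i> * (\<Sum>i\<in>UNIV. complex_gradient \<rho> p $ i * \<xi> $ i)"
      by (simp add: sum_distrib_left mult_ac)
    then have "?D p \<xi> = 0" "?D p (\<i> *s \<xi>) = 0"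
      unfolding frechet_complex_gradient(2)[OF C2_diffble(1)[OF \<rho> UNIV_I]] s by simp_all
    then have "?H \<xi> \<xi> \<ge> 0" "?H (\<i> *s \<xi>) (\<i> *s \<xi>) \<ge> 0" using tang normal by blast+
    then show ?thesis using second_derivative_expand[OF \<rho>, of p \<xi>] by simp
  qed
  have H: "hermitian (complex_hessian \<rho> p)" by (rule hermitian_complex_hessian[OF open_UNIV \<rho> UNIV_I])
  obtain e \<mu> where e: "levi_eigenbasis \<rho> p e \<mu>" using levi_eigenbasis_exists[OF H] by blast
  have \<mu>: "\<mu> a \<ge> 0" if "a < CARD('n) - 1" for a
  proof -
    have ea: "e a \<in> complex_tangent \<rho> p" using e that by (simp add: levi_eigenbasis_def)
    have "levi_form \<rho> p (e a) (e a) = of_real (\<mu> a)" using e that ea by (auto simp: levi_eigenbasis_def)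
    then have "\<mu> a = Re (levi_form \<rho> p (e a) (e a))" by simp
    also have "\<dots> \<ge> 0" unfolding levi_form_sform using pos[OF ea] by simp
    finally show ?thesis .
  qed
  have "levi_sym j \<rho> p \<ge> 0" if "j < CARD('n)" for j
    unfolding levi_eigenbasis_sym(1)[OF H grad[OF pF] e that] using \<mu> by (intro mult_nonneg_nonneg esym_nonneg) auto
  then show ?thesis using pF by blast
qed

text \<open>By connectedness of the boundary the positivity of all lower symmetric functions propagates from that point.\<close>

lemma levi_sym_positive:
  fixes \<rho> :: "complex^'n \<Rightarrow> real"
  assumes op: "open \<Omega>" and bd: "bounded \<Omega>" and ne: "\<Omega> \<noteq> {}" and \<rho>: "C_diff 2 UNIV \<rho>" and
    zero: "\<And>z. z \<in> \<Omega> \<longleftrightarrow> \<rho> z < 0" "\<And>z. z \<in> frontier \<Omega> \<Longrightarrow> \<rho> z = 0"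
    and grad: "\<And>z. z \<in> frontier \<Omega> \<Longrightarrow> complex_gradient \<rho> z \<noteq> 0"
    and con: "connected (frontier \<Omega>)" and j: "j < CARD('n)" and pos: "\<And>z. z \<in> frontier \<Omega> \<Longrightarrow> levi_sym j \<rho> z > 0"
    and z: "z \<in> frontier \<Omega>" and i: "i \<le> j"
  shows "levi_sym i \<rho> z > 0"
proof -
  let ?F = "frontier \<Omega>"
  define T where "T = ?F \<inter> (\<Inter>i\<in>{..j}. {z. 0 < levi_sym i \<rho> z})"
  \<comment> \<open>Strict and weak inequalities cut out the same set, by
    \<open>levi_sym_lower_positive\<close>; the one description is relatively open, the other
    relatively closed.\<close>
  have T: "T = ?F \<inter> (\<Inter>i\<in>{..j}. {z. 0 \<le> levi_sym i \<rho> z})"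
  proof
    show "T \<subseteq> ?F \<inter> (\<Inter>i\<in>{..j}. {z. 0 \<le> levi_sym i \<rho> z})" by (auto simp: T_def less_imp_le)
    show "?F \<inter> (\<Inter>i\<in>{..j}. {z. 0 \<le> levi_sym i \<rho> z}) \<subseteq> T"
    proof
      fix x assume x: "x \<in> ?F \<inter> (\<Inter>i\<in>{..j}. {z. 0 \<le> levi_sym i \<rho> z})"
      have "levi_sym i \<rho> x > 0" if "i \<le> j" for i
        by (rule levi_sym_lower_positive[OF hermitian_complex_hessian[OF open_UNIV \<rho> UNIV_I] grad j pos _ that]) (use x in auto)
      then show "x \<in> T" using x by (simp add: T_def)
    qed
  qed
  have "openin (top_of_set ?F) T"
    unfolding T_def by (intro openin_open_Int open_INT ballI open_Collect_less continuous_intros continuous_on_levi_sym \<rho>) simp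
  moreover have "closedin (top_of_set ?F) T"
    unfolding T by (intro closedin_closed_Int closed_INT ballI closed_Collect_le continuous_intros continuous_on_levi_sym \<rho>)
  ultimately have "T = {} \<or> T = ?F" using con unfolding connected_clopen by blast
  moreover obtain p where "p \<in> ?F" "\<forall>j<CARD('n). levi_sym j \<rho> p \<ge> 0"
    using levi_sym_nonneg_somewhere[OF op bd ne \<rho> zero grad] by blast
  then have "p \<in> T" using j unfolding T by auto
  ultimately show ?thesis using z i unfolding T_def by blast
qed

subsection \<open>A strictly subharmonic function vanishing on the boundary\<close>

text \<open>By \<open>levi_eigenbasis_sym\<close> each symmetric function is affine in
  \<open>M\<close> with positive slope \<open>levi_sym j \<rho> z\<close>. The ratio of constant
  term to slope is bounded on the compact set, so a large \<open>M\<close> works for all finitely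
  many orders.\<close>

lemma boundary_rank_one_perturbation:
  fixes \<rho> :: "complex^'n \<Rightarrow> real"
  assumes F: "compact F" and \<rho>: "C_diff 2 UNIV \<rho>" and k: "k \<le> CARD('n)"
    and grad: "\<And>z. z \<in> F \<Longrightarrow> complex_gradient \<rho> z \<noteq> 0" and pos: "\<And>z i. z \<in> F \<Longrightarrow> i < k \<Longrightarrow> levi_sym i \<rho> z > 0"
  obtains M where "M \<ge> 0"
    "\<And>z. z \<in> F \<Longrightarrow> complex_hessian \<rho> z + smat (of_real M) (gout (complex_gradient \<rho> z) (complex_gradient \<rho> z)) \<in> herm_Gamma_open k"
proof -
  let ?f = "\<lambda>j z. Re (esym_mat (Suc j) (complex_hessian \<rho> z))"
  have ev: "eventually (\<lambda>M. \<forall>z\<in>F. ?f j z + M * levi_sym j \<rho> z > 0) at_top" if j: "j < k" for j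
  proof -
    have cf: "continuous_on F (?f j)"
      by (intro continuous_on_Re continuous_on_esym_mat continuous_on_subset[OF continuous_on_complex_hessian[OF open_UNIV \<rho>]] subset_UNIV)
    have "continuous_on F (\<lambda>z. ?f j z / levi_sym j \<rho> z)"
      by (rule continuous_on_divide[OF cf continuous_on_levi_sym[OF \<rho>]]) (use pos[OF _ j] in force)
    then have "bounded ((\<lambda>z. ?f j z / levi_sym j \<rho> z) ` F)" by (intro compact_imp_bounded compact_continuous_image F)
    then obtain B where B: "\<And>z. z \<in> F \<Longrightarrow> \<bar>?f j z / levi_sym j \<rho> z\<bar> \<le> B" unfolding bounded_iff by auto
    show ?thesis
    proof (rule eventually_mono[OF eventually_gt_at_top[of B]], intro ballI)
      fix M z assume "B < M" and z: "z \<in> F"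
      then have "- M < ?f j z / levi_sym j \<rho> z" using B[OF z] by linarith
      then have "- M * levi_sym j \<rho> z < ?f j z" using pos[OF z j] by (simp add: pos_less_divide_eq)
      then show "?f j z + M * levi_sym j \<rho> z > 0" by simp
    qed
  qed
  have "eventually (\<lambda>M. M \<ge> 0 \<and> (\<forall>j\<in>{..<k}. \<forall>z\<in>F. ?f j z + M * levi_sym j \<rho> z > 0)) at_top"
    using ev by (intro eventually_conj eventually_ge_at_top eventually_ball_finite) auto
  then obtain M where M: "M \<ge> 0" "\<And>j z. j < k \<Longrightarrow> z \<in> F \<Longrightarrow> ?f j z + M * levi_sym j \<rho> z > 0"
    using eventually_happens'[OF trivial_limit_at_top_linorder] by blast
  show thesis
  proof (rule that[OF M(1)])
    fix z assume z: "z \<in> F"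
    have H: "hermitian (complex_hessian \<rho> z)" by (rule hermitian_complex_hessian[OF open_UNIV \<rho> UNIV_I])
    obtain e \<mu> where e: "levi_eigenbasis \<rho> z e \<mu>" using levi_eigenbasis_exists[OF H] by blast
    have "Re (esym_mat j (complex_hessian \<rho> z + smat (of_real M) (gout (complex_gradient \<rho> z) (complex_gradient \<rho> z)))) > 0"
      if j: "j \<in> {1..k}" for j
    proof -
      obtain i where i: "j = Suc i" "i < k" using j by (cases j) auto
      show ?thesis unfolding i(1) using levi_eigenbasis_sym(2)[OF H grad[OF z] e, of i M] M(2)[OF i(2) z] i(2) k by simp
    qed
    then show "complex_hessian \<rho> z + smat (of_real M) (gout (complex_gradient \<rho> z) (complex_gradient \<rho> z)) \<in> herm_Gamma_open k"
      unfolding herm_Gamma_open_def using H by (auto intro: hermitian_add hermitian_smat hermitian_gout)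
  qed
qed

text \<open>The conditions are open jointly in the point and in the shift, so a uniform
  neighbourhood of the compact set \<open>F \<times> {0}\<close> yields both the margin
  \<open>c\<close> and the open set \<open>W\<close>.\<close>

lemma herm_Gamma_open_neighbourhood:
  fixes H :: "complex^'n \<Rightarrow> complex^'n^'n"
  assumes F: "compact F" and cont: "continuous_on UNIV H" and herm: "\<And>z. hermitian (H z)" and HF: "\<And>z. z \<in> F \<Longrightarrow> H z \<in> herm_Gamma_open k"
  obtains c W where "c > 0" "open W" "F \<subseteq> W" "\<And>z. z \<in> W \<Longrightarrow> H z - mat (of_real c) \<in> herm_Gamma_open k"
proof -
  define Q where "Q = (\<Inter>j\<in>{1..k}. {x. 0 < Re (esym_mat j (H (fst x) - mat (of_real (snd x))))})"
  have cH: "continuous_on UNIV (\<lambda>x. H (fst x))"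
    by (rule continuous_on_compose2[OF cont]) (auto intro: continuous_intros)
  have "open Q"
    unfolding Q_def by (intro open_INT ballI open_Collect_less continuous_intros continuous_on_esym_mat cH continuous_on_mat) auto
  moreover have "compact (F \<times> {0::real})" using F by (intro compact_Times) auto
  moreover have "F \<times> {0} \<subseteq> Q" using HF by (auto simp: Q_def herm_Gamma_open_def)
  ultimately obtain e where e: "e > 0" "(\<Union>x\<in>F \<times> {0}. ball x e) \<subseteq> Q"
    using compact_subset_open_imp_ball_epsilon_subset by metis
  show thesis
  proof (rule that[of "e / 2" "\<Union>x\<in>F. ball x (e / 2)"])
    show "F \<subseteq> (\<Union>x\<in>F. ball x (e / 2))" using e(1) by force
    fix z assume "z \<in> (\<Union>x\<in>F. ball x (e / 2))"
    then obtain x where x: "x \<in> F" "dist x z < e / 2" by auto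
    have "dist (x, 0) (z, e / 2) \<le> dist x z + e / 2"
      unfolding dist_Pair_Pair using sqrt_sum_squares_le_sum[of "dist x z" "dist 0 (e / 2)"] e(1) by (simp add: dist_real_def)
    then have "(z, e / 2) \<in> ball (x, 0) e" using x(2) by simp
    then have "(z, e / 2) \<in> Q" using e(2) x(1) by blast
    then show "H z - mat (of_real (e / 2)) \<in> herm_Gamma_open k"
      unfolding Q_def herm_Gamma_open_def using hermitian_diff[OF herm hermitian_mat, of z "e / 2"] by auto
  qed (use e(1) in auto)
qed

lemma psd_mat: "r \<ge> 0 \<Longrightarrow> psd (mat (of_real r) :: complex^'n^'n)"
  using psd_mat_diff(1)[of "0 :: complex^'n^'n" "r / (real CARD('n) * real CARD('n))"]
  by (simp add: hermitian_def ctranspose_def vec_eq_iff)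

text \<open>With \<open>\<phi>2\<close> the derivative of \<open>\<phi>1\<close>, the Hessian of the
  composition is \<open>\<phi>1\<close> times the perturbed Hessian plus
  \<open>\<phi>2 - M * \<phi>1\<close> times the rank-one matrix. The exponential is there to make
  the second coefficient nonnegative; the cubic truncation makes the function constant beyond the
  layer while keeping two continuous derivatives.\<close>

lemma boundary_layer_function:
  fixes \<rho> :: "complex^'n \<Rightarrow> real"
  assumes k: "k \<le> CARD('n)" and \<rho>: "C_diff 2 UNIV \<rho>" and M: "M \<ge> 0" and t: "t > 0"
    and dual: "\<And>z. z \<in> \<Omega> \<Longrightarrow> \<rho> z \<ge> - t \<Longrightarrow>
      complex_hessian \<rho> z + smat (of_real M) (gout (complex_gradient \<rho> z) (complex_gradient \<rho> z)) - mat (of_real c) \<in> dual_Gamma k"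
  obtains \<phi> \<phi>1 where "C_diff 2 UNIV (\<lambda>z. \<phi> (\<rho> z))" "\<phi> 0 = 0" "\<And>s. \<phi>1 s \<ge> 0"
    "\<And>s. s \<ge> - t / 2 \<Longrightarrow> \<phi>1 s \<ge> 3 * (t / 2)\<^sup>2 * exp (- M * t / 2)"
    "\<And>z. z \<in> \<Omega> \<Longrightarrow> complex_hessian (\<lambda>z. \<phi> (\<rho> z)) z - mat (of_real (c * \<phi>1 (\<rho> z))) \<in> dual_Gamma k"
proof -
  define \<phi> where "\<phi> s = ppos 3 (s + t) * exp (M * s) - t ^ 3" for s
  define \<phi>1 where "\<phi>1 s = (3 * ppos 2 (s + t) + M * ppos 3 (s + t)) * exp (M * s)" for s
  define \<phi>2 where "\<phi>2 s = (6 * ppos 1 (s + t) + 6 * M * ppos 2 (s + t) + M\<^sup>2 * ppos 3 (s + t)) * exp (M * s)" for s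
  have d3: "((\<lambda>s. ppos 3 (s + t)) has_real_derivative 3 * ppos 2 (s + t)) (at s)" for s
    using ppos_deriv[of 3 "s + t"] by (simp add: DERIV_shift)
  have d2: "((\<lambda>s. ppos 2 (s + t)) has_real_derivative 2 * ppos 1 (s + t)) (at s)" for s
    using ppos_deriv[of 2 "s + t"] by (simp add: DERIV_shift)
  have 1: "(\<phi> has_real_derivative \<phi>1 s) (at s)" for s
    unfolding \<phi>_def \<phi>1_def by (auto intro!: derivative_eq_intros d3 simp: algebra_simps)
  have 2: "(\<phi>1 has_real_derivative \<phi>2 s) (at s)" for s
    unfolding \<phi>1_def \<phi>2_def by (auto intro!: derivative_eq_intros d3 d2 simp: algebra_simps power2_eq_square)
  have 3: "continuous_on UNIV \<phi>2"
    unfolding \<phi>2_def by (intro continuous_intros continuous_on_compose2[OF continuous_ppos]) auto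
  have p0: "ppos i s \<ge> 0" for i s by (simp add: ppos_def)
  have nn: "\<phi>1 s \<ge> 0" for s using M by (simp add: \<phi>1_def p0)
  note hess = complex_hessian_compose[OF open_UNIV \<rho> UNIV_I 1 2 3]
  show thesis
  proof (rule that[of \<phi> \<phi>1, OF hess(2) _ nn])
    show "\<phi> 0 = 0" using t by (simp add: \<phi>_def ppos_def)
    show "\<phi>1 s \<ge> 3 * (t / 2)\<^sup>2 * exp (- M * t / 2)" if s: "s \<ge> - t / 2" for s
    proof -
      have "(t / 2)\<^sup>2 \<le> ppos 2 (s + t)" unfolding ppos_def by (rule power_mono) (use s t in auto)
      moreover have "M * (- t / 2) \<le> M * s" by (rule mult_left_mono[OF s M])
      then have "exp (- M * t / 2) \<le> exp (M * s)" by simp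
      ultimately have "3 * (t / 2)\<^sup>2 * exp (- M * t / 2) \<le> (3 * ppos 2 (s + t)) * exp (M * s)"
        by (intro mult_mono) (auto simp: p0)
      also have "\<dots> \<le> \<phi>1 s" unfolding \<phi>1_def using M by (intro mult_right_mono) (auto simp: p0)
      finally show ?thesis .
    qed
    fix z assume z: "z \<in> \<Omega>"
    let ?A = "complex_hessian \<rho> z" and ?G = "gout (complex_gradient \<rho> z) (complex_gradient \<rho> z)" and ?s = "\<rho> z"
    define X where "X = ?A + smat (of_real M) ?G - mat (of_real c)"
    have "smat (of_real (\<phi>1 ?s)) X \<in> dual_Gamma k"
    proof (cases "?s \<ge> - t")
      case True
      then show ?thesis unfolding X_def by (intro dual_Gamma_smat dual z nn)
    next
      case False
      then have "\<phi>1 ?s = 0" by (simp add: \<phi>1_def ppos_def)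
      then show ?thesis using psd_dual_Gamma[OF k psd_mat[of 0]] by (simp add: smat_simps mat_def zero_vec_def)
    qed
    moreover have "smat (of_real (\<phi>2 ?s - M * \<phi>1 ?s)) ?G \<in> dual_Gamma k"
    proof (intro dual_Gamma_smat psd_dual_Gamma k psd_gout)
      have "\<phi>2 ?s - M * \<phi>1 ?s = (6 * ppos 1 (?s + t) + 3 * M * ppos 2 (?s + t)) * exp (M * ?s)"
        by (simp add: \<phi>1_def \<phi>2_def algebra_simps power2_eq_square)
      also have "\<dots> \<ge> 0" using M by (simp add: p0)
      finally show "\<phi>2 ?s - M * \<phi>1 ?s \<ge> 0" .
    qed
    ultimately have "smat (of_real (\<phi>1 ?s)) X + smat (of_real (\<phi>2 ?s - M * \<phi>1 ?s)) ?G \<in> dual_Gamma k" by (rule dual_Gamma_add)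
    moreover have "complex_hessian (\<lambda>z. \<phi> (\<rho> z)) z - mat (of_real (c * \<phi>1 (\<rho> z))) = smat (of_real (\<phi>1 ?s)) X + smat (of_real (\<phi>2 ?s - M * \<phi>1 ?s)) ?G"
      unfolding hess(1) X_def by (simp add: vec_eq_iff smat_def mat_def algebra_simps)
    ultimately show "complex_hessian (\<lambda>z. \<phi> (\<rho> z)) z - mat (of_real (c * \<phi>1 (\<rho> z))) \<in> dual_Gamma k" by simp
  qed
qed

lemma strict_subsolution_exists:
  fixes \<Omega> :: "(complex^'n) set"
  assumes k: "0 < k" "k \<le> CARD('n)" and \<Omega>: "smooth_bounded_domain \<Omega>" and psc: "strong_pseudoconvex k \<Omega>"
  obtains v c where "adm \<Omega> v" "c > 0" "\<And>z. z \<in> \<Omega> \<Longrightarrow> complex_hessian v z - mat (of_real c) \<in> dual_Gamma k"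
proof -
  let ?F = "frontier \<Omega>"
  have op: "open \<Omega>" and bd: "bounded \<Omega>" and ne: "\<Omega> \<noteq> {}" using \<Omega> by (auto simp: smooth_bounded_domain_def)
  obtain \<rho> where \<rho>C: "\<And>r. C_diff r UNIV \<rho>" and zero: "\<And>z. z \<in> \<Omega> \<longleftrightarrow> \<rho> z < 0" "\<And>z. z \<in> ?F \<Longrightarrow> \<rho> z = 0"
    and nz: "\<And>z. z \<in> ?F \<Longrightarrow> \<exists>v. frechet_derivative \<rho> (at z) v \<noteq> 0"
    using global_defining_function[OF \<Omega>] by blast
  note \<rho> = \<rho>C[of 2]
  have \<rho>c: "continuous_on S \<rho>" for S using C_diff_continuous[OF \<rho>] continuous_on_subset by blast
  have cF: "compact ?F" using bd by (rule compact_frontier_bounded)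
  \<comment> \<open>On the open set where the differential is nonzero, \<open>\<rho>\<close> is
    itself a local defining function at every boundary point, so the hypothesis on Levi eigenvalues
    applies to \<open>\<rho>\<close>.\<close>
  define U where "U = (\<Union>v. {z. frechet_derivative \<rho> (at z) v \<noteq> 0})"
  have "open {z. frechet_derivative \<rho> (at z) v \<noteq> 0}" for v
    by (intro open_Collect_neq continuous_on_const C_diff_continuous[OF C_diff_frechet[OF \<rho>C[of "Suc 0"]]])
  then have "open U" unfolding U_def by blast
  then have ldf: "local_defining_function \<Omega> p U \<rho>" if "p \<in> ?F" for p
    unfolding local_defining_function_def using nz[OF that] \<rho>C C_diff_subset[of _ UNIV \<rho> U] zero(1) by (auto simp: U_def)
  have grad: "complex_gradient \<rho> z \<noteq> 0" if "z \<in> ?F" for z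
    using nz[OF that] frechet_complex_gradient(2)[OF C2_diffble(1)[OF \<rho> UNIV_I]] by auto
  have k1: "k - 1 < CARD('n)" using k by simp
  have "levi_sym (k - 1) \<rho> z > 0" if z: "z \<in> ?F" for z
    using psc ldf[OF z] z unfolding strong_pseudoconvex_def
    by (subst levi_sym_pos_iff[OF hermitian_complex_hessian[OF open_UNIV \<rho> UNIV_I] grad[OF z] k1]) blast
  moreover have "connected ?F" using psc by (simp add: strong_pseudoconvex_def)
  ultimately have levi: "levi_sym i \<rho> z > 0" if "z \<in> ?F" "i < k" for z i
    using levi_sym_positive[OF op bd ne \<rho> zero grad _ k1 _ that(1), of i] that(2) by simp
  obtain M where M: "M \<ge> 0"
    "\<And>z. z \<in> ?F \<Longrightarrow> complex_hessian \<rho> z + smat (of_real M) (gout (complex_gradient \<rho> z) (complex_gradient \<rho> z)) \<in> herm_Gamma_open k"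
    using boundary_rank_one_perturbation[OF cF \<rho> k(2) grad levi] by blast
  define H where "H z = complex_hessian \<rho> z + smat (of_real M) (gout (complex_gradient \<rho> z) (complex_gradient \<rho> z))" for z
  have cH: "continuous_on UNIV H"
    unfolding H_def by (intro continuous_on_add continuous_on_smat continuous_on_const continuous_on_gout
        continuous_on_complex_hessian continuous_on_complex_gradient open_UNIV \<rho> C_diff_le[OF _ \<rho>]) auto
  have hH: "hermitian (H z)" for z
    unfolding H_def by (intro hermitian_add hermitian_smat hermitian_gout hermitian_complex_hessian[OF open_UNIV \<rho> UNIV_I])
  obtain c W where c: "c > 0" and W: "open W" "?F \<subseteq> W" and HW: "\<And>z. z \<in> W \<Longrightarrow> H z - mat (of_real c) \<in> herm_Gamma_open k"
    using herm_Gamma_open_neighbourhood[OF cF cH hH] M(2) unfolding H_def by metis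
  \<comment> \<open>The part of the closure outside \<open>W\<close> is a compact subset of
    \<open>\<Omega>\<close>, on which \<open>\<rho>\<close> has a negative maximum; half of it
    bounds the layer.\<close>
  obtain t where t: "t > 0" and tW: "\<And>z. z \<in> \<Omega> \<Longrightarrow> \<rho> z \<ge> - t \<Longrightarrow> z \<in> W"
  proof (cases "closure \<Omega> - W = {}")
    case True
    then show thesis using that[of 1] closure_subset[of \<Omega>] by auto
  next
    case False
    have "compact (closure \<Omega> - W)" using bd W(1) by (intro compact_diff) auto
    then obtain x where x: "x \<in> closure \<Omega> - W" "\<And>y. y \<in> closure \<Omega> - W \<Longrightarrow> \<rho> y \<le> \<rho> x"
      using continuous_attains_sup[OF _ False \<rho>c] by blast
    then have "x \<in> \<Omega>" using W(2) op by (auto simp: frontier_def interior_open)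
    then have x0: "\<rho> x < 0" using zero(1) by simp
    show thesis
    proof (rule that[of "- \<rho> x / 2"])
      fix z assume z: "z \<in> \<Omega>" "\<rho> z \<ge> - (- \<rho> x / 2)"
      show "z \<in> W"
      proof (rule ccontr)
        assume "z \<notin> W"
        then have "\<rho> z \<le> \<rho> x" using x(2) z(1) closure_subset[of \<Omega>] by auto
        then show False using z(2) x0 by simp
      qed
    qed (use x0 in simp)
  qed
  have dual: "complex_hessian \<rho> z + smat (of_real M) (gout (complex_gradient \<rho> z) (complex_gradient \<rho> z)) - mat (of_real c) \<in> dual_Gamma k"
    if "z \<in> \<Omega>" "\<rho> z \<ge> - t" for z
    using HW[OF tW[OF that]] herm_Gamma_open_subset garding_dual[OF k(2)] unfolding H_def by blast
  obtain \<phi> \<phi>1 where \<phi>: "C_diff 2 UNIV (\<lambda>z. \<phi> (\<rho> z))" "\<phi> 0 = 0" "\<And>s. \<phi>1 s \<ge> 0"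
    "\<And>s. s \<ge> - t / 2 \<Longrightarrow> \<phi>1 s \<ge> 3 * (t / 2)\<^sup>2 * exp (- M * t / 2)"
    "\<And>z. z \<in> \<Omega> \<Longrightarrow> complex_hessian (\<lambda>z. \<phi> (\<rho> z)) z - mat (of_real (c * \<phi>1 (\<rho> z))) \<in> dual_Gamma k"
    using boundary_layer_function[where \<rho> = \<rho> and M = M and t = t and \<Omega> = \<Omega> and c = c, OF k(2) \<rho> M(1) t dual] by blast
  define m1 where "m1 = c * (3 * (t / 2)\<^sup>2 * exp (- M * t / 2))"
  have m1: "m1 > 0" using c t by (simp add: m1_def)
  \<comment> \<open>The factor \<open>8 / t ^ 3\<close> makes the cutoff vanish where
    \<open>\<rho>\<close> is 0, and the cutoff equals 1 where \<open>\<rho>\<close> is below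
    \<open>- t / 2\<close>.\<close>
  define w where "w z = (1 - ppos 3 (\<rho> z + t / 2) * (8 / t ^ 3)) * (z \<bullet> z)" for z
  have sq: "C_diff 2 U (\<lambda>z :: complex^'n. z \<bullet> z)" "complex_hessian (\<lambda>z :: complex^'n. z \<bullet> z) z = mat 1" for U z
    using norm_square_hessian(1)[where r = 0 and U = U] norm_square_hessian(2)[where r = 0 and x = z] by simp_all
  have w: "C_diff 2 UNIV w"
    unfolding w_def by (intro C_diff_mult C_diff_diff C_diff_const C_diff_ppos3 C_diff_add \<rho> sq open_UNIV)
  have w1: "complex_hessian w z = mat 1" if z: "\<rho> z < - t / 2" for z
  proof -
    have "open {z. \<rho> z < - t / 2}" by (intro open_Collect_less \<rho>c continuous_intros)
    from complex_hessian_cong(1)[OF this sq(1), of z w] z show ?thesis by (simp add: sq(2) w_def ppos_def)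
  qed
  have bnd: "\<exists>B. \<forall>z\<in>\<Omega>. norm (complex_hessian u z) \<le> B" if u: "C_diff 2 UNIV u" for u
  proof -
    have "bounded (complex_hessian u ` closure \<Omega>)"
      by (intro compact_imp_bounded compact_continuous_image continuous_on_subset[OF continuous_on_complex_hessian[OF open_UNIV u]]) (use bd in auto)
    then show ?thesis unfolding bounded_iff using closure_subset by blast
  qed
  obtain B where B: "\<And>z. z \<in> \<Omega> \<Longrightarrow> norm (complex_hessian w z) \<le> B" using bnd[OF w] by blast
  define N where "N = real CARD('n) * real CARD('n) * \<bar>B\<bar>"
  \<comment> \<open>The Hessian of \<open>w\<close> may be negative near the boundary; this choice
    lets \<open>\<epsilon>\<close> times it consume at most half of the margin \<open>m1\<close>,
    and the other half is kept for the final constant.\<close>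
  define \<epsilon> where "\<epsilon> = m1 / (2 * (N + 1))"
  have N: "N \<ge> 0" by (simp add: N_def)
  have \<epsilon>: "\<epsilon> > 0" "\<epsilon> * N \<le> m1 / 2"
  proof -
    show "\<epsilon> > 0" using m1 N by (simp add: \<epsilon>_def)
    have "\<epsilon> * (N + 1) = m1 / 2" using N by (simp add: \<epsilon>_def field_simps)
    then show "\<epsilon> * N \<le> m1 / 2" using \<open>\<epsilon> > 0\<close> by (simp add: distrib_left)
  qed
  have psdw: "psd (mat (of_real N) + complex_hessian w z)" if z: "z \<in> \<Omega>" for z
    unfolding N_def
  proof (rule psd_mat_diff(2)[OF hermitian_complex_hessian[OF open_UNIV w UNIV_I]])
    fix i j
    have "cmod (complex_hessian w z $ i $ j) \<le> norm (complex_hessian w z)"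
      by (rule order_trans[OF Finite_Cartesian_Product.norm_nth_le Finite_Cartesian_Product.norm_nth_le])
    then show "cmod (complex_hessian w z $ i $ j) \<le> \<bar>B\<bar>" using B[OF z] by linarith
  qed
  define c' where "c' = min \<epsilon> (m1 / 2)"
  define v where "v z = \<phi> (\<rho> z) + \<epsilon> * w z" for z
  have v: "C_diff 2 UNIV v" unfolding v_def by (intro C_diff_add C_diff_mult C_diff_const \<phi>(1) w open_UNIV)
  have Hv: "complex_hessian v z = complex_hessian (\<lambda>z. \<phi> (\<rho> z)) z + smat (of_real \<epsilon>) (complex_hessian w z)" for z
    unfolding v_def[abs_def] complex_hessian_scale[OF open_UNIV w UNIV_I, symmetric]
    by (rule complex_hessian_add[OF open_UNIV \<phi>(1) C_diff_mult[OF open_UNIV C_diff_const w] UNIV_I])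
  show thesis
  proof (rule that[of v c'])
    show "adm \<Omega> v"
      unfolding adm_def
    proof (intro conjI ballI)
      show "C_diff 2 \<Omega> v" using v by (rule C_diff_subset) simp
      show "continuous_on (closure \<Omega>) v" using C_diff_continuous[OF v] by (rule continuous_on_subset) simp
      show "v z = 0" if "z \<in> ?F" for z using zero(2)[OF that] \<phi>(2) t by (simp add: v_def w_def ppos_def power_divide)
    qed (rule bnd[OF v])
    show "c' > 0" using \<epsilon> m1 by (simp add: c'_def)
    fix z assume z: "z \<in> \<Omega>"
    show "complex_hessian v z - mat (of_real c') \<in> dual_Gamma k"
    proof (cases "\<rho> z < - t / 2")
      case True
      \<comment> \<open>Here the squared norm is not cut off and contributes
        \<open>\<epsilon>\<close> times the identity, of which \<open>c'\<close> is given
        away.\<close>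
      have "mat (of_real (c * \<phi>1 (\<rho> z) + (\<epsilon> - c'))) \<in> (dual_Gamma k :: (complex^'n^'n) set)"
        using c \<phi>(3)[of "\<rho> z"] by (intro psd_dual_Gamma k psd_mat) (simp add: c'_def)
      from dual_Gamma_add[OF \<phi>(5)[OF z] this] show ?thesis
        by (rule back_subst[of "\<lambda>X. X \<in> dual_Gamma k"]) (simp add: Hv w1[OF True] vec_eq_iff smat_def mat_def)
    next
      case False
      have "m1 \<le> c * \<phi>1 (\<rho> z)" unfolding m1_def using \<phi>(4)[of "\<rho> z"] False c by (intro mult_left_mono) auto
      then have "c * \<phi>1 (\<rho> z) - \<epsilon> * N - c' \<ge> 0" using \<epsilon>(2) by (simp add: c'_def)
      then have 1: "mat (of_real (c * \<phi>1 (\<rho> z) - \<epsilon> * N - c')) \<in> (dual_Gamma k :: (complex^'n^'n) set)"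
        by (intro psd_dual_Gamma k psd_mat)
      have 2: "smat (of_real \<epsilon>) (mat (of_real N) + complex_hessian w z) \<in> dual_Gamma k"
        using \<epsilon>(1) by (intro dual_Gamma_smat psd_dual_Gamma k psdw z) simp
      from dual_Gamma_add[OF dual_Gamma_add[OF \<phi>(5)[OF z] 1] 2] show ?thesis
        by (rule back_subst[of "\<lambda>X. X \<in> dual_Gamma k"]) (simp add: Hv vec_eq_iff smat_def mat_def algebra_simps)
    qed
  qed
qed

section \<open>Passage from the chain of energies to the normalized Hessian integrals\<close>

theorem theorem2:
  fixes \<Omega> :: "(complex^'n) set" and m k :: nat
  assumes "m < k" and "k \<le> CARD('n)"
    and "smooth_bounded_domain \<Omega>"
    and "strong_pseudoconvex k \<Omega>"
  shows "\<exists>C::real. \<forall>u \<in> P0 k \<Omega>.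
           hess_integral \<Omega> m u powr (1 / real (m + 1))
             \<le> C * hess_integral \<Omega> k u powr (1 / real (k + 1))"
proof -
  have op: "open \<Omega>" and bd: "bounded \<Omega>" using assms(3) by (auto simp: smooth_bounded_domain_def)
  interpret hess_domain \<Omega> k by unfold_locales (use op bd assms(2) in auto)
  have k0: "0 < k" using assms(1) by simp
  obtain v c where v: "adm \<Omega> v" "c > 0" "\<And>z. z \<in> \<Omega> \<Longrightarrow> complex_hessian v z - mat (of_real c) \<in> dual_Gamma k"
    using strict_subsolution_exists[OF k0 assms(2,3,4)] by blast
  define a where "a u j = (LINT z:\<Omega>|lborel. - u z * Re (esym_mat j (complex_hessian u z)))" for u j
  \<comment> \<open>The factor between \<open>norm_sym_mat j\<close> and the real part of
    \<open>esym_mat j\<close>; its powers for \<open>m\<close> and \<open>k\<close> are absorbed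
    into the final constant.\<close>
  define w where "w j = fact j * fact (CARD('n) - j) / (fact CARD('n) :: real)" for j
  have w: "w j > 0" for j by (simp add: w_def)
  obtain D where D: "D \<ge> 0" "\<And>u. u \<in> P0 k \<Omega> \<Longrightarrow> (\<forall>i\<le>k. a u i \<ge> 0) \<and> (a u 0)\<^sup>2 \<le> D * a u 1 \<and>
      (\<forall>i. Suc i < k \<longrightarrow> (a u (Suc i))\<^sup>2 \<le> D * a u (Suc (Suc i)) * a u i)"
    using energy_recursion[OF k0 v] unfolding a_def Let_def by meson
  obtain C where C: "C \<ge> 0" "\<And>u. u \<in> P0 k \<Omega> \<Longrightarrow> a u m powr (1 / real (m + 1)) \<le> C * a u k powr (1 / real (k + 1))"
  proof -
    from power_chain[OF D(1) assms(1)] obtain C where C: "C \<ge> 0 \<and> (\<forall>b. (\<forall>i\<le>k. b i \<ge> 0) \<and> (b 0)\<^sup>2 \<le> D * b 1 \<and>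
      (\<forall>i. Suc i < k \<longrightarrow> (b (Suc i))\<^sup>2 \<le> D * b (Suc (Suc i)) * b i) \<longrightarrow> b m powr (1 / real (m + 1)) \<le> C * b k powr (1 / real (k + 1)))" ..
    show thesis by (rule that[OF C[THEN conjunct1]]) (rule C[THEN conjunct2, THEN spec, THEN mp, OF D(2)])
  qed
  have I: "hess_integral \<Omega> j u = w j * a u j" if u: "u \<in> P0 k \<Omega>" for u j
  proof -
    have "hess_integral \<Omega> j u = (LINT z:\<Omega>|lborel. w j * (- u z * Re (esym_mat j (complex_hessian u z))))"
      unfolding hess_integral_def hess_op_def
    proof (rule set_lebesgue_integral_cong)
      show "\<Omega> \<in> sets lborel" using op by simp
      show "\<forall>z. z \<in> \<Omega> \<longrightarrow> - u z * norm_sym_mat j (complex_hessian u z) = w j * (- u z * Re (esym_mat j (complex_hessian u z)))"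
        using norm_sym_mat_eq(1)[OF hermitian_complex_hessian[OF op adm_C2[OF P0_adm(1)[OF op bd u]]], of _ j] by (simp add: w_def)
    qed
    then show ?thesis unfolding a_def by (simp only: set_integral_mult_right)
  qed
  define P where "P = w m powr (1 / real (m + 1))"
  define Q where "Q = w k powr (1 / real (k + 1))"
  have Q: "Q > 0" using w[of k] by (simp add: Q_def)
  have "hess_integral \<Omega> m u powr (1 / real (m + 1)) \<le> (P * C / Q) * hess_integral \<Omega> k u powr (1 / real (k + 1))"
    if u: "u \<in> P0 k \<Omega>" for u
  proof -
    have a0: "a u m \<ge> 0" "a u k \<ge> 0" using D(2)[OF u] assms(1) by auto
    have "hess_integral \<Omega> m u powr (1 / real (m + 1)) = P * a u m powr (1 / real (m + 1))"
      unfolding I[OF u] P_def using w[of m] a0 by (simp add: powr_mult)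
    also have "\<dots> \<le> P * (C * a u k powr (1 / real (k + 1)))" by (intro mult_left_mono C(2)[OF u]) (simp add: P_def)
    also have "\<dots> = (P * C / Q) * (Q * a u k powr (1 / real (k + 1)))" using Q by simp
    also have "Q * a u k powr (1 / real (k + 1)) = hess_integral \<Omega> k u powr (1 / real (k + 1))"
      unfolding I[OF u] Q_def using w[of k] a0 by (simp add: powr_mult)
    finally show ?thesis .
  qed
  then show ?thesis by blast
qed

end
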